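(* Let $d\ge3$, $1\le q\le p\le2q$, $p<d$ and $$\frac1q<\frac1p+\frac2d .$$ Then there is a constant $C$ such that for all $a,b\in\dot B^{\frac dp-2}_{p,\infty}\cap\dot B^{\frac dp}_{p,\infty}$ on $\mathbb R^d$, $$\|ab\|_{\dot B^{\frac dq-2}_{q,\infty}}\le C\Big(\|a\|_{\dot B^{\frac dp-2}_{p,\infty}}\|b\|_{\dot B^{\frac dp}_{p,\infty}}+\|b\|_{\dot B^{\frac dp-2}_{p,\infty}}\|a\|_{\dot B^{\frac dp}_{p,\infty}}\Big).$$
   Context: Let $\chi$ be smooth with values in $[0,1]$, supported in $\{|\xi|\le\frac43\}$, such that $\varphi(\xi)=\chi(\xi/2)-\chi(\xi)$ is supported in $\{\frac34\le|\xi|\le\frac83\}$ and $\sum_{j\in\mathbb Z}\varphi(2^{-j}\xi)=1$ for $\xi\ne0$. Put $\dot\Delta_j=\varphi(2^{-j}D)$, $\dot S_j=\chi(2^{-j}D)$ (Fourier multipliers on $\mathbb R^d$). For $f\in\mathcal S_0'$ (tempered distributions modulo polynomials), $\|f\|_{\dot B^s_{p,r}}=\big\|2^{js}\|\dot\Delta_jf\|_{L^p}\big\|_{\ell^r(\mathbb Z)}$. Products are understood through Bony's decomposition $ab=T_ab+R(a,b)+T_ba$ with $T_ab=\sum_j\dot S_{j-1}a\,\dot\Delta_jb$ and $R(a,b)=\sum_j\tilde{\dot\Delta}_ja\,\dot\Delta_jb$, $\tilde{\dot\Delta}_j=\sum_{|k-j|\le1}\dot\Delta_k$. *)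

theory Defs
  imports "HOL-Analysis.Analysis" "HOL-Probability.Essential_Supremum"
begin

section \<open>Schwartz functions and the Fourier transform\<close>

text \<open>\<open>iterated_partial [i\<^sub>1, ..., i\<^sub>n] f\<close> is the partial derivative of \<open>f\<close> in the coordinate
  directions \<open>i\<^sub>n\<close>, ..., \<open>i\<^sub>1\<close>; lists of coordinates play the role of multi-indices.\<close>

primrec iterated_partial ::
    "'d::finite list \<Rightarrow> (real^'d \<Rightarrow> 'b::real_normed_vector) \<Rightarrow> real^'d \<Rightarrow> 'b" where
  "iterated_partial [] f = f"
| "iterated_partial (i # is) f =
     (\<lambda>x. frechet_derivative (iterated_partial is f) (at x) (axis i 1))"

definition smooth :: "(real^'d::finite \<Rightarrow> 'b::real_normed_vector) \<Rightarrow> bool" where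
  "smooth f \<longleftrightarrow> (\<forall>is x. iterated_partial is f differentiable (at x))"

definition schwartz :: "(real^'d::finite \<Rightarrow> complex) set" where
  "schwartz = {\<psi>. smooth \<psi> \<and>
     (\<forall>is N. bounded (range (\<lambda>x. (1 + norm x) ^ N *\<^sub>R iterated_partial is \<psi> x)))}"

definition schwartz_seminorm :: "nat \<Rightarrow> (real^'d::finite \<Rightarrow> complex) \<Rightarrow> real" where
  "schwartz_seminorm N \<psi> =
     (SUP x. (1 + norm x) ^ N * (\<Sum>is | length is \<le> N. norm (iterated_partial is \<psi> x)))"

definition fourier :: "(real^'d::finite \<Rightarrow> complex) \<Rightarrow> real^'d \<Rightarrow> complex" where
  "fourier \<psi> \<xi> = (LINT x|lborel. cis (- (x \<bullet> \<xi>)) * \<psi> x)"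

definition inverse_fourier :: "(real^'d::finite \<Rightarrow> complex) \<Rightarrow> real^'d \<Rightarrow> complex" where
  "inverse_fourier \<psi> x =
     complex_of_real (1 / (2 * pi) ^ CARD('d)) * (LINT \<xi>|lborel. cis (x \<bullet> \<xi>) * \<psi> \<xi>)"


section \<open>Tempered distributions\<close>

text \<open>A distribution is a functional of which only the values on \<^const>\<open>schwartz\<close> matter.\<close>

type_synonym 'd functional = "(real^'d \<Rightarrow> complex) \<Rightarrow> complex"

definition tempered :: "'d::finite functional \<Rightarrow> bool" where
  "tempered u \<longleftrightarrow>
     (\<forall>\<psi>\<in>schwartz. \<forall>\<eta>\<in>schwartz. u (\<lambda>x. \<psi> x + \<eta> x) = u \<psi> + u \<eta>) \<and>
     (\<forall>c. \<forall>\<psi>\<in>schwartz. u (\<lambda>x. c * \<psi> x) = c * u \<psi>) \<and>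
     (\<exists>C N. \<forall>\<psi>\<in>schwartz. norm (u \<psi>) \<le> C * schwartz_seminorm N \<psi>)"

definition distr_of_fun :: "(real^'d::finite \<Rightarrow> complex) \<Rightarrow> 'd functional" where
  "distr_of_fun g \<psi> = (LINT x|lborel. g x * \<psi> x)"

definition represented_by :: "'d::finite functional \<Rightarrow> (real^'d \<Rightarrow> complex) \<Rightarrow> bool" where
  "represented_by u g \<longleftrightarrow> continuous_on UNIV g \<and>
     (\<forall>\<psi>\<in>schwartz. integrable lborel (\<lambda>x. g x * \<psi> x) \<and> u \<psi> = distr_of_fun g \<psi>)"

text \<open>The continuous function that a distribution is, when there is one (it is then unique).
  It is only used for distributions with compactly supported Fourier transform, which are
  smooth functions by the Paley-Wiener-Schwartz theorem.\<close>

definition fun_of_distr :: "'d::finite functional \<Rightarrow> real^'d \<Rightarrow> complex" where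
  "fun_of_distr u = (THE g. represented_by u g)"

definition fourier_distr :: "'d::finite functional \<Rightarrow> 'd functional" where
  "fourier_distr u \<psi> = u (fourier \<psi>)"

definition inverse_fourier_distr :: "'d::finite functional \<Rightarrow> 'd functional" where
  "inverse_fourier_distr u \<psi> = u (inverse_fourier \<psi>)"

definition mult_distr :: "(real^'d::finite \<Rightarrow> real) \<Rightarrow> 'd functional \<Rightarrow> 'd functional" where
  "mult_distr m u \<psi> = u (\<lambda>\<xi>. complex_of_real (m \<xi>) * \<psi> \<xi>)"

text \<open>The operator \<open>m(D)\<close>.\<close>

definition fourier_multiplier ::
    "(real^'d::finite \<Rightarrow> real) \<Rightarrow> 'd functional \<Rightarrow> 'd functional" where
  "fourier_multiplier m u = inverse_fourier_distr (mult_distr m (fourier_distr u))"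


section \<open>Tempered distributions modulo polynomials\<close>

definition poly_equiv :: "('d::finite functional \<times> 'd functional) set" where
  "poly_equiv = {(u, v). tempered u \<and> tempered v \<and>
     (\<exists>P. polynomial_function P \<and> represented_by (\<lambda>\<psi>. u \<psi> - v \<psi>) P)}"

lemma represented_by_uminus:
  assumes "represented_by u g"
  shows "represented_by (\<lambda>\<psi>. - u \<psi>) (\<lambda>x. - g x)"
  using assms by (auto simp: represented_by_def distr_of_fun_def intro!: continuous_intros)

lemma represented_by_add:
  assumes "represented_by u g" "represented_by v h"
  shows "represented_by (\<lambda>\<psi>. u \<psi> + v \<psi>) (\<lambda>x. g x + h x)"
  using assms
  by (auto simp: represented_by_def distr_of_fun_def distrib_right intro!: continuous_intros)

lemma poly_equiv_iff:
  "(u, v) \<in> poly_equiv \<longleftrightarrow> tempered u \<and> tempered v \<and>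
     (\<exists>P. polynomial_function P \<and> represented_by (\<lambda>\<psi>. u \<psi> - v \<psi>) P)"
  by (simp add: poly_equiv_def)

lemma poly_equiv_sym:
  assumes "(u, v) \<in> poly_equiv"
  shows "(v, u) \<in> poly_equiv"
proof -
  obtain P where P: "polynomial_function P" "represented_by (\<lambda>\<psi>. u \<psi> - v \<psi>) P"
    using assms unfolding poly_equiv_iff by (elim conjE exE)
  have "represented_by (\<lambda>\<psi>. v \<psi> - u \<psi>) (\<lambda>x. - P x)"
    using represented_by_uminus[OF P(2)] by simp
  then have "\<exists>Q. polynomial_function Q \<and> represented_by (\<lambda>\<psi>. v \<psi> - u \<psi>) Q"
    using polynomial_function_minus[OF P(1)] by (intro exI[of _ "\<lambda>x. - P x"] conjI)
  then show ?thesis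
    using assms unfolding poly_equiv_iff by simp
qed

lemma poly_equiv_trans:
  assumes "(u, v) \<in> poly_equiv" "(v, w) \<in> poly_equiv"
  shows "(u, w) \<in> poly_equiv"
proof -
  obtain P where P: "polynomial_function P" "represented_by (\<lambda>\<psi>. u \<psi> - v \<psi>) P"
    using assms(1) unfolding poly_equiv_iff by (elim conjE exE)
  obtain Q where Q: "polynomial_function Q" "represented_by (\<lambda>\<psi>. v \<psi> - w \<psi>) Q"
    using assms(2) unfolding poly_equiv_iff by (elim conjE exE)
  have "represented_by (\<lambda>\<psi>. u \<psi> - w \<psi>) (\<lambda>x. P x + Q x)"
    using represented_by_add[OF P(2) Q(2)] by simp
  then have "\<exists>R. polynomial_function R \<and> represented_by (\<lambda>\<psi>. u \<psi> - w \<psi>) R"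
    using polynomial_function_add[OF P(1) Q(1)] by (intro exI[of _ "\<lambda>x. P x + Q x"] conjI)
  then show ?thesis
    using assms unfolding poly_equiv_iff by simp
qed

lemma equiv_poly_equiv: "equiv (Collect tempered) poly_equiv"
proof (rule equivI)
  show "poly_equiv \<subseteq> Collect tempered \<times> Collect tempered"
    by (auto simp: poly_equiv_def)
  show "refl_on (Collect tempered) poly_equiv"
    unfolding refl_on_def poly_equiv_def
    by (auto intro!: exI[of _ "\<lambda>_. 0"] simp: represented_by_def distr_of_fun_def)
  show "sym poly_equiv"
    by (rule symI) (rule poly_equiv_sym)
  show "trans poly_equiv"
    by (rule transI) (rule poly_equiv_trans)
qed

text \<open>The space \<open>S\<^sub>0'\<close>.\<close>

definition tempered_mod_poly :: "'d::finite functional set set" where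
  "tempered_mod_poly = Collect tempered // poly_equiv"


section \<open>Littlewood-Paley decomposition\<close>

definition lp_phi :: "(real^'d::finite \<Rightarrow> real) \<Rightarrow> real^'d \<Rightarrow> real" where
  "lp_phi chi \<xi> = chi (\<xi> /\<^sub>R 2) - chi \<xi>"

definition littlewood_paley_cutoff :: "(real^'d::finite \<Rightarrow> real) \<Rightarrow> bool" where
  "littlewood_paley_cutoff chi \<longleftrightarrow> smooth chi \<and> range chi \<subseteq> {0..1} \<and>
     closure {\<xi>. chi \<xi> \<noteq> 0} \<subseteq> {\<xi>. norm \<xi> \<le> 4/3} \<and>
     closure {\<xi>. lp_phi chi \<xi> \<noteq> 0} \<subseteq> {\<xi>. 3/4 \<le> norm \<xi> \<and> norm \<xi> \<le> 8/3} \<and>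
     (\<forall>\<xi>. \<xi> \<noteq> 0 \<longrightarrow> ((\<lambda>j::int. lp_phi chi (2 powi (- j) *\<^sub>R \<xi>)) has_sum 1) UNIV)"

definition Delta :: "(real^'d::finite \<Rightarrow> real) \<Rightarrow> int \<Rightarrow> 'd functional \<Rightarrow> 'd functional" where
  "Delta chi j = fourier_multiplier (\<lambda>\<xi>. lp_phi chi (2 powi (- j) *\<^sub>R \<xi>))"

definition low_cut :: "(real^'d::finite \<Rightarrow> real) \<Rightarrow> int \<Rightarrow> 'd functional \<Rightarrow> 'd functional" where
  "low_cut chi j = fourier_multiplier (\<lambda>\<xi>. chi (2 powi (- j) *\<^sub>R \<xi>))"

text \<open>On a class modulo polynomials the dyadic blocks do not depend on the representative,
  because \<^term>\<open>lp_phi chi\<close> vanishes near the origin.\<close>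

definition block :: "(real^'d::finite \<Rightarrow> real) \<Rightarrow> int \<Rightarrow> 'd functional set \<Rightarrow> real^'d \<Rightarrow> complex" where
  "block chi j a = fun_of_distr (Delta chi j (SOME u. u \<in> a))"

definition wide_block ::
    "(real^'d::finite \<Rightarrow> real) \<Rightarrow> int \<Rightarrow> 'd functional set \<Rightarrow> real^'d \<Rightarrow> complex" where
  "wide_block chi j a x = (\<Sum>k | \<bar>k - j\<bar> \<le> 1. block chi k a x)"

text \<open>The low-frequency cut-off does depend on the representative: it fixes polynomials. As usual,
  it is applied to the representative without polynomial part, that is, the one whose
  low-frequency cut-offs tend to zero in the sense of distributions as \<open>j \<rightarrow> -\<infinity>\<close>. As a
  distribution there is at most one; as a functional it is unique up to its irrelevant values
  outside \<^const>\<open>schwartz\<close>.\<close>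

definition vanishes_at_low_freq :: "(real^'d::finite \<Rightarrow> real) \<Rightarrow> 'd functional \<Rightarrow> bool" where
  "vanishes_at_low_freq chi u \<longleftrightarrow>
     (\<forall>\<psi>\<in>schwartz. ((\<lambda>j. low_cut chi j u \<psi>) \<longlongrightarrow> 0) at_bot)"

definition realization ::
    "(real^'d::finite \<Rightarrow> real) \<Rightarrow> 'd functional set \<Rightarrow> 'd functional" where
  "realization chi a = (SOME u. u \<in> a \<and> vanishes_at_low_freq chi u)"

definition low_block ::
    "(real^'d::finite \<Rightarrow> real) \<Rightarrow> int \<Rightarrow> 'd functional set \<Rightarrow> real^'d \<Rightarrow> complex" where
  "low_block chi j a = fun_of_distr (low_cut chi j (realization chi a))"


section \<open>Homogeneous Besov spaces\<close>

definition ennpowr :: "ennreal \<Rightarrow> real \<Rightarrow> ennreal" where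
  "ennpowr x s = (if x = \<infinity> then \<infinity> else ennreal (enn2real x powr s))"

text \<open>The \<open>L\<^sup>p\<close> norm of a function with values in \<open>[0,\<infinity>]\<close>, for \<open>1 \<le> p \<le> \<infinity>\<close>. With the counting
  measure it is the \<open>\<ell>\<^sup>p\<close> norm; in particular the essential supremum is then the supremum.\<close>

definition Lp_norm :: "ennreal \<Rightarrow> 'a measure \<Rightarrow> ('a \<Rightarrow> ennreal) \<Rightarrow> ennreal" where
  "Lp_norm p M f =
     (if p = \<infinity> then esssup M f
      else ennpowr (\<integral>\<^sup>+x. ennpowr (f x) (enn2real p) \<partial>M) (1 / enn2real p))"

lemma Lp_norm_infinity_count_space: "Lp_norm \<infinity> (count_space UNIV) f = (SUP x. f x)"
proof -
  have "ae_filter (count_space (UNIV :: 'a set)) = principal UNIV"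
    by (rule filter_eqI) (auto simp: AE_count_space eventually_principal)
  then show ?thesis
    by (simp add: Lp_norm_def esssup_def Limsup_def eventually_principal)
       (auto intro!: antisym INF_lower2[of "\<lambda>_. True"] INF_greatest SUP_mono)
qed

definition besov_norm :: "(real^'d::finite \<Rightarrow> real) \<Rightarrow> real \<Rightarrow> ennreal \<Rightarrow> ennreal
    \<Rightarrow> 'd functional set \<Rightarrow> ennreal" where
  "besov_norm chi s p r f =
     Lp_norm r (count_space UNIV)
       (\<lambda>j::int. ennreal (2 powr (real_of_int j * s)) *
          Lp_norm p lborel (\<lambda>x. ennreal (norm (block chi j f x))))"

definition besov :: "(real^'d::finite \<Rightarrow> real) \<Rightarrow> real \<Rightarrow> ennreal \<Rightarrow> ennreal
    \<Rightarrow> 'd functional set set" where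
  "besov chi s p r = {f \<in> tempered_mod_poly. besov_norm chi s p r f < \<infinity>}"


section \<open>Products through Bony's decomposition\<close>

text \<open>Series of functions over \<open>\<int>\<close>, summed (unconditionally) in the space of tempered
  distributions with its weak topology.\<close>

definition distr_summable :: "(int \<Rightarrow> real^'d::finite \<Rightarrow> complex) \<Rightarrow> bool" where
  "distr_summable g \<longleftrightarrow> (\<forall>\<psi>\<in>schwartz.
     (\<forall>j. integrable lborel (\<lambda>x. g j x * \<psi> x)) \<and> (\<lambda>j. distr_of_fun (g j) \<psi>) summable_on UNIV)"

definition distr_sum :: "(int \<Rightarrow> real^'d::finite \<Rightarrow> complex) \<Rightarrow> 'd functional" where
  "distr_sum g \<psi> = (\<Sum>\<^sub>\<infinity>j. distr_of_fun (g j) \<psi>)"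

definition para_term :: "(real^'d::finite \<Rightarrow> real) \<Rightarrow> 'd functional set \<Rightarrow> 'd functional set
    \<Rightarrow> int \<Rightarrow> real^'d \<Rightarrow> complex" where
  "para_term chi a b j x = low_block chi (j - 1) a x * block chi j b x"

definition remainder_term :: "(real^'d::finite \<Rightarrow> real) \<Rightarrow> 'd functional set \<Rightarrow> 'd functional set
    \<Rightarrow> int \<Rightarrow> real^'d \<Rightarrow> complex" where
  "remainder_term chi a b j x = wide_block chi j a x * block chi j b x"

definition paraproduct :: "(real^'d::finite \<Rightarrow> real) \<Rightarrow> 'd functional set \<Rightarrow> 'd functional set
    \<Rightarrow> 'd functional" where
  "paraproduct chi a b = distr_sum (para_term chi a b)"

definition remainder :: "(real^'d::finite \<Rightarrow> real) \<Rightarrow> 'd functional set \<Rightarrow> 'd functional set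
    \<Rightarrow> 'd functional" where
  "remainder chi a b = distr_sum (remainder_term chi a b)"

definition bony_product :: "(real^'d::finite \<Rightarrow> real) \<Rightarrow> 'd functional set \<Rightarrow> 'd functional set
    \<Rightarrow> 'd functional set" where
  "bony_product chi a b =
     poly_equiv `` {\<lambda>\<psi>. paraproduct chi a b \<psi> + remainder chi a b \<psi> + paraproduct chi b a \<psi>}"

definition bony_product_exists ::
    "(real^'d::finite \<Rightarrow> real) \<Rightarrow> 'd functional set \<Rightarrow> 'd functional set \<Rightarrow> bool" where
  "bony_product_exists chi a b \<longleftrightarrow>
     distr_summable (para_term chi a b) \<and> distr_summable (remainder_term chi a b) \<and>
     distr_summable (para_term chi b a) \<and> bony_product chi a b \<in> tempered_mod_poly"

end

theory Submission
  imports Defs "HOL-Probability.Characteristic_Functions" "HOL-Probability.Sinc_Integral"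
begin

text \<open>Why the estimate holds. Let \<open>f\<^sub>l\<close> and \<open>g\<^sub>l\<close> be the dyadic blocks of \<open>a\<close> and \<open>b\<close>, and let \<open>A0\<close>, \<open>A2\<close>,
  \<open>B0\<close>, \<open>B2\<close> be their norms of regularity \<open>d/p - 2\<close> and \<open>d/p\<close>. Bernstein's inequality (lemma \<open>bernstein\<close>)
  turns the \<open>L\<^sup>p\<close> bounds of \<open>f\<^sub>l\<close> into the uniform bounds \<open>C 2\<^sup>2\<^sup>l A0\<close> and \<open>C A2\<close>.

  Paraproduct. Put \<open>\<epsilon> = 2 - d (1/q - 1/p)\<close>, which is positive by hypothesis. Since \<open>p \<le> 2 q\<close>, the
  \<open>L\<^sup>q\<close> norm of \<open>f\<^sub>l g\<^sub>k\<close> is controlled by the \<open>L\<^sup>p\<close> norms of both factors and the supremum of \<open>f\<^sub>l\<close>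
  (lemma \<open>Lp_le_product\<close>), and the powers of \<open>2\<close> combine to \<open>2 powr (l \<epsilon> - k d/p) A0 B2\<close>. As \<open>\<epsilon> > 0\<close>, the sum
  over \<open>l \<le> k - 2\<close> is geometric, so the term of index \<open>k\<close> of the paraproduct is bounded by \<open>2 powr (- k (d/q - 2)) A0 B2\<close>. Its
  spectrum lies in an annulus of size \<open>2\<^sup>k\<close>, hence only boundedly many \<open>k\<close> contribute to a block of
  index \<open>j\<close>, and they have \<open>k\<close> close to \<open>j\<close>.

  Remainder. Its term of index \<open>k\<close> has its spectrum in a ball only, so that all \<open>k \<ge> j - 3\<close> contribute
  and decay in \<open>k\<close> is needed. It comes from estimating the term in \<open>L\<^sup>r\<close> with \<open>r = max 1 (p/2)\<close>: the bound
  is \<open>2 powr (- k (d/r - 2)) A0 B2\<close>, with \<open>d/r > 2\<close> because \<open>p < d\<close> and \<open>d \<ge> 3\<close>. Bernstein's inequality from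
  \<open>L\<^sup>r\<close> to \<open>L\<^sup>q\<close> (lemma \<open>dyadic_convolution\<close>) costs \<open>2 powr (j d (1/r - 1/q))\<close>, and the geometric sum over \<open>k \<ge> j - 3\<close>
  gives again \<open>2 powr (- j (d/q - 2)) A0 B2\<close>.

  The rest is the distribution theory that makes this rigorous. A Fourier multiplier with Schwartz
  symbol, applied to a tempered distribution, is the function obtained by pairing the
  distribution with the translates of a Schwartz kernel (lemma \<open>multiplier_representation\<close>). This
  makes blocks concrete functions, and the statement on the spectrum of a product becomes the vanishing of an integral
  (lemma \<open>spectral_product_vanishes\<close>). The sum of the blocks of \<open>a\<close> is
  a representative of \<open>a\<close> whose low-frequency cut-offs vanish in the limit (lemma \<open>realization_exists\<close>), because a
  distribution all of whose blocks are zero is a polynomial (lemma \<open>polynomial_if_Delta_vanish\<close>); so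
  the low-frequency cut-off is \<open>\<Sum>\<^sub>l\<^sub><\<^sub>j f\<^sub>l\<close>, as used above.\<close>

section \<open>Schwartz functions\<close>

definition partial :: "'d::finite \<Rightarrow> (real^'d \<Rightarrow> 'b::real_normed_vector) \<Rightarrow> real^'d \<Rightarrow> 'b" where
  "partial i f = (\<lambda>x. frechet_derivative f (at x) (axis i 1))"

lemma iterated_partial_Cons [simp]:
  "iterated_partial (i # is) f = partial i (iterated_partial is f)"
  unfolding partial_def by (rule iterated_partial.simps(2))

declare iterated_partial.simps(2) [simp del]

lemma iterated_partial_append:
  "iterated_partial (xs @ ys) f = iterated_partial xs (iterated_partial ys f)"
  by (induction xs) auto

lemma partial_eqI: "(f has_derivative f') (at x) \<Longrightarrow> partial i f x = f' (axis i 1)"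
  unfolding partial_def using frechet_derivative_at by metis

lemma has_derivative_partial:
  fixes f :: "real^'d::finite \<Rightarrow> 'b::real_normed_vector"
  assumes "f differentiable (at x)"
  shows "(f has_derivative (\<lambda>h. \<Sum>i\<in>UNIV. (h $ i) *\<^sub>R partial i f x)) (at x)"
proof -
  define D where "D = frechet_derivative f (at x)"
  have D: "(f has_derivative D) (at x)"
    unfolding D_def using assms frechet_derivative_works by blast
  have "linear D" using D has_derivative_linear by blast
  have "D h = (\<Sum>i\<in>UNIV. (h $ i) *\<^sub>R partial i f x)" for h
  proof -
    have "D h = D (\<Sum>i\<in>UNIV. (h $ i) *\<^sub>R axis i 1)"
      by (simp add: basis_expansion scalar_mult_eq_scaleR[symmetric])
    also have "\<dots> = (\<Sum>i\<in>UNIV. (h $ i) *\<^sub>R D (axis i 1))"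
      using \<open>linear D\<close> by (simp add: linear_sum linear_cmul)
    finally show ?thesis by (simp add: partial_def D_def)
  qed
  then have "D = (\<lambda>h. \<Sum>i\<in>UNIV. (h $ i) *\<^sub>R partial i f x)" by auto
  then show ?thesis using D by simp
qed

text \<open>The decay half of the Schwartz condition, for a single function. Keeping it apart from
  differentiability allows closure properties of \<^const>\<open>schwartz\<close> to be proved by coinduction.\<close>

definition rapid :: "(real^'d::finite \<Rightarrow> 'b::real_normed_vector) \<Rightarrow> bool" where
  "rapid f \<longleftrightarrow> (\<forall>N. \<exists>C. \<forall>x. (1 + norm x) ^ N * norm (f x) \<le> C)"

lemma rapidE:
  fixes f :: "real^'d::finite \<Rightarrow> 'b::real_normed_vector"
  assumes "rapid f"
  obtains C where "0 \<le> C" "\<And>x. (1 + norm x) ^ N * norm (f x) \<le> C"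
proof -
  obtain C where C: "\<forall>x. (1 + norm x) ^ N * norm (f x) \<le> C"
    using assms unfolding rapid_def by blast
  have "0 \<le> (1 + norm (0::real^'d)) ^ N * norm (f 0)" by simp
  also have "\<dots> \<le> C" using C by blast
  finally show ?thesis using C that by blast
qed

lemma rapid_add: assumes "rapid f" "rapid g" shows "rapid (\<lambda>x. f x + g x)"
  unfolding rapid_def
proof
  fix N
  obtain A where A: "\<And>x. (1 + norm x) ^ N * norm (f x) \<le> A" using rapidE[OF assms(1)] by blast
  obtain B where B: "\<And>x. (1 + norm x) ^ N * norm (g x) \<le> B" using rapidE[OF assms(2)] by blast
  have "(1 + norm x) ^ N * norm (f x + g x) \<le> A + B" for x
  proof -
    have "(1 + norm x) ^ N * norm (f x + g x) \<le> (1 + norm x) ^ N * (norm (f x) + norm (g x))"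
      by (intro mult_left_mono norm_triangle_ineq) auto
    then show ?thesis using A[of x] B[of x] by (simp add: distrib_left)
  qed
  then show "\<exists>C. \<forall>x. (1 + norm x) ^ N * norm (f x + g x) \<le> C" by blast
qed

lemma rapid_bounded_mult:
  assumes "rapid f" and "\<And>x. norm (g x) \<le> C * (1 + norm x) ^ M * norm (f x)"
  shows "rapid g"
  unfolding rapid_def
proof
  fix N
  obtain A where A: "0 \<le> A" "\<And>x. (1 + norm x) ^ (N + M) * norm (f x) \<le> A" using rapidE[OF assms(1)] by blast
  have "(1 + norm x) ^ N * norm (g x) \<le> \<bar>C\<bar> * A" for x
  proof -
    have "C * (1 + norm x) ^ M * norm (f x) \<le> \<bar>C\<bar> * (1 + norm x) ^ M * norm (f x)"
      by (intro mult_right_mono) auto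
    then have "(1 + norm x) ^ N * norm (g x) \<le> (1 + norm x) ^ N * (\<bar>C\<bar> * (1 + norm x) ^ M * norm (f x))"
      by (intro mult_left_mono order_trans[OF assms(2)]) auto
    also have "\<dots> = \<bar>C\<bar> * ((1 + norm x) ^ (N + M) * norm (f x))" by (simp add: power_add)
    also have "\<dots> \<le> \<bar>C\<bar> * A" by (intro mult_left_mono A) auto
    finally show ?thesis .
  qed
  then show "\<exists>C. \<forall>x. (1 + norm x) ^ N * norm (g x) \<le> C" by blast
qed

lemma schwartz_iff:
  "f \<in> schwartz \<longleftrightarrow> (\<forall>is. (\<forall>x. iterated_partial is f differentiable (at x)) \<and> rapid (iterated_partial is f))"
proof -
  have "bounded (range (\<lambda>x. (1 + norm x) ^ N *\<^sub>R iterated_partial is f x))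
      \<longleftrightarrow> (\<exists>C. \<forall>x. (1 + norm x) ^ N * norm (iterated_partial is f x) \<le> C)" for "is" N
    by (auto simp: bounded_iff)
  then show ?thesis by (auto simp: schwartz_def smooth_def rapid_def)
qed

lemma schwartz_differentiable: "f \<in> schwartz \<Longrightarrow> f differentiable (at x)"
  unfolding schwartz_iff by (metis iterated_partial.simps(1))

lemma schwartz_rapid: "f \<in> schwartz \<Longrightarrow> rapid f"
  unfolding schwartz_iff by (metis iterated_partial.simps(1))

lemma schwartz_iterated_partial: "f \<in> schwartz \<Longrightarrow> iterated_partial is f \<in> schwartz"
  unfolding schwartz_iff by (simp flip: iterated_partial_append)

lemma schwartz_partial: "f \<in> schwartz \<Longrightarrow> partial i f \<in> schwartz"
  using schwartz_iterated_partial[of f "[i]"] by simp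

lemma schwartz_continuous: "f \<in> schwartz \<Longrightarrow> continuous_on A f"
  using schwartz_differentiable differentiable_imp_continuous_within
  by (metis continuous_at_imp_continuous_on)

text \<open>Derivatives of a product are sums of products, so the invariant of the coinduction below is only
  required up to finite sums.\<close>

inductive add_closure :: "('a \<Rightarrow> 'b::plus) set \<Rightarrow> ('a \<Rightarrow> 'b) \<Rightarrow> bool" for A where
  base: "f \<in> A \<Longrightarrow> add_closure A f"
| add: "add_closure A f \<Longrightarrow> add_closure A g \<Longrightarrow> add_closure A (\<lambda>x. f x + g x)"

lemma add_closure_partial:
  assumes "add_closure A f" and "\<And>g. g \<in> A \<Longrightarrow>
    (\<forall>x. g differentiable (at x)) \<and> rapid g \<and> (\<forall>i. add_closure A (partial i g))"
  shows "(\<forall>x. f differentiable (at x)) \<and> rapid f \<and> (\<forall>i. add_closure A (partial i f))"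
  using assms(1)
proof induction
  case (base f)
  then show ?case using assms(2) by blast
next
  case (add f g)
  have "partial i (\<lambda>x. f x + g x) = (\<lambda>x. partial i f x + partial i g x)" for i
  proof
    fix x
    have "((\<lambda>x. f x + g x) has_derivative (\<lambda>h. frechet_derivative f (at x) h + frechet_derivative g (at x) h)) (at x)"
      using add.IH by (intro has_derivative_add) (auto simp: frechet_derivative_works)
    then show "partial i (\<lambda>x. f x + g x) x = partial i f x + partial i g x"
      by (subst partial_eqI) (auto simp: partial_def)
  qed
  then show ?case using add by (auto intro: add_closure.add rapid_add)
qed

text \<open>Coinduction for \<^const>\<open>schwartz\<close>: a family of differentiable, rapidly decreasing functions that is
  stable under partial derivatives up to finite
  sums consists of Schwartz functions.\<close>

lemma schwartz_coinduct_upto: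
  assumes "add_closure A f" and A: "\<And>g. g \<in> A \<Longrightarrow>
    (\<forall>x. g differentiable (at x)) \<and> rapid g \<and> (\<forall>i. add_closure A (partial i g))"
  shows "f \<in> schwartz"
proof -
  have "add_closure A (iterated_partial is f)" for "is"
    using assms(1) by (induction "is") (auto dest: add_closure_partial[OF _ A])
  then show ?thesis unfolding schwartz_iff using add_closure_partial[OF _ A] by blast
qed

lemma schwartz_coinduct:
  assumes "f \<in> A" and A: "\<And>g. g \<in> A \<Longrightarrow>
    (\<forall>x. g differentiable (at x)) \<and> rapid g \<and> (\<forall>i. partial i g \<in> A)"
  shows "f \<in> schwartz"
  by (rule schwartz_coinduct_upto[OF add_closure.base[OF assms(1)]]) (use A in \<open>auto intro: add_closure.base\<close>)

lemma schwartz_has_derivative: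
  "f \<in> schwartz \<Longrightarrow> (f has_derivative (\<lambda>h. \<Sum>i\<in>UNIV. (h $ i) *\<^sub>R partial i f x)) (at x)"
  by (intro has_derivative_partial schwartz_differentiable)

lemma sum_axis_scaleR [simp]: "(\<Sum>i\<in>UNIV. (axis k (1::real) $ i) *\<^sub>R (g i :: 'b::real_vector)) = g k"
proof -
  have "(\<Sum>i\<in>UNIV. (axis k (1::real) $ i) *\<^sub>R g i) = (\<Sum>i\<in>UNIV. if i = k then g i else 0)"
    by (intro sum.cong) (auto simp: axis_def)
  then show ?thesis by simp
qed

lemma schwartz_add: assumes "f \<in> schwartz" "g \<in> schwartz" shows "(\<lambda>x. f x + g x) \<in> schwartz"
  by (rule schwartz_coinduct_upto[where A = schwartz])
     (use assms in \<open>auto intro: add_closure.intros schwartz_differentiable schwartz_rapid schwartz_partial\<close>)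

lemma partial_mult:
  fixes f g :: "real^'d::finite \<Rightarrow> 'b::real_normed_algebra"
  assumes "f differentiable (at x)" "g differentiable (at x)"
  shows "partial i (\<lambda>x. f x * g x) x = partial i f x * g x + f x * partial i g x"
proof -
  have "((\<lambda>x. f x * g x) has_derivative (\<lambda>h. f x * frechet_derivative g (at x) h + frechet_derivative f (at x) h * g x)) (at x)"
    using assms by (intro has_derivative_mult) (auto simp: frechet_derivative_works)
  from partial_eqI[OF this] show ?thesis by (simp add: partial_def add.commute)
qed

lemma schwartz_mult: assumes "f \<in> schwartz" "g \<in> schwartz" shows "(\<lambda>x. f x * g x) \<in> schwartz"
proof (rule schwartz_coinduct_upto[where A = "{\<lambda>x. f x * g x |f g. f \<in> schwartz \<and> g \<in> schwartz}"])
  show "add_closure {\<lambda>x. f x * g x |f g. f \<in> schwartz \<and> g \<in> schwartz} (\<lambda>x. f x * g x)"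
    using assms by (intro add_closure.base) auto
next
  let ?A = "{\<lambda>x. f x * g x |f g. f \<in> schwartz \<and> (g :: real^'a \<Rightarrow> complex) \<in> schwartz}"
  fix h assume "h \<in> ?A"
  then obtain f g where h: "h = (\<lambda>x. f x * g x)" and fg: "f \<in> schwartz" "g \<in> schwartz" by auto
  have "rapid h"
  proof -
    obtain C where "\<And>x. (1 + norm x) ^ 0 * norm (f x) \<le> C" using rapidE[OF schwartz_rapid[OF fg(1)]] by blast
    then have "norm (h x) \<le> C * (1 + norm x) ^ 0 * norm (g x)" for x
      by (auto simp: h norm_mult intro!: mult_right_mono)
    then show ?thesis by (rule rapid_bounded_mult[OF schwartz_rapid[OF fg(2)]])
  qed
  moreover have "partial i h = (\<lambda>x. partial i f x * g x + f x * partial i g x)" for i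
    unfolding h using fg by (auto intro!: partial_mult schwartz_differentiable)
  then have "add_closure ?A (partial i h)" for i
    by (simp only:, intro add_closure.add[of ?A] add_closure.base) (use fg schwartz_partial in blast)+
  moreover have "h differentiable (at x)" for x
    unfolding h using fg by (blast intro: differentiable_mult schwartz_differentiable)
  ultimately show "(\<forall>x. h differentiable (at x)) \<and> rapid h \<and> (\<forall>i. add_closure ?A (partial i h))"
    by blast
qed

lemma partial_const [simp]: "partial i (\<lambda>x. c) = (\<lambda>x. 0)"
  by (auto intro!: ext partial_eqI derivative_eq_intros)

lemma schwartz_zero [simp]: "(\<lambda>x. 0) \<in> schwartz"
  by (rule schwartz_coinduct[where A = "{\<lambda>x. 0}"]) (auto simp: rapid_def)

lemma partial_cmult:
  fixes f :: "real^'d::finite \<Rightarrow> 'b::real_normed_algebra"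
  assumes "f differentiable (at x)"
  shows "partial i (\<lambda>x. c * f x) x = c * partial i f x"
  using partial_mult[of "\<lambda>_. c" x f i] assms by simp

lemma schwartz_cmult: assumes "f \<in> schwartz" shows "(\<lambda>x. c * f x) \<in> schwartz"
proof (rule schwartz_coinduct[where A = "{\<lambda>x. c * f x |f. f \<in> schwartz}"])
  fix g assume "g \<in> {\<lambda>x. c * f x |f. f \<in> schwartz}"
  then obtain f where g: "g = (\<lambda>x. c * f x)" and f: "f \<in> schwartz" by auto
  have "partial i g = (\<lambda>x. c * partial i f x)" for i
    unfolding g using f by (auto intro!: partial_cmult schwartz_differentiable)
  moreover have "rapid g"
    by (rule rapid_bounded_mult[OF schwartz_rapid[OF f], of _ "norm c" 0]) (auto simp: g norm_mult)
  ultimately show "(\<forall>x. g differentiable (at x)) \<and> rapid g \<and> (\<forall>i. partial i g \<in> {\<lambda>x. c * f x |f. f \<in> schwartz})"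
    using f schwartz_partial differentiable_mult[OF differentiable_const schwartz_differentiable[OF f]]
    by (auto simp: g)
qed (use assms in auto)

lemma schwartz_uminus: "f \<in> schwartz \<Longrightarrow> (\<lambda>x. - f x) \<in> schwartz"
  using schwartz_cmult[of f "-1"] by simp

lemma schwartz_diff: "f \<in> schwartz \<Longrightarrow> g \<in> schwartz \<Longrightarrow> (\<lambda>x. f x - g x) \<in> schwartz"
  using schwartz_add[of f "\<lambda>x. - g x"] schwartz_uminus[of g] by simp

lemma schwartz_sum: "finite I \<Longrightarrow> (\<And>i. i \<in> I \<Longrightarrow> f i \<in> schwartz) \<Longrightarrow> (\<lambda>x. \<Sum>i\<in>I. f i x) \<in> schwartz"
  by (induction I rule: finite_induct) (auto intro: schwartz_add)

lemma partial_add: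
  assumes "f differentiable (at x)" "g differentiable (at x)"
  shows "partial i (\<lambda>x. f x + g x) x = partial i f x + partial i g x"
proof -
  have "((\<lambda>x. f x + g x) has_derivative (\<lambda>h. frechet_derivative f (at x) h + frechet_derivative g (at x) h)) (at x)"
    using assms by (intro has_derivative_add) (auto simp: frechet_derivative_works)
  then show ?thesis by (subst partial_eqI) (auto simp: partial_def)
qed

lemma iterated_partial_add:
  assumes "f \<in> schwartz" "g \<in> schwartz"
  shows "iterated_partial is (\<lambda>x. f x + g x) = (\<lambda>x. iterated_partial is f x + iterated_partial is g x)"
  by (induction "is") (auto intro!: ext partial_add schwartz_differentiable schwartz_iterated_partial assms)

lemma iterated_partial_cmult:
  assumes "f \<in> schwartz"
  shows "iterated_partial is (\<lambda>x. c * f x) = (\<lambda>x. c * iterated_partial is f x)"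
  by (induction "is") (auto intro!: ext partial_cmult schwartz_differentiable schwartz_iterated_partial assms)

lemma iterated_partial_diff:
  assumes "f \<in> schwartz" "g \<in> schwartz"
  shows "iterated_partial is (\<lambda>x. f x - g x) = (\<lambda>x. iterated_partial is f x - iterated_partial is g x)"
  using iterated_partial_add[OF assms(1) schwartz_uminus[OF assms(2)], of "is"]
    iterated_partial_cmult[OF assms(2), of "is" "-1"] by simp

lemma iterated_partial_zero [simp]: "iterated_partial is (\<lambda>x. 0) = (\<lambda>x. 0)"
  by (induction "is") auto

lemma iterated_partial_sum:
  assumes "finite I" "\<And>i. i \<in> I \<Longrightarrow> f i \<in> schwartz"
  shows "iterated_partial is (\<lambda>x. \<Sum>i\<in>I. f i x) = (\<lambda>x. \<Sum>i\<in>I. iterated_partial is (f i) x)"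
  using assms
  by (induction I rule: finite_induct) (simp_all add: iterated_partial_add schwartz_sum)

lemma partial_affine:
  fixes f :: "real^'d::finite \<Rightarrow> 'b::real_normed_vector"
  assumes "f differentiable (at (c *\<^sub>R x + y))"
  shows "partial i (\<lambda>x. f (c *\<^sub>R x + y)) x = c *\<^sub>R partial i f (c *\<^sub>R x + y)"
proof -
  have "((\<lambda>x. f (c *\<^sub>R x + y)) has_derivative (\<lambda>h. \<Sum>i\<in>UNIV. ((c *\<^sub>R h) $ i) *\<^sub>R partial i f (c *\<^sub>R x + y))) (at x)"
    by (rule has_derivative_compose[where f = "\<lambda>x. c *\<^sub>R x + y" and g = f, OF _ has_derivative_partial[OF assms]])
       (auto intro!: derivative_eq_intros)
  also have "(\<lambda>h. \<Sum>i\<in>UNIV. ((c *\<^sub>R h) $ i) *\<^sub>R partial i f (c *\<^sub>R x + y))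
     = (\<lambda>h. c *\<^sub>R (\<Sum>i\<in>UNIV. (h $ i) *\<^sub>R partial i f (c *\<^sub>R x + y)))"
    by (simp add: scaleR_sum_right)
  finally show ?thesis by (auto dest!: partial_eqI)
qed

lemma rapid_affine:
  assumes "rapid f" "c \<noteq> 0"
  shows "rapid (\<lambda>x. f (c *\<^sub>R x + y))"
  unfolding rapid_def
proof
  fix N
  obtain A where A: "0 \<le> A" "\<And>x. (1 + norm x) ^ N * norm (f x) \<le> A" using rapidE[OF assms(1)] by blast
  define K where "K = (1 + 1 / \<bar>c\<bar>) * (1 + norm y)"
  have K: "0 \<le> K" by (simp add: K_def)
  have "1 + norm x \<le> K * (1 + norm (c *\<^sub>R x + y))" for x
  proof -
    have "norm (c *\<^sub>R x) \<le> norm (c *\<^sub>R x + y) + norm y"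
      by (metis add_diff_cancel_right' norm_triangle_ineq4)
    then have "\<bar>c\<bar> * norm x \<le> norm (c *\<^sub>R x + y) + norm y" by simp
    then have "norm x \<le> (1 / \<bar>c\<bar>) * (norm (c *\<^sub>R x + y) + norm y)"
      using assms(2) by (simp add: field_simps)
    moreover have "(1 / \<bar>c\<bar>) * (norm (c *\<^sub>R x + y) + norm y) \<le> (1 / \<bar>c\<bar>) * ((1 + norm y) * (1 + norm (c *\<^sub>R x + y)))"
      by (intro mult_left_mono) (auto simp: algebra_simps)
    moreover have "1 * 1 \<le> (1 + norm y) * (1 + norm (c *\<^sub>R x + y))" by (intro mult_mono) auto
    moreover have "K * (1 + norm (c *\<^sub>R x + y)) = (1 + norm y) * (1 + norm (c *\<^sub>R x + y))
        + (1 / \<bar>c\<bar>) * ((1 + norm y) * (1 + norm (c *\<^sub>R x + y)))"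
      by (simp add: K_def distrib_right mult.assoc)
    ultimately show ?thesis by linarith
  qed
  then have "(1 + norm x) ^ N * norm (f (c *\<^sub>R x + y)) \<le> (K * (1 + norm (c *\<^sub>R x + y))) ^ N * norm (f (c *\<^sub>R x + y))" for x
    by (intro mult_right_mono power_mono) auto
  also have "(K * (1 + norm (c *\<^sub>R x + y))) ^ N * norm (f (c *\<^sub>R x + y)) \<le> K ^ N * A" for x
    using A(2)[of "c *\<^sub>R x + y"] K by (simp add: power_mult_distrib mult.assoc mult_left_mono)
  finally show "\<exists>C. \<forall>x. (1 + norm x) ^ N * norm (f (c *\<^sub>R x + y)) \<le> C" by blast
qed

lemma schwartz_affine: assumes "f \<in> schwartz" "c \<noteq> 0" shows "(\<lambda>x. f (c *\<^sub>R x + y)) \<in> schwartz"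
proof (rule schwartz_coinduct[where A = "{\<lambda>x. f (c *\<^sub>R x + y) |f. f \<in> schwartz}"])
  fix g assume "g \<in> {\<lambda>x. f (c *\<^sub>R x + y) |f. f \<in> schwartz}"
  then obtain f where g: "g = (\<lambda>x. f (c *\<^sub>R x + y))" and f: "f \<in> schwartz" by auto
  have "partial i g = (\<lambda>x. complex_of_real c * partial i f (c *\<^sub>R x + y))" for i
    unfolding g using f
    by (intro ext) (simp add: partial_affine schwartz_differentiable scaleR_conv_of_real[where 'a = complex])
  moreover have "(\<lambda>x. complex_of_real c * partial i f x) \<in> schwartz" for i
    using f by (intro schwartz_cmult schwartz_partial)
  ultimately have "partial i g \<in> {\<lambda>x. f (c *\<^sub>R x + y) |f. f \<in> schwartz}" for i
    by (auto intro!: exI[of _ "\<lambda>x. complex_of_real c * partial i f x"])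
  moreover have "g differentiable (at x)" for x
    unfolding g using differentiable_compose[of f "\<lambda>x. c *\<^sub>R x + y" x UNIV] schwartz_differentiable[OF f]
    by auto
  ultimately show "(\<forall>x. g differentiable (at x)) \<and> rapid g \<and> (\<forall>i. partial i g \<in> {\<lambda>x. f (c *\<^sub>R x + y) |f. f \<in> schwartz})"
    using rapid_affine[OF schwartz_rapid[OF f] assms(2), of y] by (auto simp: g)
qed (use assms in auto)

lemma schwartz_shift: "f \<in> schwartz \<Longrightarrow> (\<lambda>x. f (x - y)) \<in> schwartz"
  using schwartz_affine[of f 1 "-y"] by simp

lemma schwartz_reflect: "f \<in> schwartz \<Longrightarrow> (\<lambda>x. f (- x)) \<in> schwartz"
  using schwartz_affine[of f "-1" 0] by simp

lemma iterated_partial_affine: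
  assumes "f \<in> schwartz"
  shows "iterated_partial is (\<lambda>x. f (c *\<^sub>R x + y)) = (\<lambda>x. c ^ length is *\<^sub>R iterated_partial is f (c *\<^sub>R x + y))"
proof (induction "is")
  case (Cons i "is")
  let ?g = "iterated_partial is f"
  have "partial i (\<lambda>x. c ^ length is *\<^sub>R ?g (c *\<^sub>R x + y)) = (\<lambda>x. c ^ length is *\<^sub>R partial i (\<lambda>x. ?g (c *\<^sub>R x + y)) x)"
  proof
    fix x
    have "(\<lambda>x. ?g (c *\<^sub>R x + y)) differentiable (at x)"
      using differentiable_compose[of ?g "\<lambda>x. c *\<^sub>R x + y" x UNIV] schwartz_differentiable[OF schwartz_iterated_partial[OF assms]]
      by auto
    from has_derivative_scaleR_right[OF has_derivative_partial[OF this], of "c ^ length is"]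
    show "partial i (\<lambda>x. c ^ length is *\<^sub>R ?g (c *\<^sub>R x + y)) x = c ^ length is *\<^sub>R partial i (\<lambda>x. ?g (c *\<^sub>R x + y)) x"
      by (auto dest!: partial_eqI)
  qed
  then show ?case
    by (simp add: Cons partial_affine schwartz_differentiable schwartz_iterated_partial assms mult.commute)
qed simp

lemma iterated_partial_shift:
  "f \<in> schwartz \<Longrightarrow> iterated_partial is (\<lambda>x. f (x - y)) = (\<lambda>x. iterated_partial is f (x - y))"
  using iterated_partial_affine[of f "is" 1 "-y"] by simp

text \<open>The coordinate functions have polynomial growth, and so have their derivatives; the products
  of Schwartz functions with a coordinate or without one form a family as required by the coinduction.\<close>

lemma schwartz_coord: assumes "f \<in> schwartz" shows "(\<lambda>x. complex_of_real (x $ i) * f x) \<in> schwartz"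
proof (rule schwartz_coinduct_upto[where A = "schwartz \<union> {\<lambda>x. complex_of_real (x $ i) * f x |f. f \<in> schwartz}"])
  let ?A = "schwartz \<union> {\<lambda>x. complex_of_real (x $ i) * f x |f. f \<in> schwartz}"
  show "add_closure ?A (\<lambda>x. complex_of_real (x $ i) * f x)"
    using assms by (intro add_closure.base) auto
  fix g assume "g \<in> ?A"
  then show "(\<forall>x. g differentiable (at x)) \<and> rapid g \<and> (\<forall>k. add_closure ?A (partial k g))"
  proof
    assume "g \<in> schwartz"
    then show ?thesis
      by (auto intro!: add_closure.base schwartz_differentiable schwartz_rapid schwartz_partial)
  next
    assume "g \<in> {\<lambda>x. complex_of_real (x $ i) * f x |f. f \<in> schwartz}"
    then obtain f where g: "g = (\<lambda>x. complex_of_real (x $ i) * f x)" and f: "f \<in> schwartz" by auto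
    have d: "((\<lambda>x. complex_of_real (x $ i)) has_derivative (\<lambda>h. complex_of_real (h $ i))) (at x)" for x
      by (intro bounded_linear_imp_has_derivative bounded_linear_compose[OF bounded_linear_of_real]
          bounded_linear_vec_nth)
    have diff: "(\<lambda>x. complex_of_real (x $ i)) differentiable (at x)" for x
      using d unfolding differentiable_def by blast
    have "partial k g = (\<lambda>x. complex_of_real (axis k 1 $ i) * f x + complex_of_real (x $ i) * partial k f x)" for k
      unfolding g using partial_mult[OF diff schwartz_differentiable[OF f]] partial_eqI[OF d] by auto
    then have "add_closure ?A (partial k g)" for k
      by (simp only:, intro add_closure.add[of ?A] add_closure.base)
         (use f in \<open>auto intro: schwartz_cmult schwartz_partial\<close>)
    moreover have "rapid g"
    proof (rule rapid_bounded_mult[OF schwartz_rapid[OF f], of _ 1 1])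
      fix x show "norm (g x) \<le> 1 * (1 + norm x) ^ 1 * norm (f x)"
        using component_le_norm_cart[of x i] by (auto simp: g norm_mult intro!: mult_right_mono)
    qed
    ultimately show ?thesis
      using differentiable_mult[OF diff schwartz_differentiable[OF f]] by (auto simp: g)
  qed
qed

lemma cis_inner_has_derivative:
  "((\<lambda>x. cis (x \<bullet> y)) has_derivative (\<lambda>h. \<i> * cis (x \<bullet> y) * complex_of_real (h \<bullet> y))) (at x)"
proof -
  have "((\<lambda>x. \<i> * complex_of_real (x \<bullet> y)) has_derivative (\<lambda>h. \<i> * complex_of_real (h \<bullet> y))) (at x)"
    by (intro bounded_linear_imp_has_derivative bounded_linear_compose[OF bounded_linear_mult_right]
        bounded_linear_compose[OF bounded_linear_of_real] bounded_linear_inner_left)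
  from has_derivative_compose[OF this DERIV_exp[unfolded has_field_derivative_def]]
  show ?thesis by (simp add: cis_conv_exp mult_ac)
qed

lemma schwartz_modulate: assumes "f \<in> schwartz" shows "(\<lambda>x. cis (x \<bullet> y) * f x) \<in> schwartz"
proof (rule schwartz_coinduct_upto[where A = "{\<lambda>x. cis (x \<bullet> y) * f x |f. f \<in> schwartz}"])
  let ?A = "{\<lambda>x. cis (x \<bullet> y) * f x |f. f \<in> schwartz}"
  show "add_closure ?A (\<lambda>x. cis (x \<bullet> y) * f x)"
    using assms by (intro add_closure.base) auto
  fix g assume "g \<in> ?A"
  then obtain f where g: "g = (\<lambda>x. cis (x \<bullet> y) * f x)" and f: "f \<in> schwartz" by auto
  have diff: "(\<lambda>x. cis (x \<bullet> y)) differentiable (at x)" for x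
    using cis_inner_has_derivative unfolding differentiable_def by blast
  have "partial k g = (\<lambda>x. cis (x \<bullet> y) * (\<i> * complex_of_real (axis k 1 \<bullet> y) * f x) + cis (x \<bullet> y) * partial k f x)" for k
    unfolding g
    by (intro ext, subst partial_mult[OF diff schwartz_differentiable[OF f]],
        subst partial_eqI[OF cis_inner_has_derivative]) (simp add: mult_ac)
  moreover have "add_closure ?A (\<lambda>x. cis (x \<bullet> y) * h x)" if "h \<in> schwartz" for h
    using that by (intro add_closure.base) auto
  ultimately have "add_closure ?A (partial k g)" for k
    using f by (simp only:) (intro add_closure.add[of ?A], auto intro: schwartz_cmult schwartz_partial)
  moreover have "rapid g"
    by (rule rapid_bounded_mult[OF schwartz_rapid[OF f], of _ 1 0]) (auto simp: g norm_mult)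
  ultimately show "(\<forall>x. g differentiable (at x)) \<and> rapid g \<and> (\<forall>i. add_closure ?A (partial i g))"
    using differentiable_mult[OF diff schwartz_differentiable[OF f]] by (auto simp: g)
qed

lemma smooth_partial: "smooth f \<Longrightarrow> smooth (partial i f)"
  unfolding smooth_def using iterated_partial_append[of _ "[i]" f] by (metis iterated_partial.simps(1) iterated_partial_Cons)

lemma smooth_differentiable: "smooth f \<Longrightarrow> f differentiable (at x)"
  unfolding smooth_def by (metis iterated_partial.simps(1))

lemma schwartz_compact_support:
  fixes m :: "real^'d::finite \<Rightarrow> real"
  assumes "smooth m" "\<And>x. R < norm x \<Longrightarrow> m x = 0"
  shows "(\<lambda>x. complex_of_real (m x)) \<in> schwartz"
proof (rule schwartz_coinduct[where A = "{\<lambda>x. complex_of_real (m x) |m. smooth m \<and> (\<forall>x. R < norm x \<longrightarrow> m x = 0)}"])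
  fix g :: "real^'d \<Rightarrow> complex"
  assume "g \<in> {\<lambda>x. complex_of_real (m x) |m. smooth m \<and> (\<forall>x. R < norm x \<longrightarrow> m x = 0)}"
  then obtain m where g: "g = (\<lambda>x. complex_of_real (m x))" and m: "smooth m" "\<And>x. R < norm x \<Longrightarrow> m x = 0" by auto
  have md: "m differentiable (at x)" for x using smooth_differentiable[OF m(1)] .
  have gd: "(g has_derivative (\<lambda>h. complex_of_real (frechet_derivative m (at x) h))) (at x)" for x
    unfolding g using md by (intro has_derivative_of_real) (auto simp: frechet_derivative_works)
  have p: "partial i g = (\<lambda>x. complex_of_real (partial i m x))" for i
    using partial_eqI[OF gd] by (auto simp: partial_def)
  have p0: "partial i m x = 0" if "R < norm x" for i x
  proof -
    have "((\<lambda>x. 0) has_derivative (\<lambda>h. 0 :: real)) (at x)" by simp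
    then have "(m has_derivative (\<lambda>h. 0)) (at x)"
      by (rule has_derivative_transform_within_open[where s = "{x. R < norm x}"])
         (use that m(2) in \<open>auto intro!: open_Collect_less continuous_intros\<close>)
    then show ?thesis by (subst partial_eqI) auto
  qed
  have "rapid g" unfolding rapid_def
  proof
    fix N
    let ?w = "\<lambda>x. (1 + norm x) ^ N * norm (g x)"
    have "continuous_on UNIV g" using gd
      by (meson UNIV_I continuous_at_imp_continuous_on has_derivative_continuous)
    then have "continuous_on (cball 0 R) ?w"
      by (auto intro!: continuous_intros intro: continuous_on_subset)
    then have "compact (?w ` cball 0 R)" by (intro compact_continuous_image) auto
    then obtain C where C: "\<forall>y \<in> ?w ` cball 0 R. norm y \<le> C"
      using compact_imp_bounded bounded_iff by metis
    have "?w x \<le> max C 0" for x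
    proof (cases "norm x \<le> R")
      case True
      then have "norm (?w x) \<le> C" using C by (simp add: dist_norm)
      then have "?w x \<le> C" by (rule order_trans[rotated]) simp
      then show ?thesis by simp
    next
      case False
      then show ?thesis by (simp add: g m(2))
    qed
    then show "\<exists>C. \<forall>x. ?w x \<le> C" by blast
  qed
  moreover have "\<forall>i. partial i g \<in> {\<lambda>x. complex_of_real (m x) |m. smooth m \<and> (\<forall>x. R < norm x \<longrightarrow> m x = 0)}"
    unfolding p using p0 smooth_partial[OF m(1)] by auto
  ultimately show "(\<forall>x. g differentiable (at x)) \<and> rapid g \<and> (\<forall>i. partial i g \<in> {\<lambda>x. complex_of_real (m x) |m. smooth m \<and> (\<forall>x. R < norm x \<longrightarrow> m x = 0)})"
    using gd unfolding differentiable_def by blast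
qed (use assms in auto)

lemma norm_sum_scaleR_le:
  fixes h :: "real^'d::finite"
  shows "norm (\<Sum>i\<in>UNIV. (h $ i) *\<^sub>R (g i :: 'b::real_normed_vector)) \<le> norm h * (\<Sum>i\<in>UNIV. norm (g i))"
proof -
  have "norm (\<Sum>i\<in>UNIV. (h $ i) *\<^sub>R g i) \<le> (\<Sum>i\<in>UNIV. norm h * norm (g i))"
    by (intro sum_norm_le) (auto intro!: mult_right_mono component_le_norm_cart)
  then show ?thesis by (simp add: sum_distrib_left)
qed

lemma one_plus_norm_mult: "1 + norm (z::'a::real_normed_vector) \<le> (1 + norm (z + h)) * (1 + norm h)"
proof -
  have "norm z \<le> norm (z + h) + norm h" by (metis add_diff_cancel_right' norm_triangle_ineq4)
  moreover have "0 \<le> norm (z + h) * norm h" by simp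
  moreover have "(1 + norm (z + h)) * (1 + norm h) = 1 + norm (z + h) + norm h + norm (z + h) * norm h"
    by (simp add: distrib_left distrib_right)
  ultimately show ?thesis by linarith
qed

text \<open>The mean value theorem on the segment from \<open>z\<close> to \<open>z + h\<close>. The weight at an intermediate point
  is compared with the weight at \<open>z\<close> by \<open>one_plus_norm_mult\<close>, at the price of a power of \<open>1 + norm h\<close>.\<close>

lemma schwartz_lipschitz:
  assumes "\<rho> \<in> schwartz"
  obtains C where "0 \<le> C" "\<And>z h. (1 + norm z) ^ N * norm (\<rho> (z + h) - \<rho> z) \<le> C * norm h * (1 + norm h) ^ N"
proof -
  have "\<forall>i. \<exists>C. \<forall>x. (1 + norm x) ^ N * norm (partial i \<rho> x) \<le> C"
    using schwartz_rapid[OF schwartz_partial[OF assms]] unfolding rapid_def by blast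
  from choice[OF this] obtain B where B: "\<And>i x. (1 + norm x) ^ N * norm (partial i \<rho> x) \<le> B i" by auto
  have B0: "0 \<le> sum B UNIV"
  proof (intro sum_nonneg)
    fix i show "0 \<le> B i" by (rule order_trans[OF _ B[of 0 i]]) simp
  qed
  have "(1 + norm z) ^ N * norm (\<rho> (z + h) - \<rho> z) \<le> sum B UNIV * norm h * (1 + norm h) ^ N" for z h
  proof -
    define K where "K = sum B UNIV * (1 + norm h) ^ N / (1 + norm z) ^ N"
    have "norm (\<rho> (z + h) - \<rho> z) \<le> K * norm (z + h - z)"
    proof (rule differentiable_bound[of "closed_segment z (z + h)" \<rho> "\<lambda>x h. \<Sum>i\<in>UNIV. (h $ i) *\<^sub>R partial i \<rho> x"])
      fix x assume "x \<in> closed_segment z (z + h)"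
      then obtain t where t: "0 \<le> t" "t \<le> 1" "x = z + t *\<^sub>R h"
        by (auto simp: in_segment algebra_simps)
      show "(\<rho> has_derivative (\<lambda>h. \<Sum>i\<in>UNIV. (h $ i) *\<^sub>R partial i \<rho> x)) (at x within closed_segment z (z + h))"
        using schwartz_has_derivative[OF assms] has_derivative_at_withinI by blast
      have "1 + norm z \<le> (1 + norm x) * (1 + norm (t *\<^sub>R h))" unfolding t(3) by (rule one_plus_norm_mult)
      also have "\<dots> \<le> (1 + norm x) * (1 + norm h)"
        using t by (intro mult_left_mono) (auto simp: mult_left_le_one_le)
      finally have "(1 + norm z) ^ N \<le> ((1 + norm x) * (1 + norm h)) ^ N" by (intro power_mono) auto
      then have w: "(1 + norm z) ^ N \<le> (1 + norm x) ^ N * (1 + norm h) ^ N" by (simp add: power_mult_distrib)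
      have "(\<Sum>i\<in>UNIV. norm (partial i \<rho> x)) * (1 + norm z) ^ N
         \<le> (\<Sum>i\<in>UNIV. norm (partial i \<rho> x)) * ((1 + norm x) ^ N * (1 + norm h) ^ N)"
        by (intro mult_left_mono w sum_nonneg) auto
      also have "\<dots> = (\<Sum>i\<in>UNIV. (1 + norm x) ^ N * norm (partial i \<rho> x)) * (1 + norm h) ^ N"
        by (simp add: sum_distrib_left sum_distrib_right mult_ac)
      also have "\<dots> \<le> sum B UNIV * (1 + norm h) ^ N"
        by (intro mult_right_mono sum_mono B) auto
      finally have "(\<Sum>i\<in>UNIV. norm (partial i \<rho> x)) \<le> K"
        by (simp add: K_def pos_le_divide_eq add_pos_nonneg)
      then have "norm k * (\<Sum>i\<in>UNIV. norm (partial i \<rho> x)) \<le> norm k * K" for k :: "real^'a"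
        by (rule mult_left_mono) simp
      then have "norm (\<Sum>i\<in>UNIV. (k $ i) *\<^sub>R partial i \<rho> x) \<le> K * norm k" for k
        by (subst mult.commute) (rule order_trans[OF norm_sum_scaleR_le])
      then show "onorm (\<lambda>k. \<Sum>i\<in>UNIV. (k $ i) *\<^sub>R partial i \<rho> x) \<le> K"
        by (intro onorm_le)
    qed auto
    then have "(1 + norm z) ^ N * norm (\<rho> (z + h) - \<rho> z) \<le> (1 + norm z) ^ N * (K * norm h)"
      by (intro mult_left_mono) auto
    also have "\<dots> = sum B UNIV * norm h * (1 + norm h) ^ N"
    proof -
      have "0 < 1 + norm z" by (simp add: add_pos_nonneg)
      then have "1 + norm z \<noteq> 0" by (rule less_imp_neq[symmetric])
      then show ?thesis by (simp add: K_def mult_ac)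
    qed
    finally show ?thesis .
  qed
  then show ?thesis by (rule that[OF B0])
qed

text \<open>The mean value theorem for \<open>\<rho>\<close> minus its affine part, whose derivative is estimated by applying the previous
  lemma to the partial derivatives of \<open>\<rho>\<close>.\<close>

lemma schwartz_taylor:
  assumes "\<rho> \<in> schwartz"
  obtains C where "0 \<le> C" "\<And>z h. (1 + norm z) ^ N * norm (\<rho> (z + h) - \<rho> z - (\<Sum>i\<in>UNIV. (h $ i) *\<^sub>R partial i \<rho> z))
       \<le> C * (norm h)\<^sup>2 * (1 + norm h) ^ N"
proof -
  have "\<forall>i. \<exists>C. 0 \<le> C \<and> (\<forall>z h. (1 + norm z) ^ N * norm (partial i \<rho> (z + h) - partial i \<rho> z) \<le> C * norm h * (1 + norm h) ^ N)"
  proof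
    fix i
    obtain C where "0 \<le> C" "\<And>z h. (1 + norm z) ^ N * norm (partial i \<rho> (z + h) - partial i \<rho> z) \<le> C * norm h * (1 + norm h) ^ N"
      using schwartz_lipschitz[OF schwartz_partial[OF assms], of N i] by blast
    then show "\<exists>C. 0 \<le> C \<and> (\<forall>z h. (1 + norm z) ^ N * norm (partial i \<rho> (z + h) - partial i \<rho> z) \<le> C * norm h * (1 + norm h) ^ N)"
      by blast
  qed
  from choice[OF this] obtain B where B0: "\<And>i. 0 \<le> B i" and
    B: "\<And>i z h. (1 + norm z) ^ N * norm (partial i \<rho> (z + h) - partial i \<rho> z) \<le> B i * norm h * (1 + norm h) ^ N" by auto
  have "(1 + norm z) ^ N * norm (\<rho> (z + h) - \<rho> z - (\<Sum>i\<in>UNIV. (h $ i) *\<^sub>R partial i \<rho> z))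
       \<le> sum B UNIV * (norm h)\<^sup>2 * (1 + norm h) ^ N" for z h
  proof -
    define K where "K = sum B UNIV * norm h * (1 + norm h) ^ N / (1 + norm z) ^ N"
    define f where "f = (\<lambda>k. \<rho> (k + z) - (\<Sum>i\<in>UNIV. (k $ i) *\<^sub>R partial i \<rho> z))"
    have "norm (f h - f 0) \<le> K * norm (h - 0)"
    proof (rule differentiable_bound[of "closed_segment 0 h" f "\<lambda>x k. \<Sum>i\<in>UNIV. (k $ i) *\<^sub>R (partial i \<rho> (x + z) - partial i \<rho> z)"])
      fix x assume "x \<in> closed_segment 0 h"
      then obtain t where t: "0 \<le> t" "t \<le> 1" "x = t *\<^sub>R h"
        by (auto simp: in_segment algebra_simps)
      have nx: "norm x \<le> norm h" using t by (simp add: mult_left_le_one_le)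
      have d: "(f has_derivative (\<lambda>k. (\<Sum>i\<in>UNIV. (k $ i) *\<^sub>R partial i \<rho> (x + z)) - (\<Sum>i\<in>UNIV. (k $ i) *\<^sub>R partial i \<rho> z))) (at x)"
        unfolding f_def
      proof (rule has_derivative_diff)
        show "((\<lambda>x. \<rho> (x + z)) has_derivative (\<lambda>k. \<Sum>i\<in>UNIV. k $ i *\<^sub>R partial i \<rho> (x + z))) (at x)"
          by (rule has_derivative_compose[where f = "\<lambda>x. x + z" and f' = "\<lambda>h. h" and g = \<rho>, OF _ schwartz_has_derivative[OF assms]])
             (auto intro!: derivative_eq_intros)
        show "((\<lambda>k. \<Sum>i\<in>UNIV. (k $ i) *\<^sub>R partial i \<rho> z) has_derivative (\<lambda>k. \<Sum>i\<in>UNIV. (k $ i) *\<^sub>R partial i \<rho> z)) (at x)"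
          by (intro bounded_linear_imp_has_derivative bounded_linear_sum
              bounded_linear_compose[OF bounded_linear_scaleR_left bounded_linear_vec_nth])
      qed
      have eq: "(\<lambda>k :: real^'a. (\<Sum>i\<in>UNIV. (k $ i) *\<^sub>R partial i \<rho> (x + z)) - (\<Sum>i\<in>UNIV. (k $ i) *\<^sub>R partial i \<rho> z))
          = (\<lambda>k. \<Sum>i\<in>UNIV. (k $ i) *\<^sub>R (partial i \<rho> (x + z) - partial i \<rho> z))"
        by (intro ext) (simp add: scaleR_diff_right sum_subtractf)
      show "(f has_derivative (\<lambda>k. \<Sum>i\<in>UNIV. (k $ i) *\<^sub>R (partial i \<rho> (x + z) - partial i \<rho> z))) (at x within closed_segment 0 h)"
        by (rule has_derivative_at_withinI[OF d[unfolded eq]])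
      have "(\<Sum>i\<in>UNIV. norm (partial i \<rho> (x + z) - partial i \<rho> z)) * (1 + norm z) ^ N
         = (\<Sum>i\<in>UNIV. (1 + norm z) ^ N * norm (partial i \<rho> (z + x) - partial i \<rho> z))"
        by (simp add: sum_distrib_left mult_ac add.commute)
      also have "\<dots> \<le> (\<Sum>i\<in>UNIV. B i * norm x * (1 + norm x) ^ N)" by (intro sum_mono B)
      also have "\<dots> \<le> (\<Sum>i\<in>UNIV. B i * norm h * (1 + norm h) ^ N)"
        using nx by (intro sum_mono mult_mono power_mono) (auto simp: B0)
      finally have "(\<Sum>i\<in>UNIV. norm (partial i \<rho> (x + z) - partial i \<rho> z)) \<le> K"
        by (simp add: K_def pos_le_divide_eq add_pos_nonneg sum_distrib_right)
      then have "norm k * (\<Sum>i\<in>UNIV. norm (partial i \<rho> (x + z) - partial i \<rho> z)) \<le> norm k * K" for k :: "real^'a"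
        by (rule mult_left_mono) simp
      then have "norm (\<Sum>i\<in>UNIV. (k $ i) *\<^sub>R (partial i \<rho> (x + z) - partial i \<rho> z)) \<le> K * norm k" for k
        by (subst mult.commute) (rule order_trans[OF norm_sum_scaleR_le])
      then show "onorm (\<lambda>k. \<Sum>i\<in>UNIV. (k $ i) *\<^sub>R (partial i \<rho> (x + z) - partial i \<rho> z)) \<le> K"
        by (intro onorm_le)
    qed auto
    moreover have "f h - f 0 = \<rho> (z + h) - \<rho> z - (\<Sum>i\<in>UNIV. (h $ i) *\<^sub>R partial i \<rho> z)"
      by (simp add: f_def algebra_simps)
    ultimately have "(1 + norm z) ^ N * norm (\<rho> (z + h) - \<rho> z - (\<Sum>i\<in>UNIV. (h $ i) *\<^sub>R partial i \<rho> z))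
        \<le> (1 + norm z) ^ N * (K * norm h)"
      by (intro mult_left_mono) auto
    also have "\<dots> = sum B UNIV * (norm h)\<^sup>2 * (1 + norm h) ^ N"
    proof -
      have "0 < 1 + norm z" by (simp add: add_pos_nonneg)
      then have "1 + norm z \<noteq> 0" by (rule less_imp_neq[symmetric])
      then show ?thesis by (simp add: K_def mult_ac power2_eq_square)
    qed
    finally show ?thesis .
  qed
  then show ?thesis by (rule that[OF sum_nonneg[OF B0]])
qed

lemma has_derivative_quadratic:
  assumes "bounded_linear L" and "\<And>h. norm h \<le> 1 \<Longrightarrow> norm (f (x + h) - f x - L h) \<le> C * (norm h)\<^sup>2"
  shows "(f has_derivative L) (at x)"
  unfolding has_derivative_at
proof (intro conjI assms(1), rule tendsto_sandwich[of "\<lambda>h. 0" _ _ "\<lambda>h. C * norm h"])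
  have "\<forall>\<^sub>F h in at 0. norm (h :: 'a) < 1"
    by (auto simp: eventually_at intro!: exI[of _ 1])
  then show "\<forall>\<^sub>F h in at 0. norm (f (x + h) - f x - L h) / norm h \<le> C * norm h"
  proof eventually_elim
    case (elim h)
    then have "norm (f (x + h) - f x - L h) \<le> C * (norm h)\<^sup>2" using assms(2) by simp
    then show ?case by (cases "h = 0") (auto simp: field_simps power2_eq_square)
  qed
  show "(\<lambda>h. C * norm h) \<midarrow>0\<rightarrow> 0" by (auto intro!: tendsto_eq_intros)
qed auto

lemma finite_lists_le: "finite {is :: 'd::finite list. length is \<le> N}"
  using finite_lists_length_le[of "UNIV :: 'd set" N] by simp

text \<open>Continuity of a tempered distribution in the form in which it is applied: a bound for each single
  derivative of the test function suffices.\<close>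

lemma tempered_bound:
  fixes v :: "'d::finite functional"
  assumes "tempered v"
  obtains C N where "0 \<le> C"
    "\<And>\<psi> B. \<psi> \<in> schwartz \<Longrightarrow>
       (\<And>x is. length is \<le> N \<Longrightarrow> (1 + norm x) ^ N * norm (iterated_partial is \<psi> x) \<le> B) \<Longrightarrow> norm (v \<psi>) \<le> C * B"
proof -
  obtain C N where v: "\<And>\<psi>. \<psi> \<in> schwartz \<Longrightarrow> norm (v \<psi>) \<le> C * schwartz_seminorm N \<psi>"
    using assms unfolding tempered_def by blast
  define n where "n = real (card {is :: 'd list. length is \<le> N})"
  have "norm (v \<psi>) \<le> (\<bar>C\<bar> * n) * B"
    if \<psi>: "\<psi> \<in> schwartz" and B: "\<And>x is. length is \<le> N \<Longrightarrow> (1 + norm x) ^ N * norm (iterated_partial is \<psi> x) \<le> B" for \<psi> B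
  proof -
    have le: "(1 + norm x) ^ N * (\<Sum>is | length is \<le> N. norm (iterated_partial is \<psi> x)) \<le> n * B" for x
    proof -
      have "(1 + norm x) ^ N * (\<Sum>is | length is \<le> N. norm (iterated_partial is \<psi> x))
         \<le> (\<Sum>is :: 'd list | length is \<le> N. B)"
        unfolding sum_distrib_left by (intro sum_mono B) auto
      then show ?thesis by (simp add: n_def)
    qed
    then have "schwartz_seminorm N \<psi> \<le> n * B"
      unfolding schwartz_seminorm_def by (intro cSUP_least) auto
    moreover have "0 \<le> schwartz_seminorm N \<psi>"
    proof -
      let ?w = "\<lambda>x. (1 + norm x) ^ N * (\<Sum>is | length is \<le> N. norm (iterated_partial is \<psi> x))"
      have "bdd_above (range ?w)" using le by (rule bdd_aboveI2)
      then have "?w 0 \<le> schwartz_seminorm N \<psi>"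
        unfolding schwartz_seminorm_def by (intro cSUP_upper[OF UNIV_I])
      moreover have "0 \<le> ?w 0" by (intro mult_nonneg_nonneg sum_nonneg) auto
      ultimately show ?thesis by linarith
    qed
    ultimately have "\<bar>C\<bar> * schwartz_seminorm N \<psi> \<le> \<bar>C\<bar> * (n * B)" by (intro mult_left_mono) auto
    moreover have "C * schwartz_seminorm N \<psi> \<le> \<bar>C\<bar> * schwartz_seminorm N \<psi>"
      using \<open>0 \<le> schwartz_seminorm N \<psi>\<close> by (intro mult_right_mono) auto
    ultimately show ?thesis using v[OF \<psi>] by (simp add: mult.assoc)
  qed
  moreover have "0 \<le> \<bar>C\<bar> * n" by (simp add: n_def)
  ultimately show ?thesis using that by blast
qed

lemma schwartz_seminorm_bound:
  assumes "\<psi> \<in> schwartz" "length is \<le> N"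
  shows "(1 + norm x) ^ N * norm (iterated_partial is \<psi> x) \<le> schwartz_seminorm N \<psi>"
proof -
  have "\<forall>js. \<exists>C. \<forall>x. (1 + norm x) ^ N * norm (iterated_partial js \<psi> x) \<le> C"
    using schwartz_rapid[OF schwartz_iterated_partial[OF assms(1)]] unfolding rapid_def by blast
  from choice[OF this] obtain B where B: "\<And>js x. (1 + norm x) ^ N * norm (iterated_partial js \<psi> x) \<le> B js"
    by auto
  have "(1 + norm x) ^ N * (\<Sum>is | length is \<le> N. norm (iterated_partial is \<psi> x)) \<le> (\<Sum>is | length is \<le> N. B is)" for x
    unfolding sum_distrib_left by (intro sum_mono B)
  then have bdd: "bdd_above (range (\<lambda>x. (1 + norm x) ^ N * (\<Sum>is | length is \<le> N. norm (iterated_partial is \<psi> x))))"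
    by (intro bdd_aboveI2)
  have "norm (iterated_partial is \<psi> x) \<le> (\<Sum>is | length is \<le> N. norm (iterated_partial is \<psi> x))"
    using assms(2) finite_lists_le by (intro member_le_sum[where f = "\<lambda>js. norm (iterated_partial js \<psi> x)"]) auto
  then have "(1 + norm x) ^ N * norm (iterated_partial is \<psi> x)
     \<le> (1 + norm x) ^ N * (\<Sum>is | length is \<le> N. norm (iterated_partial is \<psi> x))"
    by (intro mult_left_mono) auto
  also have "\<dots> \<le> schwartz_seminorm N \<psi>"
    unfolding schwartz_seminorm_def by (rule cSUP_upper[OF UNIV_I bdd])
  finally show ?thesis .
qed

section \<open>The Fourier transform on Schwartz functions\<close>

lemma lborel_prod_cart:
  fixes g :: "'d::finite \<Rightarrow> real \<Rightarrow> 'b::{real_normed_field,banach,second_countable_topology}"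
  assumes g: "\<And>i. integrable lborel (g i)"
  shows "integrable lborel (\<lambda>x::real^'d. \<Prod>i\<in>UNIV. g i (x $ i))" (is ?int)
    and "(LINT x|lborel. (\<Prod>i\<in>UNIV. g i ((x::real^'d) $ i))) = (\<Prod>i\<in>UNIV. LINT t|lborel. g i t)" (is ?eq)
proof -
  interpret product_sigma_finite "\<lambda>b::real^'d. lborel :: real measure" ..
  define e where "e = (\<lambda>i::'d. axis i (1::real))"
  define ix where "ix = the_inv e"
  have inj: "inj e" by (auto simp: e_def inj_def axis_eq_axis)
  have ix: "ix (e i) = i" for i unfolding ix_def by (rule the_inv_f_f[OF inj])
  have B: "Basis = range e" by (auto simp: Basis_vec_def e_def)
  have eq: "(\<Prod>i\<in>UNIV. h i (x \<bullet> e i)) = (\<Prod>b\<in>Basis. h (ix b) (x \<bullet> b))" for h :: "'d \<Rightarrow> real \<Rightarrow> 'b" and x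
    unfolding B by (subst prod.reindex[OF inj]) (simp add: ix)
  have eq': "(\<Prod>i\<in>UNIV. h i) = (\<Prod>b\<in>Basis. h (ix b))" for h :: "'d \<Rightarrow> 'b"
    unfolding B by (subst prod.reindex[OF inj]) (simp add: ix)
  have xe: "x \<bullet> e i = x $ i" for x i by (simp add: e_def inner_axis)
  let ?T = "\<lambda>f. \<Sum>b\<in>Basis. f b *\<^sub>R b :: real^'d"
  let ?M = "\<Pi>\<^sub>M b\<in>Basis. (lborel :: real measure)"
  have [measurable]: "g i \<in> borel_measurable borel" for i using g[of i] by simp
  have [measurable]: "?T \<in> ?M \<rightarrow>\<^sub>M borel" by measurable
  have m: "(\<lambda>x::real^'d. \<Prod>b\<in>Basis. g (ix b) (x \<bullet> b)) \<in> borel_measurable borel" by measurable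
  have inn: "?T f \<bullet> b = f b" if "b \<in> Basis" for f b using that by simp
  have s: "(\<Prod>b\<in>Basis. g (ix b) (?T f \<bullet> b)) = (\<Prod>b\<in>Basis. g (ix b) (f b))" for f
    by (intro prod.cong) (auto simp: inn)
  have i1: "integrable ?M (\<lambda>f. \<Prod>b\<in>Basis. g (ix b) (f b))"
    using g by (intro product_integrable_prod) auto
  show ?int
    unfolding xe[symmetric] eq
    by (subst lborel_eq, subst integrable_distr_eq) (use m i1 s in auto)
  have "(LINT x|lborel. (\<Prod>i\<in>UNIV. g i ((x::real^'d) $ i))) = (LINT f|?M. (\<Prod>b\<in>Basis. g (ix b) (?T f \<bullet> b)))"
    unfolding xe[symmetric] eq by (subst lborel_eq, subst integral_distr) (use m in auto)
  also have "\<dots> = (LINT f|?M. (\<Prod>b\<in>Basis. g (ix b) (f b)))" by (simp only: s)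
  also have "\<dots> = (\<Prod>b\<in>Basis. LINT t|lborel. g (ix b) t)"
    using g by (intro product_integral_prod) auto
  finally show ?eq by (simp only: eq')
qed

text \<open>Decay of order \<open>2 d\<close> dominates the product of the integrable functions \<open>1 / (1 + x\<^sub>i\<^sup>2)\<close>.\<close>

lemma integrable_weight_bound:
  fixes f :: "real^'d::finite \<Rightarrow> 'b::{banach,second_countable_topology}"
  assumes [measurable]: "f \<in> borel_measurable borel"
    and f: "\<And>x. (1 + norm x) ^ (2 * CARD('d)) * norm (f x) \<le> C"
  shows "integrable lborel f"
proof (rule Bochner_Integration.integrable_bound)
  have "integrable lborel (\<lambda>x::real. inverse (1 + x\<^sup>2))"
    using integrable_inverse_1_plus_square by (simp add: set_integrable_def)
  from lborel_prod_cart(1)[OF this]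
  show "integrable lborel (\<lambda>x::real^'d. C * (\<Prod>i\<in>UNIV. inverse (1 + (x $ i)\<^sup>2)))"
    by (intro integrable_mult_right)
  show "AE x in lborel. norm (f x) \<le> norm (C * (\<Prod>i\<in>UNIV. inverse (1 + (x $ i)\<^sup>2)))"
  proof (intro AE_I2)
    fix x :: "real^'d"
    let ?P = "\<Prod>i\<in>UNIV. (1 + (x $ i)\<^sup>2)"
    have P: "0 < ?P" by (intro prod_pos) (auto simp: add_pos_nonneg)
    have "?P \<le> (\<Prod>i\<in>(UNIV::'d set). (1 + norm x)\<^sup>2)"
    proof (intro prod_mono conjI)
      fix i
      have "(x $ i)\<^sup>2 \<le> (norm x)\<^sup>2" using component_le_norm_cart[of x i] by (simp add: abs_le_square_iff[symmetric])
      then show "1 + (x $ i)\<^sup>2 \<le> (1 + norm x)\<^sup>2" by (simp add: power2_sum add_increasing2)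
    qed auto
    also have "\<dots> = (1 + norm x) ^ (2 * CARD('d))" by (simp add: power_mult)
    finally have "?P * norm (f x) \<le> (1 + norm x) ^ (2 * CARD('d)) * norm (f x)"
      by (intro mult_right_mono) auto
    also have "\<dots> \<le> C" by (rule f)
    also have "\<dots> \<le> \<bar>C\<bar>" by simp
    finally have "norm (f x) \<le> \<bar>C\<bar> / ?P" using P by (simp add: field_simps)
    also have "\<dots> = norm (C * (\<Prod>i\<in>UNIV. inverse (1 + (x $ i)\<^sup>2)))"
      using P by (simp add: prod_inversef[symmetric] abs_mult divide_inverse abs_prod)
    finally show "norm (f x) \<le> norm (C * (\<Prod>i\<in>UNIV. inverse (1 + (x $ i)\<^sup>2)))" .
  qed
qed simp

lemma schwartz_measurable [measurable_dest]: "f \<in> schwartz \<Longrightarrow> f \<in> borel_measurable borel"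
  by (intro borel_measurable_continuous_onI schwartz_continuous)

lemma schwartz_integrable_weight:
  fixes f :: "real^'d::finite \<Rightarrow> complex"
  assumes "f \<in> schwartz"
  shows "integrable lborel (\<lambda>x. (1 + norm x) ^ N * norm (f x))"
proof -
  have [measurable]: "f \<in> borel_measurable borel" by (rule schwartz_measurable[OF assms])
  obtain C where C: "\<And>x. (1 + norm x) ^ (2 * CARD('d) + N) * norm (f x) \<le> C"
    using rapidE[OF schwartz_rapid[OF assms]] by blast
  show ?thesis
    by (rule integrable_weight_bound[of _ C]) (use C in \<open>auto simp: power_add abs_mult mult.assoc\<close>)
qed

lemma schwartz_integrable: "f \<in> schwartz \<Longrightarrow> integrable lborel f"
  using schwartz_integrable_weight[of f 0] by (subst integrable_norm_iff[symmetric]) (auto intro: schwartz_measurable)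

lemma integrable_mult_bounded:
  fixes f g :: "'a \<Rightarrow> complex"
  assumes "integrable M f" "g \<in> borel_measurable M" "\<And>x. norm (g x) \<le> B"
  shows "integrable M (\<lambda>x. g x * f x)" "integrable M (\<lambda>x. f x * g x)"
proof -
  have "0 \<le> B" by (rule order_trans[OF _ assms(3)[of undefined]]) simp
  show "integrable M (\<lambda>x. g x * f x)"
  proof (rule Bochner_Integration.integrable_bound)
    show "integrable M (\<lambda>x. B * norm (f x))" using assms(1) by simp
    show "AE x in M. norm (g x * f x) \<le> norm (B * norm (f x))"
      using assms(3) \<open>0 \<le> B\<close> by (auto simp: norm_mult intro!: mult_right_mono)
  qed (use assms in auto)
  then show "integrable M (\<lambda>x. f x * g x)" by (simp add: mult.commute)
qed

lemma borel_measurable_cis_inner [measurable]: "(\<lambda>x. cis (x \<bullet> y)) \<in> borel_measurable borel"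
  "(\<lambda>x. cis (- (x \<bullet> y))) \<in> borel_measurable borel"
  by (intro borel_measurable_continuous_onI continuous_intros)+

lemma integrable_cis_mult:
  fixes f :: "'a::euclidean_space \<Rightarrow> complex"
  assumes "integrable lborel f"
  shows "integrable lborel (\<lambda>x. cis (x \<bullet> y) * f x)" "integrable lborel (\<lambda>x. cis (- (x \<bullet> y)) * f x)"
  by (rule integrable_mult_bounded[OF assms, of _ 1]; simp)+

lemma
  fixes f :: "'a::euclidean_space \<Rightarrow> 'b::{banach,second_countable_topology}"
  assumes c: "c \<noteq> 0" and [measurable]: "f \<in> borel_measurable borel"
  shows integral_affine: "(LINT x|lborel. f x) = \<bar>c\<bar> ^ DIM('a) *\<^sub>R (LINT x|lborel. f (t + c *\<^sub>R x))"
    and integrable_affine: "integrable lborel (\<lambda>x. f (t + c *\<^sub>R x)) \<longleftrightarrow> integrable lborel f"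
proof -
  let ?T = "\<lambda>x. t + c *\<^sub>R x"
  have "(LINT x|lborel. f x) = (LINT x|density (distr lborel borel ?T) (\<lambda>_. ennreal (\<bar>c\<bar> ^ DIM('a))). f x)"
    using lborel_affine[OF c, of t] by (simp add: ennreal_power)
  also have "\<dots> = (LINT x|distr lborel borel ?T. \<bar>c\<bar> ^ DIM('a) *\<^sub>R f x)"
    by (subst integral_density) auto
  also have "\<dots> = \<bar>c\<bar> ^ DIM('a) *\<^sub>R (LINT x|lborel. f (?T x))"
    by (subst integral_distr) auto
  finally show "(LINT x|lborel. f x) = \<bar>c\<bar> ^ DIM('a) *\<^sub>R (LINT x|lborel. f (t + c *\<^sub>R x))" .
  have "integrable lborel f \<longleftrightarrow> integrable (density (distr lborel borel ?T) (\<lambda>_. ennreal (\<bar>c\<bar> ^ DIM('a)))) f"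
    using lborel_affine[OF c, of t] by (simp add: ennreal_power)
  also have "\<dots> \<longleftrightarrow> integrable (distr lborel borel ?T) (\<lambda>x. \<bar>c\<bar> ^ DIM('a) *\<^sub>R f x)"
    by (subst integrable_density) auto
  also have "\<dots> \<longleftrightarrow> integrable lborel (\<lambda>x. \<bar>c\<bar> ^ DIM('a) *\<^sub>R f (?T x))"
    by (subst integrable_distr_eq) auto
  also have "\<dots> \<longleftrightarrow> integrable lborel (\<lambda>x. f (?T x))"
  proof
    assume i: "integrable lborel (\<lambda>x. \<bar>c\<bar> ^ DIM('a) *\<^sub>R f (?T x))"
    show "integrable lborel (\<lambda>x. f (?T x))"
      using integrable_scaleR_right[OF i, of "inverse (\<bar>c\<bar> ^ DIM('a))"] c by simp
  qed (rule integrable_scaleR_right)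
  finally show "integrable lborel (\<lambda>x. f (t + c *\<^sub>R x)) \<longleftrightarrow> integrable lborel f" by simp
qed

lemma integral_shift:
  fixes f :: "'a::euclidean_space \<Rightarrow> complex"
  assumes [measurable]: "f \<in> borel_measurable borel"
  shows "(LINT x|lborel. f (x + t)) = (LINT x|lborel. f x)"
  using integral_affine[of 1 f t] by (simp add: add.commute)

text \<open>Integration by parts in its simplest form. The difference quotients of \<open>\<psi>\<close> have integral zero by
  translation invariance, and converge dominatedly by \<open>schwartz_lipschitz\<close>.\<close>

lemma integral_partial_eq_0:
  fixes \<psi> :: "real^'d::finite \<Rightarrow> complex"
  assumes "\<psi> \<in> schwartz"
  shows "(LINT x|lborel. partial i \<psi> x) = 0"
proof -
  define h where "h = (\<lambda>n::nat. 1 / (1 + real n))"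
  have h: "0 < h n" "h n \<le> 1" for n by (auto simp: h_def field_simps)
  have h0: "h \<longlonglongrightarrow> 0" unfolding h_def by (rule lim_1_over_real_power[of 1, THEN LIMSEQ_ignore_initial_segment[where k = 1], simplified]) 
  define s where "s = (\<lambda>n x. (\<psi> (x + h n *\<^sub>R axis i 1) - \<psi> x) /\<^sub>R h n)"
  let ?N = "2 * CARD('d)"
  obtain C where C: "0 \<le> C" "\<And>z k. (1 + norm z) ^ ?N * norm (\<psi> (z + k) - \<psi> z) \<le> C * norm k * (1 + norm k) ^ ?N"
    using schwartz_lipschitz[OF assms, of ?N] by blast
  have [measurable]: "\<psi> \<in> borel_measurable borel" by (rule schwartz_measurable[OF assms])
  have int: "integrable lborel (\<lambda>x. \<psi> (x + t))" for t
    using integrable_affine[of 1 \<psi> t] schwartz_integrable[OF assms] by (simp add: add.commute)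
  have "(LINT x|lborel. s n x) = 0" for n
    unfolding s_def using int[of "h n *\<^sub>R axis i 1"] int[of 0] integral_shift[of \<psi> "h n *\<^sub>R axis i 1"] by simp
  moreover have "(\<lambda>n. LINT x|lborel. s n x) \<longlonglongrightarrow> (LINT x|lborel. partial i \<psi> x)"
  proof (rule integral_dominated_convergence)
    let ?w = "\<lambda>x::real^'d. C * 2 ^ ?N / (1 + norm x) ^ ?N"
    have pos: "0 < (1 + norm x) ^ ?N" for x :: "real^'d" by (intro zero_less_power) (simp add: add_pos_nonneg)
    show "integrable lborel ?w"
      by (rule integrable_weight_bound[of _ "C * 2 ^ ?N"]) (use C(1) pos in \<open>auto simp: less_imp_neq[symmetric]\<close>)
    show "AE x in lborel. norm (s n x) \<le> ?w x" for n
    proof (intro AE_I2)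
      fix x
      have "(1 + norm x) ^ ?N * norm (\<psi> (x + h n *\<^sub>R axis i 1) - \<psi> x) \<le> C * h n * (1 + h n) ^ ?N"
        using C(2)[of x "h n *\<^sub>R axis i 1"] h[of n] by simp
      also have "\<dots> \<le> C * h n * 2 ^ ?N"
        using h[of n] C(1) by (intro mult_left_mono power_mono) auto
      finally have "(1 + norm x) ^ ?N * (norm (\<psi> (x + h n *\<^sub>R axis i 1) - \<psi> x) / h n) \<le> C * 2 ^ ?N"
        using h[of n] by (simp add: field_simps)
      then show "norm (s n x) \<le> ?w x"
      proof -
        have "norm (s n x) = norm (\<psi> (x + h n *\<^sub>R axis i 1) - \<psi> x) / h n"
          using h[of n] by (simp add: s_def divide_inverse mult.commute)
        then show ?thesis using \<open>_ \<le> C * 2 ^ ?N\<close> pos[of x] by (simp only: pos_le_divide_eq mult.commute)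
      qed
    qed
    show "AE x in lborel. (\<lambda>n. s n x) \<longlonglongrightarrow> partial i \<psi> x"
    proof (intro AE_I2)
      fix x
      have "((\<lambda>t. x + t *\<^sub>R axis i (1::real)) has_derivative (\<lambda>t. t *\<^sub>R axis i (1::real))) (at 0)"
        by (auto intro!: derivative_eq_intros)
      moreover have "(\<psi> has_derivative (\<lambda>h. \<Sum>i\<in>UNIV. (h $ i) *\<^sub>R partial i \<psi> x)) (at (x + 0 *\<^sub>R axis i (1::real)))"
        using schwartz_has_derivative[OF assms] by simp
      ultimately have "((\<lambda>t. \<psi> (x + t *\<^sub>R axis i 1)) has_derivative
          (\<lambda>t. \<Sum>k\<in>UNIV. ((t *\<^sub>R axis i (1::real)) $ k) *\<^sub>R partial k \<psi> x)) (at 0)"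
        by (rule has_derivative_compose)
      also have "(\<lambda>t. \<Sum>k\<in>UNIV. ((t *\<^sub>R axis i (1::real)) $ k) *\<^sub>R partial k \<psi> x) = (\<lambda>t. t *\<^sub>R partial i \<psi> x)"
        using sum_axis_scaleR[of i "\<lambda>k. partial k \<psi> x"]
        by (simp only: vector_scaleR_component real_scaleR_def scaleR_scaleR[symmetric] scaleR_sum_right[symmetric])
      finally have "((\<lambda>t. \<psi> (x + t *\<^sub>R axis i 1)) has_vector_derivative partial i \<psi> x) (at 0)"
        by (simp add: has_vector_derivative_def)
      then have "((\<lambda>t. (\<psi> (x + t *\<^sub>R axis i 1) - \<psi> x) /\<^sub>R t) \<longlongrightarrow> partial i \<psi> x) (at 0)"
      proof -
        let ?q = "\<lambda>t. (\<psi> (x + t *\<^sub>R axis i 1) - \<psi> x) /\<^sub>R t"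
        assume "((\<lambda>t. \<psi> (x + t *\<^sub>R axis i 1)) has_vector_derivative partial i \<psi> x) (at 0)"
        then have "((\<lambda>t. norm (\<psi> (x + t *\<^sub>R axis i 1) - \<psi> x - t *\<^sub>R partial i \<psi> x) / norm t) \<longlongrightarrow> 0) (at 0)"
          by (simp add: has_vector_derivative_def has_derivative_at)
        moreover have "\<forall>\<^sub>F t in at 0. norm (\<psi> (x + t *\<^sub>R axis i 1) - \<psi> x - t *\<^sub>R partial i \<psi> x) / norm t = norm (?q t - partial i \<psi> x)"
        proof (rule eventually_at_filter[THEN iffD2, OF always_eventually], intro allI impI)
          fix t :: real assume "t \<noteq> 0"
          then have "?q t - partial i \<psi> x = (\<psi> (x + t *\<^sub>R axis i 1) - \<psi> x - t *\<^sub>R partial i \<psi> x) /\<^sub>R t"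
            by (simp add: scaleR_diff_right)
          then show "norm (\<psi> (x + t *\<^sub>R axis i 1) - \<psi> x - t *\<^sub>R partial i \<psi> x) / norm t = norm (?q t - partial i \<psi> x)"
            by (simp add: divide_inverse mult.commute)
        qed
        ultimately have "((\<lambda>t. norm (?q t - partial i \<psi> x)) \<longlongrightarrow> 0) (at 0)"
          by (rule Lim_transform_eventually)
        then show "(?q \<longlongrightarrow> partial i \<psi> x) (at 0)"
          by (rule LIM_zero_cancel[OF tendsto_norm_zero_cancel])
      qed
      then show "(\<lambda>n. s n x) \<longlonglongrightarrow> partial i \<psi> x"
        unfolding s_def
        by (rule filterlim_compose) (use h h0 in \<open>auto simp: filterlim_at less_imp_neq[symmetric]\<close>)
    qed
  qed (auto simp: s_def schwartz_measurable schwartz_partial assms)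
  ultimately show ?thesis by (simp add: LIMSEQ_const_iff)
qed

lemma fourier_norm_le:
  "norm (fourier \<psi> \<xi>) \<le> (LINT x|lborel. norm (\<psi> x))"
proof -
  have "norm (fourier \<psi> \<xi>) \<le> (LINT x|lborel. norm (cis (- (x \<bullet> \<xi>)) * \<psi> x))"
    unfolding fourier_def by (rule integral_norm_bound)
  then show ?thesis by (simp add: norm_mult)
qed

lemma fourier_add: "integrable lborel f \<Longrightarrow> integrable lborel g \<Longrightarrow>
    fourier (\<lambda>x. f x + g x) \<xi> = fourier f \<xi> + fourier g \<xi>"
  by (simp add: fourier_def distrib_left integrable_cis_mult)

lemma fourier_cmult: "fourier (\<lambda>x. c * f x) \<xi> = c * fourier f \<xi>"
proof -
  have "cis (- (x \<bullet> \<xi>)) * (c * f x) = c * (cis (- (x \<bullet> \<xi>)) * f x)" for x by simp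
  then show ?thesis unfolding fourier_def by (simp only: integral_mult_right_zero)
qed

lemma fourier_of_partial:
  assumes "\<psi> \<in> schwartz"
  shows "fourier (partial i \<psi>) \<xi> = \<i> * complex_of_real (\<xi> $ i) * fourier \<psi> \<xi>"
proof -
  let ?c = "\<lambda>x. cis (x \<bullet> - \<xi>)"
  have d: "?c differentiable (at x)" for x
    using cis_inner_has_derivative unfolding differentiable_def by blast
  have "partial i (\<lambda>x. ?c x * \<psi> x) x = (- \<i> * complex_of_real (\<xi> $ i)) * (cis (- (x \<bullet> \<xi>)) * \<psi> x) + cis (- (x \<bullet> \<xi>)) * partial i \<psi> x" for x
    by (subst partial_mult[OF d schwartz_differentiable[OF assms]], subst partial_eqI[OF cis_inner_has_derivative])
       (simp add: inner_axis' mult_ac)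
  then have "0 = (LINT x|lborel. (- \<i> * complex_of_real (\<xi> $ i)) * (cis (- (x \<bullet> \<xi>)) * \<psi> x) + cis (- (x \<bullet> \<xi>)) * partial i \<psi> x)"
    using integral_partial_eq_0[OF schwartz_modulate[OF assms, of "- \<xi>"], of i] by simp
  also have "\<dots> = (- \<i> * complex_of_real (\<xi> $ i)) * fourier \<psi> \<xi> + fourier (partial i \<psi>) \<xi>"
    unfolding fourier_def
    by (subst Bochner_Integration.integral_add)
       (intro integrable_mult_right integrable_cis_mult schwartz_integrable schwartz_partial assms refl
         | simp only: integral_mult_right_zero)+
  finally show ?thesis by (simp add: algebra_simps)
qed

lemma cis_taylor2: "norm (cis t - 1 - \<i> * complex_of_real t) \<le> t\<^sup>2"
proof -
  have "norm (exp (\<i> * complex_of_real t) - (1 + \<i> * complex_of_real t)) \<le> \<bar>t\<bar> ^ 2 / 2"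
    using iexp_approx1[of t 1] by (simp add: numeral_2_eq_2)
  then have "norm (cis t - 1 - \<i> * complex_of_real t) \<le> \<bar>t\<bar> ^ 2 / 2"
    by (simp add: cis_conv_exp diff_diff_eq)
  also have "\<dots> \<le> t\<^sup>2" by simp
  finally show ?thesis .
qed

text \<open>Differentiation under the integral. The Taylor remainder of the exponential is of second order in \<open>x \<bullet> h\<close>,
  and the factor \<open>(norm x)\<^sup>2\<close> is absorbed by the decay of \<open>\<psi>\<close>.\<close>

lemma fourier_has_derivative:
  fixes \<psi> :: "real^'d::finite \<Rightarrow> complex"
  assumes "\<psi> \<in> schwartz"
  shows "(fourier \<psi> has_derivative (\<lambda>h. \<Sum>i\<in>UNIV. (h $ i) *\<^sub>R fourier (\<lambda>x. - \<i> * complex_of_real (x $ i) * \<psi> x) \<xi>)) (at \<xi>)"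
proof (rule has_derivative_quadratic)
  let ?p = "\<lambda>i x. - \<i> * complex_of_real (x $ i) * \<psi> x"
  have p: "?p i \<in> schwartz" for i
    using schwartz_cmult[OF schwartz_coord[OF assms], of "- \<i>" i] by (simp add: mult.assoc)
  show "bounded_linear (\<lambda>h :: real^'d. \<Sum>i\<in>UNIV. (h $ i) *\<^sub>R fourier (?p i) \<xi>)"
    by (intro bounded_linear_sum bounded_linear_compose[OF bounded_linear_scaleR_left bounded_linear_vec_nth])
  fix h :: "real^'d"
  have int: "integrable lborel (\<lambda>x. cis (- (x \<bullet> \<xi>)) * f x)" if "f \<in> schwartz" for f \<xi>
    using that by (intro integrable_cis_mult schwartz_integrable)
  have "(\<Sum>i\<in>UNIV. (h $ i) *\<^sub>R fourier (?p i) \<xi>) = (LINT x|lborel. (\<Sum>i\<in>UNIV. (h $ i) *\<^sub>R (cis (- (x \<bullet> \<xi>)) * ?p i x)))"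
    unfolding fourier_def by (subst Bochner_Integration.integral_sum) (use int[OF p] in auto)
  also have "(\<lambda>x. (\<Sum>i\<in>UNIV. (h $ i) *\<^sub>R (cis (- (x \<bullet> \<xi>)) * ?p i x))) = (\<lambda>x. cis (- (x \<bullet> \<xi>)) * (- \<i> * complex_of_real (x \<bullet> h)) * \<psi> x)"
    by (auto simp: inner_vec_def scaleR_conv_of_real sum_distrib_left sum_distrib_right mult_ac sum_negf intro!: ext sum.cong)
  finally have L: "(\<Sum>i\<in>UNIV. (h $ i) *\<^sub>R fourier (?p i) \<xi>) = (LINT x|lborel. cis (- (x \<bullet> \<xi>)) * (- \<i> * complex_of_real (x \<bullet> h)) * \<psi> x)" .
  have intL: "integrable lborel (\<lambda>x. cis (- (x \<bullet> \<xi>)) * (- \<i> * complex_of_real (x \<bullet> h)) * \<psi> x)"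
  proof -
    have "integrable lborel (\<lambda>x. (\<Sum>i\<in>UNIV. (h $ i) *\<^sub>R (cis (- (x \<bullet> \<xi>)) * ?p i x)))"
      using int[OF p] by auto
    also have "(\<lambda>x. (\<Sum>i\<in>UNIV. (h $ i) *\<^sub>R (cis (- (x \<bullet> \<xi>)) * ?p i x))) = (\<lambda>x. cis (- (x \<bullet> \<xi>)) * (- \<i> * complex_of_real (x \<bullet> h)) * \<psi> x)"
      by (auto simp: inner_vec_def scaleR_conv_of_real sum_distrib_left sum_distrib_right mult_ac sum_negf intro!: ext sum.cong)
    finally show ?thesis .
  qed
  have "fourier \<psi> (\<xi> + h) - fourier \<psi> \<xi> - (\<Sum>i\<in>UNIV. (h $ i) *\<^sub>R fourier (?p i) \<xi>)
      = (LINT x|lborel. cis (- (x \<bullet> (\<xi> + h))) * \<psi> x - cis (- (x \<bullet> \<xi>)) * \<psi> x - cis (- (x \<bullet> \<xi>)) * (- \<i> * complex_of_real (x \<bullet> h)) * \<psi> x)"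
    by (simp only: L) (simp only: fourier_def Bochner_Integration.integral_diff Bochner_Integration.integrable_diff int assms intL)
  also have "(\<lambda>x. cis (- (x \<bullet> (\<xi> + h))) * \<psi> x - cis (- (x \<bullet> \<xi>)) * \<psi> x - cis (- (x \<bullet> \<xi>)) * (- \<i> * complex_of_real (x \<bullet> h)) * \<psi> x)
     = (\<lambda>x. cis (- (x \<bullet> \<xi>)) * (cis (- (x \<bullet> h)) - 1 - \<i> * complex_of_real (- (x \<bullet> h))) * \<psi> x)"
  proof
    fix x
    have "cis (- (x \<bullet> (\<xi> + h))) = cis (- (x \<bullet> \<xi>)) * cis (- (x \<bullet> h))" by (simp add: cis_mult inner_add_right)
    then show "cis (- (x \<bullet> (\<xi> + h))) * \<psi> x - cis (- (x \<bullet> \<xi>)) * \<psi> x - cis (- (x \<bullet> \<xi>)) * (- \<i> * complex_of_real (x \<bullet> h)) * \<psi> x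
       = cis (- (x \<bullet> \<xi>)) * (cis (- (x \<bullet> h)) - 1 - \<i> * complex_of_real (- (x \<bullet> h))) * \<psi> x"
      by (simp add: algebra_simps)
  qed
  also have "norm (LINT x|lborel. cis (- (x \<bullet> \<xi>)) * (cis (- (x \<bullet> h)) - 1 - \<i> * complex_of_real (- (x \<bullet> h))) * \<psi> x)
     \<le> (LINT x|lborel. (norm h)\<^sup>2 * ((1 + norm x) ^ 2 * norm (\<psi> x)))"
  proof (rule Bochner_Integration.integral_norm_bound_integral)
    show "integrable lborel (\<lambda>x. (norm h)\<^sup>2 * ((1 + norm x) ^ 2 * norm (\<psi> x)))"
      by (intro integrable_mult_right schwartz_integrable_weight assms)
    have "integrable lborel (\<lambda>x. cis (- (x \<bullet> (\<xi> + h))) * \<psi> x - cis (- (x \<bullet> \<xi>)) * \<psi> x - cis (- (x \<bullet> \<xi>)) * (- \<i> * complex_of_real (x \<bullet> h)) * \<psi> x)"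
      by (intro Bochner_Integration.integrable_diff int assms intL)
    also have "(\<lambda>x. cis (- (x \<bullet> (\<xi> + h))) * \<psi> x - cis (- (x \<bullet> \<xi>)) * \<psi> x - cis (- (x \<bullet> \<xi>)) * (- \<i> * complex_of_real (x \<bullet> h)) * \<psi> x)
     = (\<lambda>x. cis (- (x \<bullet> \<xi>)) * (cis (- (x \<bullet> h)) - 1 - \<i> * complex_of_real (- (x \<bullet> h))) * \<psi> x)" by fact
    finally show "integrable lborel (\<lambda>x. cis (- (x \<bullet> \<xi>)) * (cis (- (x \<bullet> h)) - 1 - \<i> * complex_of_real (- (x \<bullet> h))) * \<psi> x)" .
    fix x
    have "norm (cis (- (x \<bullet> h)) - 1 - \<i> * complex_of_real (- (x \<bullet> h))) \<le> (- (x \<bullet> h))\<^sup>2" by (rule cis_taylor2)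
    also have "\<dots> = \<bar>x \<bullet> h\<bar>\<^sup>2" by simp
    also have "\<dots> \<le> (norm x * norm h)\<^sup>2" by (intro power_mono Cauchy_Schwarz_ineq2) auto
    also have "\<dots> \<le> (norm h)\<^sup>2 * (1 + norm x)\<^sup>2"
      unfolding power_mult_distrib by (subst mult.commute) (intro mult_left_mono power_mono, auto)
    finally show "norm (cis (- (x \<bullet> \<xi>)) * (cis (- (x \<bullet> h)) - 1 - \<i> * complex_of_real (- (x \<bullet> h))) * \<psi> x)
       \<le> (norm h)\<^sup>2 * ((1 + norm x) ^ 2 * norm (\<psi> x))"
      by (simp add: norm_mult mult.assoc[symmetric] mult_right_mono)
  qed
  also have "\<dots> = (LINT x|lborel. (1 + norm x) ^ 2 * norm (\<psi> x)) * (norm h)\<^sup>2" by simp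
  finally show "norm (fourier \<psi> (\<xi> + h) - fourier \<psi> \<xi> - (\<Sum>i\<in>UNIV. (h $ i) *\<^sub>R fourier (?p i) \<xi>))
     \<le> (LINT x|lborel. (1 + norm x) ^ 2 * norm (\<psi> x)) * (norm h)\<^sup>2" .
qed


lemma partial_fourier:
  assumes "\<psi> \<in> schwartz"
  shows "partial i (fourier \<psi>) = fourier (\<lambda>x. - \<i> * complex_of_real (x $ i) * \<psi> x)"
  by (rule ext) (simp add: partial_eqI[OF fourier_has_derivative[OF assms]])

lemma schwartz_coord_cmult:
  assumes "\<psi> \<in> schwartz" shows "(\<lambda>x. c * complex_of_real (x $ i) * \<psi> x) \<in> schwartz"
  using schwartz_cmult[OF schwartz_coord[OF assms], of c i] by (simp add: mult.assoc)

text \<open>Each factor \<open>\<xi>\<^sub>i\<close> is traded for a derivative of \<open>\<psi>\<close>, which is again a Schwartz function.\<close>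

lemma rapid_fourier:
  fixes \<psi> :: "real^'d::finite \<Rightarrow> complex"
  assumes "\<psi> \<in> schwartz" shows "rapid (fourier \<psi>)"
proof -
  have "\<exists>C. \<forall>\<xi>. (1 + norm \<xi>) ^ N * norm (fourier \<psi> \<xi>) \<le> C" for N
    using assms
  proof (induction N arbitrary: \<psi>)
    case 0
    then show ?case using fourier_norm_le[of \<psi>] by auto
  next
    case (Suc N)
    obtain C where C: "\<And>\<xi>. (1 + norm \<xi>) ^ N * norm (fourier \<psi> \<xi>) \<le> C" using Suc.IH[OF Suc.prems] by blast
    have "\<forall>i. \<exists>C. \<forall>\<xi>. (1 + norm \<xi>) ^ N * norm (fourier (partial i \<psi>) \<xi>) \<le> C"
      using Suc.IH[OF schwartz_partial[OF Suc.prems]] by blast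
    from choice[OF this] obtain B where B: "\<And>i \<xi>. (1 + norm \<xi>) ^ N * norm (fourier (partial i \<psi>) \<xi>) \<le> B i" by auto
    have "(1 + norm \<xi>) ^ Suc N * norm (fourier \<psi> \<xi>) \<le> C + sum B UNIV" for \<xi>
    proof -
      have "norm \<xi> \<le> (\<Sum>i\<in>UNIV. \<bar>\<xi> $ i\<bar>)" by (rule norm_le_l1_cart)
      then have "(1 + norm \<xi>) * norm (fourier \<psi> \<xi>) \<le> (1 + (\<Sum>i\<in>UNIV. \<bar>\<xi> $ i\<bar>)) * norm (fourier \<psi> \<xi>)"
        by (intro mult_right_mono) auto
      also have "\<dots> = norm (fourier \<psi> \<xi>) + (\<Sum>i\<in>UNIV. norm (fourier (partial i \<psi>) \<xi>))"
        by (simp add: fourier_of_partial[OF Suc.prems] norm_mult distrib_right sum_distrib_right)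
      finally have "(1 + norm \<xi>) ^ N * ((1 + norm \<xi>) * norm (fourier \<psi> \<xi>)) \<le>
         (1 + norm \<xi>) ^ N * (norm (fourier \<psi> \<xi>) + (\<Sum>i\<in>UNIV. norm (fourier (partial i \<psi>) \<xi>)))"
        by (intro mult_left_mono) auto
      also have "\<dots> = (1 + norm \<xi>) ^ N * norm (fourier \<psi> \<xi>) + (\<Sum>i\<in>UNIV. (1 + norm \<xi>) ^ N * norm (fourier (partial i \<psi>) \<xi>))"
        by (simp add: distrib_left sum_distrib_left)
      also have "\<dots> \<le> C + sum B UNIV" by (intro add_mono C sum_mono B)
      finally show ?thesis by (simp add: mult_ac)
    qed
    then show ?case by blast
  qed
  then show ?thesis by (simp add: rapid_def)
qed

lemma schwartz_fourier: assumes "\<psi> \<in> schwartz" shows "fourier \<psi> \<in> schwartz"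
proof (rule schwartz_coinduct[where A = "fourier ` schwartz"])
  fix g assume "g \<in> fourier ` (schwartz :: (real^'a \<Rightarrow> complex) set)"
  then obtain \<psi> where g: "g = fourier \<psi>" and \<psi>: "\<psi> \<in> schwartz" by blast
  have "partial i g \<in> fourier ` schwartz" for i
    unfolding g partial_fourier[OF \<psi>] using schwartz_coord_cmult[OF \<psi>] by blast
  moreover have "g differentiable (at x)" for x
    unfolding g using fourier_has_derivative[OF \<psi>] by (auto simp: differentiable_def)
  ultimately show "(\<forall>x. g differentiable (at x)) \<and> rapid g \<and> (\<forall>i. partial i g \<in> fourier ` schwartz)"
    using rapid_fourier[OF \<psi>] g by blast
qed (use assms in blast)

lemma inverse_fourier_eq:
  fixes \<psi> :: "real^'d::finite \<Rightarrow> complex"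
  shows "inverse_fourier \<psi> x = complex_of_real (1 / (2 * pi) ^ CARD('d)) * fourier \<psi> (- x)"
  by (simp add: inverse_fourier_def fourier_def inner_commute)

lemma schwartz_inverse_fourier:
  fixes \<psi> :: "real^'d::finite \<Rightarrow> complex"
  assumes "\<psi> \<in> schwartz" shows "inverse_fourier \<psi> \<in> schwartz"
proof -
  have "inverse_fourier \<psi> = (\<lambda>x. complex_of_real (1 / (2 * pi) ^ CARD('d)) * fourier \<psi> (- x))"
    by (rule ext) (rule inverse_fourier_eq)
  then show ?thesis by (simp only:) (rule schwartz_cmult[OF schwartz_reflect[OF schwartz_fourier[OF assms]]])
qed

text \<open>The convolution kernel of the Fourier multiplier with symbol \<open>m\<close>, up to a reflection: with the
  convention used here for transposed operators, \<open>m(D)\<close> acts on distributions by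
  pairing them with translates of \<open>Ker m\<close>.\<close>

definition Ker :: "(real^'d::finite \<Rightarrow> complex) \<Rightarrow> real^'d \<Rightarrow> complex" where
  "Ker m x = complex_of_real (1 / (2 * pi) ^ CARD('d)) * fourier m x"

lemma schwartz_Ker: fixes m :: "real^'d::finite \<Rightarrow> complex"
  assumes "m \<in> schwartz" shows "Ker m \<in> schwartz"
proof -
  have "Ker m = (\<lambda>x. complex_of_real (1 / (2 * pi) ^ CARD('d)) * fourier m x)" by (rule ext) (rule Ker_def)
  then show ?thesis by (simp only:) (rule schwartz_cmult[OF schwartz_fourier[OF assms]])
qed

lemma fubini_bounded_kernel:
  fixes f g :: "'a::euclidean_space \<Rightarrow> complex" and k :: "'a \<Rightarrow> 'a \<Rightarrow> complex"
  assumes f: "integrable lborel f" and g: "integrable lborel g"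
    and k: "continuous_on UNIV (\<lambda>p. k (fst p) (snd p))" and k1: "\<And>x y. norm (k x y) \<le> 1"
  shows "(LINT x|lborel. LINT y|lborel. f x * g y * k x y) = (LINT y|lborel. LINT x|lborel. f x * g y * k x y)"
proof -
  have [measurable]: "f \<in> borel_measurable borel" "g \<in> borel_measurable borel" using f g by auto
  have "sets (lborel \<Otimes>\<^sub>M lborel) = sets (borel :: ('a \<times> 'a) measure)"
    unfolding borel_prod[symmetric] by (rule sets_pair_measure_cong) auto
  then have [measurable]: "(\<lambda>p. k (fst p) (snd p)) \<in> borel_measurable (lborel \<Otimes>\<^sub>M lborel)"
    using borel_measurable_continuous_onI[OF k] by (simp add: measurable_cong_sets[of "lborel \<Otimes>\<^sub>M lborel" borel borel borel])
  have 0: "integrable (lborel \<Otimes>\<^sub>M lborel) (\<lambda>p. f (fst p) * g (snd p))"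
  proof (rule lborel_pair.Fubini_integrable)
    show "integrable lborel (\<lambda>x. LINT y|lborel. norm (f (fst (x, y)) * g (snd (x, y))))"
      using f by (simp add: norm_mult)
    show "AE x in lborel. integrable lborel (\<lambda>y. f (fst (x, y)) * g (snd (x, y)))"
      using g by simp
  qed measurable
  have "integrable (lborel \<Otimes>\<^sub>M lborel) (\<lambda>p. f (fst p) * g (snd p) * k (fst p) (snd p))"
    by (rule integrable_mult_bounded(2)[OF 0, of _ 1]) (auto simp: k1)
  then have "integrable (lborel \<Otimes>\<^sub>M lborel) (\<lambda>(x, y). f x * g y * k x y)" by (simp add: case_prod_unfold)
  from lborel_pair.Fubini_integral[OF this] show ?thesis by simp
qed

lemma multiplier_convolution:
  fixes m \<psi> :: "real^'d::finite \<Rightarrow> complex"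
  assumes m: "integrable lborel m" and \<psi>: "integrable lborel \<psi>"
  shows "fourier (\<lambda>\<xi>. m \<xi> * inverse_fourier \<psi> \<xi>) x = (LINT y|lborel. \<psi> y * Ker m (x - y))"
proof -
  define c where "c = complex_of_real (1 / (2 * pi) ^ CARD('d))"
  have "fourier (\<lambda>\<xi>. m \<xi> * inverse_fourier \<psi> \<xi>) x
     = (LINT \<xi>|lborel. LINT y|lborel. m \<xi> * \<psi> y * (cis (- (\<xi> \<bullet> x)) * cis (\<xi> \<bullet> y)) * c)"
  proof -
    have "cis (- (\<xi> \<bullet> x)) * (m \<xi> * inverse_fourier \<psi> \<xi>) = (LINT y|lborel. m \<xi> * \<psi> y * (cis (- (\<xi> \<bullet> x)) * cis (\<xi> \<bullet> y)) * c)" for \<xi>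
    proof -
      have "cis (- (\<xi> \<bullet> x)) * (m \<xi> * inverse_fourier \<psi> \<xi>) = (LINT y|lborel. (cis (- (\<xi> \<bullet> x)) * m \<xi> * c) * (cis (y \<bullet> \<xi>) * \<psi> y))"
        unfolding integral_mult_right_zero by (simp add: inverse_fourier_def c_def inner_commute[of \<xi>])
      also have "(\<lambda>y. (cis (- (\<xi> \<bullet> x)) * m \<xi> * c) * (cis (y \<bullet> \<xi>) * \<psi> y)) = (\<lambda>y. m \<xi> * \<psi> y * (cis (- (\<xi> \<bullet> x)) * cis (\<xi> \<bullet> y)) * c)"
        by (simp add: mult_ac inner_commute)
      finally show ?thesis .
    qed
    then show ?thesis unfolding fourier_def by (simp only:)
  qed
  also have "\<dots> = c * (LINT \<xi>|lborel. LINT y|lborel. m \<xi> * \<psi> y * (cis (- (\<xi> \<bullet> x)) * cis (\<xi> \<bullet> y)))"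
    by (simp add: mult.commute)
  also have "(LINT \<xi>|lborel. LINT y|lborel. m \<xi> * \<psi> y * (cis (- (\<xi> \<bullet> x)) * cis (\<xi> \<bullet> y)))
     = (LINT y|lborel. LINT \<xi>|lborel. m \<xi> * \<psi> y * (cis (- (\<xi> \<bullet> x)) * cis (\<xi> \<bullet> y)))"
    by (rule fubini_bounded_kernel[OF m \<psi>]) (auto simp: norm_mult intro!: continuous_intros)
  also have "\<dots> = (LINT y|lborel. \<psi> y * fourier m (x - y))"
  proof -
    have "m \<xi> * \<psi> y * (cis (- (\<xi> \<bullet> x)) * cis (\<xi> \<bullet> y)) = \<psi> y * (cis (- (\<xi> \<bullet> (x - y))) * m \<xi>)" for \<xi> y
      by (simp add: cis_mult inner_diff_right)
    then show ?thesis by (simp only: fourier_def integral_mult_right_zero)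
  qed
  also have "c * \<dots> = (LINT y|lborel. \<psi> y * Ker m (x - y))"
    unfolding Ker_def c_def[symmetric] by (subst integral_mult_right_zero[symmetric]) (simp add: mult_ac)
  finally show ?thesis .
qed

lemma Ker_rescale:
  fixes m :: "real^'d::finite \<Rightarrow> complex"
  assumes [measurable]: "m \<in> borel_measurable borel" and e: "0 < e"
  shows "Ker (\<lambda>\<xi>. m (e *\<^sub>R \<xi>)) x = complex_of_real (1 / e ^ CARD('d)) * Ker m (x /\<^sub>R e)"
proof -
  have mm: "(\<lambda>\<xi>. cis (- (\<xi> \<bullet> (x /\<^sub>R e))) * m \<xi>) \<in> borel_measurable borel" by measurable
  have "fourier m (x /\<^sub>R e) = \<bar>e\<bar> ^ CARD('d) *\<^sub>R (LINT \<xi>|lborel. cis (- ((0 + e *\<^sub>R \<xi>) \<bullet> (x /\<^sub>R e))) * m (0 + e *\<^sub>R \<xi>))"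
    unfolding fourier_def using integral_affine[OF _ mm, of e 0] e by simp
  also have "(LINT \<xi>|lborel. cis (- ((0 + e *\<^sub>R \<xi>) \<bullet> (x /\<^sub>R e))) * m (0 + e *\<^sub>R \<xi>)) = fourier (\<lambda>\<xi>. m (e *\<^sub>R \<xi>)) x"
    using e by (simp add: fourier_def mult.assoc[symmetric])
  finally have "fourier m (x /\<^sub>R e) = complex_of_real (e ^ CARD('d)) * fourier (\<lambda>\<xi>. m (e *\<^sub>R \<xi>)) x"
    using e by (simp add: scaleR_conv_of_real[where 'a = complex])
  then show ?thesis using e by (simp add: Ker_def)
qed

text \<open>The substitution \<open>y = x - e w\<close>. As \<open>e\<close> tends to zero the right-hand side tends to \<open>\<psi> x\<close> times the
  integral of the kernel; this is used for the Gaussian and for the cut-off \<open>chi\<close>.\<close>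

lemma multiplier_rescaled:
  fixes m \<psi> :: "real^'d::finite \<Rightarrow> complex"
  assumes m: "integrable lborel m" and \<psi>: "integrable lborel \<psi>" and K: "Ker m \<in> borel_measurable borel" and e: "0 < e"
  shows "fourier (\<lambda>\<xi>. m (e *\<^sub>R \<xi>) * inverse_fourier \<psi> \<xi>) x = (LINT w|lborel. \<psi> (x - e *\<^sub>R w) * Ker m w)"
proof -
  have [measurable]: "m \<in> borel_measurable borel" "\<psi> \<in> borel_measurable borel" "Ker m \<in> borel_measurable borel"
    using m \<psi> K by auto
  have me: "integrable lborel (\<lambda>\<xi>. m (e *\<^sub>R \<xi>))" using integrable_affine[of e m 0] m e by simp
  have "fourier (\<lambda>\<xi>. m (e *\<^sub>R \<xi>) * inverse_fourier \<psi> \<xi>) x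
     = (LINT y|lborel. \<psi> y * (complex_of_real (1 / e ^ CARD('d)) * Ker m ((x - y) /\<^sub>R e)))"
    by (simp only: multiplier_convolution[OF me \<psi>] Ker_rescale[OF \<open>m \<in> borel_measurable borel\<close> e])
  also have "\<dots> = \<bar>- e\<bar> ^ CARD('d) *\<^sub>R (LINT w|lborel. \<psi> (x + (- e) *\<^sub>R w) * (complex_of_real (1 / e ^ CARD('d)) * Ker m ((x - (x + (- e) *\<^sub>R w)) /\<^sub>R e)))"
    by (subst integral_affine[of "- e" _ x]) (use e in auto)
  also have "\<dots> = (LINT w|lborel. \<bar>- e\<bar> ^ CARD('d) *\<^sub>R (\<psi> (x + (- e) *\<^sub>R w) * (complex_of_real (1 / e ^ CARD('d)) * Ker m ((x - (x + (- e) *\<^sub>R w)) /\<^sub>R e))))"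
    by (simp only: integral_scaleR_right)
  also have "\<dots> = (LINT w|lborel. \<psi> (x - e *\<^sub>R w) * Ker m w)"
    using e by (simp add: scaleR_conv_of_real[where 'a = complex])
  finally show ?thesis .
qed

lemma gaussian_fourier_1d:
  "integrable lborel (\<lambda>t. complex_of_real (exp (- t\<^sup>2 / 2)) * cis (- (t * s)))"
  "(LINT t|lborel. complex_of_real (exp (- t\<^sup>2 / 2)) * cis (- (t * s))) = complex_of_real (sqrt (2 * pi) * exp (- s\<^sup>2 / 2))"
proof -
  have e: "exp (- t\<^sup>2 / 2) = sqrt (2 * pi) * std_normal_density t" for t
    by (simp add: std_normal_density_def)
  have i: "integrable lborel std_normal_density" by (rule integrable_normal_density) simp
  have i': "integrable lborel (\<lambda>t. complex_of_real (std_normal_density t))" using i by simp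
  have m: "(\<lambda>t. cis (- (t * s))) \<in> borel_measurable borel" by (intro borel_measurable_continuous_onI continuous_intros)
  have "integrable lborel (\<lambda>t. complex_of_real (std_normal_density t) * cis (- (t * s)))"
    by (rule integrable_mult_bounded(2)[OF i', of _ 1]) (use m in auto)
  then have "integrable lborel (\<lambda>t. complex_of_real (sqrt (2 * pi)) * (complex_of_real (std_normal_density t) * cis (- (t * s))))"
    by (rule integrable_mult_right)
  then show "integrable lborel (\<lambda>t. complex_of_real (exp (- t\<^sup>2 / 2)) * cis (- (t * s)))"
    by (simp only: e of_real_mult mult.assoc)
  have "complex_of_real (exp (- ((- s)\<^sup>2) / 2)) = char std_normal_distribution (- s)"
    by (simp add: char_std_normal_distribution)
  also have "\<dots> = (LINT t|lborel. std_normal_density t *\<^sub>R cis (- (t * s)))"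
    unfolding char_def by (subst integral_density) (auto simp: cis_conv_exp mult_ac)
  finally have "complex_of_real (exp (- s\<^sup>2 / 2)) = (LINT t|lborel. complex_of_real (std_normal_density t) * cis (- (t * s)))"
    by (simp add: scaleR_conv_of_real)
  then have "complex_of_real (sqrt (2 * pi) * exp (- s\<^sup>2 / 2)) = (LINT t|lborel. complex_of_real (sqrt (2 * pi)) * (complex_of_real (std_normal_density t) * cis (- (t * s))))"
    by (simp only: integral_mult_right_zero of_real_mult)
  then show "(LINT t|lborel. complex_of_real (exp (- t\<^sup>2 / 2)) * cis (- (t * s))) = complex_of_real (sqrt (2 * pi) * exp (- s\<^sup>2 / 2))"
    by (simp only: e of_real_mult mult.assoc)
qed

text \<open>The regularizing symbol of the inversion formula, chosen because its kernel is
  explicit: it is the standard normal density.\<close>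

definition gaussian :: "real^'d::finite \<Rightarrow> complex" where
  "gaussian \<xi> = (\<Prod>i\<in>UNIV. complex_of_real (exp (- (\<xi> $ i)\<^sup>2 / 2)))"

lemma gaussian_integrable: "integrable lborel (gaussian :: real^'d::finite \<Rightarrow> complex)"
  unfolding gaussian_def using gaussian_fourier_1d(1)[of 0]
  by (intro lborel_prod_cart(1)[where g = "\<lambda>i t. complex_of_real (exp (- t\<^sup>2 / 2))"]) simp

lemma Ker_gaussian:
  "Ker (gaussian :: real^'d::finite \<Rightarrow> complex) = (\<lambda>x. \<Prod>i\<in>UNIV. complex_of_real (std_normal_density (x $ i)))"
proof
  fix x :: "real^'d"
  have "cis (- (\<xi> \<bullet> x)) * gaussian \<xi> = (\<Prod>i\<in>UNIV. complex_of_real (exp (- (\<xi> $ i)\<^sup>2 / 2)) * cis (- (\<xi> $ i * x $ i)))" for \<xi>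
  proof -
    have "cis (- (\<xi> \<bullet> x)) = (\<Prod>i\<in>UNIV. cis (- (\<xi> $ i * x $ i)))"
      by (simp add: inner_vec_def cis_conv_exp exp_sum[symmetric] sum_negf[symmetric] sum_distrib_left)
    then show ?thesis by (simp add: gaussian_def prod.distrib mult.commute)
  qed
  then have "fourier gaussian x = (\<Prod>i\<in>UNIV. complex_of_real (sqrt (2 * pi) * exp (- (x $ i)\<^sup>2 / 2)))"
    using lborel_prod_cart(2)[of "\<lambda>i t. complex_of_real (exp (- t\<^sup>2 / 2)) * cis (- (t * x $ i))"]
    by (simp only: fourier_def gaussian_fourier_1d)
  then have "Ker gaussian x = (\<Prod>i\<in>(UNIV::'d set). complex_of_real (1 / (2 * pi))) * (\<Prod>i\<in>UNIV. complex_of_real (sqrt (2 * pi) * exp (- (x $ i)\<^sup>2 / 2)))"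
    by (simp add: Ker_def power_divide)
  also have "\<dots> = (\<Prod>i\<in>UNIV. complex_of_real (1 / (2 * pi) * (sqrt (2 * pi) * exp (- (x $ i)\<^sup>2 / 2))))"
    by (simp only: prod.distrib[symmetric] of_real_mult)
  finally have Kx: "Ker gaussian x = (\<Prod>i\<in>UNIV. complex_of_real (1 / (2 * pi) * (sqrt (2 * pi) * exp (- (x $ i)\<^sup>2 / 2))))" .
  have d: "1 / (2 * pi) * (sqrt (2 * pi) * exp (- (x $ i)\<^sup>2 / 2)) = std_normal_density (x $ i)" for i
  proof -
    define S where "S = sqrt (2 * pi)"
    have S: "0 < S" "2 * pi = S * S" by (auto simp: S_def)
    show ?thesis unfolding std_normal_density_def S(2) using S(1) by simp
  qed
  show "Ker gaussian x = (\<Prod>i\<in>UNIV. complex_of_real (std_normal_density (x $ i)))" unfolding Kx d ..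
qed

lemma Ker_gaussian_integral:
  "integrable lborel (Ker (gaussian :: real^'d::finite \<Rightarrow> complex))"
  "(LINT x|lborel. Ker (gaussian :: real^'d \<Rightarrow> complex) x) = 1"
proof -
  have i: "integrable lborel (\<lambda>t. complex_of_real (std_normal_density t))"
    using integrable_normal_density[of 1 0] by simp
  show "integrable lborel (Ker (gaussian :: real^'d \<Rightarrow> complex))"
    unfolding Ker_gaussian by (rule lborel_prod_cart(1)[OF i])
  show "(LINT x|lborel. Ker (gaussian :: real^'d \<Rightarrow> complex) x) = 1"
    unfolding Ker_gaussian lborel_prod_cart(2)[OF i] by (simp add: integral_normal_density)
qed

text \<open>Insert the factor \<open>gaussian (h \<xi>)\<close> and let \<open>h\<close> tend to zero. By dominated convergence the regularized
  integral tends to the left-hand side; by \<open>multiplier_rescaled\<close> it is an average of \<open>\<psi>\<close> with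
  respect to normal distributions that concentrate at \<open>x\<close>.\<close>

lemma fourier_inverse_fourier:
  fixes \<psi> :: "real^'d::finite \<Rightarrow> complex"
  assumes \<psi>: "\<psi> \<in> schwartz"
  shows "fourier (inverse_fourier \<psi>) = \<psi>"
proof
  fix x :: "real^'d"
  define h where "h = (\<lambda>n::nat. 1 / (1 + real n))"
  have h: "0 < h n" for n by (auto simp: h_def)
  have h0: "h \<longlonglongrightarrow> 0" unfolding h_def by (rule lim_1_over_real_power[of 1, THEN LIMSEQ_ignore_initial_segment[where k = 1], simplified])
  have [measurable]: "\<psi> \<in> borel_measurable borel" "inverse_fourier \<psi> \<in> borel_measurable borel"
    using schwartz_measurable[OF \<psi>] schwartz_measurable[OF schwartz_inverse_fourier[OF \<psi>]] by auto
  have [measurable]: "Ker (gaussian :: real^'d \<Rightarrow> complex) \<in> borel_measurable borel"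
    using borel_measurable_integrable[OF Ker_gaussian_integral(1)[where 'd = 'd]] by (simp only: measurable_lborel2)
  have [measurable]: "(gaussian :: real^'d \<Rightarrow> complex) \<in> borel_measurable borel"
    using borel_measurable_integrable[OF gaussian_integrable[where 'd = 'd]] by (simp only: measurable_lborel2)
  have cg: "continuous_on UNIV (gaussian :: real^'d \<Rightarrow> complex)"
    unfolding gaussian_def by (auto intro!: continuous_intros)
  have g1: "norm (gaussian \<xi>) \<le> 1" for \<xi> :: "real^'d"
    unfolding gaussian_def prod_norm[symmetric] by (intro prod_le_1) auto
  have g0: "gaussian (0 :: real^'d) = 1" by (simp add: gaussian_def)
  obtain C where C: "\<And>x. (1 + norm x) ^ 0 * norm (\<psi> x) \<le> C" using rapidE[OF schwartz_rapid[OF \<psi>]] by blast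
  have "(\<lambda>n. LINT w|lborel. \<psi> (x - h n *\<^sub>R w) * Ker gaussian w) \<longlonglongrightarrow> (LINT w|lborel. \<psi> x * Ker gaussian (w :: real^'d))"
  proof (rule integral_dominated_convergence[where s = "\<lambda>n w. \<psi> (x - h n *\<^sub>R w) * Ker gaussian w"
        and f = "\<lambda>w. \<psi> x * Ker gaussian w" and w = "\<lambda>w. C * norm (Ker gaussian w)"])
    show "integrable lborel (\<lambda>w::real^'d. C * norm (Ker gaussian w))"
      by (intro integrable_mult_right integrable_norm Ker_gaussian_integral(1))
    show "AE w in lborel. norm (\<psi> (x - h n *\<^sub>R w) * Ker gaussian w) \<le> C * norm (Ker gaussian w)" for n
      using C by (auto simp: norm_mult intro!: mult_right_mono)
    show "AE w in lborel. (\<lambda>n. \<psi> (x - h n *\<^sub>R w) * Ker gaussian w) \<longlonglongrightarrow> \<psi> x * Ker gaussian w"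
    proof (intro AE_I2 tendsto_mult_right)
      fix w
      have "(\<lambda>n. x - h n *\<^sub>R w) \<longlonglongrightarrow> x" using h0 by (auto intro!: tendsto_eq_intros)
      then show "(\<lambda>n. \<psi> (x - h n *\<^sub>R w)) \<longlonglongrightarrow> \<psi> x"
        using continuous_on_tendsto_compose[OF schwartz_continuous[OF \<psi>, of UNIV]] by auto
    qed
  qed auto
  also have "(LINT w|lborel. \<psi> x * Ker gaussian (w :: real^'d)) = \<psi> x"
    by (simp only: integral_mult_right_zero Ker_gaussian_integral(2) mult_1_right)
  also have "(\<lambda>n. LINT w|lborel. \<psi> (x - h n *\<^sub>R w) * Ker gaussian w) = (\<lambda>n. fourier (\<lambda>\<xi>. gaussian (h n *\<^sub>R \<xi>) * inverse_fourier \<psi> \<xi>) x)"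
    by (rule ext, subst multiplier_rescaled[OF gaussian_integrable schwartz_integrable[OF \<psi>] _ h]) auto
  finally have 1: "(\<lambda>n. fourier (\<lambda>\<xi>. gaussian (h n *\<^sub>R \<xi>) * inverse_fourier \<psi> \<xi>) x) \<longlonglongrightarrow> \<psi> x" .
  have "(\<lambda>n. fourier (\<lambda>\<xi>. gaussian (h n *\<^sub>R \<xi>) * inverse_fourier \<psi> \<xi>) x) \<longlonglongrightarrow> fourier (inverse_fourier \<psi>) x"
    unfolding fourier_def
  proof (rule integral_dominated_convergence[where s = "\<lambda>n \<xi>. cis (- (\<xi> \<bullet> x)) * (gaussian (h n *\<^sub>R \<xi>) * inverse_fourier \<psi> \<xi>)"
        and f = "\<lambda>\<xi>. cis (- (\<xi> \<bullet> x)) * inverse_fourier \<psi> \<xi>" and w = "\<lambda>\<xi>. norm (inverse_fourier \<psi> \<xi>)"])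
    show "integrable lborel (\<lambda>\<xi>. norm (inverse_fourier \<psi> \<xi>))"
      using schwartz_integrable[OF schwartz_inverse_fourier[OF \<psi>]] by simp
    show "AE \<xi> in lborel. norm (cis (- (\<xi> \<bullet> x)) * (gaussian (h n *\<^sub>R \<xi>) * inverse_fourier \<psi> \<xi>)) \<le> norm (inverse_fourier \<psi> \<xi>)" for n
      using g1 by (auto simp: norm_mult intro!: mult_left_le_one_le)
    show "AE \<xi> in lborel. (\<lambda>n. cis (- (\<xi> \<bullet> x)) * (gaussian (h n *\<^sub>R \<xi>) * inverse_fourier \<psi> \<xi>)) \<longlonglongrightarrow> cis (- (\<xi> \<bullet> x)) * inverse_fourier \<psi> \<xi>"
    proof (intro AE_I2 tendsto_mult_left)
      fix \<xi> :: "real^'d"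
      have "(\<lambda>n. h n *\<^sub>R \<xi>) \<longlonglongrightarrow> 0" using h0 by (auto intro!: tendsto_eq_intros)
      then have "(\<lambda>n. gaussian (h n *\<^sub>R \<xi>)) \<longlonglongrightarrow> gaussian (0 :: real^'d)"
        by (rule continuous_on_tendsto_compose[OF cg]) auto
      from tendsto_mult_right[OF this]
      show "(\<lambda>n. gaussian (h n *\<^sub>R \<xi>) * inverse_fourier \<psi> \<xi>) \<longlonglongrightarrow> inverse_fourier \<psi> \<xi>" by (simp add: g0)
    qed
  qed auto
  from LIMSEQ_unique[OF this 1] show "fourier (inverse_fourier \<psi>) x = \<psi> x" .
qed

lemma inverse_fourier_fourier:
  fixes \<psi> :: "real^'d::finite \<Rightarrow> complex"
  assumes \<psi>: "\<psi> \<in> schwartz"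
  shows "inverse_fourier (fourier \<psi>) = \<psi>"
proof
  fix x :: "real^'d"
  let ?c = "complex_of_real (1 / (2 * pi) ^ CARD('d))"
  have [measurable]: "fourier \<psi> \<in> borel_measurable borel"
    by (rule schwartz_measurable[OF schwartz_fourier[OF \<psi>]])
  have "fourier (\<lambda>\<xi>. fourier \<psi> (- \<xi>)) x = (LINT \<xi>|lborel. cis (- ((0 + (-1) *\<^sub>R \<xi>) \<bullet> x)) * fourier \<psi> (- (0 + (-1) *\<^sub>R \<xi>)))"
    unfolding fourier_def[of "\<lambda>\<xi>. fourier \<psi> (- \<xi>)"] by (subst integral_affine[of "-1" _ 0]) auto
  then have "fourier (\<lambda>\<xi>. fourier \<psi> (- \<xi>)) x = fourier (fourier \<psi>) (- x)"
    by (simp add: fourier_def[of "fourier \<psi>"])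
  then have "inverse_fourier (fourier \<psi>) x = fourier (\<lambda>\<xi>. ?c * fourier \<psi> (- \<xi>)) x"
    by (simp only: inverse_fourier_eq fourier_cmult)
  also have "\<dots> = fourier (inverse_fourier \<psi>) x" by (simp add: inverse_fourier_eq[abs_def])
  finally show "inverse_fourier (fourier \<psi>) x = \<psi> x" by (simp add: fourier_inverse_fourier[OF \<psi>])
qed

text \<open>The symbol of an iterated partial derivative, with the sign that occurs when a Fourier transform is
  differentiated.\<close>

definition symbol :: "'d::finite list \<Rightarrow> real^'d \<Rightarrow> complex" where
  "symbol is \<xi> = (\<Prod>i\<leftarrow>is. - \<i> * complex_of_real (\<xi> $ i))"

lemma schwartz_symbol: "\<mu> \<in> schwartz \<Longrightarrow> (\<lambda>\<xi>. symbol is \<xi> * \<mu> \<xi>) \<in> schwartz"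
proof (induction "is")
  case (Cons i "is")
  then show ?case
    using schwartz_coord_cmult[of "\<lambda>\<xi>. symbol is \<xi> * \<mu> \<xi>" "- \<i>" i] by (simp add: symbol_def mult.assoc)
qed (simp add: symbol_def)

lemma iterated_partial_fourier:
  assumes "\<mu> \<in> schwartz"
  shows "iterated_partial is (fourier \<mu>) = fourier (\<lambda>\<xi>. symbol is \<xi> * \<mu> \<xi>)"
proof (induction "is")
  case (Cons i "is")
  then show ?case
    by (simp add: partial_fourier schwartz_symbol assms) (simp add: symbol_def mult.assoc)
qed (simp add: symbol_def)

text \<open>On the Fourier side derivatives are products of coordinates; this replaces the symmetry of second
  derivatives.\<close>

lemma iterated_partial_commute:
  assumes "\<kappa> \<in> schwartz"
  shows "partial i (iterated_partial is \<kappa>) = iterated_partial is (partial i \<kappa>)"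
proof -
  define \<mu> where "\<mu> = inverse_fourier \<kappa>"
  have \<mu>: "\<mu> \<in> schwartz" "\<kappa> = fourier \<mu>"
    using assms by (auto simp: \<mu>_def schwartz_inverse_fourier fourier_inverse_fourier)
  have "iterated_partial (i # is) \<kappa> = fourier (\<lambda>\<xi>. symbol (i # is) \<xi> * \<mu> \<xi>)"
    unfolding \<mu>(2) by (rule iterated_partial_fourier[OF \<mu>(1)])
  moreover have "iterated_partial (is @ [i]) \<kappa> = fourier (\<lambda>\<xi>. symbol (is @ [i]) \<xi> * \<mu> \<xi>)"
    unfolding \<mu>(2) by (rule iterated_partial_fourier[OF \<mu>(1)])
  moreover have "symbol (i # is) = symbol (is @ [i])" by (simp add: symbol_def fun_eq_iff)
  ultimately show ?thesis by (simp add: iterated_partial_append)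
qed

section \<open>Convolution of tempered distributions with Schwartz functions\<close>

text \<open>The pairing with the translates of \<open>\<kappa>\<close>. With \<open>\<kappa>\<close> reflected this is the convolution of \<open>v\<close> and \<open>\<kappa>\<close>; the
  reflection is left out because operators act on distributions by transposition.\<close>

definition tconv :: "'d::finite functional \<Rightarrow> (real^'d \<Rightarrow> complex) \<Rightarrow> real^'d \<Rightarrow> complex" where
  "tconv v \<kappa> y = v (\<lambda>x. \<kappa> (x - y))"

lemma tempered_add: "tempered v \<Longrightarrow> f \<in> schwartz \<Longrightarrow> g \<in> schwartz \<Longrightarrow> v (\<lambda>x. f x + g x) = v f + v g"
  unfolding tempered_def by blast

lemma tempered_cmult: "tempered v \<Longrightarrow> f \<in> schwartz \<Longrightarrow> v (\<lambda>x. c * f x) = c * v f"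
  unfolding tempered_def by blast

lemma tempered_zero: "tempered v \<Longrightarrow> v (\<lambda>x. 0) = 0"
  using tempered_cmult[of v "\<lambda>x. 0" 0] by simp

lemma tempered_uminus: "tempered v \<Longrightarrow> f \<in> schwartz \<Longrightarrow> v (\<lambda>x. - f x) = - v f"
  using tempered_cmult[of v f "-1"] by simp

lemma tempered_diff: "tempered v \<Longrightarrow> f \<in> schwartz \<Longrightarrow> g \<in> schwartz \<Longrightarrow> v (\<lambda>x. f x - g x) = v f - v g"
  using tempered_add[of v f "\<lambda>x. - g x"] by (simp add: tempered_uminus schwartz_uminus)

lemma tempered_sum:
  assumes "tempered v" "finite I" "\<And>i. i \<in> I \<Longrightarrow> f i \<in> schwartz"
  shows "v (\<lambda>x. \<Sum>i\<in>I. f i x) = (\<Sum>i\<in>I. v (f i))"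
  using assms(2,3)
proof (induction I rule: finite_induct)
  case (insert i I)
  have "v (\<lambda>x. f i x + (\<Sum>i\<in>I. f i x)) = v (f i) + v (\<lambda>x. \<Sum>i\<in>I. f i x)"
    using insert by (intro tempered_add[OF assms(1)] schwartz_sum) auto
  then show ?case using insert by simp
qed (simp add: tempered_zero[OF assms(1)])

lemma one_plus_norm_power_shift:
  "(1 + norm (x::'a::real_normed_vector)) ^ N \<le> (1 + norm y) ^ N * (1 + norm (x - y)) ^ N"
  using one_plus_norm_mult[of x "- y"] by (simp add: power_mult_distrib[symmetric] power_mono mult.commute)

text \<open>Translating \<open>\<kappa>\<close> by \<open>y\<close> enlarges its seminorm of order \<open>N\<close> at most by the factor \<open>(1 + norm y) ^ N\<close>.\<close>

lemma tconv_bound: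
  fixes v :: "'d::finite functional"
  assumes "tempered v"
  obtains C N where "0 \<le> C"
    "\<And>\<kappa> B y. \<kappa> \<in> schwartz \<Longrightarrow>
       (\<And>x is. length is \<le> N \<Longrightarrow> (1 + norm x) ^ N * norm (iterated_partial is \<kappa> x) \<le> B) \<Longrightarrow>
       norm (tconv v \<kappa> y) \<le> C * ((1 + norm y) ^ N * B)"
proof -
  obtain C N where C: "0 \<le> C"
    "\<And>\<psi> B. \<psi> \<in> schwartz \<Longrightarrow>
       (\<And>x is. length is \<le> N \<Longrightarrow> (1 + norm x) ^ N * norm (iterated_partial is \<psi> x) \<le> B) \<Longrightarrow> norm (v \<psi>) \<le> C * B"
    using tempered_bound[OF assms] by blast
  have "norm (tconv v \<kappa> y) \<le> C * ((1 + norm y) ^ N * B)"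
    if \<kappa>: "\<kappa> \<in> schwartz" and B: "\<And>x is. length is \<le> N \<Longrightarrow> (1 + norm x) ^ N * norm (iterated_partial is \<kappa> x) \<le> B" for \<kappa> B y
    unfolding tconv_def
  proof (rule C(2)[OF schwartz_shift[OF \<kappa>]])
    fix x "is" assume l: "length (is :: 'd list) \<le> N"
    have "(1 + norm x) ^ N * norm (iterated_partial is (\<lambda>x. \<kappa> (x - y)) x)
        \<le> ((1 + norm y) ^ N * (1 + norm (x - y)) ^ N) * norm (iterated_partial is \<kappa> (x - y))"
      unfolding iterated_partial_shift[OF \<kappa>] by (intro mult_right_mono one_plus_norm_power_shift) auto
    also have "\<dots> = (1 + norm y) ^ N * ((1 + norm (x - y)) ^ N * norm (iterated_partial is \<kappa> (x - y)))" by simp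
    also have "\<dots> \<le> (1 + norm y) ^ N * B" by (intro mult_left_mono B l) auto
    finally show "(1 + norm x) ^ N * norm (iterated_partial is (\<lambda>x. \<kappa> (x - y)) x) \<le> (1 + norm y) ^ N * B" .
  qed
  then show ?thesis by (rule that[OF C(1)])
qed

lemma tconv_growth:
  assumes "tempered v" "\<kappa> \<in> schwartz"
  obtains C N where "\<And>y. norm (tconv v \<kappa> y) \<le> C * (1 + norm y) ^ N"
proof -
  obtain C N where C: "0 \<le> C"
    "\<And>\<kappa> B y. \<kappa> \<in> schwartz \<Longrightarrow>
       (\<And>x is. length is \<le> N \<Longrightarrow> (1 + norm x) ^ N * norm (iterated_partial is \<kappa> x) \<le> B) \<Longrightarrow>
       norm (tconv v \<kappa> y) \<le> C * ((1 + norm y) ^ N * B)"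
    using tconv_bound[OF assms(1)] by blast
  have "norm (tconv v \<kappa> y) \<le> (C * schwartz_seminorm N \<kappa>) * (1 + norm y) ^ N" for y
    using C(2)[OF assms(2) schwartz_seminorm_bound[OF assms(2)], of y] by (simp add: mult_ac)
  then show ?thesis by (rule that)
qed

text \<open>A seminorm involves only finitely many derivatives, so constants chosen for each of them can be replaced
  by a common one.\<close>

lemma uniform_over_lists:
  assumes "\<And>is. length (is :: 'd::finite list) \<le> N \<Longrightarrow> \<exists>C\<ge>0. P is (C::real)"
    and "\<And>is C C'. P is C \<Longrightarrow> C \<le> C' \<Longrightarrow> P is C'"
  obtains C where "0 \<le> C" "\<And>is. length is \<le> N \<Longrightarrow> P is C"
proof -
  have "\<forall>is\<in>{is. length is \<le> N}. \<exists>C. 0 \<le> C \<and> P is C" using assms(1) by auto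
  from bchoice[OF this] obtain B where B: "\<And>is. length is \<le> N \<Longrightarrow> 0 \<le> B is \<and> P is (B is)" by auto
  show ?thesis
  proof (rule that)
    show "0 \<le> (\<Sum>is | length is \<le> N. B is)" using B by (intro sum_nonneg) auto
    fix "is" assume l: "length (is :: 'd list) \<le> N"
    have "B is \<le> (\<Sum>is | length is \<le> N. B is)" using B l by (intro member_le_sum finite_lists_le) auto
    then show "P is (\<Sum>is | length is \<le> N. B is)" using assms(2) B l by blast
  qed
qed

text \<open>By continuity of \<open>v\<close> it is enough to expand the translates of \<open>\<kappa>\<close> to first order in all seminorms at once, which is
  \<open>schwartz_taylor\<close> for the derivatives of \<open>\<kappa>\<close>.\<close>

lemma tconv_has_derivative:
  fixes v :: "'d::finite functional"
  assumes v: "tempered v" and \<kappa>: "\<kappa> \<in> schwartz"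
  shows "(tconv v \<kappa> has_derivative (\<lambda>h. \<Sum>i\<in>UNIV. (h $ i) *\<^sub>R (- tconv v (partial i \<kappa>) y))) (at y)"
proof -
  obtain C N where C: "0 \<le> C"
    "\<And>\<psi> B. \<psi> \<in> schwartz \<Longrightarrow>
       (\<And>x is. length is \<le> N \<Longrightarrow> (1 + norm x) ^ N * norm (iterated_partial is \<psi> x) \<le> B) \<Longrightarrow> norm (v \<psi>) \<le> C * B"
    using tempered_bound[OF v] by blast
  define T where "T = (\<lambda>\<rho> (z :: real^'d) (h :: real^'d). \<rho> (z + h) - \<rho> z - (\<Sum>i\<in>UNIV. (h $ i) *\<^sub>R partial i \<rho> z) :: complex)"
  obtain K where K: "0 \<le> K" "\<And>is. length (is :: 'd list) \<le> N \<Longrightarrow>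
      (\<forall>z h. (1 + norm z) ^ N * norm (T (iterated_partial is \<kappa>) z h) \<le> K * (norm h)\<^sup>2 * (1 + norm h) ^ N)"
  proof (rule uniform_over_lists[where N = N and P = "\<lambda>is K. \<forall>z h. (1 + norm z) ^ N * norm (T (iterated_partial is \<kappa>) z h) \<le> K * (norm h)\<^sup>2 * (1 + norm h) ^ N"])
    fix "is" :: "'d list"
    obtain B where "0 \<le> B" "\<And>z h. (1 + norm z) ^ N * norm (T (iterated_partial is \<kappa>) z h) \<le> B * (norm h)\<^sup>2 * (1 + norm h) ^ N"
      using schwartz_taylor[OF schwartz_iterated_partial[OF \<kappa>], of N "is"] unfolding T_def by blast
    then show "\<exists>C\<ge>0. \<forall>z h. (1 + norm z) ^ N * norm (T (iterated_partial is \<kappa>) z h) \<le> C * (norm h)\<^sup>2 * (1 + norm h) ^ N" by blast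
  next
    fix "is" :: "'d list" and C C' :: real
    assume a: "\<forall>z h. (1 + norm z) ^ N * norm (T (iterated_partial is \<kappa>) z h) \<le> C * (norm h)\<^sup>2 * (1 + norm h) ^ N" and "C \<le> C'"
    then have "C * (norm h)\<^sup>2 * (1 + norm h) ^ N \<le> C' * (norm h)\<^sup>2 * (1 + norm h) ^ N" for h :: "real^'d"
      by (intro mult_right_mono) auto
    then show "\<forall>z h. (1 + norm z) ^ N * norm (T (iterated_partial is \<kappa>) z h) \<le> C' * (norm h)\<^sup>2 * (1 + norm h) ^ N"
      using a order_trans by blast
  qed (rule that)
  show ?thesis
  proof (rule has_derivative_quadratic[where C = "C * ((1 + norm y) ^ N * (K * 2 ^ N))"])
    show "bounded_linear (\<lambda>h :: real^'d. \<Sum>i\<in>UNIV. (h $ i) *\<^sub>R (- tconv v (partial i \<kappa>) y))"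
      by (intro bounded_linear_sum bounded_linear_compose[OF bounded_linear_scaleR_left bounded_linear_vec_nth])
    fix h :: "real^'d" assume h: "norm h \<le> 1"
    define \<theta> where "\<theta> = (\<lambda>x. T \<kappa> (x - y) (- h))"
    have s1: "(\<lambda>x. \<kappa> (x - y + - h)) \<in> schwartz" using schwartz_shift[OF \<kappa>, of "y + h"] by (simp add: algebra_simps)
    have s2: "(\<lambda>x. \<kappa> (x - y)) \<in> schwartz" by (rule schwartz_shift[OF \<kappa>])
    have s4: "(\<lambda>x. complex_of_real (- h $ i) * partial i \<kappa> (x - y)) \<in> schwartz" for i
      by (intro schwartz_cmult schwartz_shift[of "partial i \<kappa>"] schwartz_partial \<kappa>)
    have s3: "(\<lambda>x. \<Sum>i\<in>UNIV. complex_of_real (- h $ i) * partial i \<kappa> (x - y)) \<in> schwartz"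
      by (intro schwartz_sum s4) auto
    have \<theta>: "\<theta> = (\<lambda>x. (\<kappa> (x - y + - h) - \<kappa> (x - y)) - (\<Sum>i\<in>UNIV. complex_of_real (- h $ i) * partial i \<kappa> (x - y)))"
      by (simp add: \<theta>_def T_def scaleR_conv_of_real[where 'a = complex])
    have \<theta>S: "\<theta> \<in> schwartz" unfolding \<theta> by (intro schwartz_diff s1 s2 s3)
    have "v \<theta> = v (\<lambda>x. \<kappa> (x - y + - h)) - v (\<lambda>x. \<kappa> (x - y)) - (\<Sum>i\<in>UNIV. v (\<lambda>x. complex_of_real (- h $ i) * partial i \<kappa> (x - y)))"
      unfolding \<theta> tempered_diff[OF v schwartz_diff[OF s1 s2] s3] tempered_diff[OF v s1 s2]
      by (subst tempered_sum[OF v finite_class.finite_UNIV s4]) (rule refl)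
    also have "v (\<lambda>x. \<kappa> (x - y + - h)) = tconv v \<kappa> (y + h)" by (simp add: tconv_def algebra_simps)
    also have "v (\<lambda>x. \<kappa> (x - y)) = tconv v \<kappa> y" by (simp add: tconv_def)
    finally have e0: "v \<theta> = tconv v \<kappa> (y + h) - tconv v \<kappa> y - (\<Sum>i\<in>UNIV. v (\<lambda>x. complex_of_real (- h $ i) * partial i \<kappa> (x - y)))" .
    have vi: "v (\<lambda>x. complex_of_real (- h $ i) * partial i \<kappa> (x - y)) = (h $ i) *\<^sub>R (- tconv v (partial i \<kappa>) y)" for i
      by (subst tempered_cmult[OF v schwartz_shift[OF schwartz_partial[OF \<kappa>]]])
         (simp add: tconv_def scaleR_conv_of_real[where 'a = complex])
    have eq: "tconv v \<kappa> (y + h) - tconv v \<kappa> y - (\<Sum>i\<in>UNIV. (h $ i) *\<^sub>R (- tconv v (partial i \<kappa>) y)) = v \<theta>"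
      by (simp only: e0 vi)
    have "norm (v \<theta>) \<le> C * ((1 + norm y) ^ N * (K * (norm h)\<^sup>2 * 2 ^ N))"
    proof (rule C(2)[OF \<theta>S])
      fix x "is" assume l: "length (is :: 'd list) \<le> N"
      let ?\<rho> = "iterated_partial is \<kappa>"
      have i1: "iterated_partial is (\<lambda>x. \<kappa> (x - y + - h)) = (\<lambda>x. ?\<rho> (x - y + - h))"
        using iterated_partial_shift[OF \<kappa>, of "is" "y + h"] by (simp add: algebra_simps)
      have i3: "iterated_partial is (\<lambda>x. complex_of_real (- h $ i) * partial i \<kappa> (x - y)) = (\<lambda>x. complex_of_real (- h $ i) * partial i ?\<rho> (x - y))" for i
        by (simp only: iterated_partial_cmult[OF schwartz_shift[OF schwartz_partial[OF \<kappa>]]]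
            iterated_partial_shift[OF schwartz_partial[OF \<kappa>]] iterated_partial_commute[OF \<kappa>])
      have "iterated_partial is \<theta> x = ?\<rho> (x - y + - h) - ?\<rho> (x - y) - (\<Sum>i\<in>UNIV. complex_of_real (- h $ i) * partial i ?\<rho> (x - y))"
        unfolding \<theta> by (simp only: iterated_partial_diff[OF schwartz_diff[OF s1 s2] s3] iterated_partial_diff[OF s1 s2]
            iterated_partial_sum[OF finite_class.finite_UNIV s4] i1 i3 iterated_partial_shift[OF \<kappa>])
      then have it: "iterated_partial is \<theta> x = T ?\<rho> (x - y) (- h)"
        by (simp add: T_def scaleR_conv_of_real[where 'a = complex])
      have "(1 + norm x) ^ N * norm (iterated_partial is \<theta> x)
          \<le> ((1 + norm y) ^ N * (1 + norm (x - y)) ^ N) * norm (T ?\<rho> (x - y) (- h))"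
        unfolding it by (intro mult_right_mono one_plus_norm_power_shift) auto
      also have "\<dots> = (1 + norm y) ^ N * ((1 + norm (x - y)) ^ N * norm (T ?\<rho> (x - y) (- h)))" by simp
      also have "\<dots> \<le> (1 + norm y) ^ N * (K * (norm (- h))\<^sup>2 * (1 + norm (- h)) ^ N)"
        by (intro mult_left_mono K(2)[OF l, rule_format]) auto
      also have "\<dots> \<le> (1 + norm y) ^ N * (K * (norm h)\<^sup>2 * 2 ^ N)"
        using K(1) h by (intro mult_left_mono) (auto intro!: power_mono mult_left_mono)
      finally show "(1 + norm x) ^ N * norm (iterated_partial is \<theta> x) \<le> (1 + norm y) ^ N * (K * (norm h)\<^sup>2 * 2 ^ N)" .
    qed
    then show "norm (tconv v \<kappa> (y + h) - tconv v \<kappa> y - (\<Sum>i\<in>UNIV. (h $ i) *\<^sub>R (- tconv v (partial i \<kappa>) y)))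
        \<le> C * ((1 + norm y) ^ N * (K * 2 ^ N)) * (norm h)\<^sup>2"
      unfolding eq by (simp add: mult_ac)
  qed
qed

lemma tconv_differentiable: "tempered v \<Longrightarrow> \<kappa> \<in> schwartz \<Longrightarrow> tconv v \<kappa> differentiable (at y)"
  using tconv_has_derivative unfolding differentiable_def by blast

lemma tconv_continuous: "tempered v \<Longrightarrow> \<kappa> \<in> schwartz \<Longrightarrow> continuous_on A (tconv v \<kappa>)"
  by (intro continuous_at_imp_continuous_on ballI differentiable_imp_continuous_within tconv_differentiable)

lemma partial_tconv:
  assumes "tempered v" "\<kappa> \<in> schwartz"
  shows "partial i (tconv v \<kappa>) = tconv v (\<lambda>x. - partial i \<kappa> x)"
proof
  fix y
  have "partial i (tconv v \<kappa>) y = - tconv v (partial i \<kappa>) y"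
    unfolding partial_eqI[OF tconv_has_derivative[OF assms]] sum_axis_scaleR ..
  then show "partial i (tconv v \<kappa>) y = tconv v (\<lambda>x. - partial i \<kappa> x) y"
    using tempered_uminus[OF assms(1) schwartz_shift[OF schwartz_partial[OF assms(2)]]] by (simp add: tconv_def)
qed

text \<open>The functions \<open>tconv v \<kappa>\<close> and their derivatives, which are of the same form, have polynomial growth.\<close>

lemma schwartz_tconv_mult:
  assumes v: "tempered v" and "\<kappa> \<in> schwartz" "h \<in> schwartz"
  shows "(\<lambda>x. tconv v \<kappa> x * h x) \<in> schwartz"
proof (rule schwartz_coinduct_upto[where A = "{\<lambda>x. tconv v \<kappa> x * h x |\<kappa> h. \<kappa> \<in> schwartz \<and> h \<in> schwartz}"])
  let ?A = "{\<lambda>x. tconv v \<kappa> x * h x |\<kappa> h. \<kappa> \<in> schwartz \<and> h \<in> schwartz}"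
  have inA: "add_closure ?A (\<lambda>x. tconv v \<kappa> x * h x)" if "\<kappa> \<in> schwartz" "h \<in> schwartz" for \<kappa> h
    using that by (intro add_closure.base) auto
  show "add_closure ?A (\<lambda>x. tconv v \<kappa> x * h x)" by (rule inA) fact+
  fix g assume "g \<in> ?A"
  then obtain \<kappa> h where g: "g = (\<lambda>x. tconv v \<kappa> x * h x)" and \<kappa>: "\<kappa> \<in> schwartz" and h: "h \<in> schwartz" by auto
  have "rapid g"
  proof -
    obtain C N where "\<And>y. norm (tconv v \<kappa> y) \<le> C * (1 + norm y) ^ N" using tconv_growth[OF v \<kappa>] by blast
    then have "norm (g x) \<le> C * (1 + norm x) ^ N * norm (h x)" for x
      by (auto simp: g norm_mult intro!: mult_right_mono)
    then show ?thesis by (rule rapid_bounded_mult[OF schwartz_rapid[OF h]])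
  qed
  moreover have "partial i g = (\<lambda>x. tconv v (\<lambda>x. - partial i \<kappa> x) x * h x + tconv v \<kappa> x * partial i h x)" for i
    unfolding g partial_tconv[OF v \<kappa>, symmetric]
    by (intro ext partial_mult tconv_differentiable[OF v \<kappa>] schwartz_differentiable[OF h])
  then have "add_closure ?A (partial i g)" for i
    by (simp only:) (intro add_closure.add[of ?A] inA schwartz_uminus schwartz_partial \<kappa> h)
  ultimately show "(\<forall>x. g differentiable (at x)) \<and> rapid g \<and> (\<forall>i. add_closure ?A (partial i g))"
    unfolding g using differentiable_mult[OF tconv_differentiable[OF v \<kappa>] schwartz_differentiable[OF h]] by blast
qed

text \<open>Inside the box the error is the oscillation \<open>m\<close> on the cells times the volume; outside it is the tail of the
  integral.\<close>

lemma riemann_sum_bound: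
  fixes H :: "real^'d::finite \<Rightarrow> complex"
  assumes cont: "continuous_on UNIV H" and int: "integrable lborel H"
    and p: "p tagged_division_of (cbox a b)"
    and m: "\<And>t k y. (t, k) \<in> p \<Longrightarrow> y \<in> k \<Longrightarrow> norm (H y - H t) \<le> m"
    and "0 \<le> m"
  shows "norm ((LINT y|lborel. H y) - (\<Sum>(t,k)\<in>p. measure lborel k *\<^sub>R H t))
     \<le> (LINT y|lborel. indicator (- cbox a b) y * norm (H y)) + measure lborel (cbox a b) * m"
proof -
  let ?Q = "cbox a b"
  have i1: "integrable lborel (\<lambda>y. indicator ?Q y *\<^sub>R H y)"
    using integrable_mult_indicator[OF _ int, of ?Q] by simp
  have i2: "integrable lborel (\<lambda>y. indicator (- ?Q) y *\<^sub>R H y)"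
    using integrable_mult_indicator[OF _ int, of "- ?Q"] by simp
  have "(LINT y|lborel. H y) = (LINT y|lborel. indicator ?Q y *\<^sub>R H y + indicator (- ?Q) y *\<^sub>R H y)"
    by (intro Bochner_Integration.integral_cong) (auto simp: indicator_def)
  also have "\<dots> = (LINT y|lborel. indicator ?Q y *\<^sub>R H y) + (LINT y|lborel. indicator (- ?Q) y *\<^sub>R H y)"
    by (rule Bochner_Integration.integral_add[OF i1 i2])
  also have "(LINT y|lborel. indicator ?Q y *\<^sub>R H y) = integral ?Q H"
    using set_borel_integral_eq_integral(2)[of ?Q H] i1 by (simp add: set_lebesgue_integral_def set_integrable_def)
  finally have split: "(LINT y|lborel. H y) = integral ?Q H + (LINT y|lborel. indicator (- ?Q) y *\<^sub>R H y)" .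
  have "norm (LINT y|lborel. indicator (- ?Q) y *\<^sub>R H y) \<le> (LINT y|lborel. norm (indicator (- ?Q) y *\<^sub>R H y))"
    by (rule integral_norm_bound)
  then have tail: "norm (LINT y|lborel. indicator (- ?Q) y *\<^sub>R H y) \<le> (LINT y|lborel. indicator (- ?Q) y * norm (H y))"
    by simp
  have cQ: "H integrable_on cbox c d" for c d
    by (rule integrable_continuous) (rule continuous_on_subset[OF cont], simp)
  have "integral ?Q H = (\<Sum>(t,k)\<in>p. integral k H)"
    by (rule integral_combine_tagged_division_topdown[OF cQ p])
  then have "integral ?Q H - (\<Sum>(t,k)\<in>p. measure lborel k *\<^sub>R H t) = (\<Sum>(t,k)\<in>p. integral k H - measure lborel k *\<^sub>R H t)"
    by (simp add: sum_subtractf case_prod_unfold)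
  also have "norm \<dots> \<le> (\<Sum>(t,k)\<in>p. measure lborel k * m)"
  proof (rule sum_norm_le, clarify)
    fix t k assume tk: "(t, k) \<in> p"
    obtain c d where k: "k = cbox c d" using tagged_division_ofD(4)[OF p tk] by blast
    have "integral k H - measure lborel k *\<^sub>R H t = integral k (\<lambda>y. H y - H t)"
      unfolding k by (subst Henstock_Kurzweil_Integration.integral_diff[OF cQ integrable_const]) simp
    also have "norm \<dots> \<le> m * measure lborel k"
      unfolding k by (rule has_integral_bound[OF \<open>0 \<le> m\<close> integrable_integral[OF Henstock_Kurzweil_Integration.integrable_diff[OF cQ integrable_const]]]) (use m tk k in auto)
    finally show "norm (integral k H - measure lborel k *\<^sub>R H t) \<le> measure lborel k * m" by (simp add: mult.commute)
  qed
  also have "\<dots> = (\<Sum>(t,k)\<in>p. measure lborel k) * m" by (simp add: sum_distrib_right case_prod_unfold)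
  also have "(\<Sum>(t,k)\<in>p. measure lborel k) = measure lborel ?Q" by (rule additive_content_tagged_division[OF p])
  finally have "norm (integral ?Q H - (\<Sum>(t,k)\<in>p. measure lborel k *\<^sub>R H t)) \<le> measure lborel ?Q * m" .
  moreover have eq: "(LINT y|lborel. H y) - (\<Sum>(t,k)\<in>p. measure lborel k *\<^sub>R H t)
     = (LINT y|lborel. indicator (- ?Q) y *\<^sub>R H y) + (integral ?Q H - (\<Sum>(t,k)\<in>p. measure lborel k *\<^sub>R H t))"
    by (simp add: split)
  ultimately show ?thesis unfolding eq using tail norm_triangle_ineq[of "LINT y|lborel. indicator (- ?Q) y *\<^sub>R H y" "integral ?Q H - (\<Sum>(t,k)\<in>p. measure lborel k *\<^sub>R H t)"]
    by linarith
qed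

lemma small_tail:
  fixes w :: "real^'d::finite \<Rightarrow> real"
  assumes "integrable lborel w" "0 < \<epsilon>"
  obtains a b where "(LINT y|lborel. indicator (- cbox a b) y * w y) < \<epsilon>"
proof -
  let ?Q = "\<lambda>n::nat. cbox (- (real n *\<^sub>R One)) (real n *\<^sub>R One) :: (real^'d) set"
  have "(\<lambda>n. LINT y|lborel. indicator (- ?Q n) y * w y) \<longlonglongrightarrow> (LINT y|(lborel :: (real^'d) measure). 0)"
  proof (rule integral_dominated_convergence[where w = "\<lambda>y. norm (w y)"])
    show "AE y in lborel. (\<lambda>n. indicator (- ?Q n) y * w y) \<longlonglongrightarrow> 0"
    proof (intro AE_I2)
      fix y :: "real^'d"
      obtain n0 :: nat where n0: "norm y \<le> real n0" using real_arch_simple by blast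
      have "\<forall>\<^sub>F n in sequentially. indicator (- ?Q n) y * w y = 0"
      proof (rule eventually_sequentiallyI[of n0])
        fix n assume "n0 \<le> n"
        then have "norm y \<le> real n" using n0 by linarith
        then have "- real n \<le> y \<bullet> e \<and> y \<bullet> e \<le> real n" if "e \<in> Basis" for e
          using Basis_le_norm[OF that, of y] by linarith
        then have "y \<in> ?Q n" by (auto simp: mem_box)
        then show "indicator (- ?Q n) y * w y = 0" by simp
      qed
      then show "(\<lambda>n. indicator (- ?Q n) y * w y) \<longlonglongrightarrow> 0" by (rule tendsto_eventually)
    qed
    show "AE y in lborel. norm (indicator (- ?Q n) y * w y) \<le> norm (w y)" for n
      by (auto simp: indicator_def)
  qed (use assms in auto)
  then have "(\<lambda>n. LINT y|lborel. indicator (- ?Q n) y * w y) \<longlonglongrightarrow> 0" by simp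
  from order_tendstoD(2)[OF this assms(2)]
  obtain n where "(LINT y|lborel. indicator (- ?Q n) y * w y) < \<epsilon>"
    using eventually_sequentially by auto
  then show ?thesis by (rule that)
qed


text \<open>A tempered distribution commutes with the integral that defines \<open>f\<close>, a superposition of translates
  of \<open>\<kappa>\<close>. For Riemann sums this is linearity. The Riemann sums of \<open>f\<close> converge to \<open>f\<close> in the seminorm that controls \<open>v\<close>, since
  the integrand is Lipschitz and has an integrable majorant, uniformly in the weighted variable \<open>x\<close>.\<close>

lemma tempered_integral:
  fixes v :: "'d::finite functional"
  assumes v: "tempered v" and \<psi>: "\<psi> \<in> schwartz" and \<kappa>: "\<kappa> \<in> schwartz" and f: "f \<in> schwartz"
    and fi: "\<And>is x. iterated_partial is f x = (LINT y|lborel. \<psi> y * iterated_partial is \<kappa> (x - y))"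
  shows "v f = (LINT y|lborel. tconv v \<kappa> y * \<psi> y)"
proof -
  obtain C N where C: "0 \<le> C"
    "\<And>\<psi> B. \<psi> \<in> schwartz \<Longrightarrow>
       (\<And>x is. length is \<le> N \<Longrightarrow> (1 + norm x) ^ N * norm (iterated_partial is \<psi> x) \<le> B) \<Longrightarrow> norm (v \<psi>) \<le> C * B"
    using tempered_bound[OF v] by blast
  define J where "J = (\<lambda>is. iterated_partial is \<kappa>)"
  have J: "J is \<in> schwartz" for "is" unfolding J_def by (rule schwartz_iterated_partial[OF \<kappa>])
  define w where "w = (\<lambda>y. (1 + norm y) ^ N * norm (\<psi> y))"
  have w: "integrable lborel w" unfolding w_def by (rule schwartz_integrable_weight[OF \<psi>])
  obtain B where B: "0 \<le> B" "\<And>x is. length is \<le> N \<Longrightarrow> (1 + norm x) ^ N * norm (J is x) \<le> B"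
  proof
    show "0 \<le> schwartz_seminorm N \<kappa>"
      by (rule order_trans[OF _ schwartz_seminorm_bound[OF \<kappa>, of "[]" N 0]]) auto
    show "(1 + norm x) ^ N * norm (J is x) \<le> schwartz_seminorm N \<kappa>" if "length is \<le> N" for x "is"
      unfolding J_def by (rule schwartz_seminorm_bound[OF \<kappa> that])
  qed
  have dom: "(1 + norm x) ^ N * norm (\<psi> y * J is (x - y)) \<le> B * w y" if l: "length is \<le> N" for x y "is"
  proof -
    have "(1 + norm x) ^ N * norm (\<psi> y * J is (x - y)) \<le> ((1 + norm y) ^ N * (1 + norm (x - y)) ^ N) * norm (\<psi> y * J is (x - y))"
      by (intro mult_right_mono one_plus_norm_power_shift) auto
    also have "\<dots> = ((1 + norm (x - y)) ^ N * norm (J is (x - y))) * w y" by (simp add: w_def norm_mult)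
    also have "\<dots> \<le> B * w y" by (intro mult_right_mono B l) (simp add: w_def)
    finally show ?thesis .
  qed
  \<comment> \<open>A Lipschitz constant of the integrand in the integration variable, weighted and uniform in \<open>x\<close>.\<close>
  obtain M where M: "0 \<le> M" "\<And>is. length is \<le> N \<Longrightarrow> (\<forall>x y t. norm (y - t) \<le> 1 \<longrightarrow>
      (1 + norm x) ^ N * norm (\<psi> y * J is (x - y) - \<psi> t * J is (x - t)) \<le> M * norm (y - t))"
  proof (rule uniform_over_lists[where N = N and P = "\<lambda>is M. \<forall>x y t. norm (y - t) \<le> 1 \<longrightarrow>
      (1 + norm x) ^ N * norm (\<psi> y * J is (x - y) - \<psi> t * J is (x - t)) \<le> M * norm (y - t)"])
    fix "is" :: "'d list" assume l: "length is \<le> N"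
    obtain C1 where C1: "0 \<le> C1" "\<And>z h. (1 + norm z) ^ N * norm (\<psi> (z + h) - \<psi> z) \<le> C1 * norm h * (1 + norm h) ^ N"
      using schwartz_lipschitz[OF \<psi>, of N] by blast
    obtain C4 where C4: "0 \<le> C4" "\<And>z h. (1 + norm z) ^ N * norm (J is (z + h) - J is z) \<le> C4 * norm h * (1 + norm h) ^ N"
      using schwartz_lipschitz[OF J, of N "is"] by blast
    obtain C3 where C3: "0 \<le> C3" "\<And>z. (1 + norm z) ^ N * norm (\<psi> z) \<le> C3"
      using rapidE[OF schwartz_rapid[OF \<psi>], of N] by blast
    have "(1 + norm x) ^ N * norm (\<psi> y * J is (x - y) - \<psi> t * J is (x - t)) \<le> (C1 * 2 ^ N * B + C3 * (C4 * 2 ^ N)) * norm (y - t)"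
      if yt: "norm (y - t) \<le> 1" for x y t
    proof -
      have p2: "(1 + norm (t - y)) ^ N \<le> 2 ^ N" using yt by (intro power_mono) (auto simp: norm_minus_commute)
      have "(1 + norm y) ^ N * norm (\<psi> t - \<psi> y) \<le> C1 * norm (t - y) * (1 + norm (t - y)) ^ N"
        using C1(2)[of y "t - y"] by simp
      also have "\<dots> \<le> C1 * norm (t - y) * 2 ^ N" using C1(1) by (intro mult_left_mono p2) auto
      finally have a1: "(1 + norm y) ^ N * norm (\<psi> t - \<psi> y) \<le> C1 * 2 ^ N * norm (y - t)" by (simp add: norm_minus_commute mult_ac)
      have "(1 + norm (x - t)) ^ N * norm (J is (x - y) - J is (x - t)) \<le> C4 * norm (t - y) * (1 + norm (t - y)) ^ N"
        using C4(2)[of "x - t" "t - y"] by simp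
      also have "\<dots> \<le> C4 * norm (t - y) * 2 ^ N" using C4(1) by (intro mult_left_mono p2) auto
      finally have a4: "(1 + norm (x - t)) ^ N * norm (J is (x - y) - J is (x - t)) \<le> C4 * 2 ^ N * norm (y - t)" by (simp add: norm_minus_commute mult_ac)
      have b1: "(1 + norm x) ^ N * norm ((\<psi> y - \<psi> t) * J is (x - y)) \<le> (C1 * 2 ^ N * norm (y - t)) * B"
      proof -
        have "(1 + norm x) ^ N * norm ((\<psi> y - \<psi> t) * J is (x - y)) \<le> ((1 + norm y) ^ N * (1 + norm (x - y)) ^ N) * norm ((\<psi> y - \<psi> t) * J is (x - y))"
          by (intro mult_right_mono one_plus_norm_power_shift) auto
        also have "\<dots> = ((1 + norm y) ^ N * norm (\<psi> t - \<psi> y)) * ((1 + norm (x - y)) ^ N * norm (J is (x - y)))"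
          by (simp add: norm_mult norm_minus_commute)
        also have "\<dots> \<le> (C1 * 2 ^ N * norm (y - t)) * B"
          using C1(1) by (intro mult_mono a1 B l) auto
        finally show ?thesis .
      qed
      have b2: "(1 + norm x) ^ N * norm (\<psi> t * (J is (x - y) - J is (x - t))) \<le> C3 * (C4 * 2 ^ N * norm (y - t))"
      proof -
        have "(1 + norm x) ^ N * norm (\<psi> t * (J is (x - y) - J is (x - t))) \<le> ((1 + norm t) ^ N * (1 + norm (x - t)) ^ N) * norm (\<psi> t * (J is (x - y) - J is (x - t)))"
          by (intro mult_right_mono one_plus_norm_power_shift) auto
        also have "\<dots> = ((1 + norm t) ^ N * norm (\<psi> t)) * ((1 + norm (x - t)) ^ N * norm (J is (x - y) - J is (x - t)))"
          by (simp add: norm_mult)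
        also have "\<dots> \<le> C3 * (C4 * 2 ^ N * norm (y - t))"
          using C3(1) by (intro mult_mono a4 C3) auto
        finally show ?thesis .
      qed
      have "\<psi> y * J is (x - y) - \<psi> t * J is (x - t) = (\<psi> y - \<psi> t) * J is (x - y) + \<psi> t * (J is (x - y) - J is (x - t))"
        by (simp add: algebra_simps)
      then have "(1 + norm x) ^ N * norm (\<psi> y * J is (x - y) - \<psi> t * J is (x - t))
         \<le> (1 + norm x) ^ N * (norm ((\<psi> y - \<psi> t) * J is (x - y)) + norm (\<psi> t * (J is (x - y) - J is (x - t))))"
        by (intro mult_left_mono) (auto intro: norm_triangle_ineq)
      also have "\<dots> \<le> (C1 * 2 ^ N * norm (y - t)) * B + C3 * (C4 * 2 ^ N * norm (y - t))"
        unfolding distrib_left by (intro add_mono b1 b2)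
      also have "\<dots> = (C1 * 2 ^ N * B + C3 * (C4 * 2 ^ N)) * norm (y - t)" by (simp add: algebra_simps)
      finally show ?thesis .
    qed
    moreover have "0 \<le> C1 * 2 ^ N * B + C3 * (C4 * 2 ^ N)" using C1(1) C3(1) C4(1) B(1) by simp
    ultimately show "\<exists>M\<ge>0. \<forall>x y t. norm (y - t) \<le> 1 \<longrightarrow>
      (1 + norm x) ^ N * norm (\<psi> y * J is (x - y) - \<psi> t * J is (x - t)) \<le> M * norm (y - t)" by blast
  next
    fix "is" :: "'d list" and M M' :: real
    assume a: "\<forall>x y t. norm (y - t) \<le> 1 \<longrightarrow> (1 + norm x) ^ N * norm (\<psi> y * J is (x - y) - \<psi> t * J is (x - t)) \<le> M * norm (y - t)"
      and "M \<le> M'"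
    then have "M * norm (y - t) \<le> M' * norm (y - t)" for y t :: "real^'d" by (intro mult_right_mono) auto
    then show "\<forall>x y t. norm (y - t) \<le> 1 \<longrightarrow> (1 + norm x) ^ N * norm (\<psi> y * J is (x - y) - \<psi> t * J is (x - t)) \<le> M' * norm (y - t)"
      using a order_trans by blast
  qed (rule that)
  define g where "g = tconv v \<kappa>"
  have nc: "norm (complex_of_real ((1 + norm x) ^ N) * z) = (1 + norm x) ^ N * norm z" for x :: "real^'d" and z
    by (subst norm_mult, subst norm_of_real) simp
  define G where "G = (\<lambda>y. g y * \<psi> y)"
  have GS: "G \<in> schwartz" unfolding G_def g_def by (rule schwartz_tconv_mult[OF v \<kappa> \<psi>])
  have sh: "(\<lambda>x. c * \<kappa> (x - y)) \<in> schwartz" for c y by (intro schwartz_cmult schwartz_shift \<kappa>)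
  have shi: "iterated_partial is (\<lambda>x. c * \<kappa> (x - y)) = (\<lambda>x. c * J is (x - y))" for c y "is"
    unfolding J_def by (simp only: iterated_partial_cmult[OF schwartz_shift[OF \<kappa>]] iterated_partial_shift[OF \<kappa>])
  have vs: "v (\<lambda>x. \<psi> y * \<kappa> (x - y)) = G y" for y
    unfolding G_def g_def tconv_def by (subst tempered_cmult[OF v schwartz_shift[OF \<kappa>]]) simp
  have Gbound: "norm (G y) \<le> C * (B * w y)" for y
    unfolding vs[symmetric] by (rule C(2)[OF sh]) (simp only: shi dom)
  have Glip: "norm (G y - G t) \<le> C * (M * norm (y - t))" if "norm (y - t) \<le> 1" for y t
    unfolding vs[symmetric] tempered_diff[OF v sh sh, symmetric]
    by (rule C(2)[OF schwartz_diff[OF sh sh]]) (use M(2) that in \<open>simp only: shi iterated_partial_diff[OF sh sh]\<close>)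
  have close: "norm (v f - (LINT y|lborel. G y)) \<le> (2 * C * (B + 1)) * \<epsilon>" if \<epsilon>: "0 < \<epsilon>" for \<epsilon>
  proof -
    obtain a b where ab: "(LINT y|lborel. indicator (- cbox a b) y * w y) < \<epsilon>" using small_tail[OF w \<epsilon>] by blast
    let ?Q = "cbox a b"
    define V where "V = measure lborel ?Q"
    have V0: "0 \<le> V" by (simp add: V_def)
    \<comment> \<open>The mesh, so fine that the Lipschitz error integrated over the box is at most \<open>\<epsilon>\<close>.\<close>
    define \<delta> where "\<delta> = min 1 (\<epsilon> / ((V + 1) * (M + 1)))"
    have \<delta>: "0 < \<delta>" "\<delta> \<le> 1" using \<epsilon> V0 M(1) by (auto simp: \<delta>_def)
    have VM: "V * (M * \<delta>) \<le> \<epsilon>"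
    proof -
      have "V * (M * \<delta>) \<le> ((V + 1) * (M + 1)) * \<delta>"
        unfolding mult.assoc[symmetric] using V0 M(1) \<delta> by (intro mult_right_mono mult_mono) auto
      also have "\<dots> \<le> ((V + 1) * (M + 1)) * (\<epsilon> / ((V + 1) * (M + 1)))"
        using V0 M(1) by (intro mult_left_mono) (auto simp: \<delta>_def)
      also have "\<dots> = \<epsilon>" using V0 M(1) by simp
      finally show ?thesis .
    qed
    obtain p where p: "p tagged_division_of ?Q" "(\<lambda>x. ball x \<delta>) fine p"
      using fine_division_exists[OF gauge_ball[OF \<delta>(1)], of a b] by blast
    have near: "norm (y - t) \<le> \<delta>" if "(t, k) \<in> p" "y \<in> k" for t k y
      using fineD[OF p(2) that(1)] that(2) by (auto simp: dist_norm norm_minus_commute less_imp_le)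
    have near1: "norm (y - t) \<le> 1" if "(t, k) \<in> p" "y \<in> k" for t k y using near[OF that] \<delta>(2) by linarith
    have finp: "finite p" by (rule tagged_division_of_finite[OF p(1)])
    \<comment> \<open>The Riemann sum of \<open>f\<close>, a finite combination of translates of \<open>\<kappa>\<close>.\<close>
    define S where "S = (\<lambda>x. \<Sum>q\<in>p. (complex_of_real (measure lborel (snd q)) * \<psi> (fst q)) * \<kappa> (x - fst q))"
    have SS: "S \<in> schwartz" unfolding S_def by (intro schwartz_sum finp sh)
    have Si: "iterated_partial is S = (\<lambda>x. \<Sum>q\<in>p. (complex_of_real (measure lborel (snd q)) * \<psi> (fst q)) * J is (x - fst q))" for "is"
      unfolding S_def by (simp only: iterated_partial_sum[OF finp sh] shi)
    have vS: "v S = (\<Sum>(t,k)\<in>p. measure lborel k *\<^sub>R G t)"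
    proof -
      have "v S = (\<Sum>q\<in>p. v (\<lambda>x. (complex_of_real (measure lborel (snd q)) * \<psi> (fst q)) * \<kappa> (x - fst q)))"
        unfolding S_def by (rule tempered_sum[OF v finp sh])
      also have "\<dots> = (\<Sum>q\<in>p. measure lborel (snd q) *\<^sub>R G (fst q))"
        by (intro sum.cong refl, subst tempered_cmult[OF v schwartz_shift[OF \<kappa>]])
           (simp add: G_def g_def tconv_def scaleR_conv_of_real[where 'a = complex])
      finally show ?thesis by (simp add: case_prod_unfold)
    qed
    have "norm (v (\<lambda>x. f x - S x)) \<le> C * (B * \<epsilon> + \<epsilon>)"
    proof (rule C(2)[OF schwartz_diff[OF f SS]])
      fix x "is" assume l: "length (is :: 'd list) \<le> N"
      define H where "H = (\<lambda>y. complex_of_real ((1 + norm x) ^ N) * (\<psi> y * J is (x - y)))"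
      have nH: "norm (H y) = (1 + norm x) ^ N * norm (\<psi> y * J is (x - y))" for y unfolding H_def by (rule nc)
      have HS: "H \<in> schwartz"
      proof -
        have "(\<lambda>y. J is (x - y)) = (\<lambda>y. J is ((- 1) *\<^sub>R y + x))" by simp
        also have "\<dots> \<in> schwartz" by (rule schwartz_affine[OF J]) simp
        finally show ?thesis unfolding H_def by (intro schwartz_cmult schwartz_mult \<psi>)
      qed
      have "norm ((LINT y|lborel. H y) - (\<Sum>(t,k)\<in>p. measure lborel k *\<^sub>R H t))
          \<le> (LINT y|lborel. indicator (- ?Q) y * norm (H y)) + measure lborel ?Q * (M * \<delta>)"
      proof (rule riemann_sum_bound[OF schwartz_continuous[OF HS] schwartz_integrable[OF HS] p(1)])
        fix t k y assume tk: "(t, k) \<in> p" "y \<in> k"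
        have "H y - H t = complex_of_real ((1 + norm x) ^ N) * (\<psi> y * J is (x - y) - \<psi> t * J is (x - t))"
          by (simp add: H_def right_diff_distrib)
        then have "norm (H y - H t) = (1 + norm x) ^ N * norm (\<psi> y * J is (x - y) - \<psi> t * J is (x - t))"
          by (simp only: nc)
        also have "\<dots> \<le> M * norm (y - t)" using M(2)[OF l] near1[OF tk] by blast
        also have "\<dots> \<le> M * \<delta>" using M(1) near[OF tk] by (intro mult_left_mono) auto
        finally show "norm (H y - H t) \<le> M * \<delta>" .
      qed (use M(1) \<delta> in simp)
      also have "(LINT y|lborel. indicator (- ?Q) y * norm (H y)) \<le> (LINT y|lborel. indicator (- ?Q) y * (B * w y))"
      proof (rule integral_mono)
        show "integrable lborel (\<lambda>y. indicator (- ?Q) y * norm (H y))"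
          using integrable_mult_indicator[OF _ integrable_norm[OF schwartz_integrable[OF HS]], of "- ?Q"] by simp
        show "integrable lborel (\<lambda>y. indicator (- ?Q) y * (B * w y))"
          using integrable_mult_indicator[OF _ integrable_mult_right[OF w], of "- ?Q" B] by simp
        show "indicator (- ?Q) y * norm (H y) \<le> indicator (- ?Q) y * (B * w y)" for y
          using dom[OF l, of x y] by (simp add: nH indicator_def)
      qed
      also have "\<dots> = B * (LINT y|lborel. indicator (- ?Q) y * w y)"
        by (subst integral_mult_right_zero[symmetric]) (simp add: mult_ac)
      also have "\<dots> \<le> B * \<epsilon>" using ab B(1) by (intro mult_left_mono) auto
      also have "measure lborel ?Q * (M * \<delta>) \<le> \<epsilon>" using VM by (simp add: V_def)
      also have "(LINT y|lborel. H y) - (\<Sum>(t,k)\<in>p. measure lborel k *\<^sub>R H t)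
          = complex_of_real ((1 + norm x) ^ N) * iterated_partial is (\<lambda>x. f x - S x) x"
      proof -
        have "(LINT y|lborel. H y) = complex_of_real ((1 + norm x) ^ N) * iterated_partial is f x"
          unfolding H_def integral_mult_right_zero by (simp only: fi J_def)
        moreover have "(\<Sum>(t,k)\<in>p. measure lborel k *\<^sub>R H t) = complex_of_real ((1 + norm x) ^ N) * iterated_partial is S x"
          unfolding Si sum_distrib_left case_prod_unfold
          by (intro sum.cong refl) (simp add: H_def scaleR_conv_of_real[where 'a = complex])
        ultimately show ?thesis by (simp add: iterated_partial_diff[OF f SS] right_diff_distrib)
      qed
      finally show "(1 + norm x) ^ N * norm (iterated_partial is (\<lambda>x. f x - S x) x) \<le> B * \<epsilon> + \<epsilon>"
        by (simp only: nc)
    qed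
    then have 1: "norm (v f - v S) \<le> C * (B * \<epsilon> + \<epsilon>)" by (simp only: tempered_diff[OF v f SS])
    have "norm ((LINT y|lborel. G y) - (\<Sum>(t,k)\<in>p. measure lborel k *\<^sub>R G t))
        \<le> (LINT y|lborel. indicator (- ?Q) y * norm (G y)) + measure lborel ?Q * (C * (M * \<delta>))"
    proof (rule riemann_sum_bound[OF schwartz_continuous[OF GS] schwartz_integrable[OF GS] p(1)])
      fix t k y assume tk: "(t, k) \<in> p" "y \<in> k"
      have "norm (G y - G t) \<le> C * (M * norm (y - t))" by (rule Glip[OF near1[OF tk]])
      also have "\<dots> \<le> C * (M * \<delta>)" using M(1) C(1) near[OF tk] by (intro mult_left_mono) auto
      finally show "norm (G y - G t) \<le> C * (M * \<delta>)" .
    qed (use M(1) C(1) \<delta> in simp)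
    also have "(LINT y|lborel. indicator (- ?Q) y * norm (G y)) \<le> (LINT y|lborel. indicator (- ?Q) y * (C * (B * w y)))"
    proof (rule integral_mono)
      show "integrable lborel (\<lambda>y. indicator (- ?Q) y * norm (G y))"
        using integrable_mult_indicator[OF _ integrable_norm[OF schwartz_integrable[OF GS]], of "- ?Q"] by simp
      show "integrable lborel (\<lambda>y. indicator (- ?Q) y * (C * (B * w y)))"
        using integrable_mult_indicator[OF _ integrable_mult_right[OF integrable_mult_right[OF w]], of "- ?Q" C B] by simp
      show "indicator (- ?Q) y * norm (G y) \<le> indicator (- ?Q) y * (C * (B * w y))" for y
        using Gbound[of y] by (simp add: indicator_def)
    qed
    also have "\<dots> = (C * B) * (LINT y|lborel. indicator (- ?Q) y * w y)"
      by (subst integral_mult_right_zero[symmetric]) (simp add: mult_ac)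
    also have "\<dots> \<le> (C * B) * \<epsilon>" using ab B(1) C(1) by (intro mult_left_mono) auto
    also have "measure lborel ?Q * (C * (M * \<delta>)) \<le> C * \<epsilon>"
      using mult_left_mono[OF VM C(1)] by (simp add: V_def mult_ac)
    finally have 2: "norm ((LINT y|lborel. G y) - v S) \<le> C * B * \<epsilon> + C * \<epsilon>" by (simp add: vS)
    have "v f - (LINT y|lborel. G y) = (v f - v S) - ((LINT y|lborel. G y) - v S)" by simp
    then have "norm (v f - (LINT y|lborel. G y)) \<le> norm (v f - v S) + norm ((LINT y|lborel. G y) - v S)"
      by (metis norm_triangle_ineq4)
    also have "\<dots> \<le> C * (B * \<epsilon> + \<epsilon>) + (C * B * \<epsilon> + C * \<epsilon>)" by (intro add_mono 1 2)
    also have "\<dots> = (2 * C * (B + 1)) * \<epsilon>" by (simp add: algebra_simps)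
    finally show ?thesis .
  qed
  have "norm (v f - (LINT y|lborel. G y)) \<le> 0"
  proof (rule field_le_epsilon)
    fix e :: real assume "0 < e"
    define K where "K = 2 * C * (B + 1)"
    have K: "0 \<le> K" using C(1) B(1) by (simp add: K_def)
    have "norm (v f - (LINT y|lborel. G y)) \<le> K * (e / (K + 1))"
      unfolding K_def by (rule close) (use \<open>0 < e\<close> K in \<open>auto simp: K_def intro!: divide_pos_pos\<close>)
    also have "\<dots> \<le> 0 + e" using K \<open>0 < e\<close> by (simp add: field_simps)
    finally show "norm (v f - (LINT y|lborel. G y)) \<le> 0 + e" .
  qed
  then show ?thesis by (simp add: G_def g_def)
qed

text \<open>The link between the abstract definition of a Fourier multiplier, by transposition, and functions. The argument of \<open>v\<close> on
  the left is the convolution of \<open>\<psi>\<close> with the kernel, a superposition of translates of the kernel.\<close>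

lemma multiplier_representation:
  fixes v :: "'d::finite functional"
  assumes v: "tempered v" and m: "m \<in> schwartz" and \<psi>: "\<psi> \<in> schwartz"
  shows "v (fourier (\<lambda>\<xi>. m \<xi> * inverse_fourier \<psi> \<xi>)) = (LINT y|lborel. tconv v (Ker m) y * \<psi> y)"
proof (rule tempered_integral[OF v \<psi> schwartz_Ker[OF m]])
  have mm: "(\<lambda>\<xi>. m \<xi> * inverse_fourier \<psi> \<xi>) \<in> schwartz" by (intro schwartz_mult m schwartz_inverse_fourier \<psi>)
  show "fourier (\<lambda>\<xi>. m \<xi> * inverse_fourier \<psi> \<xi>) \<in> schwartz" by (rule schwartz_fourier[OF mm])
  fix "is" :: "'d list" and x
  have "iterated_partial is (fourier (\<lambda>\<xi>. m \<xi> * inverse_fourier \<psi> \<xi>)) x = fourier (\<lambda>\<xi>. (symbol is \<xi> * m \<xi>) * inverse_fourier \<psi> \<xi>) x"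
    by (simp only: iterated_partial_fourier[OF mm] mult.assoc)
  also have "\<dots> = (LINT y|lborel. \<psi> y * Ker (\<lambda>\<xi>. symbol is \<xi> * m \<xi>) (x - y))"
    by (intro multiplier_convolution schwartz_integrable schwartz_symbol m \<psi>)
  also have "Ker (\<lambda>\<xi>. symbol is \<xi> * m \<xi>) = iterated_partial is (Ker m)"
  proof -
    have "Ker m = (\<lambda>x. complex_of_real (1 / (2 * pi) ^ CARD('d)) * fourier m x)" by (rule ext) (rule Ker_def)
    then have "iterated_partial is (Ker m) = (\<lambda>x. complex_of_real (1 / (2 * pi) ^ CARD('d)) * fourier (\<lambda>\<xi>. symbol is \<xi> * m \<xi>) x)"
      by (simp only: iterated_partial_cmult[OF schwartz_fourier[OF m]] iterated_partial_fourier[OF m])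
    then show ?thesis by (auto simp: Ker_def)
  qed
  finally show "iterated_partial is (fourier (\<lambda>\<xi>. m \<xi> * inverse_fourier \<psi> \<xi>)) x = (LINT y|lborel. \<psi> y * iterated_partial is (Ker m) (x - y))" .
qed

section \<open>Dyadic blocks as functions\<close>

lemma fourier_multiplier_apply:
  "fourier_multiplier m u \<psi> = u (fourier (\<lambda>\<xi>. complex_of_real (m \<xi>) * inverse_fourier \<psi> \<xi>))"
  by (simp add: fourier_multiplier_def inverse_fourier_distr_def mult_distr_def fourier_distr_def)

lemma represented_by_fourier_multiplier:
  assumes u: "tempered u" and m: "(\<lambda>\<xi>. complex_of_real (m \<xi>)) \<in> schwartz"
  shows "represented_by (fourier_multiplier m u) (tconv u (Ker (\<lambda>\<xi>. complex_of_real (m \<xi>))))"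
  unfolding represented_by_def
proof (intro conjI ballI)
  show "continuous_on UNIV (tconv u (Ker (\<lambda>\<xi>. complex_of_real (m \<xi>))))"
    by (rule tconv_continuous[OF u schwartz_Ker[OF m]])
  fix \<psi> :: "real^'a \<Rightarrow> complex" assume \<psi>: "\<psi> \<in> schwartz"
  show "integrable lborel (\<lambda>x. tconv u (Ker (\<lambda>\<xi>. complex_of_real (m \<xi>))) x * \<psi> x)"
    by (rule schwartz_integrable[OF schwartz_tconv_mult[OF u schwartz_Ker[OF m] \<psi>]])
  show "fourier_multiplier m u \<psi> = distr_of_fun (tconv u (Ker (\<lambda>\<xi>. complex_of_real (m \<xi>)))) \<psi>"
    unfolding fourier_multiplier_apply distr_of_fun_def by (rule multiplier_representation[OF u m \<psi>])
qed

locale littlewood_paley =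
  fixes chi :: "real^'d::finite \<Rightarrow> real"
  assumes cutoff: "littlewood_paley_cutoff chi"
begin

lemmas cutoff_conds = cutoff[unfolded littlewood_paley_cutoff_def]

lemma chi_smooth: "smooth chi"
  by (rule conjunct1[OF cutoff_conds])

lemma chi_nonneg: "0 \<le> chi \<xi>" and chi_le_1: "chi \<xi> \<le> 1"
proof -
  have "chi \<xi> \<in> {0..1}"
    using conjunct1[OF conjunct2[OF cutoff_conds]] rangeI[of chi \<xi>] by (rule subsetD)
  then show "0 \<le> chi \<xi>" "chi \<xi> \<le> 1" by auto
qed

lemma chi_closure: "closure {\<xi>. chi \<xi> \<noteq> 0} \<subseteq> {\<xi>. norm \<xi> \<le> 4/3}"
  by (rule conjunct1[OF conjunct2[OF conjunct2[OF cutoff_conds]]])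

lemma phi_closure: "closure {\<xi>. lp_phi chi \<xi> \<noteq> 0} \<subseteq> {\<xi>. 3/4 \<le> norm \<xi> \<and> norm \<xi> \<le> 8/3}"
  by (rule conjunct1[OF conjunct2[OF conjunct2[OF conjunct2[OF cutoff_conds]]]])

lemma phi_has_sum: "\<xi> \<noteq> 0 \<Longrightarrow> ((\<lambda>j::int. lp_phi chi (2 powi (- j) *\<^sub>R \<xi>)) has_sum 1) UNIV"
  by (rule conjunct2[OF conjunct2[OF conjunct2[OF conjunct2[OF cutoff_conds]]], rule_format])

lemma chi_support: assumes "4 / 3 < norm \<xi>" shows "chi \<xi> = 0"
proof (rule ccontr)
  assume "chi \<xi> \<noteq> 0"
  then have "\<xi> \<in> {\<xi>. chi \<xi> \<noteq> 0}" by simp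
  from subsetD[OF chi_closure subsetD[OF closure_subset this]] show False using assms by simp
qed

lemma phi_support: assumes "lp_phi chi \<xi> \<noteq> 0" shows "3 / 4 \<le> norm \<xi> \<and> norm \<xi> \<le> 8 / 3"
proof -
  have "\<xi> \<in> {\<xi>. lp_phi chi \<xi> \<noteq> 0}" using assms by simp
  from subsetD[OF phi_closure subsetD[OF closure_subset this]] show ?thesis by simp
qed

text \<open>The symbols of \<^term>\<open>low_cut chi j\<close> and \<^term>\<open>Delta chi j\<close>. They are complex-valued because Schwartz functions are.\<close>

definition low_symbol :: "int \<Rightarrow> real^'d \<Rightarrow> complex" where
  "low_symbol j \<xi> = complex_of_real (chi (2 powi (- j) *\<^sub>R \<xi>))"

definition dyadic_symbol :: "int \<Rightarrow> real^'d \<Rightarrow> complex" where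
  "dyadic_symbol j \<xi> = complex_of_real (lp_phi chi (2 powi (- j) *\<^sub>R \<xi>))"

lemma schwartz_chi: "(\<lambda>\<xi>. complex_of_real (chi \<xi>)) \<in> schwartz"
  by (rule schwartz_compact_support[OF chi_smooth chi_support])

lemma schwartz_low_symbol: "low_symbol j \<in> schwartz"
  using schwartz_affine[OF schwartz_chi, of "2 powi (- j)" 0] by (simp add: low_symbol_def[abs_def])

lemma half_dyadic_scale: "((2::real) powi (- j) *\<^sub>R (\<xi>::real^'d)) /\<^sub>R 2 = 2 powi (- (j + 1)) *\<^sub>R \<xi>"
proof -
  have "(2::real) powi (- (j + 1)) = 2 powi (- j) * inverse 2"
    using power_int_add[of "2::real" "- j" "- 1"] by simp
  then show ?thesis by (simp only: scaleR_scaleR mult.commute)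
qed

lemma dyadic_symbol_eq: "dyadic_symbol j \<xi> = low_symbol (j + 1) \<xi> - low_symbol j \<xi>"
  unfolding dyadic_symbol_def low_symbol_def lp_phi_def half_dyadic_scale by (rule of_real_diff)

lemma schwartz_dyadic_symbol: "dyadic_symbol j \<in> schwartz"
proof -
  have "dyadic_symbol j = (\<lambda>\<xi>. low_symbol (j + 1) \<xi> - low_symbol j \<xi>)" by (rule ext) (rule dyadic_symbol_eq)
  then show ?thesis by (simp only: schwartz_diff[OF schwartz_low_symbol schwartz_low_symbol])
qed

lemma powi_pos: "0 < (2::real) powi j"
  by (rule zero_less_power_int) simp

lemma powi_norm: "norm ((2::real) powi (- j) *\<^sub>R (\<xi>::real^'d)) = norm \<xi> / 2 powi j"
proof -
  have "\<bar>(2::real) powi (- j)\<bar> = inverse (2 powi j)"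
    unfolding power_int_minus by (rule abs_of_pos) (simp only: inverse_positive_iff_positive powi_pos)
  then show ?thesis by (simp only: norm_scaleR divide_inverse mult.commute)
qed

lemma low_symbol_support: assumes "low_symbol j \<xi> \<noteq> 0" shows "norm \<xi> \<le> 2 powi j * (4 / 3)"
proof (rule ccontr)
  assume "\<not> norm \<xi> \<le> 2 powi j * (4 / 3)"
  then have "4 / 3 < norm (2 powi (- j) *\<^sub>R \<xi>)"
    unfolding powi_norm pos_less_divide_eq[OF powi_pos] by (simp only: not_le mult.commute)
  from chi_support[OF this] show False using assms by (simp only: low_symbol_def of_real_0)
qed

lemma dyadic_symbol_support: assumes "dyadic_symbol j \<xi> \<noteq> 0"
  shows "2 powi j * (3 / 4) \<le> norm \<xi>" "norm \<xi> \<le> 2 powi j * (8 / 3)"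
proof -
  have "lp_phi chi (2 powi (- j) *\<^sub>R \<xi>) \<noteq> 0" using assms unfolding dyadic_symbol_def by simp
  from phi_support[OF this] show "2 powi j * (3 / 4) \<le> norm \<xi>" "norm \<xi> \<le> 2 powi j * (8 / 3)"
    unfolding powi_norm pos_le_divide_eq[OF powi_pos] pos_divide_le_eq[OF powi_pos] by (simp_all only: mult.commute)
qed

text \<open>From the partition of unity at a unit vector: its symmetric partial sums telescope to the values of \<open>chi\<close> at
  small multiples of the vector.\<close>

lemma chi_0: "chi 0 = 1"
proof -
  define \<xi> :: "real^'d" where "\<xi> = axis undefined 1"
  have n\<xi>: "norm \<xi> = 1" "\<xi> \<noteq> 0" by (auto simp: \<xi>_def norm_axis_1)
  have "((\<lambda>j::int. lp_phi chi (2 powi (- j) *\<^sub>R \<xi>)) has_sum 1) UNIV"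
    by (rule phi_has_sum[OF n\<xi>(2)])
  then have lim: "((\<lambda>F. \<Sum>j\<in>F. lp_phi chi (2 powi (- j) *\<^sub>R \<xi>)) \<longlongrightarrow> 1) (finite_subsets_at_top UNIV)"
    by (simp add: has_sum_def)
  \<comment> \<open>Unconditional summability over the integers, restricted to the symmetric intervals.\<close>
  have "filterlim (\<lambda>n::nat. {- int n..<int n}) (finite_subsets_at_top UNIV) sequentially"
    unfolding filterlim_finite_subsets_at_top
  proof (intro allI impI)
    fix X :: "int set" assume "finite X \<and> X \<subseteq> UNIV"
    then have fX: "finite X" by simp
    define n0 where "n0 = nat (Max (insert 0 (abs ` X)) + 1)"
    have n0: "\<bar>x\<bar> < int n0" if "x \<in> X" for x
      using Max_ge[of "insert 0 (abs ` X)" "\<bar>x\<bar>"] fX that by (auto simp: n0_def)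
    show "\<forall>\<^sub>F n in sequentially. finite {- int n..<int n} \<and> X \<subseteq> {- int n..<int n} \<and> {- int n..<int n} \<subseteq> UNIV"
    proof (rule eventually_sequentiallyI[of n0])
      fix n assume "n0 \<le> n"
      have "x \<in> {- int n..<int n}" if "x \<in> X" for x
        using n0[OF that] \<open>n0 \<le> n\<close> by auto
      then show "finite {- int n..<int n} \<and> X \<subseteq> {- int n..<int n} \<and> {- int n..<int n} \<subseteq> UNIV"
        by auto
    qed
  qed
  from filterlim_compose[OF lim this]
  have 1: "(\<lambda>n. \<Sum>j\<in>{- int n..<int n}. lp_phi chi (2 powi (- j) *\<^sub>R \<xi>)) \<longlonglongrightarrow> 1" .
  have tel: "(\<Sum>j\<in>{- int n..<int n}. lp_phi chi (2 powi (- j) *\<^sub>R \<xi>)) = chi (2 powi (- int n) *\<^sub>R \<xi>) - chi (2 powi (int n) *\<^sub>R \<xi>)" for n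
  proof -
    have ph: "lp_phi chi (2 powi (- j) *\<^sub>R \<xi>) = chi (2 powi (- (j + 1)) *\<^sub>R \<xi>) - chi (2 powi (- j) *\<^sub>R \<xi>)" for j
      unfolding lp_phi_def half_dyadic_scale ..
    have "(\<Sum>j\<in>{- int n..<int n}. a (j + 1) - a j) = a (int n) - a (- int n)" for a :: "int \<Rightarrow> real"
    proof (induction n)
      case (Suc n)
      have ins: "{- int (Suc n)..<int (Suc n)} = insert (- 1 - int n) (insert (int n) {- int n..<int n})" by auto
      have e: "- 1 - int n + 1 = - int n" "int n + 1 = int (Suc n)" "- 1 - int n = - int (Suc n)" by auto
      have "(\<Sum>j\<in>{- int (Suc n)..<int (Suc n)}. a (j + 1) - a j) = (a (- 1 - int n + 1) - a (- 1 - int n)) + ((a (int n + 1) - a (int n)) + (\<Sum>j\<in>{- int n..<int n}. a (j + 1) - a j))"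
        unfolding ins by (subst sum.insert, simp, simp, subst sum.insert, simp, simp, rule refl)
      then show ?case unfolding Suc e(1,2) unfolding e(3) by linarith
    qed simp
    from this[of "\<lambda>j. chi (2 powi (- j) *\<^sub>R \<xi>)"] show ?thesis by (simp only: ph minus_minus)
  qed
  have cc: "continuous_on UNIV chi"
    by (intro continuous_at_imp_continuous_on ballI differentiable_imp_continuous_within smooth_differentiable[OF chi_smooth])
  have "(2::real) powi (- int n) = inverse (2 ^ n)" for n
    by (simp only: power_int_minus power_int_of_nat)
  then have "(\<lambda>n. (2::real) powi (- int n)) \<longlonglongrightarrow> 0"
    by (simp only: LIMSEQ_inverse_realpow_zero[of "2::real"] one_less_numeral_iff semiring_norm)
  from tendsto_scaleR[OF this tendsto_const[of \<xi>]]
  have "(\<lambda>n. 2 powi (- int n) *\<^sub>R \<xi>) \<longlonglongrightarrow> 0" by (simp only: scaleR_zero_left)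
  then have lim0: "(\<lambda>n. chi (2 powi (- int n) *\<^sub>R \<xi>)) \<longlonglongrightarrow> chi 0"
    by (rule continuous_on_tendsto_compose[OF cc]) auto
  have ev: "\<forall>\<^sub>F n in sequentially. (\<Sum>j\<in>{- int n..<int n}. lp_phi chi (2 powi (- j) *\<^sub>R \<xi>)) = chi (2 powi (- int n) *\<^sub>R \<xi>)"
  proof (rule eventually_sequentiallyI[of 1])
    fix n :: nat assume "1 \<le> n"
    then have "(2::real) ^ 1 \<le> 2 ^ n" by (intro power_increasing) auto
    then have "4 / 3 < norm (2 powi (int n) *\<^sub>R \<xi>)"
      unfolding norm_scaleR power_int_of_nat n\<xi>(1) by simp
    then show "(\<Sum>j\<in>{- int n..<int n}. lp_phi chi (2 powi (- j) *\<^sub>R \<xi>)) = chi (2 powi (- int n) *\<^sub>R \<xi>)"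
      unfolding tel by (simp add: chi_support)
  qed
  show ?thesis by (rule LIMSEQ_unique[OF iffD2[OF tendsto_cong[OF ev] lim0] 1])
qed

lemma low_cut_apply: "low_cut chi j u \<psi> = u (fourier (\<lambda>\<xi>. low_symbol j \<xi> * inverse_fourier \<psi> \<xi>))"
  by (simp add: low_cut_def fourier_multiplier_apply low_symbol_def)

lemma Delta_apply: "Delta chi j u \<psi> = u (fourier (\<lambda>\<xi>. dyadic_symbol j \<xi> * inverse_fourier \<psi> \<xi>))"
  by (simp add: Delta_def fourier_multiplier_apply dyadic_symbol_def)

lemma represented_by_low_cut: "tempered u \<Longrightarrow> represented_by (low_cut chi j u) (tconv u (Ker (low_symbol j)))"
  by (rule represented_by_fourier_multiplier[of u "\<lambda>\<xi>. chi (2 powi (- j) *\<^sub>R \<xi>)", folded low_symbol_def low_cut_def, OF _ schwartz_low_symbol])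

lemma represented_by_Delta: "tempered u \<Longrightarrow> represented_by (Delta chi j u) (tconv u (Ker (dyadic_symbol j)))"
  by (rule represented_by_fourier_multiplier[of u "\<lambda>\<xi>. lp_phi chi (2 powi (- j) *\<^sub>R \<xi>)", folded dyadic_symbol_def Delta_def, OF _ schwartz_dyadic_symbol])

lemma schwartz_multiplier:
  fixes m \<psi> :: "real^'d \<Rightarrow> complex"
  shows "m \<in> schwartz \<Longrightarrow> \<psi> \<in> schwartz \<Longrightarrow> fourier (\<lambda>\<xi>. m \<xi> * inverse_fourier \<psi> \<xi>) \<in> schwartz"
  by (intro schwartz_fourier schwartz_mult schwartz_inverse_fourier)

text \<open>A rescaled translate of \<open>chi\<close> serves as a nonnegative bump at a point where \<open>f\<close> does not vanish.\<close>

lemma continuous_zero_if_orthogonal: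
  fixes f :: "real^'d \<Rightarrow> complex"
  assumes c: "continuous_on UNIV f"
    and f: "\<And>\<psi>. \<psi> \<in> schwartz \<Longrightarrow> integrable lborel (\<lambda>x. f x * \<psi> x) \<and> (LINT x|lborel. f x * \<psi> x) = 0"
  shows "f x0 = 0"
proof (rule ccontr)
  assume nz: "f x0 \<noteq> 0"
  define F where "F = (\<lambda>x. Re (cnj (f x0) * f x))"
  have cF: "continuous_on UNIV F" unfolding F_def by (intro continuous_intros c)
  have F0: "0 < F x0" using nz by (simp add: F_def complex_neq_0 flip: power2_eq_square)
  then obtain \<delta> where \<delta>: "0 < \<delta>" "\<And>x. dist x x0 < \<delta> \<Longrightarrow> dist (F x) (F x0) < F x0"
    using cF[unfolded continuous_on_iff, rule_format, of x0 "F x0"] by auto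
  define \<beta> where "\<beta> = (\<lambda>x. chi ((2 / \<delta>) *\<^sub>R x + - ((2 / \<delta>) *\<^sub>R x0)))"
  have \<beta>S: "(\<lambda>x. complex_of_real (\<beta> x)) \<in> schwartz"
    unfolding \<beta>_def using \<delta>(1) by (intro schwartz_affine[OF schwartz_chi]) simp
  have \<beta>0: "\<beta> x0 = 1" by (simp add: \<beta>_def chi_0)
  have nonneg: "0 \<le> F x * \<beta> x" for x
  proof (cases "dist x x0 < \<delta>")
    case True
    then have "0 < F x" using \<delta>(2)[OF True] F0 by (simp add: dist_real_def abs_less_iff)
    then show ?thesis by (simp add: \<beta>_def chi_nonneg)
  next
    case False
    have "(2 / \<delta>) *\<^sub>R x + - ((2 / \<delta>) *\<^sub>R x0) = (2 / \<delta>) *\<^sub>R (x - x0)" by (simp add: scaleR_diff_right)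
    then have "norm ((2 / \<delta>) *\<^sub>R x + - ((2 / \<delta>) *\<^sub>R x0)) = 2 / \<delta> * dist x x0" using \<delta>(1) by (simp add: dist_norm)
    moreover have "2 / \<delta> * \<delta> \<le> 2 / \<delta> * dist x x0" using False \<delta>(1) by (intro mult_left_mono) auto
    ultimately have "4 / 3 < norm ((2 / \<delta>) *\<^sub>R x + - ((2 / \<delta>) *\<^sub>R x0))" using \<delta>(1) by simp
    then show ?thesis by (simp add: \<beta>_def chi_support)
  qed
  note f\<beta> = f[OF \<beta>S]
  have eq: "F x * \<beta> x = Re (cnj (f x0) * (f x * complex_of_real (\<beta> x)))" for x
    by (simp add: F_def algebra_simps)
  have int: "integrable lborel (\<lambda>x. F x * \<beta> x)"
    unfolding eq using f\<beta> by (intro integrable_Re integrable_mult_right) auto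
  have "(LINT x|lborel. F x * \<beta> x) = Re (LINT x|lborel. cnj (f x0) * (f x * complex_of_real (\<beta> x)))"
    unfolding eq using f\<beta> by (intro integral_Re integrable_mult_right) auto
  also have "\<dots> = 0" using f\<beta> by simp
  finally have i0: "(LINT x|lborel. F x * \<beta> x) = 0" .
  have op: "open {x. F x * \<beta> x \<noteq> 0}"
  proof -
    have "continuous_on UNIV \<beta>"
      using continuous_on_Re[OF schwartz_continuous[OF \<beta>S, of UNIV]] by simp
    then have "continuous_on UNIV (\<lambda>x. F x * \<beta> x)" by (intro continuous_intros cF)
    then show ?thesis by (intro open_Collect_neq) auto
  qed
  have ae: "AE x in lborel. F x * \<beta> x = 0"
    using integral_nonneg_eq_0_iff_AE[OF int] nonneg i0 by simp
  have "{x \<in> space lborel. \<not> F x * \<beta> x = 0} \<in> sets lborel" using borel_open[OF op] by simp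
  from iffD1[OF AE_iff_null[OF this] ae] have "{x \<in> space lborel. \<not> F x * \<beta> x = 0} \<in> null_sets lborel" .
  then have "{x. F x * \<beta> x \<noteq> 0} \<in> null_sets lborel" by simp
  then have "negligible {x. F x * \<beta> x \<noteq> 0}"
    by (simp add: negligible_iff_null_sets null_sets_completionI)
  then have "{x. F x * \<beta> x \<noteq> 0} = {}" using open_not_negligible[OF op] by blast
  then have "F x0 * \<beta> x0 = 0" by blast
  then show False using F0 \<beta>0 by simp
qed

lemma represented_by_unique:
  fixes g h :: "real^'d \<Rightarrow> complex"
  assumes g: "represented_by u g" and h: "represented_by u h"
  shows "g = h"
proof
  fix x0
  have "g x0 - h x0 = 0"
  proof (rule continuous_zero_if_orthogonal[of "\<lambda>x. g x - h x"])
    show "continuous_on UNIV (\<lambda>x. g x - h x)"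
      using g h unfolding represented_by_def by (intro continuous_intros) auto
    fix \<psi> :: "real^'d \<Rightarrow> complex" assume "\<psi> \<in> schwartz"
    then show "integrable lborel (\<lambda>x. (g x - h x) * \<psi> x) \<and> (LINT x|lborel. (g x - h x) * \<psi> x) = 0"
      using g h unfolding represented_by_def distr_of_fun_def by (simp add: left_diff_distrib)
  qed
  then show "g x0 = h x0" by simp
qed

lemma fun_of_distr_eq:
  fixes g :: "real^'d \<Rightarrow> complex"
  assumes "represented_by u g" shows "fun_of_distr u = g"
  unfolding fun_of_distr_def using assms by (intro the_equality) (auto intro: represented_by_unique)

lemma represented_by_cong:
  fixes g :: "real^'d \<Rightarrow> complex"
  assumes "represented_by u g" "\<And>\<psi>. \<psi> \<in> schwartz \<Longrightarrow> v \<psi> = u \<psi>"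
  shows "represented_by v g"
  using assms unfolding represented_by_def by auto

text \<open>The integral of a kernel is the value of its symbol at the origin.\<close>

lemma Ker_chi_integral: "(LINT x|lborel. Ker (\<lambda>\<xi>. complex_of_real (chi \<xi>)) x) = 1"
proof -
  have "(LINT x|lborel. Ker (\<lambda>\<xi>. complex_of_real (chi \<xi>)) x) = inverse_fourier (fourier (\<lambda>\<xi>. complex_of_real (chi \<xi>))) 0"
    unfolding inverse_fourier_def Ker_def by (simp only: integral_mult_right_zero inner_zero_left cis_zero mult_1)
  then show ?thesis by (simp add: inverse_fourier_fourier[OF schwartz_chi] chi_0)
qed

text \<open>\<open>S\<^sub>n \<psi>\<close> tends to \<open>\<psi>\<close> in every Schwartz seminorm. Its derivatives are averages of the derivatives
  of \<open>\<psi>\<close> against the kernel of \<open>chi\<close> at scale \<open>2\<^sup>-\<^sup>n\<close>, which has integral one, so the weighted Lipschitz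
  bound of \<open>\<psi>\<close> gives an error of order \<open>2\<^sup>-\<^sup>n\<close>.\<close>

lemma low_cut_tendsto:
  assumes v: "tempered v" and \<psi>: "\<psi> \<in> schwartz"
  shows "(\<lambda>n::nat. low_cut chi (int n) v \<psi>) \<longlonglongrightarrow> v \<psi>"
proof -
  obtain C N where C: "0 \<le> C"
    "\<And>\<psi> B. \<psi> \<in> schwartz \<Longrightarrow>
       (\<And>x is. length is \<le> N \<Longrightarrow> (1 + norm x) ^ N * norm (iterated_partial is \<psi> x) \<le> B) \<Longrightarrow> norm (v \<psi>) \<le> C * B"
    using tempered_bound[OF v] by blast
  define m where "m = (\<lambda>\<xi>. complex_of_real (chi \<xi>))"
  define K where "K = Ker m"
  define e where "e = (\<lambda>n::nat. (1/2::real) ^ n)"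
  have e: "0 < e n" "e n \<le> 1" for n by (auto simp: e_def power_le_one)
  have mS: "m \<in> schwartz" unfolding m_def by (rule schwartz_chi)
  have KS: "K \<in> schwartz" unfolding K_def by (rule schwartz_Ker[OF mS])
  have "(2::real) powi (- int n) = e n" for n
    by (simp only: e_def power_int_minus power_int_of_nat power_one_over inverse_eq_divide)
  then have low_symbol_rescaled: "low_symbol (int n) = (\<lambda>\<xi>. m (e n *\<^sub>R \<xi>))" for n
    by (intro ext) (simp only: low_symbol_def m_def)
  define S where "S = (\<lambda>n. fourier (\<lambda>\<xi>. low_symbol (int n) \<xi> * inverse_fourier \<psi> \<xi>))"
  have SS: "S n \<in> schwartz" for n unfolding S_def by (rule schwartz_multiplier[OF schwartz_low_symbol \<psi>])
  define I where "I = (LINT w|lborel. (1 + norm w) ^ (N + 1) * norm (K w))"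
  obtain L where L: "0 \<le> L" "\<And>is. length (is :: 'd list) \<le> N \<Longrightarrow>
     (\<forall>z h. (1 + norm z) ^ N * norm (iterated_partial is \<psi> (z + h) - iterated_partial is \<psi> z) \<le> L * norm h * (1 + norm h) ^ N)"
  proof (rule uniform_over_lists[where N = N and P = "\<lambda>is L. \<forall>z h. (1 + norm z) ^ N * norm (iterated_partial is \<psi> (z + h) - iterated_partial is \<psi> z) \<le> L * norm h * (1 + norm h) ^ N"])
    fix "is" :: "'d list"
    obtain L where "0 \<le> L" "\<And>z h. (1 + norm z) ^ N * norm (iterated_partial is \<psi> (z + h) - iterated_partial is \<psi> z) \<le> L * norm h * (1 + norm h) ^ N"
      using schwartz_lipschitz[OF schwartz_iterated_partial[OF \<psi>], of N "is"] by blast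
    then show "\<exists>L\<ge>0. \<forall>z h. (1 + norm z) ^ N * norm (iterated_partial is \<psi> (z + h) - iterated_partial is \<psi> z) \<le> L * norm h * (1 + norm h) ^ N"
      by blast
  next
    fix "is" :: "'d list" and L L' :: real
    assume a: "\<forall>z h. (1 + norm z) ^ N * norm (iterated_partial is \<psi> (z + h) - iterated_partial is \<psi> z) \<le> L * norm h * (1 + norm h) ^ N" and "L \<le> L'"
    then have "L * norm h * (1 + norm h) ^ N \<le> L' * norm h * (1 + norm h) ^ N" for h :: "real^'d"
      by (intro mult_right_mono) auto
    then show "\<forall>z h. (1 + norm z) ^ N * norm (iterated_partial is \<psi> (z + h) - iterated_partial is \<psi> z) \<le> L' * norm h * (1 + norm h) ^ N"
      using a order_trans by blast
  qed (rule that)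
  have bound: "norm (v (\<lambda>x. S n x - \<psi> x)) \<le> C * (L * e n * I)" for n
  proof (rule C(2)[OF schwartz_diff[OF SS \<psi>]])
    fix x "is" assume l: "length (is :: 'd list) \<le> N"
    define \<rho> where "\<rho> = iterated_partial is \<psi>"
    have \<rho>: "\<rho> \<in> schwartz" unfolding \<rho>_def by (rule schwartz_iterated_partial[OF \<psi>])
    define \<mu> where "\<mu> = inverse_fourier \<psi>"
    have \<mu>: "\<mu> \<in> schwartz" unfolding \<mu>_def by (rule schwartz_inverse_fourier[OF \<psi>])
    have "\<psi> = fourier \<mu>" unfolding \<mu>_def by (simp add: fourier_inverse_fourier[OF \<psi>])
    then have "\<rho> = fourier (\<lambda>\<xi>. symbol is \<xi> * \<mu> \<xi>)" unfolding \<rho>_def by (simp add: iterated_partial_fourier[OF \<mu>])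
    then have inv: "inverse_fourier \<rho> = (\<lambda>\<xi>. symbol is \<xi> * \<mu> \<xi>)" by (simp add: inverse_fourier_fourier schwartz_symbol \<mu>)
    have "iterated_partial is (S n) = fourier (\<lambda>\<xi>. symbol is \<xi> * (low_symbol (int n) \<xi> * \<mu> \<xi>))"
      unfolding S_def \<mu>_def[symmetric] by (rule iterated_partial_fourier[OF schwartz_mult[OF schwartz_low_symbol \<mu>]])
    also have "(\<lambda>\<xi>. symbol is \<xi> * (low_symbol (int n) \<xi> * \<mu> \<xi>)) = (\<lambda>\<xi>. m (e n *\<^sub>R \<xi>) * inverse_fourier \<rho> \<xi>)"
      by (simp add: inv low_symbol_rescaled mult_ac)
    finally have Sx: "iterated_partial is (S n) x = (LINT w|lborel. \<rho> (x - e n *\<^sub>R w) * K w)"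
      unfolding K_def using multiplier_rescaled[OF schwartz_integrable[OF mS] schwartz_integrable[OF \<rho>] schwartz_measurable[OF KS[unfolded K_def]] e(1)[of n], of x] by simp
    have px: "\<rho> x = (LINT w|lborel. \<rho> x * K w)"
      unfolding integral_mult_right_zero K_def m_def Ker_chi_integral by simp
    have i1: "integrable lborel (\<lambda>w. \<rho> (x - e n *\<^sub>R w) * K w)"
    proof -
      have "(\<lambda>w. \<rho> (x - e n *\<^sub>R w)) = (\<lambda>w. \<rho> ((- e n) *\<^sub>R w + x))" by simp
      also have "\<dots> \<in> schwartz" using e(1)[of n] by (intro schwartz_affine[OF \<rho>]) simp
      finally show ?thesis by (intro schwartz_integrable schwartz_mult KS)
    qed
    have i2: "integrable lborel (\<lambda>w. \<rho> x * K w)" by (intro integrable_mult_right schwartz_integrable KS)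
    have iw: "integrable lborel (\<lambda>w. (1 + norm w) ^ (N + 1) * norm (K w))" by (rule schwartz_integrable_weight[OF KS])
    have "iterated_partial is (\<lambda>x. S n x - \<psi> x) x = (LINT w|lborel. (\<rho> (x - e n *\<^sub>R w) - \<rho> x) * K w)"
      unfolding left_diff_distrib Bochner_Integration.integral_diff[OF i1 i2] px[symmetric] Sx[symmetric]
      by (simp add: iterated_partial_diff[OF SS \<psi>] \<rho>_def)
    also have "norm \<dots> \<le> (LINT w|lborel. L * e n / (1 + norm x) ^ N * ((1 + norm w) ^ (N + 1) * norm (K w)))"
    proof (rule Bochner_Integration.integral_norm_bound_integral)
      show "integrable lborel (\<lambda>w. (\<rho> (x - e n *\<^sub>R w) - \<rho> x) * K w)"
        unfolding left_diff_distrib by (rule Bochner_Integration.integrable_diff[OF i1 i2])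
      show "integrable lborel (\<lambda>w. L * e n / (1 + norm x) ^ N * ((1 + norm w) ^ (N + 1) * norm (K w)))"
        by (rule integrable_mult_right[OF iw])
      fix w
      have pos: "0 < (1 + norm x) ^ N" by (intro zero_less_power) (simp add: add_pos_nonneg)
      have "(1 + norm x) ^ N * norm (\<rho> (x + - (e n *\<^sub>R w)) - \<rho> x) \<le> L * norm (- (e n *\<^sub>R w)) * (1 + norm (- (e n *\<^sub>R w))) ^ N"
        unfolding \<rho>_def by (rule L(2)[OF l, rule_format])
      also have "\<dots> = L * e n * norm w * (1 + e n * norm w) ^ N" using e(1)[of n] by simp
      also have "\<dots> \<le> L * e n * (1 + norm w) * (1 + norm w) ^ N"
        using e[of n] L(1) by (intro mult_mono power_mono mult_left_mono) (auto simp: mult_left_le_one_le)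
      finally have "norm (\<rho> (x - e n *\<^sub>R w) - \<rho> x) \<le> L * e n * (1 + norm w) ^ (N + 1) / (1 + norm x) ^ N"
        using pos by (simp add: pos_le_divide_eq mult_ac)
      then have "norm (\<rho> (x - e n *\<^sub>R w) - \<rho> x) * norm (K w) \<le> L * e n * (1 + norm w) ^ (N + 1) / (1 + norm x) ^ N * norm (K w)"
        by (intro mult_right_mono) auto
      then show "norm ((\<rho> (x - e n *\<^sub>R w) - \<rho> x) * K w) \<le> L * e n / (1 + norm x) ^ N * ((1 + norm w) ^ (N + 1) * norm (K w))"
        by (simp add: norm_mult)
    qed
    also have "\<dots> = L * e n / (1 + norm x) ^ N * I" unfolding I_def by (rule integral_mult_right_zero)
    finally have "norm (iterated_partial is (\<lambda>x. S n x - \<psi> x) x) \<le> L * e n / (1 + norm x) ^ N * I" .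
    moreover have "0 < (1 + norm x) ^ N" by (intro zero_less_power) (simp add: add_pos_nonneg)
    ultimately show "(1 + norm x) ^ N * norm (iterated_partial is (\<lambda>x. S n x - \<psi> x) x) \<le> L * e n * I"
      by (simp add: pos_le_divide_eq mult.commute)
  qed
  have "(\<lambda>n. low_cut chi (int n) v \<psi> - v \<psi>) \<longlonglongrightarrow> 0"
  proof (rule Lim_null_comparison)
    show "\<forall>\<^sub>F n in sequentially. norm (low_cut chi (int n) v \<psi> - v \<psi>) \<le> C * (L * e n * I)"
      unfolding low_cut_apply
      by (intro always_eventually allI) (rule bound[unfolded tempered_diff[OF v SS \<psi>], unfolded S_def])
    have "e \<longlonglongrightarrow> 0" unfolding e_def by (rule LIMSEQ_power_zero) simp
    then show "(\<lambda>n. C * (L * e n * I)) \<longlonglongrightarrow> 0" by (auto intro!: tendsto_eq_intros)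
  qed
  then show ?thesis by (rule LIM_zero_cancel)
qed

end

section \<open>Polynomials and spectral supports\<close>

text \<open>Grouping a polynomial by powers of the scaling parameter; it makes the integration along
  rays in the next lemma explicit.\<close>

lemma real_polynomial_along_rays:
  assumes "real_polynomial_function P"
  shows "\<exists>L. (\<forall>(k, c) \<in> set L. real_polynomial_function c) \<and> (\<forall>t x. P (t *\<^sub>R x) = (\<Sum>(k, c)\<leftarrow>L. t ^ k * c x))"
  using assms
proof induction
  case (linear f)
  have "f (t *\<^sub>R x) = t * f x" for t x
    using linear_scale[OF bounded_linear.linear[OF linear], of t x] by simp
  then show ?case using real_polynomial_function.intros(1)[OF linear] by (intro exI[of _ "[(1, f)]"]) auto
next
  case (const c)
  then show ?case by (intro exI[of _ "[(0, \<lambda>x. c)]"]) auto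
next
  case (add f g)
  then obtain L M where "\<forall>(k, c) \<in> set L. real_polynomial_function c" "\<And>t x. f (t *\<^sub>R x) = (\<Sum>(k, c)\<leftarrow>L. t ^ k * c x)"
    "\<forall>(k, c) \<in> set M. real_polynomial_function c" "\<And>t x. g (t *\<^sub>R x) = (\<Sum>(k, c)\<leftarrow>M. t ^ k * c x)" by auto
  then show ?case by (intro exI[of _ "L @ M"]) auto
next
  case (mult f g)
  obtain L where L': "\<forall>(k, c) \<in> set L. real_polynomial_function c" "\<forall>t x. f (t *\<^sub>R x) = (\<Sum>(k, c)\<leftarrow>L. t ^ k * c x)"
    using mult.IH(1) by blast
  obtain M where M': "\<forall>(k, c) \<in> set M. real_polynomial_function c" "\<forall>t x. g (t *\<^sub>R x) = (\<Sum>(k, c)\<leftarrow>M. t ^ k * c x)"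
    using mult.IH(2) by blast
  have L: "\<And>k c. (k, c) \<in> set L \<Longrightarrow> real_polynomial_function c" "\<And>t x. f (t *\<^sub>R x) = (\<Sum>(k, c)\<leftarrow>L. t ^ k * c x)"
    and M: "\<And>k c. (k, c) \<in> set M \<Longrightarrow> real_polynomial_function c" "\<And>t x. g (t *\<^sub>R x) = (\<Sum>(k, c)\<leftarrow>M. t ^ k * c x)"
    using L' M' by blast+
  define Q where "Q = concat (map (\<lambda>(k, c). map (\<lambda>(l, d). (k + l, \<lambda>x. c x * d x)) M) L)"
  have "(\<Sum>(k, c)\<leftarrow>Q. t ^ k * c x) = (\<Sum>(k, c)\<leftarrow>L. t ^ k * c x) * (\<Sum>(k, c)\<leftarrow>M. t ^ k * c x)" for t x
  proof -
    have "(\<Sum>(l, d)\<leftarrow>map (\<lambda>(l, d). (k + l, \<lambda>x. c x * d x)) M. t ^ l * d x) = t ^ k * c x * (\<Sum>(l, d)\<leftarrow>M. t ^ l * d x)" for k c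
      by (induction M) (auto simp: algebra_simps power_add)
    then show ?thesis unfolding Q_def by (induction L) (auto simp: distrib_right)
  qed
  then have "f (t *\<^sub>R x) * g (t *\<^sub>R x) = (\<Sum>(k, c)\<leftarrow>Q. t ^ k * c x)" for t x by (simp add: L(2) M(2))
  moreover have "\<forall>(k, c) \<in> set Q. real_polynomial_function c"
    unfolding Q_def using L(1) M(1) by (auto intro!: real_polynomial_function.intros(4))
  ultimately show ?case by blast
qed

lemma real_polynomial_sum_list:
  "(\<And>a. a \<in> set xs \<Longrightarrow> real_polynomial_function (f a)) \<Longrightarrow> real_polynomial_function (\<lambda>x. \<Sum>a\<leftarrow>xs. f a x)"
  by (induction xs) (auto intro: real_polynomial_function.intros)

lemma real_polynomial_nth: "real_polynomial_function (\<lambda>x::real^'d::finite. x $ i)"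
  by (rule real_polynomial_function.intros(1)) (rule bounded_linear_vec_nth)

text \<open>Integrate the gradient along the rays from the origin. Along a ray each component of the gradient is a
  polynomial in the parameter whose coefficients depend polynomially on the direction, and so is its primitive.\<close>

lemma polynomial_if_gradient_polynomial:
  fixes g :: "real^'d::finite \<Rightarrow> real"
  assumes g: "\<And>x. (g has_derivative (\<lambda>h. \<Sum>i\<in>UNIV. h $ i * p i x)) (at x)"
    and p: "\<And>i. real_polynomial_function (p i)"
  shows "real_polynomial_function g"
proof -
  have "\<forall>i. \<exists>L. (\<forall>(k, c) \<in> set L. real_polynomial_function c) \<and> (\<forall>t x. p i (t *\<^sub>R x) = (\<Sum>(k, c)\<leftarrow>L. t ^ k * c x))"
    using real_polynomial_along_rays[OF p] by blast
  from choice[OF this] obtain L where L': "\<forall>i. (\<forall>(k, c) \<in> set (L i). real_polynomial_function c) \<and> (\<forall>t x. p i (t *\<^sub>R x) = (\<Sum>(k, c)\<leftarrow>L i. t ^ k * c x))" ..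
  have L: "\<And>i k c. (k, c) \<in> set (L i) \<Longrightarrow> real_polynomial_function c"
    "\<And>i t x. p i (t *\<^sub>R x) = (\<Sum>(k, c)\<leftarrow>L i. t ^ k * c x)" using L' by blast+
  \<comment> \<open>The primitive, in the parameter \<open>t\<close>, of the derivative of \<open>g\<close> along the ray through \<open>x\<close>.\<close>
  define R where "R = (\<lambda>x t. \<Sum>i\<in>UNIV. x $ i * (\<Sum>(k, c)\<leftarrow>L i. t ^ Suc k / Suc k * c x))"
  have dl: "((\<lambda>t. \<Sum>(k, c)\<leftarrow>M. t ^ Suc k / Suc k * c x) has_real_derivative (\<Sum>(k, c)\<leftarrow>M. t ^ k * c x)) (at t)"
    for M :: "(nat \<times> (real^'d \<Rightarrow> real)) list" and x t
  proof (induction M)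
    case (Cons a M)
    obtain k c where a: "a = (k, c)" by (cases a)
    have "((\<lambda>t. t ^ Suc k / Suc k * c x) has_real_derivative (t ^ k * c x)) (at t)"
      by (rule derivative_eq_intros refl | simp)+
    from DERIV_add[OF this Cons.IH] show ?case by (simp add: a)
  qed simp
  have dR: "(R x has_real_derivative (\<Sum>i\<in>UNIV. x $ i * p i (t *\<^sub>R x))) (at t)" for x t
    unfolding R_def L(2) by (intro DERIV_sum DERIV_cmult dl)
  have dg: "((\<lambda>t. g (t *\<^sub>R x)) has_real_derivative (\<Sum>i\<in>UNIV. x $ i * p i (t *\<^sub>R x))) (at t)" for x t
  proof -
    have "((\<lambda>t. t *\<^sub>R x) has_derivative (\<lambda>s. s *\<^sub>R x)) (at t)" by (auto intro!: derivative_eq_intros)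
    from has_derivative_compose[OF this g]
    have "((\<lambda>t. g (t *\<^sub>R x)) has_derivative (\<lambda>s. \<Sum>i\<in>UNIV. (s *\<^sub>R x) $ i * p i (t *\<^sub>R x))) (at t)" .
    also have "(\<lambda>s. \<Sum>i\<in>UNIV. (s *\<^sub>R x) $ i * p i (t *\<^sub>R x)) = (\<lambda>s. (\<Sum>i\<in>UNIV. x $ i * p i (t *\<^sub>R x)) * s)"
      by (rule ext) (simp add: sum_distrib_left mult_ac)
    finally show ?thesis by (simp add: has_field_derivative_def)
  qed
  have "g x = g 0 + R x 1" for x
  proof -
    have "((\<lambda>t. g (t *\<^sub>R x) - R x t) has_real_derivative 0) (at t)" for t
      using DERIV_diff[OF dg[of x t] dR[of x t]] by simp
    then have "(\<lambda>t. g (t *\<^sub>R x) - R x t) 1 = (\<lambda>t. g (t *\<^sub>R x) - R x t) 0"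
      by (intro DERIV_isconst_all) blast
    moreover have "R x 0 = 0" by (simp add: R_def case_prod_unfold)
    ultimately show ?thesis by simp
  qed
  then have "g = (\<lambda>x. g 0 + R x 1)" by (rule ext)
  moreover have "real_polynomial_function (\<lambda>x. g 0 + R x 1)"
  proof (rule real_polynomial_function.intros(3)[OF real_polynomial_function.intros(2)])
    have "real_polynomial_function (\<lambda>x. \<Sum>a\<leftarrow>L i. (case a of (k, c) \<Rightarrow> 1 ^ Suc k / Suc k * c x))" for i
    proof (rule real_polynomial_sum_list)
      fix a assume a: "a \<in> set (L i)"
      obtain k c where kc: "a = (k, c)" by (cases a)
      have "real_polynomial_function c" by (rule L(1)[OF a[unfolded kc]])
      with kc show "real_polynomial_function (\<lambda>x. case a of (k, c) \<Rightarrow> 1 ^ Suc k / Suc k * c x)"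
        using real_polynomial_function.intros(4)[OF real_polynomial_function.intros(2)[of "1 ^ Suc k / Suc k"]] by simp
    qed
    from real_polynomial_function.intros(4)[OF real_polynomial_nth this]
    show "real_polynomial_function (\<lambda>x. R x 1)"
      unfolding R_def by (intro real_polynomial_function_sum) auto
  qed
  ultimately show ?thesis by simp
qed

lemma polynomial_if_high_partials_vanish:
  fixes G :: "real^'d::finite \<Rightarrow> complex"
  assumes "\<And>is x. iterated_partial is G differentiable (at x)"
    and "\<And>is. length is = N \<Longrightarrow> iterated_partial is G = (\<lambda>x. 0)"
  shows "polynomial_function G"
  using assms
proof (induction N arbitrary: G)
  case 0
  then have "G = (\<lambda>x. 0)" using 0(2)[of "[]"] by simp
  then show ?case by simp
next
  case (Suc N)
  have part: "iterated_partial is (partial i G) = iterated_partial (is @ [i]) G" for "is" i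
    by (simp add: iterated_partial_append)
  have pi: "polynomial_function (partial i G)" for i
    by (rule Suc.IH) (simp_all only: part Suc.prems(1), simp add: Suc.prems(2))
  have d: "(G has_derivative (\<lambda>h. \<Sum>i\<in>UNIV. (h $ i) *\<^sub>R partial i G x)) (at x)" for x
    using Suc.prems(1)[of "[]"] by (intro has_derivative_partial) simp
  show ?case unfolding polynomial_function_def
  proof (intro allI impI)
    fix f :: "complex \<Rightarrow> real" assume f: "bounded_linear f"
    have lin: "linear f" by (rule bounded_linear.linear[OF f])
    have "((\<lambda>x. f (G x)) has_derivative (\<lambda>h. f (\<Sum>i\<in>UNIV. (h $ i) *\<^sub>R partial i G x))) (at x)" for x
      by (rule bounded_linear.has_derivative[OF f d])
    also have "(\<lambda>h. f (\<Sum>i\<in>UNIV. (h $ i) *\<^sub>R partial i G x)) = (\<lambda>h. \<Sum>i\<in>UNIV. h $ i * f (partial i G x))" for x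
      by (simp add: linear_sum[OF lin] linear_scale[OF lin])
    finally have "((\<lambda>x. f (G x)) has_derivative (\<lambda>h. \<Sum>i\<in>UNIV. h $ i * f (partial i G x))) (at x)" for x .
    moreover have "real_polynomial_function (\<lambda>x. f (partial i G x))" for i
      using pi[of i] f unfolding polynomial_function_def o_def by blast
    ultimately show "real_polynomial_function (f \<circ> G)"
      unfolding o_def by (rule polynomial_if_gradient_polynomial)
  qed
qed

lemma iterated_partial_tconv:
  assumes "tempered v" "\<kappa> \<in> schwartz"
  shows "iterated_partial is (tconv v \<kappa>) = tconv v (\<lambda>x. (-1) ^ length is * iterated_partial is \<kappa> x)"
proof (induction "is")
  case (Cons i "is")
  have s: "(\<lambda>x. (-1) ^ length is * iterated_partial is \<kappa> x) \<in> schwartz"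
    by (intro schwartz_cmult schwartz_iterated_partial assms)
  have "partial i (\<lambda>x. (-1) ^ length is * iterated_partial is \<kappa> x) = (\<lambda>x. (-1) ^ length is * partial i (iterated_partial is \<kappa>) x)"
    by (intro ext partial_cmult schwartz_differentiable schwartz_iterated_partial assms)
  then show ?case by (simp add: Cons partial_tconv[OF assms(1) s])
qed simp

text \<open>Multiplication by a coordinate is a derivative on the Fourier side, and derivatives of a function that vanishes near the origin
  vanish there, too.\<close>

lemma polynomial_mult_fourier:
  fixes p :: "real^'d::finite \<Rightarrow> real"
  assumes "real_polynomial_function p"
  shows "\<eta> \<in> schwartz \<Longrightarrow> (\<And>\<xi>. norm \<xi> < r \<Longrightarrow> \<eta> \<xi> = 0) \<Longrightarrow>
    \<exists>\<eta>'\<in>schwartz. (\<forall>\<xi>. norm \<xi> < r \<longrightarrow> \<eta>' \<xi> = 0) \<and> (\<forall>x. complex_of_real (p x) * fourier \<eta> x = fourier \<eta>' x)"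
  using assms
proof (induction p arbitrary: \<eta>)
  case (linear f)
  have p0: "partial i \<eta> \<xi> = 0" if "norm \<xi> < r" for i \<xi>
  proof -
    have "((\<lambda>x. 0) has_derivative (\<lambda>h. 0 :: complex)) (at \<xi>)" by simp
    then have "(\<eta> has_derivative (\<lambda>h. 0)) (at \<xi>)"
      by (rule has_derivative_transform_within_open[where s = "ball 0 r"])
         (use that linear.prems(2) in auto)
    from partial_eqI[OF this] show ?thesis .
  qed
  define \<eta>' where "\<eta>' = (\<lambda>\<xi>. \<Sum>i\<in>UNIV. (complex_of_real (f (axis i 1)) * - \<i>) * partial i \<eta> \<xi>)"
  have s: "(\<lambda>\<xi>. (complex_of_real (f (axis i 1)) * - \<i>) * partial i \<eta> \<xi>) \<in> schwartz" for i
    by (intro schwartz_cmult schwartz_partial linear.prems(1))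
  have "\<eta>' \<in> schwartz" unfolding \<eta>'_def by (intro schwartz_sum s) auto
  moreover have "\<eta>' \<xi> = 0" if "norm \<xi> < r" for \<xi> by (simp add: \<eta>'_def p0 that)
  moreover have "complex_of_real (f x) * fourier \<eta> x = fourier \<eta>' x" for x
  proof -
    have "f x = f (\<Sum>i\<in>UNIV. (x $ i) *\<^sub>R axis i 1)"
      by (simp add: basis_expansion scalar_mult_eq_scaleR[symmetric])
    also have "\<dots> = (\<Sum>i\<in>UNIV. x $ i * f (axis i 1))"
      using bounded_linear.linear[OF linear.hyps] by (simp add: linear_sum linear_scale)
    finally have fx: "f x = (\<Sum>i\<in>UNIV. x $ i * f (axis i 1))" .
    have "fourier \<eta>' x = (\<Sum>i\<in>UNIV. (LINT \<xi>|lborel. cis (- (\<xi> \<bullet> x)) * ((complex_of_real (f (axis i 1)) * - \<i>) * partial i \<eta> \<xi>)))"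
      unfolding fourier_def \<eta>'_def sum_distrib_left
      by (rule Bochner_Integration.integral_sum) (intro integrable_cis_mult schwartz_integrable s)
    also have "\<dots> = (\<Sum>i\<in>UNIV. (complex_of_real (f (axis i 1)) * - \<i>) * fourier (partial i \<eta>) x)"
      by (intro sum.cong refl) (rule fourier_cmult[unfolded fourier_def[of "\<lambda>x. _ * _ x"]])
    also have "\<dots> = (\<Sum>i\<in>UNIV. complex_of_real (x $ i * f (axis i 1)) * fourier \<eta> x)"
    proof (intro sum.cong refl)
      fix i
      have "(a * - \<i>) * (\<i> * b * F) = (b * a) * F" for a b F :: complex using i_squared by algebra
      then show "(complex_of_real (f (axis i 1)) * - \<i>) * fourier (partial i \<eta>) x = complex_of_real (x $ i * f (axis i 1)) * fourier \<eta> x"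
        unfolding fourier_of_partial[OF linear.prems(1)] of_real_mult .
    qed
    finally show ?thesis by (simp only: fx of_real_sum sum_distrib_right)
  qed
  ultimately show ?case by blast
next
  case (const c)
  then show ?case by (intro bexI[of _ "\<lambda>x. complex_of_real c * \<eta> x"]) (auto simp: fourier_cmult schwartz_cmult)
next
  case (add f g)
  obtain \<eta>1 where 1: "\<eta>1 \<in> schwartz" "\<And>\<xi>. norm \<xi> < r \<Longrightarrow> \<eta>1 \<xi> = 0" "\<And>x. complex_of_real (f x) * fourier \<eta> x = fourier \<eta>1 x"
    using add.IH(1)[OF add.prems] by auto
  obtain \<eta>2 where 2: "\<eta>2 \<in> schwartz" "\<And>\<xi>. norm \<xi> < r \<Longrightarrow> \<eta>2 \<xi> = 0" "\<And>x. complex_of_real (g x) * fourier \<eta> x = fourier \<eta>2 x"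
    using add.IH(2)[OF add.prems] by auto
  show ?case
  proof (intro bexI[of _ "\<lambda>x. \<eta>1 x + \<eta>2 x"] conjI allI impI)
    show "(\<lambda>x. \<eta>1 x + \<eta>2 x) \<in> schwartz" by (rule schwartz_add[OF 1(1) 2(1)])
    fix x show "complex_of_real (f x + g x) * fourier \<eta> x = fourier (\<lambda>x. \<eta>1 x + \<eta>2 x) x"
      by (simp add: fourier_add schwartz_integrable 1 2 distrib_right)
  qed (simp add: 1 2)
next
  case (mult f g)
  obtain \<eta>1 where 1: "\<eta>1 \<in> schwartz" "\<And>\<xi>. norm \<xi> < r \<Longrightarrow> \<eta>1 \<xi> = 0" "\<And>x. complex_of_real (g x) * fourier \<eta> x = fourier \<eta>1 x"
    using mult.IH(2)[OF mult.prems] by auto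
  obtain \<eta>2 where 2: "\<eta>2 \<in> schwartz" "\<And>\<xi>. norm \<xi> < r \<Longrightarrow> \<eta>2 \<xi> = 0" "\<And>x. complex_of_real (f x) * fourier \<eta>1 x = fourier \<eta>2 x"
    using mult.IH(1)[OF 1(1,2)] by auto
  show ?case
    by (rule bexI[OF _ 2(1)]) (simp add: 2 1(3)[symmetric] 2(3)[symmetric] mult.assoc)
qed

lemma integral_fourier: 
  fixes \<eta> :: "real^'d::finite \<Rightarrow> complex"
  assumes "\<eta> \<in> schwartz"
  shows "(LINT x|lborel. fourier \<eta> x) = complex_of_real ((2 * pi) ^ CARD('d)) * \<eta> 0"
proof -
  have "\<eta> 0 = inverse_fourier (fourier \<eta>) 0" by (simp add: inverse_fourier_fourier[OF assms])
  also have "\<dots> = complex_of_real (1 / (2 * pi) ^ CARD('d)) * (LINT x|lborel. fourier \<eta> x)"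
    by (simp add: inverse_fourier_def)
  finally show ?thesis by simp
qed

text \<open>The integral of a Fourier transform is, up to a constant, its value at the origin.\<close>

lemma polynomial_orthogonal:
  fixes P :: "real^'d::finite \<Rightarrow> complex"
  assumes P: "polynomial_function P" and \<eta>: "\<eta> \<in> schwartz" and r: "0 < r" "\<And>\<xi>. norm \<xi> < r \<Longrightarrow> \<eta> \<xi> = 0"
  shows "(LINT x|lborel. P x * fourier \<eta> x) = 0"
proof -
  have "real_polynomial_function (\<lambda>x. Re (P x))" "real_polynomial_function (\<lambda>x. Im (P x))"
    using P bounded_linear_Re bounded_linear_Im unfolding polynomial_function_def o_def by blast+
  note pp = this
  obtain \<eta>1 where 1: "\<eta>1 \<in> schwartz" "\<And>\<xi>. norm \<xi> < r \<Longrightarrow> \<eta>1 \<xi> = 0" "\<And>x. complex_of_real (Re (P x)) * fourier \<eta> x = fourier \<eta>1 x"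
    using polynomial_mult_fourier[where r = r, OF pp(1) \<eta> r(2)] by auto
  obtain \<eta>2 where 2: "\<eta>2 \<in> schwartz" "\<And>\<xi>. norm \<xi> < r \<Longrightarrow> \<eta>2 \<xi> = 0" "\<And>x. complex_of_real (Im (P x)) * fourier \<eta> x = fourier \<eta>2 x"
    using polynomial_mult_fourier[where r = r, OF pp(2) \<eta> r(2)] by auto
  have "P x * fourier \<eta> x = fourier \<eta>1 x + \<i> * fourier \<eta>2 x" for x
  proof -
    have "P x = complex_of_real (Re (P x)) + \<i> * complex_of_real (Im (P x))" by (rule complex_eq)
    then have "P x * fourier \<eta> x = complex_of_real (Re (P x)) * fourier \<eta> x + \<i> * (complex_of_real (Im (P x)) * fourier \<eta> x)"
      by (metis distrib_right mult.assoc)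
    then show ?thesis by (simp only: 1(3) 2(3))
  qed
  then have "(LINT x|lborel. P x * fourier \<eta> x) = (LINT x|lborel. fourier \<eta>1 x) + \<i> * (LINT x|lborel. fourier \<eta>2 x)"
    by (simp add: schwartz_integrable schwartz_fourier 1 2)
  also have "\<dots> = 0" using r(1) by (simp add: integral_fourier 1 2)
  finally show ?thesis .
qed

lemma inverse_fourier_Ker_shift:
  fixes m :: "real^'d::finite \<Rightarrow> complex"
  assumes m: "m \<in> schwartz"
  shows "inverse_fourier (\<lambda>x. Ker m (x - y)) \<zeta> = complex_of_real (1 / (2 * pi) ^ CARD('d)) * (cis (\<zeta> \<bullet> y) * m \<zeta>)"
proof -
  let ?c = "complex_of_real (1 / (2 * pi) ^ CARD('d))"
  have s: "(\<lambda>\<zeta>. ?c * (cis (\<zeta> \<bullet> y) * m \<zeta>)) \<in> schwartz" by (intro schwartz_cmult schwartz_modulate m)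
  have "(\<lambda>x. Ker m (x - y)) = fourier (\<lambda>\<zeta>. ?c * (cis (\<zeta> \<bullet> y) * m \<zeta>))"
  proof
    fix x
    have "cis (- (\<zeta> \<bullet> (x - y))) * m \<zeta> = cis (- (\<zeta> \<bullet> x)) * (cis (\<zeta> \<bullet> y) * m \<zeta>)" for \<zeta>
      by (simp add: inner_diff_right cis_mult mult.assoc[symmetric])
    then have "fourier m (x - y) = fourier (\<lambda>\<zeta>. cis (\<zeta> \<bullet> y) * m \<zeta>) x" unfolding fourier_def by (simp only:)
    then show "Ker m (x - y) = fourier (\<lambda>\<zeta>. ?c * (cis (\<zeta> \<bullet> y) * m \<zeta>)) x"
      by (simp only: Ker_def fourier_cmult)
  qed
  then show ?thesis by (simp only: inverse_fourier_fourier[OF s])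
qed

text \<open>The spectrum of a product lies in the sum of the spectra. Each of the two distributions is moved to the other side by
  \<open>multiplier_representation\<close>. The remaining function is \<open>m1\<close> times an inverse Fourier transform, whose value at \<open>\<xi>\<close> is
  an integral against \<open>tconv v (Ker m2)\<close> of a modulated kernel; the modulation shifts the symbol \<open>m3\<close> by \<open>\<xi>\<close>.\<close>

lemma spectral_product_vanishes:
  fixes u v :: "'d::finite functional" and m1 m2 m3 :: "real^'d \<Rightarrow> complex"
  assumes u: "tempered u" and v: "tempered v" and m: "m1 \<in> schwartz" "m2 \<in> schwartz" "m3 \<in> schwartz"
    and sep: "\<And>\<xi> \<eta>. m1 \<xi> \<noteq> 0 \<Longrightarrow> m2 \<eta> \<noteq> 0 \<Longrightarrow> m3 (\<xi> + \<eta>) = 0"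
  shows "(LINT x|lborel. (tconv u (Ker m1) x * tconv v (Ker m2) x) * Ker m3 (x - y)) = 0"
proof -
  let ?c = "complex_of_real (1 / (2 * pi) ^ CARD('d))"
  define h where "h = (\<lambda>x. Ker m3 (x - y))"
  have h: "h \<in> schwartz" unfolding h_def by (intro schwartz_shift schwartz_Ker m)
  define g where "g = tconv v (Ker m2)"
  have f0: "fourier (\<lambda>\<eta>::real^'d. 0) = (\<lambda>x. 0)" by (simp add: fourier_def fun_eq_iff)
  have gh: "(\<lambda>x. g x * h x) \<in> schwartz" unfolding g_def by (rule schwartz_tconv_mult[OF v schwartz_Ker[OF m(2)] h])
  have z: "m1 \<xi> * inverse_fourier (\<lambda>x. g x * h x) \<xi> = 0" for \<xi>
  proof (cases "m1 \<xi> = 0")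
    case False
    \<comment> \<open>The inverse Fourier transform of \<open>e\<close> is that of \<open>h\<close>, shifted by \<open>\<xi>\<close>; it is supported where \<open>m3 (\<xi> + \<eta>)\<close> is not zero.\<close>
    define e where "e = (\<lambda>x. cis (x \<bullet> \<xi>) * h x)"
    have e: "e \<in> schwartz" unfolding e_def by (rule schwartz_modulate[OF h])
    have "inverse_fourier e \<eta> = ?c * (cis ((\<xi> + \<eta>) \<bullet> y) * m3 (\<xi> + \<eta>))" for \<eta>
    proof -
      have "inverse_fourier e \<eta> = inverse_fourier h (\<xi> + \<eta>)"
        unfolding inverse_fourier_def e_def mult.assoc[symmetric] cis_mult by (simp add: inner_add_left inner_add_right inner_commute add.commute)
      then show ?thesis unfolding h_def by (simp only: inverse_fourier_Ker_shift[OF m(3)])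
    qed
    then have z2: "m2 \<eta> * inverse_fourier e \<eta> = 0" for \<eta> using sep[OF False, of \<eta>] by auto
    have "v (fourier (\<lambda>\<eta>. m2 \<eta> * inverse_fourier e \<eta>)) = v (\<lambda>x. 0)" by (simp only: z2 f0)
    then have "(LINT x|lborel. g x * e x) = 0"
      unfolding g_def multiplier_representation[OF v m(2) e] by (simp add: tempered_zero[OF v])
    then have "inverse_fourier (\<lambda>x. g x * h x) \<xi> = 0"
      unfolding inverse_fourier_def by (simp add: e_def mult_ac inner_commute)
    then show ?thesis by simp
  qed simp
  have "(LINT x|lborel. tconv u (Ker m1) x * (g x * h x)) = u (fourier (\<lambda>\<xi>. m1 \<xi> * inverse_fourier (\<lambda>x. g x * h x) \<xi>))"
    by (rule multiplier_representation[OF u m(1) gh, symmetric])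
  also have "\<dots> = u (\<lambda>x. 0)" by (simp only: z f0)
  also have "\<dots> = 0" by (rule tempered_zero[OF u])
  finally show ?thesis by (simp add: g_def h_def mult.assoc)
qed

context littlewood_paley begin

text \<open>The symbol of a block vanishes near the origin, where the Fourier transform of a polynomial is supported.\<close>

lemma Delta_poly_equiv:
  assumes "(u, v) \<in> poly_equiv" and \<psi>: "\<psi> \<in> schwartz"
  shows "Delta chi j u \<psi> = Delta chi j v \<psi>"
proof -
  obtain P where P: "polynomial_function P" "represented_by (\<lambda>\<psi>. u \<psi> - v \<psi>) P"
    using assms(1) unfolding poly_equiv_iff by blast
  define \<eta> where "\<eta> = (\<lambda>\<xi>. dyadic_symbol j \<xi> * inverse_fourier \<psi> \<xi>)"
  have \<eta>: "\<eta> \<in> schwartz" unfolding \<eta>_def by (intro schwartz_mult schwartz_dyadic_symbol schwartz_inverse_fourier \<psi>)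
  have r: "0 < (2::real) powi j * (3 / 4)" using powi_pos[of j] by simp
  have "\<eta> \<xi> = 0" if "norm \<xi> < 2 powi j * (3 / 4)" for \<xi>
    using dyadic_symbol_support(1)[of j \<xi>] that by (cases "dyadic_symbol j \<xi> = 0") (auto simp: \<eta>_def)
  from polynomial_orthogonal[OF P(1) \<eta> r this]
  have "distr_of_fun P (fourier \<eta>) = 0" by (simp add: distr_of_fun_def)
  moreover have "u (fourier \<eta>) - v (fourier \<eta>) = distr_of_fun P (fourier \<eta>)"
    using P(2) schwartz_fourier[OF \<eta>] unfolding represented_by_def by blast
  ultimately show ?thesis by (simp add: Delta_apply \<eta>_def)
qed

lemma low_cut_Suc:
  assumes u: "tempered u" and \<psi>: "\<psi> \<in> schwartz"
  shows "low_cut chi (j + 1) u \<psi> = low_cut chi j u \<psi> + Delta chi j u \<psi>"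
proof -
  have "(\<lambda>\<xi>. low_symbol (j + 1) \<xi> * inverse_fourier \<psi> \<xi>) = (\<lambda>\<xi>. low_symbol j \<xi> * inverse_fourier \<psi> \<xi> + dyadic_symbol j \<xi> * inverse_fourier \<psi> \<xi>)"
    by (simp add: dyadic_symbol_eq algebra_simps)
  moreover have "fourier (\<lambda>\<xi>. low_symbol j \<xi> * inverse_fourier \<psi> \<xi> + dyadic_symbol j \<xi> * inverse_fourier \<psi> \<xi>)
     = (\<lambda>x. fourier (\<lambda>\<xi>. low_symbol j \<xi> * inverse_fourier \<psi> \<xi>) x + fourier (\<lambda>\<xi>. dyadic_symbol j \<xi> * inverse_fourier \<psi> \<xi>) x)"
    by (intro ext fourier_add schwartz_integrable schwartz_mult schwartz_low_symbol schwartz_dyadic_symbol schwartz_inverse_fourier \<psi>)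
  ultimately show ?thesis
    unfolding low_cut_apply Delta_apply
    by (simp only: tempered_add[OF u schwartz_multiplier[OF schwartz_low_symbol \<psi>] schwartz_multiplier[OF schwartz_dyadic_symbol \<psi>]])
qed

text \<open>A distribution whose Fourier transform lives at the origin is a polynomial. All low-frequency cut-offs of \<open>v\<close> agree, hence \<open>v\<close> is the
  function \<open>G\<close> that represents each of them. A derivative of order \<open>N\<close> of the cut-off at frequency
  \<open>2\<^sup>-\<^sup>n\<close> gains a factor \<open>2 powr (- n N)\<close> from the derivatives and \<open>2 powr (- n d)\<close> from the normalization of the kernel, but
  loses only \<open>2 powr (n N)\<close> from the weight in the seminorm of order \<open>N\<close> that controls \<open>v\<close>. Letting \<open>n\<close> grow, the
  derivatives of \<open>G\<close> of order \<open>N\<close> vanish.\<close>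

lemma polynomial_if_Delta_vanish:
  assumes v: "tempered v" and D: "\<And>j \<psi>. \<psi> \<in> schwartz \<Longrightarrow> Delta chi j v \<psi> = 0"
  shows "\<exists>P. polynomial_function P \<and> represented_by v P"
proof -
  have step: "low_cut chi (j + 1) v \<psi> = low_cut chi j v \<psi>" if "\<psi> \<in> schwartz" for j \<psi>
    using low_cut_Suc[OF v that] D[OF that] by simp
  have const: "low_cut chi j v \<psi> = low_cut chi 0 v \<psi>" if "\<psi> \<in> schwartz" for j \<psi>
  proof (induction j rule: int_induct[where k = 0])
    case (step1 i) then show ?case using step[OF that, of i] by simp
  next
    case (step2 i) then show ?case using step[OF that, of "i - 1"] by simp
  qed simp
  have vj: "v \<psi> = low_cut chi j v \<psi>" if \<psi>: "\<psi> \<in> schwartz" for j \<psi>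
  proof -
    have "(\<lambda>n::nat. low_cut chi (int n) v \<psi>) = (\<lambda>n. low_cut chi j v \<psi>)"
      by (rule ext) (rule trans[OF const[OF \<psi>] const[OF \<psi>, symmetric]])
    then show ?thesis using low_cut_tendsto[OF v \<psi>] by (simp add: LIMSEQ_const_iff)
  qed
  have rep: "represented_by v (tconv v (Ker (low_symbol j)))" for j
    by (rule represented_by_cong[OF represented_by_low_cut[OF v]]) (rule vj)
  define G where "G = tconv v (Ker (low_symbol 0))"
  have Gj: "G = tconv v (Ker (low_symbol j))" for j
    unfolding G_def by (rule represented_by_unique[OF rep rep])
  define m where "m = (\<lambda>\<xi>. complex_of_real (chi \<xi>))"
  have mS: "m \<in> schwartz" unfolding m_def by (rule schwartz_chi)
  define K where "K = Ker m"
  have KS: "K \<in> schwartz" unfolding K_def by (rule schwartz_Ker[OF mS])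
  obtain C N where C: "0 \<le> C"
    "\<And>\<kappa> B y. \<kappa> \<in> schwartz \<Longrightarrow>
       (\<And>x is. length is \<le> N \<Longrightarrow> (1 + norm x) ^ N * norm (iterated_partial is \<kappa> x) \<le> B) \<Longrightarrow>
       norm (tconv v \<kappa> y) \<le> C * ((1 + norm y) ^ N * B)"
    using tconv_bound[OF v] by blast
  have zero: "iterated_partial is G y = 0" if len: "length is = N" for "is" y
  proof -
    define \<rho> where "\<rho> = iterated_partial is K"
    have \<rho>S: "\<rho> \<in> schwartz" unfolding \<rho>_def by (rule schwartz_iterated_partial[OF KS])
    define B where "B = schwartz_seminorm N \<rho>"
    have bound: "norm (iterated_partial is G y) \<le> C * ((1 + norm y) ^ N * ((1/2) ^ n * B))" for n :: nat
    proof -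
      define s where "s = (1/2::real) ^ n"
      have s: "0 < s" "s \<le> 1" by (auto simp: s_def power_le_one)
      have se: "2 powi (- (- int n)) = 1 / s" by (simp add: s_def power_one_over)
      have "low_symbol (- int n) = (\<lambda>\<xi>. m ((1 / s) *\<^sub>R \<xi>))" unfolding low_symbol_def m_def se ..
      then have "Ker (low_symbol (- int n)) = (\<lambda>x. complex_of_real (s ^ CARD('d)) * K (s *\<^sub>R x))"
        using Ker_rescale[OF schwartz_measurable[OF mS], of "1 / s"] s
        by (intro ext) (simp add: K_def power_one_over)
      also have "\<dots> = (\<lambda>x. complex_of_real (s ^ CARD('d)) * K (s *\<^sub>R x + 0))" by simp
      finally have Ks: "Ker (low_symbol (- int n)) = (\<lambda>x. complex_of_real (s ^ CARD('d)) * K (s *\<^sub>R x + 0))" .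
      have KsS: "(\<lambda>x. K (s *\<^sub>R x + 0)) \<in> schwartz" using s by (intro schwartz_affine[OF KS]) simp
      have part: "iterated_partial js (Ker (low_symbol (- int n))) = (\<lambda>x. complex_of_real (s ^ CARD('d)) * (s ^ length js *\<^sub>R iterated_partial js K (s *\<^sub>R x + 0)))" for js
        unfolding Ks by (simp only: iterated_partial_cmult[OF KsS] iterated_partial_affine[OF KS])
      define \<kappa> where "\<kappa> = (\<lambda>x. (-1) ^ length is * iterated_partial is (Ker (low_symbol (- int n))) x)"
      have \<kappa>S: "\<kappa> \<in> schwartz" unfolding \<kappa>_def by (intro schwartz_cmult schwartz_iterated_partial schwartz_Ker schwartz_low_symbol)
      have "norm (tconv v \<kappa> y) \<le> C * ((1 + norm y) ^ N * (s * B))"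
      proof (rule C(2)[OF \<kappa>S])
        fix x js assume l: "length (js :: 'd list) \<le> N"
        have "iterated_partial js \<kappa> x = (-1) ^ length is * iterated_partial (js @ is) (Ker (low_symbol (- int n))) x"
          unfolding \<kappa>_def iterated_partial_append
          by (subst iterated_partial_cmult) (auto intro!: schwartz_iterated_partial schwartz_Ker schwartz_low_symbol)
        then have "norm (iterated_partial js \<kappa> x) = s ^ CARD('d) * (s ^ (length js + N) * norm (iterated_partial js \<rho> (s *\<^sub>R x)))"
          using s by (simp add: part len norm_mult norm_power \<rho>_def iterated_partial_append)
        moreover have "(1 + norm x) ^ N * s ^ N \<le> (1 + norm (s *\<^sub>R x)) ^ N"
          unfolding power_mult_distrib[symmetric] using s by (intro power_mono) (auto simp: algebra_simps)
        moreover have "(1 + norm (s *\<^sub>R x)) ^ N * norm (iterated_partial js \<rho> (s *\<^sub>R x)) \<le> B"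
          unfolding B_def by (rule schwartz_seminorm_bound[OF \<rho>S l])
        moreover have "s ^ CARD('d) * s ^ length js \<le> s"
        proof -
          have "s ^ (CARD('d) + length js) \<le> s ^ 1"
            using s by (intro power_decreasing) (auto simp: Suc_leI add_pos_nonneg trans_le_add1)
          then show ?thesis by (simp add: power_add)
        qed
        ultimately have "(1 + norm x) ^ N * norm (iterated_partial js \<kappa> x) \<le> s * B"
        proof -
          let ?a = "norm (iterated_partial js \<rho> (s *\<^sub>R x))"
          assume n: "norm (iterated_partial js \<kappa> x) = s ^ CARD('d) * (s ^ (length js + N) * ?a)"
            and w: "(1 + norm x) ^ N * s ^ N \<le> (1 + norm (s *\<^sub>R x)) ^ N"
            and b: "(1 + norm (s *\<^sub>R x)) ^ N * ?a \<le> B" and d: "s ^ CARD('d) * s ^ length js \<le> s"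
          have "(1 + norm x) ^ N * norm (iterated_partial js \<kappa> x) = (s ^ CARD('d) * s ^ length js) * (((1 + norm x) ^ N * s ^ N) * ?a)"
            unfolding n by (simp add: power_add mult_ac)
          also have "\<dots> \<le> s * ((1 + norm (s *\<^sub>R x)) ^ N * ?a)"
            using s by (intro mult_mono d mult_right_mono w) auto
          also have "\<dots> \<le> s * B" using s b by (intro mult_left_mono) auto
          finally show ?thesis .
        qed
        then show "(1 + norm x) ^ N * norm (iterated_partial js \<kappa> x) \<le> s * B" .
      qed
      then show ?thesis
        unfolding Gj[of "- int n"] iterated_partial_tconv[OF v schwartz_Ker[OF schwartz_low_symbol]] \<kappa>_def s_def .
    qed
    have "(\<lambda>n. C * ((1 + norm y) ^ N * ((1/2::real) ^ n * B))) \<longlonglongrightarrow> C * ((1 + norm y) ^ N * (0 * B))"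
      by (intro tendsto_intros LIMSEQ_power_zero) simp
    then have "norm (iterated_partial is G y) \<le> C * ((1 + norm y) ^ N * (0 * B))"
      by (rule LIMSEQ_le_const) (use bound in blast)
    then show ?thesis by simp
  qed
  have "polynomial_function G"
  proof (rule polynomial_if_high_partials_vanish)
    show "iterated_partial is G differentiable (at x)" for "is" x
      unfolding G_def iterated_partial_tconv[OF v schwartz_Ker[OF schwartz_low_symbol]]
      by (intro tconv_differentiable[OF v] schwartz_cmult schwartz_iterated_partial schwartz_Ker schwartz_low_symbol)
    show "iterated_partial is G = (\<lambda>x. 0)" if "length is = N" for "is"
      by (rule ext) (rule zero[OF that])
  qed
  then show ?thesis using rep[of 0] unfolding G_def by blast
qed

end

section \<open>Estimates in Lebesgue spaces\<close>

lemma weighted_young: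
  assumes "1 \<le> p" "0 < t" "0 \<le> u"
  shows "u \<le> (1 / p) * (t powr (1 - p) * u powr p) + (1 - 1 / p) * (t::real)"
proof (cases "u = 0")
  case True
  then show ?thesis using assms by simp
next
  case False
  have "(t powr (1 - p) * u powr p) powr (1 / p) * t powr (1 - 1 / p) \<le> (1 / p) * (t powr (1 - p) * u powr p) + (1 - 1 / p) * t"
    using assms False by (intro Youngs_inequality_0) auto
  also have "(t powr (1 - p) * u powr p) powr (1 / p) * t powr (1 - 1 / p) = u"
    using assms False by (simp add: powr_mult powr_powr powr_add[symmetric] diff_divide_distrib)
  finally show ?thesis .
qed

lemma powr_inverse_cancel: "0 \<le> (x::real) \<Longrightarrow> 1 \<le> p \<Longrightarrow> (x powr (1 / p)) powr p = x"
  by (simp add: powr_powr)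

text \<open>Jensen's inequality for a weight of total mass at most \<open>W\<close>, stated for integrals with values in \<open>[0,\<infinity>]\<close>. It
  is the common source of Young's convolution inequality, of duality with integrable bounded functions and of Minkowski's inequality for series.\<close>

lemma weighted_jensen:
  fixes w u :: "'a \<Rightarrow> real"
  assumes [measurable]: "w \<in> borel_measurable N" "u \<in> borel_measurable N"
    and nn: "\<And>x. 0 \<le> w x" "\<And>x. 0 \<le> u x" and p: "1 \<le> p" and W: "0 < W"
    and w: "(\<integral>\<^sup>+x. ennreal (w x) \<partial>N) \<le> ennreal W" and J: "0 \<le> J" "(\<integral>\<^sup>+x. ennreal (w x * u x powr p) \<partial>N) \<le> ennreal J"
  shows "(\<integral>\<^sup>+x. ennreal (w x * u x) \<partial>N) \<le> ennreal ((W powr (p - 1) * J) powr (1 / p))"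
proof (cases "J = 0")
  case True
  then have "(\<integral>\<^sup>+x. ennreal (w x * u x powr p) \<partial>N) = 0" using J(2) by simp
  then have "AE x in N. ennreal (w x * u x powr p) = 0" by (subst (asm) nn_integral_0_iff_AE) auto
  then have "AE x in N. ennreal (w x * u x) = 0"
  proof eventually_elim
    case (elim x)
    then have "w x * u x powr p \<le> 0" by (simp add: ennreal_eq_0_iff)
    then have "w x * u x powr p = 0" using nn by (intro antisym) auto
    then show ?case by auto
  qed
  then have "(\<integral>\<^sup>+x. ennreal (w x * u x) \<partial>N) = 0" by (subst nn_integral_0_iff_AE) auto
  then show ?thesis by simp
next
  case False
  then have Jp: "0 < J" using J(1) by simp
  \<comment> \<open>The level at which to linearize \<open>u powr p\<close>: the average of \<open>u\<close> in the sense of \<open>L\<^sup>p\<close>.\<close>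
  define A where "A = (J / W) powr (1 / p)"
  have A: "0 < A" using Jp W by (simp add: A_def)
  have Apw: "A powr p = J / W" unfolding A_def using Jp W p by (intro powr_inverse_cancel) auto
  have Ap: "A powr (1 - p) * J = A * W"
  proof -
    have "A powr (1 - p) * (A powr p) = A powr 1" unfolding powr_add[symmetric] by simp
    then have "A powr (1 - p) * (J / W) = A" using A unfolding Apw by simp
    moreover have "A powr (1 - p) * J = (A powr (1 - p) * (J / W)) * W" using W by simp
    ultimately show ?thesis by (simp only:)
  qed
  have AW: "A * W = (W powr (p - 1) * J) powr (1 / p)"
  proof -
    have "W powr p = W powr (p - 1) * W powr 1" unfolding powr_add[symmetric] by simp
    moreover have "(A * W) powr p = (J / W) * W powr p" using A W by (simp only: powr_mult less_imp_le Apw)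
    ultimately have "(A * W) powr p = W powr (p - 1) * J" using W by simp
    moreover have "((A * W) powr p) powr (1 / p) = A * W"
      using p A W by (simp add: powr_powr)
    ultimately show ?thesis by simp
  qed
  define a b where "a = (1 / p) * A powr (1 - p)" and "b = (1 - 1 / p) * A"
  have ab: "0 \<le> a" "0 \<le> b" using p A by (auto simp: a_def b_def)
  have "(\<integral>\<^sup>+x. ennreal (w x * u x) \<partial>N) \<le> (\<integral>\<^sup>+x. ennreal a * ennreal (w x * u x powr p) + ennreal b * ennreal (w x) \<partial>N)"
  proof (intro nn_integral_mono)
    fix x
    have "w x * u x \<le> w x * ((1 / p) * (A powr (1 - p) * u x powr p) + (1 - 1 / p) * A)"
      by (intro mult_left_mono weighted_young p A nn)
    also have "\<dots> = a * (w x * u x powr p) + b * w x"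
      unfolding a_def b_def by (simp only: distrib_left mult_ac)
    finally have "ennreal (w x * u x) \<le> ennreal (a * (w x * u x powr p) + b * w x)"
      by (rule ennreal_leI)
    also have "\<dots> = ennreal a * ennreal (w x * u x powr p) + ennreal b * ennreal (w x)"
      using nn ab by (simp add: ennreal_mult)
    finally show "ennreal (w x * u x) \<le> \<dots>" .
  qed
  also have "\<dots> = ennreal a * (\<integral>\<^sup>+x. ennreal (w x * u x powr p) \<partial>N) + ennreal b * (\<integral>\<^sup>+x. ennreal (w x) \<partial>N)"
    by (subst nn_integral_add, simp, simp, subst nn_integral_cmult, simp, subst nn_integral_cmult, simp, rule refl)
  also have "\<dots> \<le> ennreal a * ennreal J + ennreal b * ennreal W"
    by (intro add_mono mult_left_mono J w) auto
  also have "\<dots> = ennreal (a * J + b * W)"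
    using ab W Jp by (simp add: ennreal_mult)
  also have "a * J + b * W = A * W"
  proof -
    have "a * J = (1 / p) * (A * W)" unfolding a_def by (simp only: mult.assoc Ap)
    moreover have "b * W = A * W - (1 / p) * (A * W)" unfolding b_def by (simp only: left_diff_distrib mult.assoc mult_1)
    ultimately show ?thesis by simp
  qed
  finally show ?thesis by (simp only: AW)
qed

text \<open>An explicit bound for the \<open>L\<^sup>p\<close> norm, with a real number. Unlike \<^const>\<open>Lp_norm\<close> it involves neither roots nor
  extended reals; the two are related by \<open>Lp_le_iff_Lp_norm\<close>.\<close>

definition Lp_le :: "real \<Rightarrow> (real^'d::finite \<Rightarrow> complex) \<Rightarrow> real \<Rightarrow> bool" where
  "Lp_le p f M \<longleftrightarrow> f \<in> borel_measurable borel \<and> 0 \<le> M \<and> (\<integral>\<^sup>+x. ennreal (norm (f x) powr p) \<partial>lborel) \<le> ennreal (M powr p)"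

lemma Lp_leD:
  assumes "Lp_le p f M"
  shows "f \<in> borel_measurable borel" "0 \<le> M" "(\<integral>\<^sup>+x. ennreal (norm (f x) powr p) \<partial>lborel) \<le> ennreal (M powr p)"
  using assms unfolding Lp_le_def by auto

lemma Lp_le_mono:
  assumes "Lp_le p f M" "M \<le> M'" "0 \<le> p"
  shows "Lp_le p f M'"
proof -
  have "ennreal (M powr p) \<le> ennreal (M' powr p)"
    using assms Lp_leD(2)[OF assms(1)] by (intro ennreal_leI powr_mono2)
  from order_trans[OF Lp_leD(3)[OF assms(1)] this] show ?thesis
    unfolding Lp_le_def using Lp_leD(1,2)[OF assms(1)] assms(2) by simp
qed

lemma Lp_le_iff_Lp_norm:
  fixes f :: "real^'d::finite \<Rightarrow> complex"
  assumes p: "1 \<le> p" and f: "f \<in> borel_measurable borel" and M: "0 \<le> M"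
  shows "Lp_norm (ennreal p) lborel (\<lambda>x. ennreal (norm (f x))) \<le> ennreal M \<longleftrightarrow> Lp_le p f M"
proof -
  define I where "I = (\<integral>\<^sup>+x. ennreal (norm (f x) powr p) \<partial>lborel)"
  have e: "Lp_norm (ennreal p) lborel (\<lambda>x. ennreal (norm (f x))) = ennpowr I (1 / p)"
    using p by (simp add: Lp_norm_def I_def ennpowr_def)
  show ?thesis
  proof (cases "I = \<infinity>")
    case True
    then show ?thesis unfolding e Lp_le_def I_def[symmetric] by (simp add: ennpowr_def top_unique)
  next
    case False
    then obtain J where J: "0 \<le> J" "I = ennreal J" by (cases I) auto
    have "J powr (1 / p) \<le> M \<longleftrightarrow> J \<le> M powr p"
    proof
      assume "J powr (1 / p) \<le> M"
      then have "(J powr (1 / p)) powr p \<le> M powr p" using p by (intro powr_mono2) auto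
      then show "J \<le> M powr p" using p J by (simp add: powr_powr)
    next
      assume "J \<le> M powr p"
      then have "J powr (1 / p) \<le> (M powr p) powr (1 / p)" using p J by (intro powr_mono2) auto
      then show "J powr (1 / p) \<le> M" using p M by (simp add: powr_powr)
    qed
    then show ?thesis unfolding e Lp_le_def I_def[symmetric] using J f M by (simp add: ennpowr_def)
  qed
qed

lemma norm_integral_le_nn:
  fixes f :: "'a \<Rightarrow> complex"
  shows "ennreal (norm (LINT x|M. f x)) \<le> (\<integral>\<^sup>+x. ennreal (norm (f x)) \<partial>M)"
  by (cases "integrable M f") (simp_all add: integral_norm_bound_ennreal not_integrable_integral_eq)

text \<open>Duality without dual exponents: an integrable function that is also bounded has the norm in the dual space that interpolates between the
  two bounds.\<close>

lemma Lp_le_pairing: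
  fixes f \<kappa> :: "real^'d::finite \<Rightarrow> complex"
  assumes p: "1 \<le> p" and f: "Lp_le p f M" and [measurable]: "\<kappa> \<in> borel_measurable borel"
    and W: "0 < W" "(\<integral>\<^sup>+x. ennreal (norm (\<kappa> x)) \<partial>lborel) \<le> ennreal W" and S: "0 < S" "\<And>x. norm (\<kappa> x) \<le> S"
  shows "integrable lborel (\<lambda>x. f x * \<kappa> x)"
    and "(LINT x|lborel. norm (f x * \<kappa> x)) \<le> (W powr (p - 1) * S) powr (1 / p) * M"
    and "norm (LINT x|lborel. f x * \<kappa> x) \<le> (W powr (p - 1) * S) powr (1 / p) * M"
proof -
  note [measurable] = Lp_leD(1)[OF f]
  have "(\<integral>\<^sup>+x. ennreal (norm (\<kappa> x) * norm (f x) powr p) \<partial>lborel) \<le> (\<integral>\<^sup>+x. ennreal S * ennreal (norm (f x) powr p) \<partial>lborel)"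
    using S by (intro nn_integral_mono) (simp add: ennreal_mult[symmetric] mult_right_mono)
  also have "\<dots> = ennreal S * (\<integral>\<^sup>+x. ennreal (norm (f x) powr p) \<partial>lborel)" by (rule nn_integral_cmult) simp
  also have "\<dots> \<le> ennreal S * ennreal (M powr p)" by (intro mult_left_mono Lp_leD(3)[OF f]) simp
  also have "\<dots> = ennreal (S * M powr p)" using S by (simp add: ennreal_mult)
  finally have J: "(\<integral>\<^sup>+x. ennreal (norm (\<kappa> x) * norm (f x) powr p) \<partial>lborel) \<le> ennreal (S * M powr p)" .
  have "(\<integral>\<^sup>+x. ennreal (norm (\<kappa> x) * norm (f x)) \<partial>lborel) \<le> ennreal ((W powr (p - 1) * (S * M powr p)) powr (1 / p))"
    by (rule weighted_jensen[OF _ _ _ _ p W(1) W(2) _ J]) (use S in auto)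
  also have "(W powr (p - 1) * (S * M powr p)) powr (1 / p) = (W powr (p - 1) * S) powr (1 / p) * M"
    using S W p Lp_leD(2)[OF f] by (simp add: powr_mult powr_powr mult.assoc[symmetric])
  finally have nn: "(\<integral>\<^sup>+x. ennreal (norm (f x * \<kappa> x)) \<partial>lborel) \<le> ennreal ((W powr (p - 1) * S) powr (1 / p) * M)"
    by (simp add: norm_mult mult.commute)
  show int: "integrable lborel (\<lambda>x. f x * \<kappa> x)"
    by (rule integrableI_bounded) (use nn in \<open>auto simp: top_unique less_top[symmetric]\<close>)
  have "ennreal (LINT x|lborel. norm (f x * \<kappa> x)) = (\<integral>\<^sup>+x. ennreal (norm (f x * \<kappa> x)) \<partial>lborel)"
    using int by (intro nn_integral_eq_integral[symmetric]) auto
  then have "ennreal (LINT x|lborel. norm (f x * \<kappa> x)) \<le> ennreal ((W powr (p - 1) * S) powr (1 / p) * M)"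
    using nn by simp
  then show le: "(LINT x|lborel. norm (f x * \<kappa> x)) \<le> (W powr (p - 1) * S) powr (1 / p) * M"
    by (subst (asm) ennreal_le_iff) (use Lp_leD(2)[OF f] in auto)
  show "norm (LINT x|lborel. f x * \<kappa> x) \<le> (W powr (p - 1) * S) powr (1 / p) * M"
    by (rule order_trans[OF integral_norm_bound le])
qed

lemma nn_integral_reflect_shift:
  fixes K :: "real^'d::finite \<Rightarrow> complex"
  assumes [measurable]: "K \<in> borel_measurable borel"
  shows "(\<integral>\<^sup>+y. ennreal (norm (K (x - y))) \<partial>lborel) = (\<integral>\<^sup>+y. ennreal (norm (K y)) \<partial>lborel)"
    and "(\<integral>\<^sup>+y. ennreal (norm (K (y - x))) \<partial>lborel) = (\<integral>\<^sup>+y. ennreal (norm (K y)) \<partial>lborel)"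
proof -
  have gen: "(\<integral>\<^sup>+y. ennreal (norm (K y)) \<partial>lborel) = (\<integral>\<^sup>+y. ennreal (norm (K (t + c *\<^sub>R y))) \<partial>lborel)" if "\<bar>c\<bar> = 1" for c t
  proof -
    have "c \<noteq> 0" using that by auto
    have "(\<integral>\<^sup>+y. ennreal (norm (K y)) \<partial>lborel) = (\<integral>\<^sup>+y. ennreal (norm (K y)) \<partial>density (distr lborel borel (\<lambda>x. t + c *\<^sub>R x)) (\<lambda>_. \<bar>c\<bar> ^ DIM(real^'d)))"
      using lborel_affine[OF \<open>c \<noteq> 0\<close>, of t] by simp
    also have "\<dots> = (\<integral>\<^sup>+y. ennreal (norm (K (t + c *\<^sub>R y))) \<partial>lborel)"
      by (subst nn_integral_density) (auto simp: that nn_integral_distr)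
    finally show ?thesis .
  qed
  show "(\<integral>\<^sup>+y. ennreal (norm (K (x - y))) \<partial>lborel) = (\<integral>\<^sup>+y. ennreal (norm (K y)) \<partial>lborel)"
    using gen[of "-1" x] by simp
  show "(\<integral>\<^sup>+y. ennreal (norm (K (y - x))) \<partial>lborel) = (\<integral>\<^sup>+y. ennreal (norm (K y)) \<partial>lborel)"
    using gen[of 1 "- x"] by simp
qed

text \<open>Young's inequality with an integrable kernel, by the weighted Jensen inequality with weight \<open>norm (K (x - y))\<close> for fixed \<open>y\<close> and Fubini.\<close>

lemma Lp_le_conv:
  fixes f K :: "real^'d::finite \<Rightarrow> complex"
  assumes p: "1 \<le> p" and f: "Lp_le p f M" and [measurable]: "K \<in> borel_measurable borel"
    and W: "0 < W" "(\<integral>\<^sup>+x. ennreal (norm (K x)) \<partial>lborel) \<le> ennreal W"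
  shows "Lp_le p (\<lambda>y. LINT x|lborel. f x * K (x - y)) (W * M)"
proof -
  note [measurable] = Lp_leD(1)[OF f]
  let ?h = "\<lambda>y. LINT x|lborel. f x * K (x - y)"
  have hm: "?h \<in> borel_measurable borel"
  proof -
    have "(\<lambda>(y, x). f x * K (x - y)) \<in> borel_measurable (lborel \<Otimes>\<^sub>M lborel)" by measurable
    from lborel.borel_measurable_lebesgue_integral[OF this] show ?thesis by simp
  qed
  define I where "I = (\<lambda>y. \<integral>\<^sup>+x. ennreal (norm (K (x - y)) * norm (f x) powr p) \<partial>lborel)"
  have pt: "ennreal (norm (?h y) powr p) \<le> ennreal (W powr (p - 1)) * I y" for y
  proof (cases "I y = \<infinity>")
    case True
    then show ?thesis using W by (simp add: ennreal_mult_top)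
  next
    case False
    then obtain J where J: "0 \<le> J" "I y = ennreal J" by (cases "I y") auto
    have Wy: "(\<integral>\<^sup>+x. ennreal (norm (K (x - y))) \<partial>lborel) \<le> ennreal W"
      using W(2) by (subst nn_integral_reflect_shift(2)) auto
    have "ennreal (norm (?h y)) \<le> (\<integral>\<^sup>+x. ennreal (norm (K (x - y)) * norm (f x)) \<partial>lborel)"
      using norm_integral_le_nn[of lborel "\<lambda>x. f x * K (x - y)"] by (simp add: norm_mult mult.commute)
    also have "\<dots> \<le> ennreal ((W powr (p - 1) * J) powr (1 / p))"
      by (rule weighted_jensen[OF _ _ _ _ p W(1) Wy J(1)]) (use J in \<open>auto simp: I_def\<close>)
    finally have "norm (?h y) \<le> (W powr (p - 1) * J) powr (1 / p)" using W J by (simp add: ennreal_le_iff)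
    then have "norm (?h y) powr p \<le> ((W powr (p - 1) * J) powr (1 / p)) powr p"
      using p by (intro powr_mono2) auto
    also have "\<dots> = W powr (p - 1) * J" using W J p by (intro powr_inverse_cancel) auto
    finally have "ennreal (norm (?h y) powr p) \<le> ennreal (W powr (p - 1) * J)" by (rule ennreal_leI)
    then show ?thesis using W J by (simp add: ennreal_mult)
  qed
  have "(\<integral>\<^sup>+y. ennreal (norm (?h y) powr p) \<partial>lborel) \<le> (\<integral>\<^sup>+y. ennreal (W powr (p - 1)) * I y \<partial>lborel)"
    by (intro nn_integral_mono pt)
  also have "\<dots> = ennreal (W powr (p - 1)) * (\<integral>\<^sup>+y. I y \<partial>lborel)"
  proof (rule nn_integral_cmult)
    have "(\<lambda>(y, x). ennreal (norm (K (x - y)) * norm (f x) powr p)) \<in> borel_measurable (lborel \<Otimes>\<^sub>M lborel)" by measurable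
    from lborel.borel_measurable_nn_integral[OF this] show "I \<in> borel_measurable lborel" by (simp add: I_def)
  qed
  also have "(\<integral>\<^sup>+y. I y \<partial>lborel) = (\<integral>\<^sup>+x. (\<integral>\<^sup>+y. ennreal (norm (K (x - y)) * norm (f x) powr p) \<partial>lborel) \<partial>lborel)"
    unfolding I_def by (rule lborel_pair.Fubini'[of "\<lambda>x y. ennreal (norm (K (x - y)) * norm (f x) powr p)"]) measurable
  also have "\<dots> = (\<integral>\<^sup>+x. (\<integral>\<^sup>+y. ennreal (norm (K y)) \<partial>lborel) * ennreal (norm (f x) powr p) \<partial>lborel)"
  proof (rule nn_integral_cong)
    fix x
    have "(\<integral>\<^sup>+y. ennreal (norm (K (x - y)) * norm (f x) powr p) \<partial>lborel) = (\<integral>\<^sup>+y. ennreal (norm (K (x - y))) * ennreal (norm (f x) powr p) \<partial>lborel)"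
      by (simp add: ennreal_mult)
    also have "\<dots> = (\<integral>\<^sup>+y. ennreal (norm (K (x - y))) \<partial>lborel) * ennreal (norm (f x) powr p)"
      by (rule nn_integral_multc) simp
    finally show "(\<integral>\<^sup>+y. ennreal (norm (K (x - y)) * norm (f x) powr p) \<partial>lborel) = (\<integral>\<^sup>+y. ennreal (norm (K y)) \<partial>lborel) * ennreal (norm (f x) powr p)"
      by (simp add: nn_integral_reflect_shift)
  qed
  also have "\<dots> = (\<integral>\<^sup>+y. ennreal (norm (K y)) \<partial>lborel) * (\<integral>\<^sup>+x. ennreal (norm (f x) powr p) \<partial>lborel)"
    by (rule nn_integral_cmult) simp
  also have "ennreal (W powr (p - 1)) * ((\<integral>\<^sup>+y. ennreal (norm (K y)) \<partial>lborel) * (\<integral>\<^sup>+x. ennreal (norm (f x) powr p) \<partial>lborel))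
      \<le> ennreal (W powr (p - 1)) * (ennreal W * ennreal (M powr p))"
    by (intro mult_left_mono mult_mono W Lp_leD(3)[OF f]) auto
  also have "\<dots> = ennreal ((W * M) powr p)"
  proof -
    have "W powr (p - 1) * (W * M powr p) = (W * M) powr p"
      using W Lp_leD(2)[OF f] by (simp add: powr_mult powr_diff)
    then show ?thesis using W by (simp add: ennreal_mult[symmetric])
  qed
  finally show ?thesis unfolding Lp_le_def using hm W Lp_leD(2)[OF f] by auto
qed

text \<open>Since \<open>2 r \<ge> p\<close>, one can split \<open>|f g|\<^sup>r\<close> as \<open>|f| powr (2 r - p)\<close> times \<open>|f| powr (p - r) * |g| powr r\<close>. The first factor is bounded
  by the supremum of \<open>f\<close>, and the exponents of the second add up to \<open>p\<close>, as Hoelder's inequality requires. The supremum is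
  given as a multiple of the bound \<open>A\<close>, in agreement with Bernstein's inequality; so the result is bilinear in \<open>A\<close> and \<open>B\<close>.\<close>

lemma Lp_le_product:
  fixes f g :: "real^'d::finite \<Rightarrow> complex"
  assumes r: "1 \<le> r" "r \<le> p" "p \<le> 2 * r" and f: "Lp_le p f A" and g: "Lp_le p g B"
    and S: "0 < S" "\<And>x. norm (f x) \<le> S * A"
  shows "Lp_le r (\<lambda>x. f x * g x) (S powr ((2 * r - p) / r) * A * B)"
proof -
  note [measurable] = Lp_leD(1)[OF f] Lp_leD(1)[OF g]
  have p: "1 \<le> p" using r by simp
  have zero: "AE x in lborel. h x = 0" if "Lp_le p h 0" for h :: "real^'d \<Rightarrow> complex"
  proof -
    have [measurable]: "h \<in> borel_measurable borel" by (rule Lp_leD(1)[OF that])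
    have "(\<integral>\<^sup>+x. ennreal (norm (h x) powr p) \<partial>lborel) = 0" using Lp_leD(3)[OF that] p by simp
    then have "AE x in lborel. ennreal (norm (h x) powr p) = 0" by (subst (asm) nn_integral_0_iff_AE) auto
    then show ?thesis by eventually_elim (auto simp: ennreal_eq_0_iff)
  qed
  have "(\<integral>\<^sup>+x. ennreal (norm (f x * g x) powr r) \<partial>lborel) \<le> ennreal ((S powr ((2 * r - p) / r) * A * B) powr r)"
  proof (cases "A = 0 \<or> B = 0")
    case True
    then have "AE x in lborel. f x * g x = 0"
    proof
      assume "A = 0" then have "AE x in lborel. f x = 0" using zero f by simp
      then show ?thesis by eventually_elim simp
    next
      assume "B = 0" then have "AE x in lborel. g x = 0" using zero g by simp
      then show ?thesis by eventually_elim simp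
    qed
    then have "AE x in lborel. ennreal (norm (f x * g x) powr r) = 0" by eventually_elim simp
    then have "(\<integral>\<^sup>+x. ennreal (norm (f x * g x) powr r) \<partial>lborel) = 0" by (subst nn_integral_0_iff_AE) auto
    then show ?thesis by simp
  next
    case False
    then have A: "0 < A" and B: "0 < B" using Lp_leD(2)[OF f] Lp_leD(2)[OF g] by auto
    define c where "c = S powr (2 * r - p) * A powr r * B powr r"
    have c0: "0 < c" using A B S by (simp add: c_def)
    \<comment> \<open>The convexity parameter for the exponents \<open>p - r = p (1 - \<theta>)\<close> of \<open>f\<close> and \<open>r = p \<theta>\<close> of \<open>g\<close>.\<close>
    define \<theta> where "\<theta> = r / p"
    have \<theta>: "0 \<le> \<theta>" "\<theta> \<le> 1" using r p by (auto simp: \<theta>_def)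
    have pt: "norm (f x * g x) powr r \<le> c * (1 - \<theta>) / A powr p * norm (f x) powr p + c * \<theta> / B powr p * norm (g x) powr p" for x
    proof (cases "f x = 0 \<or> g x = 0")
      case True
      then show ?thesis using c0 \<theta> A B by auto
    next
      case False
      define a b where "a = norm (f x)" and "b = norm (g x)"
      have ab: "0 < a" "0 < b" using False by (auto simp: a_def b_def)
      have "(a * b) powr r = a powr (2 * r - p) * (a powr (p - r) * b powr r)"
        using ab by (simp add: powr_mult powr_add[symmetric] mult.assoc[symmetric])
      also have "\<dots> \<le> (S * A) powr (2 * r - p) * (a powr (p - r) * b powr r)"
        using S r ab by (intro mult_right_mono powr_mono2) (auto simp: a_def)
      also have "\<dots> = c * (((a / A) powr p) powr (1 - \<theta>) * ((b / B) powr p) powr \<theta>)"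
      proof -
        have e: "p * (1 - \<theta>) = p - r" "p * \<theta> = r" using p by (auto simp: \<theta>_def right_diff_distrib)
        have "((a / A) powr p) powr (1 - \<theta>) * ((b / B) powr p) powr \<theta> = (a powr (p - r) / A powr (p - r)) * (b powr r / B powr r)"
          using A B ab by (simp add: powr_powr e powr_divide)
        moreover have "(S * A) powr (2 * r - p) = S powr (2 * r - p) * A powr (2 * r - p)" using S A by (simp add: powr_mult)
        moreover have "A powr (2 * r - p) = A powr r / A powr (p - r)" using A by (simp add: powr_diff[symmetric])
        ultimately show ?thesis using A B by (simp add: c_def)
      qed
      also have "\<dots> \<le> c * ((1 - \<theta>) * (a / A) powr p + \<theta> * (b / B) powr p)"
        using c0 \<theta> ab A B by (intro mult_left_mono Youngs_inequality_0) auto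
      also have "\<dots> = c * (1 - \<theta>) / A powr p * a powr p + c * \<theta> / B powr p * b powr p"
        using A B ab by (simp add: powr_divide distrib_left)
      finally show ?thesis by (simp add: norm_mult a_def b_def)
    qed
    have "(\<integral>\<^sup>+x. ennreal (norm (f x * g x) powr r) \<partial>lborel)
       \<le> (\<integral>\<^sup>+x. ennreal (c * (1 - \<theta>) / A powr p) * ennreal (norm (f x) powr p) + ennreal (c * \<theta> / B powr p) * ennreal (norm (g x) powr p) \<partial>lborel)"
    proof (rule nn_integral_mono)
      fix x
      show "ennreal (norm (f x * g x) powr r) \<le> ennreal (c * (1 - \<theta>) / A powr p) * ennreal (norm (f x) powr p) + ennreal (c * \<theta> / B powr p) * ennreal (norm (g x) powr p)"
        using ennreal_leI[OF pt[of x]] c0 \<theta> A B by (simp add: ennreal_mult[symmetric] ennreal_plus[symmetric] del: ennreal_plus)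
    qed
    also have "\<dots> = ennreal (c * (1 - \<theta>) / A powr p) * (\<integral>\<^sup>+x. ennreal (norm (f x) powr p) \<partial>lborel) + ennreal (c * \<theta> / B powr p) * (\<integral>\<^sup>+x. ennreal (norm (g x) powr p) \<partial>lborel)"
      by (subst nn_integral_add, simp, simp, subst nn_integral_cmult, simp, subst nn_integral_cmult, simp, rule refl)
    also have "\<dots> \<le> ennreal (c * (1 - \<theta>) / A powr p) * ennreal (A powr p) + ennreal (c * \<theta> / B powr p) * ennreal (B powr p)"
      by (intro add_mono mult_left_mono Lp_leD(3)[OF f] Lp_leD(3)[OF g]) auto
    also have "\<dots> = ennreal (c * (1 - \<theta>) / A powr p * A powr p + c * \<theta> / B powr p * B powr p)"
      using c0 \<theta> A B by (simp add: ennreal_mult[symmetric] ennreal_plus[symmetric] del: ennreal_plus)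
    also have "c * (1 - \<theta>) / A powr p * A powr p + c * \<theta> / B powr p * B powr p = c"
    proof -
      have "c * (1 - \<theta>) / A powr p * A powr p = c * (1 - \<theta>)" "c * \<theta> / B powr p * B powr p = c * \<theta>" using A B by simp_all
      then show ?thesis by (simp add: right_diff_distrib)
    qed
    also have "c = (S powr ((2 * r - p) / r) * A * B) powr r"
      using A B S r by (simp add: c_def powr_mult powr_powr)
    finally show ?thesis .
  qed
  then show ?thesis
    unfolding Lp_le_def using Lp_leD(2)[OF f] Lp_leD(2)[OF g] by auto
qed

text \<open>Interpolation between \<open>L\<^sup>r\<close> and bounded functions.\<close>

lemma Lp_le_interpolate:
  fixes h :: "real^'d::finite \<Rightarrow> complex"
  assumes r: "1 \<le> r" "r \<le> q" and h: "Lp_le r h (W * M)" and S: "0 < S" "\<And>x. norm (h x) \<le> S * M" and W: "0 < W" and M: "0 \<le> M"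
  shows "Lp_le q h (S powr ((q - r) / q) * W powr (r / q) * M)"
proof -
  note [measurable] = Lp_leD(1)[OF h]
  have "(\<integral>\<^sup>+x. ennreal (norm (h x) powr q) \<partial>lborel) \<le> ennreal ((S powr ((q - r) / q) * W powr (r / q) * M) powr q)"
  proof (cases "M = 0")
    case True
    then have "h x = 0" for x using S(2)[of x] by simp
    then show ?thesis by simp
  next
    case False
    then have Mp: "0 < M" using M by simp
    have pt: "norm (h x) powr q \<le> (S * M) powr (q - r) * norm (h x) powr r" for x
    proof (cases "h x = 0")
      case False
      then have "norm (h x) powr q = norm (h x) powr (q - r) * norm (h x) powr r" by (simp add: powr_add[symmetric])
      also have "\<dots> \<le> (S * M) powr (q - r) * norm (h x) powr r"
        using r S by (intro mult_right_mono powr_mono2) auto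
      finally show ?thesis .
    qed simp
    have "(\<integral>\<^sup>+x. ennreal (norm (h x) powr q) \<partial>lborel) \<le> (\<integral>\<^sup>+x. ennreal ((S * M) powr (q - r)) * ennreal (norm (h x) powr r) \<partial>lborel)"
      by (intro nn_integral_mono) (simp add: ennreal_mult[symmetric] ennreal_leI pt)
    also have "\<dots> = ennreal ((S * M) powr (q - r)) * (\<integral>\<^sup>+x. ennreal (norm (h x) powr r) \<partial>lborel)"
      by (rule nn_integral_cmult) simp
    also have "\<dots> \<le> ennreal ((S * M) powr (q - r)) * ennreal ((W * M) powr r)"
      by (intro mult_left_mono Lp_leD(3)[OF h]) auto
    also have "\<dots> = ennreal ((S * M) powr (q - r) * (W * M) powr r)" by (simp add: ennreal_mult)
    also have "(S * M) powr (q - r) * (W * M) powr r = (S powr ((q - r) / q) * W powr (r / q) * M) powr q"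
    proof -
      have m: "M powr q = M powr (q - r) * M powr r" unfolding powr_add[symmetric] by simp
      have l: "(S * M) powr (q - r) = S powr (q - r) * M powr (q - r)" "(W * M) powr r = W powr r * M powr r"
        using S W Mp by (simp_all add: powr_mult)
      have a: "(S powr ((q - r) / q)) powr q = S powr (q - r)" "(W powr (r / q)) powr q = W powr r"
        using r by (simp_all add: powr_powr)
      have "(S powr ((q - r) / q) * W powr (r / q) * M) powr q = S powr (q - r) * W powr r * M powr q"
        using S W Mp by (simp add: powr_mult a)
      then show ?thesis unfolding l m by (simp only: mult_ac)
    qed
    finally show ?thesis .
  qed
  then show ?thesis unfolding Lp_le_def using M by auto
qed

text \<open>Minkowski's inequality for a series. With summable weights \<open>c n\<close> given in advance it follows from the weighted Jensen inequality on the
  index set.\<close>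

lemma Lp_le_series:
  fixes f :: "nat \<Rightarrow> real^'d::finite \<Rightarrow> complex"
  assumes p: "1 \<le> p" and f: "\<And>n. Lp_le p (f n) (c n * M)" and c: "\<And>n. 0 < c n" "summable c"
    and F: "F \<in> borel_measurable borel" "\<And>x. ennreal (norm (F x)) \<le> (\<Sum>n. ennreal (norm (f n x)))" and M: "0 \<le> M"
  shows "Lp_le p F (suminf c * M)"
proof -
  note [measurable] = Lp_leD(1)[OF f] F(1)
  define W where "W = suminf c"
  have W: "0 < W" unfolding W_def by (rule suminf_pos[OF c(2,1)])
  have Wn: "(\<integral>\<^sup>+n. ennreal (c n) \<partial>count_space UNIV) \<le> ennreal W"
  proof -
    have "0 \<le> c n" for n using c(1)[of n] by simp
    from suminf_ennreal2[OF this c(2)] show ?thesis unfolding nn_integral_count_space_nat W_def by simp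
  qed
  define I where "I = (\<lambda>x. \<Sum>n. ennreal (c n * (norm (f n x) / c n) powr p))"
  have pt: "ennreal (norm (F x) powr p) \<le> ennreal (W powr (p - 1)) * I x" for x
  proof (cases "I x = \<infinity>")
    case True
    then show ?thesis using W by (simp add: ennreal_mult_top)
  next
    case False
    then obtain J where J: "0 \<le> J" "I x = ennreal J" by (cases "I x") auto
    have "c n * (norm (f n x) / c n) = norm (f n x)" for n using c(1)[of n] by simp
    then have "ennreal (norm (F x)) \<le> (\<Sum>n. ennreal (c n * (norm (f n x) / c n)))"
      using F(2)[of x] by (simp only:)
    also have "\<dots> = (\<integral>\<^sup>+n. ennreal (c n * (norm (f n x) / c n)) \<partial>count_space UNIV)" by (simp add: nn_integral_count_space_nat)
    also have "\<dots> \<le> ennreal ((W powr (p - 1) * J) powr (1 / p))"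
    proof (rule weighted_jensen[OF _ _ _ _ p W Wn J(1)])
      show "(\<integral>\<^sup>+n. ennreal (c n * (norm (f n x) / c n) powr p) \<partial>count_space UNIV) \<le> ennreal J"
        using J(2) by (simp add: I_def nn_integral_count_space_nat)
      show "0 \<le> c n" "0 \<le> norm (f n x) / c n" for n using c(1)[of n] by simp_all
    qed simp_all
    finally have "norm (F x) \<le> (W powr (p - 1) * J) powr (1 / p)" using W J by (simp add: ennreal_le_iff)
    then have "norm (F x) powr p \<le> ((W powr (p - 1) * J) powr (1 / p)) powr p"
      using p by (intro powr_mono2) auto
    also have "\<dots> = W powr (p - 1) * J" using W J p by (intro powr_inverse_cancel) auto
    finally have "ennreal (norm (F x) powr p) \<le> ennreal (W powr (p - 1) * J)" by (rule ennreal_leI)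
    then show ?thesis using W J by (simp add: ennreal_mult)
  qed
  have "(\<integral>\<^sup>+x. ennreal (norm (F x) powr p) \<partial>lborel) \<le> (\<integral>\<^sup>+x. ennreal (W powr (p - 1)) * I x \<partial>lborel)"
    by (intro nn_integral_mono pt)
  also have "\<dots> = ennreal (W powr (p - 1)) * (\<integral>\<^sup>+x. I x \<partial>lborel)"
    by (rule nn_integral_cmult) (simp add: I_def)
  also have "(\<integral>\<^sup>+x. I x \<partial>lborel) = (\<Sum>n. \<integral>\<^sup>+x. ennreal (c n * (norm (f n x) / c n) powr p) \<partial>lborel)"
    unfolding I_def by (rule nn_integral_suminf) simp
  also have "\<dots> \<le> (\<Sum>n. ennreal (c n * M powr p))"
  proof (rule suminf_le)
    fix n
    have "(\<integral>\<^sup>+x. ennreal (c n * (norm (f n x) / c n) powr p) \<partial>lborel) = (\<integral>\<^sup>+x. ennreal (c n / c n powr p) * ennreal (norm (f n x) powr p) \<partial>lborel)"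
    proof -
      have "c n * (norm (f n x) / c n) powr p = c n / c n powr p * norm (f n x) powr p" for x
        using c(1)[of n] by (simp add: powr_divide)
      then have "ennreal (c n * (norm (f n x) / c n) powr p) = ennreal (c n / c n powr p) * ennreal (norm (f n x) powr p)" for x
        by (simp only:) (rule ennreal_mult, use c(1)[of n] in auto)
      then show ?thesis by (simp only:)
    qed
    also have "\<dots> = ennreal (c n / c n powr p) * (\<integral>\<^sup>+x. ennreal (norm (f n x) powr p) \<partial>lborel)"
      by (rule nn_integral_cmult) simp
    also have "\<dots> \<le> ennreal (c n / c n powr p) * ennreal ((c n * M) powr p)"
      by (intro mult_left_mono Lp_leD(3)[OF f]) auto
    also have "\<dots> = ennreal (c n * M powr p)"
    proof -
      have "c n / c n powr p * (c n * M) powr p = c n * M powr p"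
        using c(1)[of n] M by (simp add: powr_mult)
      then show ?thesis using c(1)[of n] by (simp add: ennreal_mult[symmetric])
    qed
    finally show "(\<integral>\<^sup>+x. ennreal (c n * (norm (f n x) / c n) powr p) \<partial>lborel) \<le> ennreal (c n * M powr p)" .
  qed auto
  also have "(\<Sum>n. ennreal (c n * M powr p)) = ennreal (W * M powr p)"
  proof -
    have s: "(\<lambda>n. c n * M powr p) sums (W * M powr p)"
      unfolding W_def by (intro sums_mult2 summable_sums c(2))
    have "0 \<le> c n * M powr p" for n using c(1)[of n] by simp
    from suminf_ennreal2[OF this sums_summable[OF s]] show ?thesis by (simp only: sums_unique[OF s, symmetric])
  qed
  also have "ennreal (W powr (p - 1)) * ennreal (W * M powr p) = ennreal ((W * M) powr p)"
  proof -
    have "W powr (p - 1) * (W * M powr p) = (W * M) powr p" using W M by (simp add: powr_mult powr_diff)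
    then show ?thesis using W by (simp add: ennreal_mult[symmetric])
  qed
  finally have "(\<integral>\<^sup>+x. ennreal (norm (F x) powr p) \<partial>lborel) \<le> ennreal ((W * M) powr p)"
    by (simp only: mult_left_mono zero_le)
  then show ?thesis unfolding Lp_le_def W_def[symmetric] using W M by auto
qed

text \<open>Rescaling the symbol preserves the integral of the modulus of the kernel and multiplies its supremum by a power of the scale.\<close>

lemma kernel_bounds:
  fixes m :: "real^'d::finite \<Rightarrow> complex"
  assumes m: "m \<in> schwartz"
  obtains W S where "0 < W" "0 < S"
    "\<And>e. 0 < e \<Longrightarrow> (\<integral>\<^sup>+x. ennreal (norm (Ker (\<lambda>\<xi>. m (e *\<^sub>R \<xi>)) x)) \<partial>lborel) \<le> ennreal W"
    "\<And>e x. 0 < e \<Longrightarrow> norm (Ker (\<lambda>\<xi>. m (e *\<^sub>R \<xi>)) x) \<le> S / e ^ CARD('d)"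
proof -
  note K = schwartz_Ker[OF m]
  note [measurable] = schwartz_measurable[OF K] schwartz_measurable[OF m]
  obtain S where S: "0 \<le> S" "\<And>x. (1 + norm x) ^ 0 * norm (Ker m x) \<le> S" using rapidE[OF schwartz_rapid[OF K]] by blast
  define W where "W = (LINT x|lborel. norm (Ker m x))"
  have W: "0 \<le> W" by (simp add: W_def)
  have resc: "norm (Ker (\<lambda>\<xi>. m (e *\<^sub>R \<xi>)) x) = norm (Ker m (x /\<^sub>R e)) / e ^ CARD('d)" if "0 < e" for e x
    using that by (simp add: Ker_rescale norm_mult norm_divide norm_power)
  show ?thesis
  proof (rule that[of "W + 1" "S + 1"])
    fix e :: real assume e: "0 < e"
    have me: "integrable lborel (\<lambda>x. norm (Ker m x))" by (intro integrable_norm schwartz_integrable K)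
    have i: "integrable lborel (\<lambda>x. norm (Ker m (x /\<^sub>R e)))"
      using integrable_affine[of "inverse e" "\<lambda>x. norm (Ker m x)" 0] me e by simp
    have "(\<integral>\<^sup>+x. ennreal (norm (Ker (\<lambda>\<xi>. m (e *\<^sub>R \<xi>)) x)) \<partial>lborel) = ennreal (LINT x|lborel. norm (Ker m (x /\<^sub>R e)) / e ^ CARD('d))"
      unfolding resc[OF e] using i e by (intro nn_integral_eq_integral) auto
    also have "(LINT x|lborel. norm (Ker m (x /\<^sub>R e)) / e ^ CARD('d)) = W"
      using integral_affine[of "inverse e" "\<lambda>x. norm (Ker m x)" 0] e by (simp add: W_def power_inverse divide_inverse mult.commute)
    also have "ennreal W \<le> ennreal (W + 1)" by (rule ennreal_leI) simp
    finally show "(\<integral>\<^sup>+x. ennreal (norm (Ker (\<lambda>\<xi>. m (e *\<^sub>R \<xi>)) x)) \<partial>lborel) \<le> ennreal (W + 1)" .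
    fix x
    have "norm (Ker m (x /\<^sub>R e)) \<le> S + 1" using S(2)[of "x /\<^sub>R e"] by simp
    then show "norm (Ker (\<lambda>\<xi>. m (e *\<^sub>R \<xi>)) x) \<le> (S + 1) / e ^ CARD('d)"
      unfolding resc[OF e] using e by (intro divide_right_mono) auto
  qed (use W S in auto)
qed

section \<open>Convergence of dyadic series of functions\<close>

lemma summable_two_sided_geometric:
  assumes "0 < \<tau>"
  shows "(\<lambda>l::int. 2 powr (- \<tau> * \<bar>real_of_int l\<bar>)) summable_on UNIV"
proof -
  define r where "r = (2::real) powr (- \<tau>)"
  have r: "0 < r" "r < 1" using assms by (auto simp: r_def powr_less_one)
  have e: "2 powr (- \<tau> * \<bar>real_of_int l\<bar>) = r ^ nat \<bar>l\<bar>" for l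
  proof -
    have "r ^ nat \<bar>l\<bar> = r powr real (nat \<bar>l\<bar>)" by (rule powr_realpow[OF r(1), symmetric])
    also have "real (nat \<bar>l\<bar>) = \<bar>real_of_int l\<bar>" by simp
    finally show ?thesis by (simp add: r_def powr_powr)
  qed
  have g: "(\<lambda>n. r ^ n) summable_on UNIV"
    using r by (intro norm_summable_imp_summable_on) (simp add: summable_geometric)
  have 1: "(\<lambda>l. r ^ nat \<bar>l\<bar>) summable_on (range int)"
    using g by (subst summable_on_reindex) (auto simp: o_def)
  have 2: "(\<lambda>l. r ^ nat \<bar>l\<bar>) summable_on (range (\<lambda>n. - int n - 1))"
  proof (subst summable_on_reindex)
    show "inj (\<lambda>n. - int n - 1)" by (auto simp: inj_def)
    have "((\<lambda>l. r ^ nat \<bar>l\<bar>) \<circ> (\<lambda>n. - int n - 1)) = (\<lambda>n. r * r ^ n)"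
    proof
      fix n
      have "nat \<bar>- int n - 1\<bar> = Suc n" by simp
      then show "((\<lambda>l. r ^ nat \<bar>l\<bar>) \<circ> (\<lambda>n. - int n - 1)) n = r * r ^ n" by (simp only: o_def power_Suc)
    qed
    then show "((\<lambda>l. r ^ nat \<bar>l\<bar>) \<circ> (\<lambda>n. - int n - 1)) summable_on UNIV"
      using summable_on_cmult_right[OF g, of r] by (simp only:)
  qed
  have "(UNIV :: int set) = range int \<union> range (\<lambda>n. - int n - 1)"
  proof (intro set_eqI iffI UNIV_I)
    fix l :: int
    show "l \<in> range int \<union> range (\<lambda>n. - int n - 1)"
    proof (cases "0 \<le> l")
      case True
      then have "l = int (nat l)" by simp
      then show ?thesis by blast
    next
      case False
      then have "l = - int (nat (- l - 1)) - 1" by simp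
      then show ?thesis by blast
    qed
  qed
  moreover have "range int \<inter> range (\<lambda>n. - int n - 1) = {}" by auto
  ultimately show ?thesis unfolding e using summable_on_Un_disjoint[OF 1 2] by simp
qed

text \<open>One seminorm controls the pairings with bounded functions and with \<open>L\<^sup>p\<close> functions, because it controls both
  the integral and the supremum of a test function.\<close>

lemma schwartz_pairing_constant:
  fixes p :: real
  assumes p: "1 \<le> p"
  obtains C N where "0 < C"
    "\<And>f M \<psi>. Lp_le p f M \<Longrightarrow> (\<psi> :: real^'d::finite \<Rightarrow> complex) \<in> schwartz \<Longrightarrow>
       integrable lborel (\<lambda>x. f x * \<psi> x) \<and> norm (LINT x|lborel. f x * \<psi> x) \<le> C * schwartz_seminorm N \<psi> * M"
    "\<And>f H \<psi>. f \<in> borel_measurable borel \<Longrightarrow> (\<And>x. norm (f x) \<le> H) \<Longrightarrow> (\<psi> :: real^'d::finite \<Rightarrow> complex) \<in> schwartz \<Longrightarrow>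
       integrable lborel (\<lambda>x. f x * \<psi> x) \<and> norm (LINT x|lborel. f x * \<psi> x) \<le> C * schwartz_seminorm N \<psi> * H"
proof -
  define N where "N = 2 * CARD('d)"
  have pos: "0 < (1 + norm x) ^ N" for x :: "real^'d" by (intro zero_less_power) (simp add: add_pos_nonneg)
  have iw: "integrable lborel (\<lambda>x :: real^'d. 1 / (1 + norm x) ^ N)"
  proof (rule integrable_weight_bound[of _ 1])
    show "(1 + norm x) ^ (2 * CARD('d)) * norm (1 / (1 + norm x) ^ N) \<le> 1" for x :: "real^'d"
      using pos[of x] by (simp add: N_def)
  qed simp
  define w where "w = 1 + (LINT x|(lborel :: (real^'d) measure). 1 / (1 + norm x) ^ N)"
  have w: "1 \<le> w" unfolding w_def using pos by (simp add: less_imp_le)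
  define C where "C = w + (w powr (p - 1)) powr (1 / p)"
  have C: "0 < C" using w by (simp add: C_def add_pos_nonneg)
  have pw: "norm (\<psi> x) \<le> schwartz_seminorm N \<psi> * (1 / (1 + norm x) ^ N)" if "\<psi> \<in> schwartz" for \<psi> :: "real^'d \<Rightarrow> complex" and x
    using schwartz_seminorm_bound[OF that, of "[]" N x] pos[of x] by (simp add: pos_le_divide_eq mult.commute)
  have sn0: "0 \<le> schwartz_seminorm N \<psi>" if "\<psi> \<in> schwartz" for \<psi> :: "real^'d \<Rightarrow> complex"
    by (rule order_trans[OF _ schwartz_seminorm_bound[OF that, of "[]" N 0]]) auto
  have L1: "(LINT x|lborel. norm (\<psi> x)) \<le> schwartz_seminorm N \<psi> * w" if \<psi>: "\<psi> \<in> schwartz" for \<psi> :: "real^'d \<Rightarrow> complex"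
  proof -
    have "(LINT x|lborel. norm (\<psi> x)) \<le> (LINT x|(lborel :: (real^'d) measure). schwartz_seminorm N \<psi> * (1 / (1 + norm x) ^ N))"
    proof (rule Bochner_Integration.integral_mono)
      show "integrable lborel (\<lambda>x. norm (\<psi> x))" by (rule integrable_norm[OF schwartz_integrable[OF \<psi>]])
      show "integrable lborel (\<lambda>x::real^'d. schwartz_seminorm N \<psi> * (1 / (1 + norm x) ^ N))"
        by (intro integrable_mult_right iw)
    qed (rule pw[OF \<psi>])
    also have "\<dots> = schwartz_seminorm N \<psi> * (w - 1)" unfolding integral_mult_right_zero w_def by simp
    also have "\<dots> \<le> schwartz_seminorm N \<psi> * w" using sn0[OF \<psi>] by (intro mult_left_mono) auto
    finally show ?thesis .
  qed
  show ?thesis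
  proof (rule that[OF C, of N])
    fix f :: "real^'d \<Rightarrow> complex" and M and \<psi> :: "real^'d \<Rightarrow> complex" assume f: "Lp_le p f M" and \<psi>: "\<psi> \<in> schwartz"
    note M = Lp_leD(2)[OF f]
    define s where "s = schwartz_seminorm N \<psi>"
    have "integrable lborel (\<lambda>x. f x * \<psi> x) \<and> norm (LINT x|lborel. f x * \<psi> x) \<le> C * s * M"
    proof (cases "s = 0")
      case True
      then have "\<psi> x = 0" for x using pw[OF \<psi>, of x] by (simp add: s_def)
      then show ?thesis using True by simp
    next
      case False
      then have s: "0 < s" using sn0[OF \<psi>] by (simp add: s_def)
      have n1: "(\<integral>\<^sup>+x. ennreal (norm (\<psi> x)) \<partial>lborel) \<le> ennreal (s * w)"
        using L1[OF \<psi>] schwartz_integrable[OF \<psi>] by (subst nn_integral_eq_integral) (auto simp: s_def intro!: ennreal_leI)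
      have n2: "norm (\<psi> x) \<le> s" for x
      proof -
        have "1 * norm (\<psi> x) \<le> (1 + norm x) ^ N * norm (\<psi> x)" by (intro mult_right_mono one_le_power) auto
        then show ?thesis using schwartz_seminorm_bound[OF \<psi>, of "[]" N x] by (simp add: s_def)
      qed
      have sw: "0 < s * w" using s w by simp
      note pair = Lp_le_pairing[OF p f schwartz_measurable[OF \<psi>] sw n1 s n2]
      have "((s * w) powr (p - 1) * s) powr (1 / p) = (w powr (p - 1)) powr (1 / p) * s"
      proof -
        have sp: "s powr p = s powr (p - 1) * s"
        proof -
          have "s powr (p - 1) * s powr 1 = s powr p" unfolding powr_add[symmetric] by simp
          then show ?thesis using s by simp
        qed
        have "(s * w) powr (p - 1) * s = w powr (p - 1) * s powr p"
          using s w by (simp add: powr_mult sp)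
        then have "((s * w) powr (p - 1) * s) powr (1 / p) = (w powr (p - 1) * s powr p) powr (1 / p)" by (simp only:)
        also have "\<dots> = (w powr (p - 1)) powr (1 / p) * (s powr p) powr (1 / p)" by (rule powr_mult)
        also have "(s powr p) powr (1 / p) = s" using s p by (simp add: powr_powr)
        finally show ?thesis .
      qed
      then have "norm (LINT x|lborel. f x * \<psi> x) \<le> (w powr (p - 1)) powr (1 / p) * s * M" using pair(3) by simp
      also have "\<dots> \<le> C * s * M" using s M w by (intro mult_right_mono) (auto simp: C_def)
      finally show ?thesis using pair(1) by blast
    qed
    then show "integrable lborel (\<lambda>x. f x * \<psi> x) \<and> norm (LINT x|lborel. f x * \<psi> x) \<le> C * schwartz_seminorm N \<psi> * M"
      by (simp only: s_def)
  next
    fix f :: "real^'d \<Rightarrow> complex" and H and \<psi> :: "real^'d \<Rightarrow> complex"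
    assume [measurable]: "f \<in> borel_measurable borel" and f: "\<And>x. norm (f x) \<le> H" and \<psi>: "\<psi> \<in> schwartz"
    have H: "0 \<le> H" by (rule order_trans[OF _ f[of 0]]) simp
    have i: "integrable lborel (\<lambda>x. f x * \<psi> x)"
      by (rule integrable_mult_bounded(1)[OF schwartz_integrable[OF \<psi>] _ f]) simp
    have "norm (LINT x|lborel. f x * \<psi> x) \<le> (LINT x|lborel. H * norm (\<psi> x))"
      by (rule Bochner_Integration.integral_norm_bound_integral[OF i])
         (auto intro!: integrable_mult_right integrable_norm schwartz_integrable[OF \<psi>] mult_right_mono f simp: norm_mult)
    also have "\<dots> = H * (LINT x|lborel. norm (\<psi> x))" by (rule integral_mult_right_zero)
    also have "\<dots> \<le> H * (schwartz_seminorm N \<psi> * w)" by (intro mult_left_mono L1 \<psi> H)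
    also have "\<dots> \<le> C * schwartz_seminorm N \<psi> * H"
    proof -
      have "w * (schwartz_seminorm N \<psi> * H) \<le> C * (schwartz_seminorm N \<psi> * H)"
        using sn0[OF \<psi>] H by (intro mult_right_mono) (auto simp: C_def)
      then show ?thesis by (simp add: mult_ac)
    qed
    finally show "integrable lborel (\<lambda>x. f x * \<psi> x) \<and> norm (LINT x|lborel. f x * \<psi> x) \<le> C * schwartz_seminorm N \<psi> * H"
      using i by blast
  qed
qed

lemma distr_of_fun_add:
  assumes "integrable lborel (\<lambda>x. g x * \<psi> x)" "integrable lborel (\<lambda>x. g x * \<eta> x)"
  shows "distr_of_fun g (\<lambda>x. \<psi> x + \<eta> x) = distr_of_fun g \<psi> + distr_of_fun g \<eta>"
  using assms by (simp add: distr_of_fun_def distrib_left)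

lemma distr_of_fun_cmult: "distr_of_fun g (\<lambda>x. c * \<psi> x) = c * distr_of_fun g \<psi>"
proof -
  have "g x * (c * \<psi> x) = c * (g x * \<psi> x)" for x by simp
  then show ?thesis unfolding distr_of_fun_def by (simp only: integral_mult_right_zero)
qed

text \<open>Low frequencies converge uniformly, high frequencies in \<open>L\<^sup>p\<close>.\<close>

lemma distr_sum_tempered:
  fixes g :: "int \<Rightarrow> real^'d::finite \<Rightarrow> complex"
  assumes p: "1 \<le> p" and \<sigma>: "0 < \<sigma>" and H: "0 \<le> H"
    and low: "\<And>l x. l \<le> 0 \<Longrightarrow> norm (g l x) \<le> 2 powr real_of_int l * H"
    and high: "\<And>l. Lp_le p (g l) (2 powr (- (real_of_int l * \<sigma>)) * H)"
  shows "distr_summable g" "tempered (distr_sum g)"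
    "\<And>\<psi>. \<psi> \<in> schwartz \<Longrightarrow> (\<lambda>l. distr_of_fun (g l) \<psi>) summable_on UNIV"
proof -
  obtain C N where C: "0 < C"
    "\<And>f M \<psi>. Lp_le p f M \<Longrightarrow> (\<psi> :: real^'d \<Rightarrow> complex) \<in> schwartz \<Longrightarrow>
       integrable lborel (\<lambda>x. f x * \<psi> x) \<and> norm (LINT x|lborel. f x * \<psi> x) \<le> C * schwartz_seminorm N \<psi> * M"
    "\<And>f H \<psi>. f \<in> borel_measurable borel \<Longrightarrow> (\<And>x. norm (f x) \<le> H) \<Longrightarrow> (\<psi> :: real^'d \<Rightarrow> complex) \<in> schwartz \<Longrightarrow>
       integrable lborel (\<lambda>x. f x * \<psi> x) \<and> norm (LINT x|lborel. f x * \<psi> x) \<le> C * schwartz_seminorm N \<psi> * H"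
    using schwartz_pairing_constant[OF p, where 'd = 'd] by blast
  define \<tau> where "\<tau> = min 1 \<sigma>"
  have \<tau>: "0 < \<tau>" "\<tau> \<le> 1" "\<tau> \<le> \<sigma>" using \<sigma> by (auto simp: \<tau>_def)
  define a where "a = (\<lambda>l::int. 2 powr (- \<tau> * \<bar>real_of_int l\<bar>))"
  have a: "a summable_on UNIV" unfolding a_def by (rule summable_two_sided_geometric[OF \<tau>(1)])
  have int: "integrable lborel (\<lambda>x. g l x * \<psi> x)" if "\<psi> \<in> schwartz" for l \<psi>
    using C(2)[OF high that] by blast
  have sn0: "0 \<le> schwartz_seminorm N \<psi>" if "\<psi> \<in> schwartz" for \<psi> :: "real^'d \<Rightarrow> complex"
    by (rule order_trans[OF _ schwartz_seminorm_bound[OF that, of "[]" N 0]]) auto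
  have bound: "norm (distr_of_fun (g l) \<psi>) \<le> C * schwartz_seminorm N \<psi> * H * a l" if \<psi>: "\<psi> \<in> schwartz" for l \<psi>
  proof -
    have key: "norm (distr_of_fun (g l) \<psi>) \<le> C * schwartz_seminorm N \<psi> * (c * H)" and "0 \<le> c" if "c = (if l \<le> 0 then 2 powr real_of_int l else 2 powr (- (real_of_int l * \<sigma>)))" for c
    proof -
      show "0 \<le> c" using that by simp
      show "norm (distr_of_fun (g l) \<psi>) \<le> C * schwartz_seminorm N \<psi> * (c * H)"
      proof (cases "l \<le> 0")
        case True
        then show ?thesis using C(3)[OF Lp_leD(1)[OF high] low[OF True] \<psi>] that by (simp add: distr_of_fun_def)
      next
        case False
        then show ?thesis using C(2)[OF high[of l] \<psi>] that by (simp add: distr_of_fun_def)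
      qed
    qed
    define c where "c = (if l \<le> 0 then 2 powr real_of_int l else 2 powr (- (real_of_int l * \<sigma>)))"
    have "c \<le> a l"
    proof (cases "l \<le> 0")
      case True
      then have "real_of_int l \<le> - \<tau> * \<bar>real_of_int l\<bar>" using \<tau> mult_right_mono[OF \<tau>(2), of "- real_of_int l"] by simp
      then show ?thesis using True by (simp add: c_def a_def)
    next
      case False
      then have "- (real_of_int l * \<sigma>) \<le> - \<tau> * \<bar>real_of_int l\<bar>" using mult_right_mono[OF \<tau>(3), of "real_of_int l"] by (simp add: mult.commute)
      then show ?thesis using False by (simp add: c_def a_def)
    qed
    then have "C * schwartz_seminorm N \<psi> * (c * H) \<le> C * schwartz_seminorm N \<psi> * (a l * H)"
      using C(1) sn0[OF \<psi>] H by (intro mult_left_mono mult_right_mono) auto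
    then show ?thesis using key(1)[OF c_def] by (simp add: mult_ac)
  qed
  have abs: "(\<lambda>l. norm (distr_of_fun (g l) \<psi>)) summable_on UNIV" if \<psi>: "\<psi> \<in> schwartz" for \<psi>
  proof (rule Infinite_Sum.abs_summable_on_comparison_test')
    show "(\<lambda>l. C * schwartz_seminorm N \<psi> * H * a l) summable_on UNIV" by (rule summable_on_cmult_right[OF a])
  qed (rule bound[OF \<psi>])
  show sum: "(\<lambda>l. distr_of_fun (g l) \<psi>) summable_on UNIV" if "\<psi> \<in> schwartz" for \<psi>
    by (rule abs_summable_summable[OF abs[OF that]])
  then show "distr_summable g" unfolding distr_summable_def using int by blast
  show "tempered (distr_sum g)" unfolding tempered_def
  proof (intro conjI ballI allI)
    fix \<psi> \<eta> :: "real^'d \<Rightarrow> complex" assume \<psi>: "\<psi> \<in> schwartz" and \<eta>: "\<eta> \<in> schwartz"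
    show "distr_sum g (\<lambda>x. \<psi> x + \<eta> x) = distr_sum g \<psi> + distr_sum g \<eta>"
      unfolding distr_sum_def infsum_add[OF sum[OF \<psi>] sum[OF \<eta>], symmetric]
      by (simp only: distr_of_fun_add[OF int[OF \<psi>] int[OF \<eta>]])
  next
    fix c and \<psi> :: "real^'d \<Rightarrow> complex" assume \<psi>: "\<psi> \<in> schwartz"
    show "distr_sum g (\<lambda>x. c * \<psi> x) = c * distr_sum g \<psi>"
      unfolding distr_sum_def distr_of_fun_cmult by (rule infsum_cmult_right) (rule sum[OF \<psi>])
  next
    define Z where "Z = infsum a UNIV"
    show "\<exists>C N. \<forall>\<psi>\<in>schwartz. norm (distr_sum g \<psi>) \<le> C * schwartz_seminorm N \<psi>"
    proof (intro exI ballI)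
      fix \<psi> :: "real^'d \<Rightarrow> complex" assume \<psi>: "\<psi> \<in> schwartz"
      have "norm (distr_sum g \<psi>) \<le> (\<Sum>\<^sub>\<infinity>l. norm (distr_of_fun (g l) \<psi>))"
        unfolding distr_sum_def by (rule norm_infsum_bound[OF abs[OF \<psi>]])
      also have "\<dots> \<le> (\<Sum>\<^sub>\<infinity>l. C * schwartz_seminorm N \<psi> * H * a l)"
        by (rule infsum_mono[OF abs[OF \<psi>] summable_on_cmult_right[OF a] bound[OF \<psi>]])
      also have "\<dots> = C * schwartz_seminorm N \<psi> * H * Z"
        unfolding Z_def by (rule infsum_cmult_right) (rule a)
      finally show "norm (distr_sum g \<psi>) \<le> (C * H * Z) * schwartz_seminorm N \<psi>" by (simp add: mult_ac)
    qed
  qed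
qed

lemma Lp_le_bounded_mult:
  assumes p: "1 \<le> p" and [measurable]: "f \<in> borel_measurable borel" and f: "\<And>x. norm (f x) \<le> c" and g: "Lp_le p g M"
  shows "Lp_le p (\<lambda>x. f x * g x) (c * M)"
proof -
  note [measurable] = Lp_leD(1)[OF g]
  have c: "0 \<le> c" by (rule order_trans[OF _ f[of 0]]) simp
  have "(\<integral>\<^sup>+x. ennreal (norm (f x * g x) powr p) \<partial>lborel) \<le> (\<integral>\<^sup>+x. ennreal (c powr p) * ennreal (norm (g x) powr p) \<partial>lborel)"
  proof (rule nn_integral_mono)
    fix x
    have "norm (f x * g x) powr p \<le> (c * norm (g x)) powr p"
      using p f c by (intro powr_mono2) (auto simp: norm_mult intro!: mult_right_mono)
    then show "ennreal (norm (f x * g x) powr p) \<le> ennreal (c powr p) * ennreal (norm (g x) powr p)"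
      using c by (simp add: powr_mult ennreal_mult[symmetric] ennreal_leI)
  qed
  also have "\<dots> = ennreal (c powr p) * (\<integral>\<^sup>+x. ennreal (norm (g x) powr p) \<partial>lborel)" by (rule nn_integral_cmult) simp
  also have "\<dots> \<le> ennreal (c powr p) * ennreal (M powr p)" by (intro mult_left_mono Lp_leD(3)[OF g]) simp
  also have "\<dots> = ennreal ((c * M) powr p)" using c Lp_leD(2)[OF g] by (simp add: powr_mult ennreal_mult[symmetric])
  finally show ?thesis unfolding Lp_le_def using c Lp_leD(2)[OF g] by auto
qed

lemma Lp_le_zero: "0 \<le> M \<Longrightarrow> 0 < p \<Longrightarrow> Lp_le p (\<lambda>x. 0) M"
  by (simp add: Lp_le_def)

text \<open>A crude form of the triangle inequality, sufficient for a bounded number of terms. It is \<open>Lp_le_series\<close> with the weights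
  \<open>2\<^sup>N 2\<^sup>-\<^sup>n\<close>, which are at least one for \<open>n < N\<close>.\<close>

lemma Lp_le_sum:
  fixes f :: "nat \<Rightarrow> real^'d::finite \<Rightarrow> complex"
  assumes p: "1 \<le> p" and f: "\<And>n. n < N \<Longrightarrow> Lp_le p (f n) M" and M: "0 \<le> M"
  shows "Lp_le p (\<lambda>x. \<Sum>n<N. f n x) (2 ^ Suc N * M)"
proof -
  define g where "g = (\<lambda>n. if n < N then f n else (\<lambda>x. 0))"
  define c where "c = (\<lambda>n::nat. 2 ^ N * (1 / 2) ^ n :: real)"
  have cs: "c sums (2 ^ N * (1 / (1 - 1 / 2)))" unfolding c_def by (intro sums_mult geometric_sums) simp
  have c0: "0 < c n" for n by (simp add: c_def)
  have g: "Lp_le p (g n) (c n * M)" for n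
  proof (cases "n < N")
    case True
    have "(2::real) ^ n \<le> 2 ^ N" using True by (intro power_increasing) auto
    then have "1 \<le> c n" by (simp add: c_def power_one_over)
    then have "M \<le> c n * M" using M mult_right_mono[of 1 "c n" M] by simp
    with Lp_le_mono[OF f[OF True]] p show ?thesis using True by (simp add: g_def)
  next
    case False
    then show ?thesis using c0[of n] M p by (simp add: g_def Lp_le_zero)
  qed
  have "Lp_le p (\<lambda>x. \<Sum>n<N. f n x) (suminf c * M)"
  proof (rule Lp_le_series[OF p g c0 sums_summable[OF cs] _ _ M])
    show "(\<lambda>x. \<Sum>n<N. f n x) \<in> borel_measurable borel"
      using Lp_leD(1)[OF f] by (intro borel_measurable_sum) auto
    fix x
    have "ennreal (norm (\<Sum>n<N. f n x)) \<le> ennreal (\<Sum>n<N. norm (f n x))" by (intro ennreal_leI norm_sum)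
    also have "\<dots> = (\<Sum>n<N. ennreal (norm (f n x)))" by (simp add: sum_ennreal)
    also have "\<dots> = (\<Sum>n<N. ennreal (norm (g n x)))" by (simp add: g_def)
    also have "\<dots> \<le> (\<Sum>n. ennreal (norm (g n x)))" by (intro sum_le_suminf) auto
    finally show "ennreal (norm (\<Sum>n<N. f n x)) \<le> (\<Sum>n. ennreal (norm (g n x)))" .
  qed
  then show ?thesis by (simp add: sums_unique[OF cs, symmetric] mult.commute)
qed

section \<open>Bernstein inequality and Besov norms\<close>

context littlewood_paley begin

lemma powi_powr: "(2::real) powi j = 2 powr real_of_int j"
  by (simp add: powr_real_of_int')

text \<open>Near the origin \<open>chi\<close> is invariant under halving its argument, since \<open>lp_phi chi\<close> vanishes there; hence it
  is equal to its value at the origin.\<close>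

lemma chi_eq_1: assumes "norm \<xi> < 3 / 4" shows "chi \<xi> = 1"
proof -
  have step: "chi ((1/2) ^ Suc n *\<^sub>R \<xi>) = chi ((1/2) ^ n *\<^sub>R \<xi>)" for n
  proof -
    have "norm ((1/2) ^ n *\<^sub>R \<xi>) \<le> norm \<xi>" by (simp add: power_le_one mult_left_le_one_le)
    then have "lp_phi chi ((1/2) ^ n *\<^sub>R \<xi>) = 0"
      using phi_support[of "(1/2) ^ n *\<^sub>R \<xi>"] assms by (cases "lp_phi chi ((1/2) ^ n *\<^sub>R \<xi>) = 0") auto
    then show ?thesis by (simp add: lp_phi_def)
  qed
  have c: "chi ((1/2) ^ n *\<^sub>R \<xi>) = chi \<xi>" for n
    by (induction n) (simp_all only: step, simp)
  have cc: "continuous_on UNIV chi"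
    by (intro continuous_at_imp_continuous_on ballI differentiable_imp_continuous_within smooth_differentiable[OF chi_smooth])
  have "(\<lambda>n. (1/2::real) ^ n) \<longlonglongrightarrow> 0" by (rule LIMSEQ_power_zero) simp
  from tendsto_scaleR[OF this tendsto_const[of \<xi>]] have "(\<lambda>n. (1/2) ^ n *\<^sub>R \<xi>) \<longlonglongrightarrow> 0" by (simp only: scaleR_zero_left)
  then have "(\<lambda>n. chi ((1/2) ^ n *\<^sub>R \<xi>)) \<longlonglongrightarrow> chi 0"
    by (rule continuous_on_tendsto_compose[OF cc]) auto
  then have "(\<lambda>n. chi \<xi>) \<longlonglongrightarrow> 1" by (simp only: c chi_0)
  then show ?thesis by (simp add: LIMSEQ_const_iff)
qed

lemma low_symbol_eq_1: assumes "norm \<xi> < 2 powi j * (3 / 4)" shows "low_symbol j \<xi> = 1"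
proof -
  have "norm (2 powi (- j) *\<^sub>R \<xi>) < 3 / 4"
    unfolding powi_norm pos_divide_less_eq[OF powi_pos] using assms by (simp only: mult.commute)
  from chi_eq_1[OF this] show ?thesis by (simp only: low_symbol_def of_real_1)
qed

lemma powi_shift: "(2::real) powi (j + k) = 2 powi j * 2 powi k"
  by (simp add: power_int_add)

text \<open>The symbol of the sum of three adjacent blocks, a partition of unity on the support of the middle one.\<close>

definition wide_symbol :: "int \<Rightarrow> real^'d \<Rightarrow> complex" where
  "wide_symbol l \<xi> = low_symbol (l + 2) \<xi> - low_symbol (l - 1) \<xi>"

lemma schwartz_wide_symbol: "wide_symbol l \<in> schwartz"
proof -
  have "wide_symbol l = (\<lambda>\<xi>. low_symbol (l + 2) \<xi> - low_symbol (l - 1) \<xi>)" by (rule ext) (rule wide_symbol_def)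
  then show ?thesis by (simp only: schwartz_diff[OF schwartz_low_symbol schwartz_low_symbol])
qed

lemma wide_symbol_eq: "wide_symbol l \<xi> = dyadic_symbol (l - 1) \<xi> + dyadic_symbol l \<xi> + dyadic_symbol (l + 1) \<xi>"
proof -
  have e: "l - 1 + 1 = l" "l + 1 + 1 = l + 2" by auto
  show ?thesis unfolding wide_symbol_def dyadic_symbol_eq e by simp
qed

lemma dyadic_symbol_wide_symbol: "dyadic_symbol l \<xi> * wide_symbol l \<xi> = dyadic_symbol l \<xi>"
proof (cases "dyadic_symbol l \<xi> = 0")
  case False
  note s = dyadic_symbol_support[OF False]
  have pl: "0 < (2::real) powi l" by (rule powi_pos)
  have "(2::real) powi (l + 2) = 2 powi l * 4" by (simp add: powi_shift)
  then have "norm \<xi> < 2 powi (l + 2) * (3 / 4)" using s pl by linarith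
  then have 1: "low_symbol (l + 2) \<xi> = 1" by (rule low_symbol_eq_1)
  have "(2::real) powi (l - 1) = 2 powi l / 2" using powi_shift[of l "- 1"] by simp
  then have "2 powi (l - 1) * (4 / 3) < norm \<xi>" using s pl by linarith
  then have "\<not> norm \<xi> \<le> 2 powi (l - 1) * (4 / 3)" by simp
  then have "low_symbol (l - 1) \<xi> = 0" using low_symbol_support[of "l - 1" \<xi>] by blast
  then show ?thesis by (simp add: wide_symbol_def 1)
qed simp

lemma dyadic_symbol_disjoint: assumes "l + 2 \<le> j \<or> j + 2 \<le> l" shows "dyadic_symbol l \<xi> * dyadic_symbol j \<xi> = 0"
proof (rule ccontr)
  assume "dyadic_symbol l \<xi> * dyadic_symbol j \<xi> \<noteq> 0"
  then have n: "dyadic_symbol l \<xi> \<noteq> 0" "dyadic_symbol j \<xi> \<noteq> 0" by auto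
  have far: "(2::real) powi a * 4 \<le> 2 powi b" if "a + 2 \<le> b" for a b :: int
  proof -
    have "(2::real) powi (a + 2) \<le> 2 powi b" using that by (intro power_int_increasing) auto
    then show ?thesis by (simp add: powi_shift)
  qed
  show False using assms
  proof
    assume "l + 2 \<le> j"
    from far[OF this] dyadic_symbol_support(2)[OF n(1)] dyadic_symbol_support(1)[OF n(2)] powi_pos[of l] show False by simp
  next
    assume "j + 2 \<le> l"
    from far[OF this] dyadic_symbol_support(2)[OF n(2)] dyadic_symbol_support(1)[OF n(1)] powi_pos[of j] show False by simp
  qed
qed

lemma multiplier_Ker_shift:
  assumes m: "m \<in> schwartz" and \<mu>: "\<mu> \<in> schwartz"
  shows "fourier (\<lambda>\<xi>. m \<xi> * inverse_fourier (\<lambda>x. Ker \<mu> (x - y)) \<xi>) = (\<lambda>x. Ker (\<lambda>\<xi>. m \<xi> * \<mu> \<xi>) (x - (y::real^'d)))"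
proof -
  have mm: "(\<lambda>\<xi>. m \<xi> * \<mu> \<xi>) \<in> schwartz" by (rule schwartz_mult[OF m \<mu>])
  have "(\<lambda>\<xi>. m \<xi> * inverse_fourier (\<lambda>x. Ker \<mu> (x - y)) \<xi>) = inverse_fourier (\<lambda>x. Ker (\<lambda>\<xi>. m \<xi> * \<mu> \<xi>) (x - y))"
    unfolding inverse_fourier_Ker_shift[OF \<mu>] inverse_fourier_Ker_shift[OF mm] by (simp only: mult_ac)
  then show ?thesis by (simp only: fourier_inverse_fourier[OF schwartz_shift[OF schwartz_Ker[OF mm]]])
qed

text \<open>Composition of multipliers. With \<open>m' = m\<close>, that is, \<open>\<mu> = 1\<close> on the support of \<open>m\<close>, it is a reproducing formula for blocks.\<close>

lemma tconv_reproducing: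
  assumes u: "tempered u" and m: "m \<in> schwartz" and \<mu>: "\<mu> \<in> schwartz" and e: "\<And>\<xi>. m \<xi> * \<mu> \<xi> = m' \<xi>"
  shows "tconv u (Ker m') (y::real^'d) = (LINT x|lborel. tconv u (Ker m) x * Ker \<mu> (x - y))"
  using multiplier_representation[OF u m schwartz_shift[OF schwartz_Ker[OF \<mu>]], of y]
  unfolding multiplier_Ker_shift[OF m \<mu>] e by (simp add: tconv_def)

lemma dyadic_symbol_scale: "dyadic_symbol j = (\<lambda>\<xi>. dyadic_symbol 0 (2 powi (- j) *\<^sub>R \<xi>))"
  by (simp add: fun_eq_iff dyadic_symbol_def)

lemma wide_symbol_scale: "wide_symbol j = (\<lambda>\<xi>. wide_symbol 0 (2 powi (- j) *\<^sub>R \<xi>))"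
proof
  fix \<xi>
  have e: "(2::real) powi (- (0 + k)) * 2 powi (- j) = 2 powi (- (j + k))" for k
    unfolding powi_shift[symmetric] by (rule arg_cong[where f = "(powi) 2"]) simp
  have e': "(2::real) powi (- (0 - 1)) * 2 powi (- j) = 2 powi (- (j - 1))"
    unfolding powi_shift[symmetric] by (rule arg_cong[where f = "(powi) 2"]) simp
  show "wide_symbol j \<xi> = wide_symbol 0 (2 powi (- j) *\<^sub>R \<xi>)"
    unfolding wide_symbol_def low_symbol_def scaleR_scaleR e e' ..
qed

lemma Ker_dyadic_bounds:
  assumes m: "m \<in> schwartz"
  obtains W S where "0 < W" "0 < S"
    "\<And>j. (\<integral>\<^sup>+x. ennreal (norm (Ker (\<lambda>\<xi>. m (2 powi (- j) *\<^sub>R \<xi>)) (x - y))) \<partial>lborel) \<le> ennreal W"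
    "\<And>j x. norm (Ker (\<lambda>\<xi>. m (2 powi (- j) *\<^sub>R \<xi>)) (x::real^'d)) \<le> S * 2 powr (real_of_int j * real CARD('d))"
proof -
  obtain W S where WS: "0 < W" "0 < S"
    "\<And>e. 0 < e \<Longrightarrow> (\<integral>\<^sup>+x. ennreal (norm (Ker (\<lambda>\<xi>. m (e *\<^sub>R \<xi>)) x)) \<partial>lborel) \<le> ennreal W"
    "\<And>e x. 0 < e \<Longrightarrow> norm (Ker (\<lambda>\<xi>. m (e *\<^sub>R \<xi>)) x) \<le> S / e ^ CARD('d)"
    using kernel_bounds[OF m] by blast
  have e: "S / (2 powi (- j)) ^ CARD('d) = S * 2 powr (real_of_int j * real CARD('d))" for j
  proof -
    have "(2::real) powi (- j) = 2 powr (- real_of_int j)" by (simp only: powi_powr of_int_minus)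
    then have "((2::real) powi (- j)) ^ CARD('d) = 2 powr (- (real_of_int j * real CARD('d)))"
      by (simp add: powr_realpow[symmetric] powr_powr)
    then show ?thesis by (simp add: powr_minus divide_inverse)
  qed
  show ?thesis
  proof (rule that[OF WS(1,2)])
    fix j
    have "Ker (\<lambda>\<xi>. m (2 powi (- j) *\<^sub>R \<xi>)) \<in> borel_measurable borel"
    proof -
      have "(\<lambda>\<xi>. m (2 powi (- j) *\<^sub>R \<xi> + 0)) \<in> schwartz" by (rule schwartz_affine[OF m]) simp
      then show ?thesis by (intro schwartz_measurable schwartz_Ker) simp
    qed
    from nn_integral_reflect_shift(2)[OF this]
    show "(\<integral>\<^sup>+x. ennreal (norm (Ker (\<lambda>\<xi>. m (2 powi (- j) *\<^sub>R \<xi>)) (x - y))) \<partial>lborel) \<le> ennreal W"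
      using WS(3)[OF powi_pos[of "- j"]] by simp
  next
    fix j and x :: "real^'d"
    show "norm (Ker (\<lambda>\<xi>. m (2 powi (- j) *\<^sub>R \<xi>)) x) \<le> S * 2 powr (real_of_int j * real CARD('d))"
      using WS(4)[OF powi_pos[of "- j"], of x] unfolding e .
  qed
qed

text \<open>A block reproduces itself under the wider multiplier, whose kernel has bounded integral and a supremum of order \<open>2\<^sup>l\<^sup>d\<close>. Duality with
  this kernel gives the factor \<open>2 powr (l d / p)\<close>.\<close>

lemma bernstein:
  assumes p: "1 \<le> p"
  obtains C where "0 < C" "\<And>u l M y. tempered u \<Longrightarrow> Lp_le p (tconv u (Ker (dyadic_symbol l))) M \<Longrightarrow>
     norm (tconv u (Ker (dyadic_symbol l)) (y::real^'d)) \<le> C * 2 powr (real_of_int l * (real CARD('d) / p)) * M"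
proof -
  obtain W S where WS: "0 < W" "0 < S"
    "\<And>j. (\<integral>\<^sup>+x. ennreal (norm (Ker (\<lambda>\<xi>. wide_symbol 0 (2 powi (- j) *\<^sub>R \<xi>)) (x - 0))) \<partial>lborel) \<le> ennreal W"
    "\<And>j x. norm (Ker (\<lambda>\<xi>. wide_symbol 0 (2 powi (- j) *\<^sub>R \<xi>)) (x::real^'d)) \<le> S * 2 powr (real_of_int j * real CARD('d))"
    using Ker_dyadic_bounds[OF schwartz_wide_symbol[of 0], of 0] by blast
  define C where "C = (W powr (p - 1) * S) powr (1 / p)"
  have "0 < C" using WS by (simp add: C_def)
  then show ?thesis
  proof (rule that)
    fix u l M and y :: "real^'d" assume u: "tempered u" and f: "Lp_le p (tconv u (Ker (dyadic_symbol l))) M"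
    have K: "Ker (wide_symbol l) \<in> borel_measurable borel" by (intro schwartz_measurable schwartz_Ker schwartz_wide_symbol)
    have Ky: "(\<lambda>x. Ker (wide_symbol l) (x - y)) \<in> borel_measurable borel"
      by (intro schwartz_measurable schwartz_shift[of "Ker (wide_symbol l)"] schwartz_Ker schwartz_wide_symbol)
    have 1: "(\<integral>\<^sup>+x. ennreal (norm (Ker (wide_symbol l) (x - y))) \<partial>lborel) \<le> ennreal W"
      using WS(3)[of l] unfolding wide_symbol_scale[symmetric] nn_integral_reflect_shift(2)[OF K] .
    have 2: "norm (Ker (wide_symbol l) (x - y)) \<le> S * 2 powr (real_of_int l * real CARD('d))" for x
      using WS(4)[of l "x - y"] unfolding wide_symbol_scale[symmetric] .
    have Sp: "0 < S * 2 powr (real_of_int l * real CARD('d))" using WS by simp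
    have "norm (tconv u (Ker (dyadic_symbol l)) y) \<le> (W powr (p - 1) * (S * 2 powr (real_of_int l * real CARD('d)))) powr (1 / p) * M"
      by (subst tconv_reproducing[OF u schwartz_dyadic_symbol schwartz_wide_symbol dyadic_symbol_wide_symbol]) (rule Lp_le_pairing(3)[OF p f Ky WS(1) 1 Sp 2])
    also have "(W powr (p - 1) * (S * 2 powr (real_of_int l * real CARD('d)))) powr (1 / p) = C * 2 powr (real_of_int l * (real CARD('d) / p))"
      unfolding C_def mult.assoc[symmetric] using WS by (simp add: powr_mult powr_powr)
    finally show "norm (tconv u (Ker (dyadic_symbol l)) y) \<le> C * 2 powr (real_of_int l * (real CARD('d) / p)) * M" .
  qed
qed

lemma tempered_mod_polyE:
  assumes "a \<in> tempered_mod_poly" "u \<in> a"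
  shows "tempered u" "a = poly_equiv `` {u}"
proof -
  obtain u0 where u0: "tempered u0" "a = poly_equiv `` {u0}"
    using assms(1) unfolding tempered_mod_poly_def by (auto elim: quotientE)
  have r: "(u0, u) \<in> poly_equiv" using assms(2) u0(2) by simp
  then show "tempered u" unfolding poly_equiv_iff by simp
  show "a = poly_equiv `` {u}"
    unfolding u0(2) by (rule equiv_class_eq[OF equiv_poly_equiv r])
qed

lemma tempered_mod_poly_some: "a \<in> tempered_mod_poly \<Longrightarrow> (SOME u. u \<in> a) \<in> a"
  unfolding tempered_mod_poly_def by (metis equiv_poly_equiv in_quotient_imp_non_empty some_in_eq)

lemma block_eq:
  assumes a: "a \<in> tempered_mod_poly" "u \<in> a"
  shows "block chi j a = tconv u (Ker (dyadic_symbol j))"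
proof -
  define v where "v = (SOME u. u \<in> a)"
  have v: "v \<in> a" unfolding v_def by (rule tempered_mod_poly_some[OF a(1)])
  have "(v, u) \<in> poly_equiv" using a(2) tempered_mod_polyE(2)[OF a(1) v] by simp
  then have e: "Delta chi j v \<psi> = Delta chi j u \<psi>" if "\<psi> \<in> schwartz" for \<psi> by (rule Delta_poly_equiv[OF _ that])
  have "represented_by (Delta chi j v) (tconv u (Ker (dyadic_symbol j)))"
    by (rule represented_by_cong[OF represented_by_Delta[OF tempered_mod_polyE(1)[OF a]] e])
  then show ?thesis unfolding block_def v_def[symmetric] by (rule fun_of_distr_eq)
qed

lemma besov_norm_infinity:
  "besov_norm chi s q \<infinity> f = (SUP j::int. ennreal (2 powr (real_of_int j * s)) * Lp_norm q lborel (\<lambda>x. ennreal (norm (block chi j f x))))"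
  unfolding besov_norm_def Lp_norm_infinity_count_space ..

lemma besov_block_bound:
  assumes p: "1 \<le> p" and a: "a \<in> besov chi s (ennreal p) \<infinity>"
  shows "a \<in> tempered_mod_poly" "besov_norm chi s (ennreal p) \<infinity> a = ennreal (enn2real (besov_norm chi s (ennreal p) \<infinity> a))"
    "u \<in> a \<Longrightarrow> Lp_le p (tconv u (Ker (dyadic_symbol j))) (2 powr (- (real_of_int j * s)) * enn2real (besov_norm chi s (ennreal p) \<infinity> a))"
proof -
  show t: "a \<in> tempered_mod_poly" using a by (simp add: besov_def)
  define A where "A = enn2real (besov_norm chi s (ennreal p) \<infinity> a)"
  have fin: "besov_norm chi s (ennreal p) \<infinity> a < \<infinity>" using a by (simp add: besov_def)
  then show eq: "besov_norm chi s (ennreal p) \<infinity> a = ennreal A" by (simp add: A_def)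
  assume u: "u \<in> a"
  define L where "L = Lp_norm (ennreal p) lborel (\<lambda>x. ennreal (norm (tconv u (Ker (dyadic_symbol j)) x)))"
  have "ennreal (2 powr (real_of_int j * s)) * L \<le> ennreal A"
    unfolding eq[symmetric] besov_norm_infinity L_def block_eq[OF t u, symmetric] by (rule SUP_upper) simp
  then have "ennreal (2 powr (- (real_of_int j * s))) * (ennreal (2 powr (real_of_int j * s)) * L) \<le> ennreal (2 powr (- (real_of_int j * s))) * ennreal A"
    by (rule mult_left_mono) simp
  moreover have "ennreal (2 powr (- (real_of_int j * s))) * ennreal (2 powr (real_of_int j * s)) = 1"
    by (simp add: ennreal_mult[symmetric] powr_add[symmetric])
  ultimately have "L \<le> ennreal (2 powr (- (real_of_int j * s)) * A)"
    by (simp add: mult.assoc[symmetric] ennreal_mult A_def)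
  moreover have "tconv u (Ker (dyadic_symbol j)) \<in> borel_measurable borel"
    by (intro borel_measurable_continuous_onI tconv_continuous tempered_mod_polyE(1)[OF t u] schwartz_Ker schwartz_dyadic_symbol)
  moreover have "0 \<le> 2 powr (- (real_of_int j * s)) * A" by (simp add: A_def)
  ultimately show "Lp_le p (tconv u (Ker (dyadic_symbol j))) (2 powr (- (real_of_int j * s)) * A)"
    unfolding L_def using Lp_le_iff_Lp_norm[OF p] by blast
qed

end

section \<open>Realization of a class modulo polynomials\<close>

text \<open>Distributions are compared on a common seminorm, which requires monotonicity in its order.\<close>

lemma tempered_seminorm_bound:
  fixes v :: "'d::finite functional"
  assumes "tempered v"
  obtains C N where "0 \<le> C" "\<And>M \<psi>. N \<le> M \<Longrightarrow> \<psi> \<in> schwartz \<Longrightarrow> norm (v \<psi>) \<le> C * schwartz_seminorm M \<psi>"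
proof -
  obtain C N where C: "0 \<le> C"
    "\<And>\<psi> B. \<psi> \<in> schwartz \<Longrightarrow>
       (\<And>x is. length is \<le> N \<Longrightarrow> (1 + norm x) ^ N * norm (iterated_partial is \<psi> x) \<le> B) \<Longrightarrow> norm (v \<psi>) \<le> C * B"
    using tempered_bound[OF assms] by blast
  show ?thesis
  proof (rule that[OF C(1)])
    fix M and \<psi> :: "real^'d \<Rightarrow> complex" assume M: "N \<le> M" and \<psi>: "\<psi> \<in> schwartz"
    show "norm (v \<psi>) \<le> C * schwartz_seminorm M \<psi>"
    proof (rule C(2)[OF \<psi>])
      fix x :: "real^'d" and "is" :: "'d list" assume "length is \<le> N"
      then have l: "length is \<le> M" using M by simp
      have "(1 + norm x) ^ N \<le> (1 + norm x) ^ M" using M by (intro power_increasing) auto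
      then have "(1 + norm x) ^ N * norm (iterated_partial is \<psi> x) \<le> (1 + norm x) ^ M * norm (iterated_partial is \<psi> x)"
        by (rule mult_right_mono) simp
      also have "\<dots> \<le> schwartz_seminorm M \<psi>" by (rule schwartz_seminorm_bound[OF \<psi> l])
      finally show "(1 + norm x) ^ N * norm (iterated_partial is \<psi> x) \<le> schwartz_seminorm M \<psi>" .
    qed
  qed
qed

lemma tempered_fun_lincomb:
  fixes u v :: "'d::finite functional"
  assumes u: "tempered u" and v: "tempered v"
  shows "tempered (\<lambda>\<psi>. u \<psi> + k * v \<psi>)"
  unfolding tempered_def
proof (intro conjI ballI allI)
  fix \<psi> \<eta> :: "real^'d \<Rightarrow> complex" assume "\<psi> \<in> schwartz" "\<eta> \<in> schwartz"
  then show "u (\<lambda>x. \<psi> x + \<eta> x) + k * v (\<lambda>x. \<psi> x + \<eta> x) = u \<psi> + k * v \<psi> + (u \<eta> + k * v \<eta>)"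
    by (simp add: tempered_add[OF u] tempered_add[OF v] algebra_simps)
next
  fix c and \<psi> :: "real^'d \<Rightarrow> complex" assume "\<psi> \<in> schwartz"
  then show "u (\<lambda>x. c * \<psi> x) + k * v (\<lambda>x. c * \<psi> x) = c * (u \<psi> + k * v \<psi>)"
    by (simp add: tempered_cmult[OF u] tempered_cmult[OF v] algebra_simps)
next
  obtain C N where C: "0 \<le> C" "\<And>M \<psi>. N \<le> M \<Longrightarrow> \<psi> \<in> schwartz \<Longrightarrow> norm (u \<psi>) \<le> C * schwartz_seminorm M \<psi>"
    using tempered_seminorm_bound[OF u] by blast
  obtain C' N' where C': "0 \<le> C'" "\<And>M \<psi>. N' \<le> M \<Longrightarrow> \<psi> \<in> schwartz \<Longrightarrow> norm (v \<psi>) \<le> C' * schwartz_seminorm M \<psi>"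
    using tempered_seminorm_bound[OF v] by blast
  show "\<exists>C N. \<forall>\<psi>\<in>schwartz. norm (u \<psi> + k * v \<psi>) \<le> C * schwartz_seminorm N \<psi>"
  proof (intro exI ballI)
    fix \<psi> :: "real^'d \<Rightarrow> complex" assume \<psi>: "\<psi> \<in> schwartz"
    have "norm (u \<psi> + k * v \<psi>) \<le> norm (u \<psi>) + norm k * norm (v \<psi>)"
      by (rule order_trans[OF norm_triangle_ineq]) (simp add: norm_mult)
    also have "\<dots> \<le> C * schwartz_seminorm (max N N') \<psi> + norm k * (C' * schwartz_seminorm (max N N') \<psi>)"
      by (intro add_mono mult_left_mono C(2) C'(2) \<psi>) auto
    also have "\<dots> = (C + norm k * C') * schwartz_seminorm (max N N') \<psi>" by (simp add: algebra_simps)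
    finally show "norm (u \<psi> + k * v \<psi>) \<le> (C + norm k * C') * schwartz_seminorm (max N N') \<psi>" .
  qed
qed

lemma summable_on_interval_approx:
  fixes c :: "int \<Rightarrow> complex"
  assumes c: "c summable_on UNIV" and e: "0 < e"
  obtains m0 k0 where "\<And>m k. m \<le> m0 \<Longrightarrow> k0 \<le> k \<Longrightarrow> norm (sum c {m..<k} - infsum c UNIV) < e"
proof -
  have "((\<lambda>F. sum c F) \<longlongrightarrow> infsum c UNIV) (finite_subsets_at_top UNIV)"
    using has_sum_infsum[OF c] by (simp add: has_sum_def)
  from tendstoD[OF this e] obtain F0 where F0: "finite F0" "\<And>F. finite F \<Longrightarrow> F0 \<subseteq> F \<Longrightarrow> dist (sum c F) (infsum c UNIV) < e"
    unfolding eventually_finite_subsets_at_top by auto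
  show ?thesis
  proof (rule that[of "Min (insert 0 F0)" "Max (insert 0 F0) + 1"])
    fix m k assume m: "m \<le> Min (insert 0 F0)" and k: "Max (insert 0 F0) + 1 \<le> k"
    have "F0 \<subseteq> {m..<k}"
    proof
      fix x assume x: "x \<in> F0"
      have "Min (insert 0 F0) \<le> x" "x \<le> Max (insert 0 F0)" using x F0(1) by (auto intro!: Min_le Max_ge)
      then show "x \<in> {m..<k}" using m k by simp
    qed
    then show "norm (sum c {m..<k} - infsum c UNIV) < e" using F0(2)[of "{m..<k}"] by (simp add: dist_norm)
  qed
qed

context littlewood_paley begin

text \<open>The low-frequency cut-off grows by one block at each step.\<close>

lemma low_cut_telescope:
  assumes u: "tempered u" and \<psi>: "\<psi> \<in> schwartz" and "m \<le> k"
  shows "low_cut chi k u \<psi> = low_cut chi m u \<psi> + (\<Sum>l\<in>{m..<k}. Delta chi l u \<psi>)"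
  using \<open>m \<le> k\<close>
proof (induction k rule: int_ge_induct)
  case (step k)
  have "{m..<k + 1} = insert k {m..<k}" using step(1) by auto
  then show ?case using step(2) low_cut_Suc[OF u \<psi>, of k] by simp
qed simp

lemma Delta_Delta:
  assumes \<psi>: "\<psi> \<in> schwartz"
  shows "Delta chi l u (fourier (\<lambda>\<xi>. dyadic_symbol j \<xi> * inverse_fourier \<psi> \<xi>))
    = u (fourier (\<lambda>\<xi>. dyadic_symbol l \<xi> * (dyadic_symbol j \<xi> * inverse_fourier \<psi> \<xi>)))"
  unfolding Delta_apply
  by (simp only: inverse_fourier_fourier[OF schwartz_mult[OF schwartz_dyadic_symbol schwartz_inverse_fourier[OF \<psi>]]])

lemma sum_Delta_Delta:
  assumes u: "tempered u" and \<psi>: "\<psi> \<in> schwartz"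
  shows "(\<Sum>l\<in>{j - 1, j, j + 1}. Delta chi l u (fourier (\<lambda>\<xi>. dyadic_symbol j \<xi> * inverse_fourier \<psi> \<xi>))) = Delta chi j u \<psi>"
proof -
  define \<eta> where "\<eta> = (\<lambda>\<xi>. dyadic_symbol j \<xi> * inverse_fourier \<psi> \<xi>)"
  have \<eta>: "\<eta> \<in> schwartz" unfolding \<eta>_def by (intro schwartz_mult schwartz_dyadic_symbol schwartz_inverse_fourier \<psi>)
  have S: "(\<lambda>\<xi>. dyadic_symbol l \<xi> * \<eta> \<xi>) \<in> schwartz" for l by (intro schwartz_mult schwartz_dyadic_symbol \<eta>)
  note F = schwartz_fourier[OF S]
  have e: "(\<lambda>\<xi>. dyadic_symbol (j - 1) \<xi> * \<eta> \<xi> + dyadic_symbol j \<xi> * \<eta> \<xi> + dyadic_symbol (j + 1) \<xi> * \<eta> \<xi>) = \<eta>"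
  proof
    fix \<xi>
    have "dyadic_symbol (j - 1) \<xi> * \<eta> \<xi> + dyadic_symbol j \<xi> * \<eta> \<xi> + dyadic_symbol (j + 1) \<xi> * \<eta> \<xi> = (dyadic_symbol j \<xi> * wide_symbol j \<xi>) * inverse_fourier \<psi> \<xi>"
      unfolding wide_symbol_eq \<eta>_def by (simp add: algebra_simps)
    then show "dyadic_symbol (j - 1) \<xi> * \<eta> \<xi> + dyadic_symbol j \<xi> * \<eta> \<xi> + dyadic_symbol (j + 1) \<xi> * \<eta> \<xi> = \<eta> \<xi>"
      unfolding dyadic_symbol_wide_symbol by (simp only: \<eta>_def)
  qed
  have f: "fourier \<eta> x = fourier (\<lambda>\<xi>. dyadic_symbol (j - 1) \<xi> * \<eta> \<xi>) x + fourier (\<lambda>\<xi>. dyadic_symbol j \<xi> * \<eta> \<xi>) x + fourier (\<lambda>\<xi>. dyadic_symbol (j + 1) \<xi> * \<eta> \<xi>) x" for x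
    by (subst e[symmetric]) (simp only: fourier_add[OF schwartz_integrable[OF schwartz_add[OF S S]] schwartz_integrable[OF S]]
         fourier_add[OF schwartz_integrable[OF S] schwartz_integrable[OF S]])
  have "u (fourier \<eta>) = u (\<lambda>x. fourier (\<lambda>\<xi>. dyadic_symbol (j - 1) \<xi> * \<eta> \<xi>) x + fourier (\<lambda>\<xi>. dyadic_symbol j \<xi> * \<eta> \<xi>) x + fourier (\<lambda>\<xi>. dyadic_symbol (j + 1) \<xi> * \<eta> \<xi>) x)"
    by (rule arg_cong[where f = u]) (rule ext, rule f)
  also have "\<dots> = u (fourier (\<lambda>\<xi>. dyadic_symbol (j - 1) \<xi> * \<eta> \<xi>)) + u (fourier (\<lambda>\<xi>. dyadic_symbol j \<xi> * \<eta> \<xi>)) + u (fourier (\<lambda>\<xi>. dyadic_symbol (j + 1) \<xi> * \<eta> \<xi>))"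
    by (simp only: tempered_add[OF u schwartz_add[OF F F] F] tempered_add[OF u F F])
  finally have "Delta chi j u \<psi> = u (fourier (\<lambda>\<xi>. dyadic_symbol (j - 1) \<xi> * \<eta> \<xi>)) + u (fourier (\<lambda>\<xi>. dyadic_symbol j \<xi> * \<eta> \<xi>)) + u (fourier (\<lambda>\<xi>. dyadic_symbol (j + 1) \<xi> * \<eta> \<xi>))"
    by (simp only: Delta_apply \<eta>_def)
  then show ?thesis unfolding Delta_Delta[OF \<psi>] \<eta>_def by simp
qed

lemma Delta_Delta_disjoint:
  assumes u: "tempered u" and \<psi>: "\<psi> \<in> schwartz" and l: "l + 2 \<le> j \<or> j + 2 \<le> l"
  shows "Delta chi l u (fourier (\<lambda>\<xi>. dyadic_symbol j \<xi> * inverse_fourier \<psi> \<xi>)) = 0"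
proof -
  have "(\<lambda>\<xi>. dyadic_symbol l \<xi> * (dyadic_symbol j \<xi> * inverse_fourier \<psi> \<xi>)) = (\<lambda>\<xi>. 0)"
    by (rule ext) (simp only: mult.assoc[symmetric] dyadic_symbol_disjoint[OF l] mult_zero_left)
  moreover have "fourier (\<lambda>\<xi>::real^'d. 0) = (\<lambda>x. 0)" by (simp add: fourier_def fun_eq_iff)
  ultimately show ?thesis unfolding Delta_Delta[OF \<psi>] by (simp only: tempered_zero[OF u])
qed

text \<open>The sum \<open>w\<close> of all blocks of \<open>a\<close> is the representative sought. It converges by \<open>distr_sum_tempered\<close>. It has
  the same blocks as \<open>a\<close>, because in \<open>\<Delta>\<^sub>j w\<close> only the three neighbours of \<open>j\<close> survive; so it differs from an element of \<open>a\<close> by a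
  polynomial. Its cut-offs vanish in the limit because \<open>\<Sum>\<^sub>l\<^sub>\<ge>\<^sub>m \<Delta>\<^sub>l w\<close> tends to \<open>w\<close>, the sum of the whole series, as \<open>m\<close>
  decreases, and is also \<open>w\<close> minus its cut-off at \<open>m\<close>.\<close>

lemma realization_exists:
  assumes a: "a \<in> tempered_mod_poly" and p: "1 \<le> p" and \<sigma>: "0 < \<sigma>" and H: "0 \<le> H"
    and low: "\<And>l x. l \<le> 0 \<Longrightarrow> norm (block chi l a x) \<le> 2 powr real_of_int l * H"
    and high: "\<And>l. Lp_le p (block chi l a) (2 powr (- (real_of_int l * \<sigma>)) * H)"
  shows "\<exists>w. w \<in> a \<and> vanishes_at_low_freq chi w"
proof -
  define u where "u = (SOME u. u \<in> a)"
  have u: "u \<in> a" unfolding u_def by (rule tempered_mod_poly_some[OF a])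
  note tu = tempered_mod_polyE(1)[OF a u]
  define g where "g = (\<lambda>l. block chi l a)"
  define w where "w = distr_sum g"
  have low': "\<And>l x. l \<le> 0 \<Longrightarrow> norm (g l x) \<le> 2 powr real_of_int l * H" and high': "\<And>l. Lp_le p (g l) (2 powr (- (real_of_int l * \<sigma>)) * H)"
    unfolding g_def by (fact low, fact high)
  note D = distr_sum_tempered[OF p \<sigma> H low' high']
  have tw: "tempered w" unfolding w_def by (rule D(2)) simp_all
  have sm: "(\<lambda>l. distr_of_fun (g l) \<psi>) summable_on UNIV" if "\<psi> \<in> schwartz" for \<psi>
    by (rule D(3)) (simp_all add: that)
  have gD: "distr_of_fun (g l) \<psi> = Delta chi l u \<psi>" if "\<psi> \<in> schwartz" for l \<psi>
    using represented_by_Delta[OF tu, of l] that unfolding represented_by_def g_def block_eq[OF a u] by simp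
  have w_eq: "w \<psi> = (\<Sum>\<^sub>\<infinity>l. Delta chi l u \<psi>)" if "\<psi> \<in> schwartz" for \<psi>
    unfolding w_def distr_sum_def gD[OF that] ..
  have Dw: "Delta chi j w \<psi> = Delta chi j u \<psi>" if \<psi>: "\<psi> \<in> schwartz" for j \<psi>
  proof -
    define \<psi>' where "\<psi>' = fourier (\<lambda>\<xi>. dyadic_symbol j \<xi> * inverse_fourier \<psi> \<xi>)"
    have \<psi>': "\<psi>' \<in> schwartz" unfolding \<psi>'_def by (rule schwartz_multiplier[OF schwartz_dyadic_symbol \<psi>])
    have "Delta chi j w \<psi> = w \<psi>'" by (simp only: Delta_apply \<psi>'_def)
    also have "\<dots> = (\<Sum>\<^sub>\<infinity>l. Delta chi l u \<psi>')" by (rule w_eq[OF \<psi>'])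
    also have "\<dots> = (\<Sum>\<^sub>\<infinity>l\<in>{j - 1, j, j + 1}. Delta chi l u \<psi>')"
    proof (rule infsum_cong_neutral)
      fix l assume "l \<in> UNIV - {j - 1, j, j + 1}"
      then have "l + 2 \<le> j \<or> j + 2 \<le> l" by auto
      from Delta_Delta_disjoint[OF tu \<psi> this] show "Delta chi l u \<psi>' = 0" by (simp only: \<psi>'_def)
    qed auto
    also have "\<dots> = (\<Sum>l\<in>{j - 1, j, j + 1}. Delta chi l u \<psi>')" by (rule infsum_finite) simp
    also have "\<dots> = Delta chi j u \<psi>" unfolding \<psi>'_def by (rule sum_Delta_Delta[OF tu \<psi>])
    finally show ?thesis .
  qed
  have "tempered (\<lambda>\<psi>. u \<psi> + (- 1) * w \<psi>)" by (rule tempered_fun_lincomb[OF tu tw])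
  then have td: "tempered (\<lambda>\<psi>. u \<psi> - w \<psi>)" by simp
  have "Delta chi j (\<lambda>\<psi>. u \<psi> - w \<psi>) \<psi> = 0" if "\<psi> \<in> schwartz" for j \<psi>
    using Dw[OF that, of j] unfolding Delta_apply by simp
  from polynomial_if_Delta_vanish[OF td this] have "(u, w) \<in> poly_equiv"
    unfolding poly_equiv_iff using tu tw by blast
  then have wa: "w \<in> a" using tempered_mod_polyE(2)[OF a u] by simp
  have "((\<lambda>j. low_cut chi j w \<psi>) \<longlongrightarrow> 0) at_bot" if \<psi>: "\<psi> \<in> schwartz" for \<psi>
  proof (rule tendstoI)
    fix e :: real assume e: "0 < e"
    then have e2: "0 < e / 2" by simp
    define c where "c = (\<lambda>l. Delta chi l w \<psi>)"
    have cg: "c = (\<lambda>l. distr_of_fun (g l) \<psi>)" by (rule ext) (simp only: c_def Dw[OF \<psi>] gD[OF \<psi>])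
    have wc: "w \<psi> = infsum c UNIV" unfolding cg w_def distr_sum_def ..
    have cs: "c summable_on UNIV" unfolding cg by (rule sm[OF \<psi>])
    obtain m0 k0 where mk: "\<And>m k. m \<le> m0 \<Longrightarrow> k0 \<le> k \<Longrightarrow> norm (sum c {m..<k} - infsum c UNIV) < e / 2"
      by (rule summable_on_interval_approx[OF cs e2], rule that, blast)
    from LIMSEQ_D[OF low_cut_tendsto[OF tw \<psi>] e2] obtain N0
      where N0: "\<And>n. N0 \<le> n \<Longrightarrow> norm (low_cut chi (int n) w \<psi> - w \<psi>) < e / 2" by blast
    have "dist (low_cut chi m w \<psi>) 0 < e" if m: "m \<le> m0" for m
    proof -
      \<comment> \<open>An upper frequency that is beyond both thresholds; the interval from \<open>m\<close> to it then exhausts the series up to \<open>e / 2\<close>.\<close>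
      define n where "n = max N0 (max (nat k0) (nat m))"
      have n: "N0 \<le> n" "k0 \<le> int n" "m \<le> int n" unfolding n_def by auto
      have t: "low_cut chi (int n) w \<psi> = low_cut chi m w \<psi> + sum c {m..<int n}"
        unfolding c_def by (rule low_cut_telescope[OF tw \<psi> n(3)])
      have "norm (low_cut chi m w \<psi>) = norm ((low_cut chi (int n) w \<psi> - w \<psi>) - (sum c {m..<int n} - infsum c UNIV))"
        unfolding t wc by simp
      also have "\<dots> \<le> norm (low_cut chi (int n) w \<psi> - w \<psi>) + norm (sum c {m..<int n} - infsum c UNIV)"
        by (rule norm_triangle_ineq4)
      also have "\<dots> < e" using N0[OF n(1)] mk[OF m n(2)] by linarith
      finally show ?thesis by simp
    qed
    then show "eventually (\<lambda>j. dist (low_cut chi j w \<psi>) 0 < e) at_bot"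
      unfolding eventually_at_bot_linorder by blast
  qed
  then have "vanishes_at_low_freq chi w" unfolding vanishes_at_low_freq_def by blast
  with wa show ?thesis by blast
qed

text \<open>Evaluate the cut-off on a translate of the kernel of \<open>low_symbol (j + 1)\<close>. That symbol is one on the supports of
  \<open>low_symbol j\<close> and of all lower blocks, so the pairings are pointwise values.\<close>

lemma low_cut_series:
  assumes v: "tempered v" and van: "vanishes_at_low_freq chi v"
  shows "(\<lambda>i::nat. tconv v (Ker (dyadic_symbol (j - 1 - int i))) y) sums tconv v (Ker (low_symbol j)) (y::real^'d)"
proof -
  define \<psi> where "\<psi> = (\<lambda>x. Ker (low_symbol (j + 1)) (x - y))"
  have \<psi>: "\<psi> \<in> schwartz" unfolding \<psi>_def by (intro schwartz_shift schwartz_Ker schwartz_low_symbol)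
  have p2: "(2::real) powi (j + 1) = 2 powi j * 2" by (simp add: powi_shift)
  have 1: "low_symbol j \<xi> * low_symbol (j + 1) \<xi> = low_symbol j \<xi>" for \<xi>
  proof (cases "low_symbol j \<xi> = 0")
    case False
    have "norm \<xi> < 2 powi (j + 1) * (3 / 4)" unfolding p2 using low_symbol_support[OF False] powi_pos[of j] by linarith
    then show ?thesis by (simp add: low_symbol_eq_1)
  qed simp
  have 2: "dyadic_symbol l \<xi> * low_symbol (j + 1) \<xi> = dyadic_symbol l \<xi>" if "l < j" for l \<xi>
  proof (cases "dyadic_symbol l \<xi> = 0")
    case False
    have "(2::real) powi (l + 1) \<le> 2 powi j" using that by (intro power_int_increasing) auto
    then have "(2::real) powi l * 2 \<le> 2 powi j" by (simp add: powi_shift)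
    then have "norm \<xi> < 2 powi (j + 1) * (3 / 4)" unfolding p2 using dyadic_symbol_support(2)[OF False] powi_pos[of j] by linarith
    then show ?thesis by (simp add: low_symbol_eq_1)
  qed simp
  have L: "low_cut chi j v \<psi> = tconv v (Ker (low_symbol j)) y"
    unfolding low_cut_apply \<psi>_def multiplier_Ker_shift[OF schwartz_low_symbol schwartz_low_symbol] 1 tconv_def ..
  have D: "Delta chi l v \<psi> = tconv v (Ker (dyadic_symbol l)) y" if "l < j" for l
    unfolding Delta_apply \<psi>_def multiplier_Ker_shift[OF schwartz_dyadic_symbol schwartz_low_symbol] 2[OF that] tconv_def ..
  have tele: "(\<Sum>i<n. tconv v (Ker (dyadic_symbol (j - 1 - int i))) y) = low_cut chi j v \<psi> - low_cut chi (j - int n) v \<psi>" for n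
  proof (induction n)
    case (Suc n)
    have e: "j - int (Suc n) = j - 1 - int n" "j - 1 - int n + 1 = j - int n" by auto
    have "low_cut chi (j - int n) v \<psi> = low_cut chi (j - 1 - int n) v \<psi> + tconv v (Ker (dyadic_symbol (j - 1 - int n))) y"
      using low_cut_Suc[OF v \<psi>, of "j - 1 - int n"] D[of "j - 1 - int n"] unfolding e by simp
    then show ?case unfolding sum.lessThan_Suc Suc e by simp
  qed simp
  have "filterlim (\<lambda>n. j - int n) at_bot sequentially"
    unfolding filterlim_at_bot eventually_sequentially
  proof (intro allI exI impI)
    fix Z :: int and n assume "nat (j - Z) \<le> n" then show "j - int n \<le> Z" by linarith
  qed
  from filterlim_compose[OF van[unfolded vanishes_at_low_freq_def, rule_format, OF \<psi>] this]
  have "(\<lambda>n. low_cut chi (j - int n) v \<psi>) \<longlonglongrightarrow> 0" .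
  from tendsto_diff[OF tendsto_const[of "low_cut chi j v \<psi>"] this]
  show ?thesis unfolding sums_def tele by (simp add: L)
qed

text \<open>The representative is not unique as a functional, so the statements are derived for the one selected by
  \<^const>\<open>realization\<close>, from the two properties by which it is selected.\<close>

lemma realization_representation:
  assumes a: "a \<in> tempered_mod_poly" and p: "1 \<le> p" and \<sigma>: "0 < \<sigma>" and H: "0 \<le> H"
    and low: "\<And>l x. norm (block chi l a x) \<le> 2 powr real_of_int l * H"
    and high: "\<And>l. Lp_le p (block chi l a) (2 powr (- (real_of_int l * \<sigma>)) * H)"
  obtains v where "tempered v" "\<And>l. block chi l a = tconv v (Ker (dyadic_symbol l))" "\<And>j. low_block chi j a = tconv v (Ker (low_symbol j))"
    "\<And>j y. (\<lambda>i::nat. block chi (j - 1 - int i) a y) sums low_block chi j a y"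
    "\<And>j y. norm (low_block chi j a y) \<le> 2 powr real_of_int j * H"
proof -
  define v where "v = realization chi a"
  have ex: "\<exists>w. w \<in> a \<and> vanishes_at_low_freq chi w"
  proof (rule realization_exists[OF a p \<sigma> H])
    show "norm (block chi l a x) \<le> 2 powr real_of_int l * H" for l x by (rule low)
    show "Lp_le p (block chi l a) (2 powr (- (real_of_int l * \<sigma>)) * H)" for l by (rule high)
  qed
  have v: "v \<in> a \<and> vanishes_at_low_freq chi v"
    using someI_ex[OF ex] unfolding v_def realization_def .
  have tv: "tempered v" using tempered_mod_polyE(1)[OF a] v by blast
  have b: "block chi l a = tconv v (Ker (dyadic_symbol l))" for l using block_eq[OF a] v by blast
  have lb: "low_block chi j a = tconv v (Ker (low_symbol j))" for j
    unfolding low_block_def v_def[symmetric] by (rule fun_of_distr_eq[OF represented_by_low_cut[OF tv]])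
  have s: "(\<lambda>i::nat. block chi (j - 1 - int i) a y) sums low_block chi j a y" for j y
    unfolding b lb by (rule low_cut_series[OF tv]) (use v in blast)
  have bound: "norm (low_block chi j a y) \<le> 2 powr real_of_int j * H" for j y
  proof -
    have gs: "(\<lambda>i. (2 powr real_of_int j * H / 2) * (1 / 2) ^ i) sums ((2 powr real_of_int j * H / 2) * (1 / (1 - 1 / 2)))"
      by (intro sums_mult geometric_sums) simp
    have t: "norm (block chi (j - 1 - int i) a y) \<le> (2 powr real_of_int j * H / 2) * (1 / 2) ^ i" for i
    proof -
      have "2 powr real_of_int (j - 1 - int i) = 2 powr real_of_int j / 2 * (1 / 2) ^ i"
      proof -
        have "real_of_int (j - 1 - int i) = real_of_int j - (1 + real i)" by simp
        then have "2 powr real_of_int (j - 1 - int i) = 2 powr real_of_int j / 2 powr (1 + real i)" by (simp only: powr_diff)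
        also have "2 powr (1 + real i) = 2 * 2 ^ i" by (simp add: powr_add powr_realpow)
        finally show ?thesis by (simp add: power_one_over)
      qed
      then have "2 powr real_of_int (j - 1 - int i) * H = 2 powr real_of_int j * H / 2 * (1 / 2) ^ i" by (simp only: mult_ac times_divide_eq_left times_divide_eq_right)
      then show ?thesis using low[of "j - 1 - int i" y] by (simp only:)
    qed
    have "norm (low_block chi j a y) = norm (\<Sum>i. block chi (j - 1 - int i) a y)" by (simp only: sums_unique[OF s])
    also have "\<dots> \<le> (\<Sum>i. (2 powr real_of_int j * H / 2) * (1 / 2) ^ i)"
      by (rule norm_suminf_le[OF t sums_summable[OF gs]])
    also have "\<dots> = 2 powr real_of_int j * H" unfolding sums_unique[OF gs, symmetric] by simp
    finally show ?thesis .
  qed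
  show ?thesis by (rule that[OF tv b lb s bound])
qed

end

section \<open>The product estimate\<close>

lemma powr2_mult: "x + y = z \<Longrightarrow> 2 powr x * (2 powr y * M) = 2 powr z * (M::real)"
  by (auto simp: powr_add)

lemma ennreal_norm_sums:
  fixes f :: "nat \<Rightarrow> complex"
  assumes f: "f sums S"
  shows "ennreal (norm S) \<le> (\<Sum>n. ennreal (norm (f n)))"
proof (rule LIMSEQ_le_const2)
  show "(\<lambda>n. ennreal (norm (\<Sum>i<n. f i))) \<longlonglongrightarrow> ennreal (norm S)"
    by (rule tendsto_ennrealI[OF tendsto_norm[OF f[unfolded sums_def]]])
  have "ennreal (norm (\<Sum>i<n. f i)) \<le> (\<Sum>n. ennreal (norm (f n)))" for n
  proof -
    have "ennreal (norm (\<Sum>i<n. f i)) \<le> ennreal (\<Sum>i<n. norm (f i))" by (intro ennreal_leI norm_sum)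
    also have "\<dots> = (\<Sum>i<n. ennreal (norm (f i)))" by (simp add: sum_ennreal)
    also have "\<dots> \<le> (\<Sum>n. ennreal (norm (f n)))" by (intro sum_le_suminf) auto
    finally show ?thesis .
  qed
  then show "\<exists>N. \<forall>n\<ge>N. ennreal (norm (\<Sum>i<n. f i)) \<le> (\<Sum>n. ennreal (norm (f n)))" by blast
qed

lemma int_series_from:
  fixes c :: "int \<Rightarrow> complex"
  assumes c: "c summable_on UNIV" and z: "\<And>k. k < m \<Longrightarrow> c k = 0"
  shows "(\<lambda>n::nat. c (m + int n)) sums infsum c UNIV"
proof -
  have "(c has_sum infsum c UNIV) UNIV" by (rule has_sum_infsum[OF c])
  moreover have "(c has_sum S) UNIV \<longleftrightarrow> (c has_sum S) {m..}" for S
    by (rule has_sum_cong_neutral) (auto intro: z)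
  ultimately have h: "(c has_sum infsum c UNIV) {m..}" by simp
  have r: "range (\<lambda>n. m + int n) = {m..}"
  proof (intro equalityI subsetI)
    fix x assume "x \<in> {m..}"
    then have "x = m + int (nat (x - m))" by simp
    then show "x \<in> range (\<lambda>n. m + int n)" by blast
  qed auto
  have "inj (\<lambda>n. m + int n)" by (auto simp: inj_def)
  from has_sum_reindex[OF this, of c "infsum c UNIV"] h
  have "(c \<circ> (\<lambda>n. m + int n) has_sum infsum c UNIV) UNIV" unfolding r by simp
  from has_sum_imp_sums[OF this] show ?thesis by (simp only: o_def)
qed

lemma Lp_le_plus:
  fixes f g :: "real^'d::finite \<Rightarrow> complex"
  assumes p: "1 \<le> p" and f: "Lp_le p f M" and g: "Lp_le p g M"
  shows "Lp_le p (\<lambda>x. f x + g x) (8 * M)"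
proof -
  define h where "h = (\<lambda>n::nat. if n = 0 then f else g)"
  have "Lp_le p (\<lambda>x. \<Sum>n<2. h n x) (2 ^ Suc 2 * M)"
    by (rule Lp_le_sum[OF p _ Lp_leD(2)[OF f]]) (simp add: h_def f g)
  moreover have "(\<Sum>n<2. h n x) = f x + g x" for x by (simp add: h_def numeral_2_eq_2)
  ultimately show ?thesis by simp
qed

context littlewood_paley begin

text \<open>All that is used about an element of the two Besov spaces: the \<open>L\<^sup>p\<close> bounds of its blocks and the uniform bounds that
  Bernstein's inequality derives from them. The constant \<open>K\<close> does not depend on \<open>a\<close>.\<close>

definition dyadic_bounds :: "real \<Rightarrow> real \<Rightarrow> 'd functional set \<Rightarrow> real \<Rightarrow> real \<Rightarrow> bool" where
  "dyadic_bounds p K a A0 A2 \<longleftrightarrow> a \<in> tempered_mod_poly \<and> 0 \<le> A0 \<and> 0 \<le> A2 \<and>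
     (\<forall>l. Lp_le p (block chi l a) (2 powr (- (real_of_int l * (real CARD('d) / p - 2))) * A0) \<and>
          Lp_le p (block chi l a) (2 powr (- (real_of_int l * (real CARD('d) / p))) * A2)) \<and>
     (\<forall>l x. norm (block chi l a x) \<le> K * (2 powr (2 * real_of_int l) * A0) \<and> norm (block chi l a x) \<le> K * A2)"

lemma dyadic_boundsD:
  assumes "dyadic_bounds p K a A0 A2"
  shows "a \<in> tempered_mod_poly" "0 \<le> A0" "0 \<le> A2"
    "Lp_le p (block chi l a) (2 powr (- (real_of_int l * (real CARD('d) / p - 2))) * A0)"
    "Lp_le p (block chi l a) (2 powr (- (real_of_int l * (real CARD('d) / p))) * A2)"
    "norm (block chi l a x) \<le> K * (2 powr (2 * real_of_int l) * A0)"
    "norm (block chi l a x) \<le> K * A2"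
  using assms unfolding dyadic_bounds_def by blast+

lemma dyadic_bounds_exist:
  assumes p: "1 \<le> p"
  obtains K where "1 \<le> K" "\<And>a. a \<in> besov chi (real CARD('d) / p - 2) (ennreal p) \<infinity> \<Longrightarrow> a \<in> besov chi (real CARD('d) / p) (ennreal p) \<infinity> \<Longrightarrow>
     dyadic_bounds p K a (enn2real (besov_norm chi (real CARD('d) / p - 2) (ennreal p) \<infinity> a)) (enn2real (besov_norm chi (real CARD('d) / p) (ennreal p) \<infinity> a))"
proof -
  let ?s = "real CARD('d) / p"
  obtain C where C: "0 < C" "\<And>u l M y. tempered u \<Longrightarrow> Lp_le p (tconv u (Ker (dyadic_symbol l))) M \<Longrightarrow>
     norm (tconv u (Ker (dyadic_symbol l)) (y::real^'d)) \<le> C * 2 powr (real_of_int l * ?s) * M"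
    using bernstein[OF p] by blast
  have "1 \<le> max 1 C" by simp
  then show ?thesis
  proof (rule that)
    fix a assume a0: "a \<in> besov chi (?s - 2) (ennreal p) \<infinity>" and a2: "a \<in> besov chi ?s (ennreal p) \<infinity>"
    define A0 where "A0 = enn2real (besov_norm chi (?s - 2) (ennreal p) \<infinity> a)"
    define A2 where "A2 = enn2real (besov_norm chi ?s (ennreal p) \<infinity> a)"
    have nn: "0 \<le> A0" "0 \<le> A2" by (auto simp: A0_def A2_def)
    have t: "a \<in> tempered_mod_poly" by (rule besov_block_bound(1)[OF p a0])
    define u where "u = (SOME u. u \<in> a)"
    have u: "u \<in> a" unfolding u_def by (rule tempered_mod_poly_some[OF t])
    note tu = tempered_mod_polyE(1)[OF t u]
    have L0: "Lp_le p (tconv u (Ker (dyadic_symbol l))) (2 powr (- (real_of_int l * (?s - 2))) * A0)" for l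
      unfolding A0_def by (rule besov_block_bound(3)[OF p a0 u])
    have L2: "Lp_le p (tconv u (Ker (dyadic_symbol l))) (2 powr (- (real_of_int l * ?s)) * A2)" for l
      unfolding A2_def by (rule besov_block_bound(3)[OF p a2 u])
    have S: "norm (tconv u (Ker (dyadic_symbol l)) y) \<le> max 1 C * (2 powr e * M)"
      if "Lp_le p (tconv u (Ker (dyadic_symbol l))) (2 powr x * M)" "real_of_int l * ?s + x = e" "0 \<le> M" for l y x M e
    proof -
      have "norm (tconv u (Ker (dyadic_symbol l)) y) \<le> C * (2 powr (real_of_int l * ?s) * (2 powr x * M))"
        using C(2)[OF tu that(1)] by (simp only: mult.assoc)
      also have "\<dots> = C * (2 powr e * M)" by (simp only: powr2_mult[OF that(2)])
      also have "\<dots> \<le> max 1 C * (2 powr e * M)" using that(3) by (intro mult_right_mono) auto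
      finally show ?thesis .
    qed
    have S0: "norm (tconv u (Ker (dyadic_symbol l)) y) \<le> max 1 C * (2 powr (2 * real_of_int l) * A0)" for l y
      by (rule S[OF L0 _ nn(1)]) (simp add: algebra_simps)
    have "norm (tconv u (Ker (dyadic_symbol l)) y) \<le> max 1 C * (2 powr 0 * A2)" for l y
      by (rule S[OF L2 _ nn(2)]) simp
    then have S2: "norm (tconv u (Ker (dyadic_symbol l)) y) \<le> max 1 C * A2" for l y by simp
    show "dyadic_bounds p (max 1 C) a A0 A2"
      unfolding dyadic_bounds_def block_eq[OF t u] using t nn L0 L2 S0 S2 by blast
  qed
qed

text \<open>The bound \<open>2\<^sup>l H\<close> is the geometric mean of the bounds of order \<open>2\<^sup>2\<^sup>l\<close> and \<open>1\<close>. It makes the sum over low frequencies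
  converge, and its growth at high frequencies is compensated by the decay of the other factor of a product.\<close>

lemma dyadic_bounds_coarse:
  assumes a: "dyadic_bounds p K a A0 A2" and K: "1 \<le> K" and p: "1 \<le> p"
  defines "H \<equiv> K * (A0 + A2)"
  shows "0 \<le> H" "norm (block chi l a x) \<le> 2 powr real_of_int l * H"
    "Lp_le p (block chi l a) (2 powr (- (real_of_int l * (real CARD('d) / p))) * H)"
proof -
  note nn = dyadic_boundsD(2,3)[OF a]
  show H: "0 \<le> H" using nn K by (simp add: H_def)
  show "norm (block chi l a x) \<le> 2 powr real_of_int l * H"
  proof (cases "l \<le> 0")
    case True
    have "norm (block chi l a x) \<le> K * (2 powr (2 * real_of_int l) * A0)" by (rule dyadic_boundsD(6)[OF a])
    also have "\<dots> \<le> K * (2 powr real_of_int l * (A0 + A2))"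
      using True nn K by (intro mult_left_mono mult_mono powr_mono) auto
    finally show ?thesis by (simp only: H_def mult.left_commute)
  next
    case False
    have "norm (block chi l a x) \<le> K * A2" by (rule dyadic_boundsD(7)[OF a])
    also have "\<dots> \<le> H" unfolding H_def using nn K by (intro mult_left_mono) auto
    also have "\<dots> = 1 * H" by simp
    also have "\<dots> \<le> 2 powr real_of_int l * H"
      using False by (intro mult_right_mono H ge_one_powr_ge_zero) auto
    finally show ?thesis .
  qed
  have "A2 \<le> H"
    unfolding H_def using nn K mult_mono[of 1 K A2 "A0 + A2"] by simp
  then have "2 powr (- (real_of_int l * (real CARD('d) / p))) * A2 \<le> 2 powr (- (real_of_int l * (real CARD('d) / p))) * H"
    by (rule mult_left_mono) simp
  then show "Lp_le p (block chi l a) (2 powr (- (real_of_int l * (real CARD('d) / p))) * H)"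
    by (rule Lp_le_mono[OF dyadic_boundsD(5)[OF a]]) (use p in simp)
qed

lemma dyadic_realization:
  assumes a: "dyadic_bounds p K a A0 A2" and K: "1 \<le> K" and p: "1 \<le> p"
  obtains v where "tempered v" "\<And>l. block chi l a = tconv v (Ker (dyadic_symbol l))" "\<And>j. low_block chi j a = tconv v (Ker (low_symbol j))"
    "\<And>j y. (\<lambda>i::nat. block chi (j - 1 - int i) a y) sums low_block chi j a y"
    "\<And>j y. norm (low_block chi j a y) \<le> 2 powr real_of_int j * (K * (A0 + A2))"
proof -
  note b = dyadic_bounds_coarse[OF a K p]
  have \<sigma>: "0 < real CARD('d) / p" using p by simp
  show ?thesis
    by (rule realization_representation[OF dyadic_boundsD(1)[OF a] p \<sigma> b]) (rule that)
qed

text \<open>Paraproducts and remainders at once: the left factor grows like \<open>2\<^sup>l\<close>, while the right factor decays like \<open>2 powr (- l d / p)\<close>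
  in \<open>L\<^sup>p\<close>. As \<open>d / p > 1\<close>, the series converges at high frequencies.\<close>

lemma product_series_tempered:
  fixes s :: "int \<Rightarrow> real^'d \<Rightarrow> complex"
  assumes b: "dyadic_bounds p K b B0 B2" and K: "1 \<le> K" and p: "1 \<le> p" "p < real CARD('d)"
    and s: "\<And>l. s l \<in> borel_measurable borel" "\<And>l x. norm (s l x) \<le> 2 powr real_of_int l * J" and J: "0 \<le> J"
  defines "g \<equiv> \<lambda>l x. s l x * block chi l b x"
  shows "distr_summable g" "tempered (distr_sum g)" "\<And>\<psi>. \<psi> \<in> schwartz \<Longrightarrow> (\<lambda>l. distr_of_fun (g l) \<psi>) summable_on UNIV"
proof -
  define \<sigma> where "\<sigma> = real CARD('d) / p - 1"
  have \<sigma>: "0 < \<sigma>" using p by (simp add: \<sigma>_def)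
  define H where "H = K * (B0 + B2)"
  note c = dyadic_bounds_coarse[OF b K p(1), folded H_def]
  have JH: "0 \<le> J * H" using J c(1) by simp
  have low: "norm (g l x) \<le> 2 powr real_of_int l * (J * H)" if l: "l \<le> 0" for l x
  proof -
    have "norm (g l x) \<le> (2 powr real_of_int l * J) * (2 powr real_of_int l * H)"
      unfolding g_def norm_mult using J by (intro mult_mono s c) auto
    also have "\<dots> = 2 powr real_of_int l * (2 powr real_of_int l * (J * H))" by (simp only: mult_ac)
    also have "\<dots> \<le> 1 * (2 powr real_of_int l * (J * H))"
    proof (rule mult_right_mono)
      show "2 powr real_of_int l \<le> (1::real)" using powr_mono[of "real_of_int l" 0 2] l by simp
    qed (use JH in simp)
    finally show ?thesis by simp
  qed
  have high: "Lp_le p (g l) (2 powr (- (real_of_int l * \<sigma>)) * (J * H))" for l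
  proof -
    have "Lp_le p (g l) ((2 powr real_of_int l * J) * (2 powr (- (real_of_int l * (real CARD('d) / p))) * H))"
      unfolding g_def using J p by (intro Lp_le_bounded_mult s c(3)) auto
    also have "(2 powr real_of_int l * J) * (2 powr (- (real_of_int l * (real CARD('d) / p))) * H)
       = 2 powr real_of_int l * (2 powr (- (real_of_int l * (real CARD('d) / p))) * (J * H))" by (simp only: mult_ac)
    also have "\<dots> = 2 powr (- (real_of_int l * \<sigma>)) * (J * H)"
      by (rule powr2_mult) (simp add: \<sigma>_def algebra_simps)
    finally show ?thesis .
  qed
  note D = distr_sum_tempered[OF p(1) \<sigma> JH low high]
  show "distr_summable g" by (rule D(1)) simp_all
  show "tempered (distr_sum g)" by (rule D(2)) simp_all
  show "(\<lambda>l. distr_of_fun (g l) \<psi>) summable_on UNIV" if "\<psi> \<in> schwartz" for \<psi> by (rule D(3)) (simp_all add: that)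
qed

lemma neighbours: "{k::int. \<bar>k - j\<bar> \<le> 1} = {j - 1, j, j + 1}"
  by auto

lemma wide_block_eq: "wide_block chi j a x = block chi (j - 1) a x + block chi j a x + block chi (j + 1) a x"
  unfolding wide_block_def neighbours by simp

lemma para_tempered:
  assumes a: "dyadic_bounds p K a A0 A2" and b: "dyadic_bounds p K b B0 B2" and K: "1 \<le> K" and p: "1 \<le> p" "p < real CARD('d)"
  shows "distr_summable (para_term chi a b)" "tempered (paraproduct chi a b)"
    "\<And>\<psi>. \<psi> \<in> schwartz \<Longrightarrow> (\<lambda>l. distr_of_fun (para_term chi a b l) \<psi>) summable_on UNIV"
proof -
  obtain v where v: "tempered v" "\<And>l. block chi l a = tconv v (Ker (dyadic_symbol l))" "\<And>j. low_block chi j a = tconv v (Ker (low_symbol j))"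
    "\<And>j y. (\<lambda>i::nat. block chi (j - 1 - int i) a y) sums low_block chi j a y"
    "\<And>j y. norm (low_block chi j a y) \<le> 2 powr real_of_int j * (K * (A0 + A2))"
    using dyadic_realization[OF a K p(1)] by blast
  note H = dyadic_bounds_coarse(1)[OF a K p(1)]
  have m: "low_block chi (l - 1) a \<in> borel_measurable borel" for l
    unfolding v(3) by (intro borel_measurable_continuous_onI tconv_continuous v(1) schwartz_Ker schwartz_low_symbol)
  have n: "norm (low_block chi (l - 1) a x) \<le> 2 powr real_of_int l * (K * (A0 + A2))" for l x
    by (rule order_trans[OF v(5)]) (intro mult_right_mono powr_mono H, simp_all)
  have e: "para_term chi a b = (\<lambda>l x. low_block chi (l - 1) a x * block chi l b x)"
    by (intro ext) (rule para_term_def)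
  note P = product_series_tempered[OF b K p m n H]
  show "distr_summable (para_term chi a b)" unfolding e by (rule P(1))
  show "tempered (paraproduct chi a b)" unfolding paraproduct_def e by (rule P(2))
  show "(\<lambda>l. distr_of_fun (para_term chi a b l) \<psi>) summable_on UNIV" if "\<psi> \<in> schwartz" for \<psi>
    unfolding e by (rule P(3)[OF that])
qed

lemma remainder_tempered:
  assumes a: "dyadic_bounds p K a A0 A2" and b: "dyadic_bounds p K b B0 B2" and K: "1 \<le> K" and p: "1 \<le> p" "p < real CARD('d)"
  shows "distr_summable (remainder_term chi a b)" "tempered (remainder chi a b)"
    "\<And>\<psi>. \<psi> \<in> schwartz \<Longrightarrow> (\<lambda>l. distr_of_fun (remainder_term chi a b l) \<psi>) summable_on UNIV"
proof -
  define H where "H = K * (A0 + A2)"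
  note c = dyadic_bounds_coarse[OF a K p(1), folded H_def]
  have H4: "0 \<le> 4 * H" using c(1) by simp
  have bm: "block chi l a \<in> borel_measurable borel" for l by (rule Lp_leD(1)[OF c(3)])
  have m: "wide_block chi l a \<in> borel_measurable borel" for l
    unfolding wide_block_eq[abs_def] using bm by (intro borel_measurable_add)
  have n: "norm (wide_block chi l a x) \<le> 2 powr real_of_int l * (4 * H)" for l x
  proof -
    have "norm (wide_block chi l a x) \<le> norm (block chi (l - 1) a x) + norm (block chi l a x) + norm (block chi (l + 1) a x)"
      unfolding wide_block_eq by (intro order_trans[OF norm_triangle_ineq] add_right_mono norm_triangle_ineq)
    also have "\<dots> \<le> 2 powr real_of_int (l - 1) * H + 2 powr real_of_int l * H + 2 powr real_of_int (l + 1) * H"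
      by (intro add_mono c(2))
    also have "\<dots> \<le> 2 powr real_of_int l * (4 * H)"
    proof -
      have "2 powr real_of_int (l - 1) = 2 powr real_of_int l / 2" "2 powr real_of_int (l + 1) = 2 powr real_of_int l * 2"
        by (simp_all add: powr_diff powr_add)
      then have "2 powr real_of_int (l - 1) + 2 powr real_of_int l + 2 powr real_of_int (l + 1) \<le> 2 powr real_of_int l * 4" by simp
      from mult_right_mono[OF this c(1)] show ?thesis by (simp add: algebra_simps)
    qed
    finally show ?thesis .
  qed
  have e: "remainder_term chi a b = (\<lambda>l x. wide_block chi l a x * block chi l b x)"
    by (intro ext) (rule remainder_term_def)
  note P = product_series_tempered[OF b K p m n H4]
  show "distr_summable (remainder_term chi a b)" unfolding e by (rule P(1))
  show "tempered (remainder chi a b)" unfolding remainder_def e by (rule P(2))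
  show "(\<lambda>l. distr_of_fun (remainder_term chi a b l) \<psi>) summable_on UNIV" if "\<psi> \<in> schwartz" for \<psi>
    unfolding e by (rule P(3)[OF that])
qed

text \<open>The supremum of the first factor exceeds its \<open>L\<^sup>p\<close> bound by a factor of order \<open>2 powr (l d / p)\<close>, by Bernstein's inequality.\<close>

lemma block_product:
  assumes a: "dyadic_bounds p K a A0 A2" and b: "dyadic_bounds p K b B0 B2" and K: "1 \<le> K"
    and r: "1 \<le> r" "r \<le> p" "p \<le> 2 * r"
  shows "Lp_le r (\<lambda>x. block chi l a x * block chi k b x)
    (2 powr (real_of_int l * (real CARD('d) / p - real CARD('d) / r + 2) - real_of_int k * (real CARD('d) / p)) * (K powr ((2 * r - p) / r) * (A0 * B2)))"
proof -
  let ?s = "real CARD('d) / p" and ?l = "real_of_int l" and ?k = "real_of_int k"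
  have p: "1 \<le> p" using r by simp
  have S: "norm (block chi l a x) \<le> (K * 2 powr (?l * ?s)) * (2 powr (- (?l * (?s - 2))) * A0)" for x
  proof -
    have "2 powr (?l * ?s) * (2 powr (- (?l * (?s - 2))) * A0) = 2 powr (2 * ?l) * A0"
      by (rule powr2_mult) (simp add: algebra_simps)
    then show ?thesis using dyadic_boundsD(6)[OF a, of l x] by (simp only: mult.assoc)
  qed
  have S0: "0 < K * 2 powr (?l * ?s)" using K by simp
  have e: "(K * 2 powr (?l * ?s)) powr ((2 * r - p) / r) * (2 powr (- (?l * (?s - 2))) * A0) * (2 powr (- (?k * ?s)) * B2)
     = 2 powr (?l * (?s - real CARD('d) / r + 2) - ?k * ?s) * (K powr ((2 * r - p) / r) * (A0 * B2))"
  proof -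
    have "(K * 2 powr (?l * ?s)) powr ((2 * r - p) / r) = K powr ((2 * r - p) / r) * 2 powr (?l * ?s * ((2 * r - p) / r))"
      using K by (simp add: powr_mult powr_powr)
    moreover have "?l * (?s - real CARD('d) / r + 2) - ?k * ?s = ?l * ?s * ((2 * r - p) / r) + (- (?l * (?s - 2))) + (- (?k * ?s))"
      using r p by (simp add: field_simps)
    then have "2 powr (?l * (?s - real CARD('d) / r + 2) - ?k * ?s) = 2 powr (?l * ?s * ((2 * r - p) / r)) * 2 powr (- (?l * (?s - 2))) * 2 powr (- (?k * ?s))"
      by (simp only: powr_add)
    ultimately show ?thesis by (simp only: mult_ac)
  qed
  show ?thesis
    using Lp_le_product[OF r dyadic_boundsD(4)[OF a] dyadic_boundsD(5)[OF b] S0 S, of k] unfolding e .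
qed

text \<open>The sum over the blocks of \<open>a\<close> below \<open>k - 1\<close> is geometric since the exponent of \<open>2\<^sup>l\<close> in \<open>block_product\<close> is positive; this is
  where the condition on \<open>1 / q\<close> enters.\<close>

lemma para_Lp_le:
  assumes q: "1 \<le> q" "q \<le> p" "p \<le> 2 * q" and K: "1 \<le> K" and \<epsilon>: "real CARD('d) / q < real CARD('d) / p + 2"
  obtains C where "0 < C" "\<And>a b A0 A2 B0 B2 k. dyadic_bounds p K a A0 A2 \<Longrightarrow> dyadic_bounds p K b B0 B2 \<Longrightarrow>
    Lp_le q (para_term chi a b k) (C * (2 powr (- (real_of_int k * (real CARD('d) / q - 2))) * (A0 * B2)))"
proof -
  have p: "1 \<le> p" using q by simp
  define e where "e = real CARD('d) / p - real CARD('d) / q + 2"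
  have e: "0 < e" using \<epsilon> by (simp add: e_def)
  define c where "c = (\<lambda>i::nat. (2 powr (- e)) ^ i)"
  have c0: "0 < c i" for i by (simp add: c_def)
  have "2 powr (- e) < 1" using e by (simp add: powr_less_one)
  then have cs: "summable c" unfolding c_def by (intro summable_geometric) simp
  define L where "L = 2 powr (- (2 * e)) * K powr ((2 * q - p) / q)"
  have L: "0 < L" using K by (simp add: L_def)
  have "0 < suminf c * L" using suminf_pos[OF cs c0] L by simp
  then show ?thesis
  proof (rule that)
    fix a b A0 A2 B0 B2 k assume a: "dyadic_bounds p K a A0 A2" and b: "dyadic_bounds p K b B0 B2"
    let ?k = "real_of_int k"
    obtain v where v: "tempered v" "\<And>l. block chi l a = tconv v (Ker (dyadic_symbol l))" "\<And>j. low_block chi j a = tconv v (Ker (low_symbol j))"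
      "\<And>j y. (\<lambda>i::nat. block chi (j - 1 - int i) a y) sums low_block chi j a y"
      "\<And>j y. norm (low_block chi j a y) \<le> 2 powr real_of_int j * (K * (A0 + A2))"
      using dyadic_realization[OF a K p] by blast
    define f where "f = (\<lambda>i::nat. \<lambda>x. block chi (k - 1 - 1 - int i) a x * block chi k b x)"
    define M where "M = L * (2 powr (- (?k * (real CARD('d) / q - 2))) * (A0 * B2))"
    have M: "0 \<le> M" using L dyadic_boundsD(2)[OF a] dyadic_boundsD(3)[OF b] by (simp add: M_def)
    have fi: "Lp_le q (f i) (c i * M)" for i
    proof -
      have ci: "c i = 2 powr (- (real i * e))" by (simp add: c_def powr_realpow[symmetric] powr_powr mult.commute)
      have "real_of_int (k - 1 - 1 - int i) * e - ?k * (real CARD('d) / p) = - (real i * e) + (- (2 * e)) + (- (?k * (real CARD('d) / q - 2)))"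
        by (simp add: e_def algebra_simps)
      then have "2 powr (real_of_int (k - 1 - 1 - int i) * e - ?k * (real CARD('d) / p)) = c i * 2 powr (- (2 * e)) * 2 powr (- (?k * (real CARD('d) / q - 2)))"
        by (simp only: powr_add ci)
      then have "2 powr (real_of_int (k - 1 - 1 - int i) * e - ?k * (real CARD('d) / p)) * (K powr ((2 * q - p) / q) * (A0 * B2)) = c i * M"
        unfolding M_def L_def by (simp only: mult_ac)
      then show ?thesis using block_product[OF a b K q, of "k - 1 - 1 - int i" k] unfolding f_def e_def by (simp only:)
    qed
    have "Lp_le q (para_term chi a b k) (suminf c * M)"
    proof (rule Lp_le_series[OF q(1) fi c0 cs _ _ M])
      have lm: "low_block chi (k - 1) a \<in> borel_measurable borel"
        unfolding v(3) by (intro borel_measurable_continuous_onI tconv_continuous v(1) schwartz_Ker schwartz_low_symbol)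
      have bm: "block chi k b \<in> borel_measurable borel" by (rule Lp_leD(1)[OF dyadic_boundsD(4)[OF b]])
      show "para_term chi a b k \<in> borel_measurable borel"
        unfolding para_term_def[abs_def] by (intro borel_measurable_times lm bm)
      fix x
      have "(\<lambda>i. f i x) sums para_term chi a b k x"
        unfolding f_def para_term_def by (rule sums_mult2[OF v(4)])
      then show "ennreal (norm (para_term chi a b k x)) \<le> (\<Sum>n. ennreal (norm (f n x)))" by (rule ennreal_norm_sums)
    qed
    then show "Lp_le q (para_term chi a b k) (suminf c * L * (2 powr (- (?k * (real CARD('d) / q - 2))) * (A0 * B2)))"
      by (simp only: M_def mult.assoc)
  qed
qed

lemma remainder_Lp_le:
  assumes r: "1 \<le> r" "r \<le> p" "p \<le> 2 * r" and K: "1 \<le> K"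
  obtains C where "0 < C" "\<And>a b A0 A2 B0 B2 k. dyadic_bounds p K a A0 A2 \<Longrightarrow> dyadic_bounds p K b B0 B2 \<Longrightarrow>
    Lp_le r (remainder_term chi a b k) (C * (2 powr (- (real_of_int k * (real CARD('d) / r - 2))) * (A0 * B2)))"
proof -
  define e where "e = real CARD('d) / p - real CARD('d) / r + 2"
  define L where "L = 2 powr \<bar>e\<bar> * K powr ((2 * r - p) / r)"
  have L: "0 < L" using K by (simp add: L_def)
  then have "0 < 2 ^ Suc 3 * L" by simp
  then show ?thesis
  proof (rule that)
    fix a b A0 A2 B0 B2 k assume a: "dyadic_bounds p K a A0 A2" and b: "dyadic_bounds p K b B0 B2"
    let ?k = "real_of_int k"
    define f where "f = (\<lambda>i::nat. \<lambda>x. block chi (k - 1 + int i) a x * block chi k b x)"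
    define M where "M = L * (2 powr (- (?k * (real CARD('d) / r - 2))) * (A0 * B2))"
    have AB: "0 \<le> A0 * B2" using dyadic_boundsD(2)[OF a] dyadic_boundsD(3)[OF b] by simp
    have M: "0 \<le> M" using L AB by (simp add: M_def)
    have fi: "Lp_le r (f i) M" if i: "i < 3" for i
    proof -
      have x: "\<bar>real i - 1\<bar> \<le> 1" using i by linarith
      have "(real i - 1) * e \<le> \<bar>real i - 1\<bar> * \<bar>e\<bar>" by (metis abs_ge_self abs_mult)
      also have "\<dots> \<le> 1 * \<bar>e\<bar>" by (rule mult_right_mono[OF x]) simp
      finally have "(real i - 1) * e \<le> \<bar>e\<bar>" by simp
      moreover have "real_of_int (k - 1 + int i) * e - ?k * (real CARD('d) / p) = (real i - 1) * e + (- (?k * (real CARD('d) / r - 2)))"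
      proof -
        have "(m + t) * (x - y + 2) - m * x = t * (x - y + 2) + (- (m * (y - 2)))" for m t x y :: real
          by (simp add: algebra_simps)
        from this[of ?k "real i - 1" "real CARD('d) / p" "real CARD('d) / r"] show ?thesis unfolding e_def by (simp add: add_diff_eq diff_add_eq)
      qed
      ultimately have "2 powr (real_of_int (k - 1 + int i) * e - ?k * (real CARD('d) / p)) \<le> 2 powr (\<bar>e\<bar> + (- (?k * (real CARD('d) / r - 2))))"
        by (intro powr_mono) auto
      then have "2 powr (real_of_int (k - 1 + int i) * e - ?k * (real CARD('d) / p)) * (K powr ((2 * r - p) / r) * (A0 * B2))
        \<le> 2 powr (\<bar>e\<bar> + (- (?k * (real CARD('d) / r - 2)))) * (K powr ((2 * r - p) / r) * (A0 * B2))"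
        by (rule mult_right_mono) (use AB in simp)
      also have "\<dots> = M" unfolding M_def L_def powr_add by (simp only: mult_ac)
      finally have le: "2 powr (real_of_int (k - 1 + int i) * e - ?k * (real CARD('d) / p)) * (K powr ((2 * r - p) / r) * (A0 * B2)) \<le> M" .
      show ?thesis
        unfolding f_def by (rule Lp_le_mono[OF block_product[OF a b K r] le[unfolded e_def]]) (use r in simp)
    qed
    have "(\<lambda>x. \<Sum>n<3. f n x) = remainder_term chi a b k"
    proof
      fix x
      have "(\<Sum>n<3. f n x) = f 0 x + f 1 x + f 2 x" by (simp add: numeral_3_eq_3 numeral_2_eq_2)
      also have "\<dots> = remainder_term chi a b k x" unfolding f_def remainder_term_def wide_block_eq by (simp add: algebra_simps)
      finally show "(\<Sum>n<3. f n x) = remainder_term chi a b k x" .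
    qed
    moreover have "Lp_le r (\<lambda>x. \<Sum>n<3. f n x) (2 ^ Suc 3 * M)" by (rule Lp_le_sum[OF r(1) _ M]) (rule fi)
    ultimately have "Lp_le r (remainder_term chi a b k) (2 ^ Suc 3 * M)" by (simp only:)
    then show "Lp_le r (remainder_term chi a b k) (2 ^ Suc 3 * L * (2 powr (- (?k * (real CARD('d) / r - 2))) * (A0 * B2)))"
      by (simp only: M_def mult.assoc)
  qed
qed

text \<open>Bernstein's inequality from \<open>L\<^sup>r\<close> to \<open>L\<^sup>q\<close>, by interpolation between the bounds from \<open>L\<^sup>r\<close> to \<open>L\<^sup>r\<close> and to bounded functions.\<close>

lemma dyadic_convolution:
  assumes r: "1 \<le> r" "r \<le> q"
  obtains C where "0 < C" "\<And>j g M. Lp_le r g M \<Longrightarrow>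
    Lp_le q (\<lambda>y::real^'d. LINT x|lborel. g x * Ker (dyadic_symbol j) (x - y)) (C * (2 powr (real_of_int j * (real CARD('d) / r - real CARD('d) / q)) * M))"
proof -
  obtain W S where WS: "0 < W" "0 < S"
    "\<And>j. (\<integral>\<^sup>+x. ennreal (norm (Ker (\<lambda>\<xi>. dyadic_symbol 0 (2 powi (- j) *\<^sub>R \<xi>)) (x - 0))) \<partial>lborel) \<le> ennreal W"
    "\<And>j x. norm (Ker (\<lambda>\<xi>. dyadic_symbol 0 (2 powi (- j) *\<^sub>R \<xi>)) (x::real^'d)) \<le> S * 2 powr (real_of_int j * real CARD('d))"
    using Ker_dyadic_bounds[OF schwartz_dyadic_symbol[of 0], of 0] by blast
  define C1 where "C1 = (W powr (r - 1) * S) powr (1 / r)"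
  have C1: "0 < C1" using WS by (simp add: C1_def)
  define C where "C = C1 powr ((q - r) / q) * W powr (r / q)"
  have "0 < C" using C1 WS by (simp add: C_def)
  then show ?thesis
  proof (rule that)
    fix j M and g :: "real^'d \<Rightarrow> complex" assume g: "Lp_le r g M"
    let ?j = "real_of_int j" and ?d = "real CARD('d)"
    have K: "Ker (dyadic_symbol j) \<in> borel_measurable borel" by (intro schwartz_measurable schwartz_Ker schwartz_dyadic_symbol)
    have 1: "(\<integral>\<^sup>+x. ennreal (norm (Ker (dyadic_symbol j) x)) \<partial>lborel) \<le> ennreal W"
      using WS(3)[of j] unfolding dyadic_symbol_scale[symmetric] diff_zero .
    have Lr: "Lp_le r (\<lambda>y. LINT x|lborel. g x * Ker (dyadic_symbol j) (x - y)) (W * M)"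
      by (rule Lp_le_conv[OF r(1) g K WS(1) 1])
    define T where "T = C1 * 2 powr (?j * (?d / r))"
    have T: "0 < T" using C1 by (simp add: T_def)
    have Te: "(W powr (r - 1) * (S * 2 powr (?j * ?d))) powr (1 / r) = T"
      unfolding T_def C1_def mult.assoc[symmetric] using WS by (simp add: powr_mult powr_powr)
    have sup: "norm (LINT x|lborel. g x * Ker (dyadic_symbol j) (x - y)) \<le> T * M" for y
    proof -
      have Ky: "(\<lambda>x. Ker (dyadic_symbol j) (x - y)) \<in> borel_measurable borel"
        by (intro schwartz_measurable schwartz_shift[of "Ker (dyadic_symbol j)"] schwartz_Ker schwartz_dyadic_symbol)
      have 1: "(\<integral>\<^sup>+x. ennreal (norm (Ker (dyadic_symbol j) (x - y))) \<partial>lborel) \<le> ennreal W"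
        using 1 unfolding nn_integral_reflect_shift(2)[OF K] .
      have 2: "norm (Ker (dyadic_symbol j) (x - y)) \<le> S * 2 powr (?j * ?d)" for x
        using WS(4)[of j "x - y"] unfolding dyadic_symbol_scale[symmetric] .
      have Sp: "0 < S * 2 powr (?j * ?d)" using WS by simp
      show ?thesis
        using Lp_le_pairing(3)[OF r(1) g Ky WS(1) 1 Sp 2] unfolding Te .
    qed
    have "Lp_le q (\<lambda>y. LINT x|lborel. g x * Ker (dyadic_symbol j) (x - y)) (T powr ((q - r) / q) * W powr (r / q) * M)"
      by (rule Lp_le_interpolate[OF r Lr T sup WS(1) Lp_leD(2)[OF g]])
    also have "T powr ((q - r) / q) = C1 powr ((q - r) / q) * 2 powr (?j * (?d / r - ?d / q))"
    proof -
      have "?j * (?d / r) * ((q - r) / q) = ?j * (?d / r - ?d / q)" using r by (simp add: field_simps)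
      then show ?thesis unfolding T_def using C1 by (simp add: powr_mult powr_powr)
    qed
    finally show "Lp_le q (\<lambda>y. LINT x|lborel. g x * Ker (dyadic_symbol j) (x - y)) (C * (2 powr (?j * (?d / r - ?d / q)) * M))"
      unfolding C_def by (simp only: mult_ac)
  qed
qed

lemma powi_far: "a + int n \<le> b \<Longrightarrow> 2 ^ n * 2 powi a \<le> (2::real) powi b"
proof -
  assume "a + int n \<le> b"
  then have "(2::real) powi (a + int n) \<le> 2 powi b" by (intro power_int_increasing) auto
  then show ?thesis by (simp add: powi_shift mult.commute)
qed

text \<open>The first factor has frequencies up to \<open>2/3 2\<^sup>k\<close>, the second one from \<open>3/4 2\<^sup>k\<close> to \<open>8/3 2\<^sup>k\<close>. So the product has frequencies from
  \<open>1/12 2\<^sup>k\<close> to \<open>10/3 2\<^sup>k\<close>, disjoint from the annulus between \<open>3/4 2\<^sup>j\<close> and \<open>8/3 2\<^sup>j\<close> in the two cases.\<close>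

lemma para_spectrum:
  assumes u: "tempered u" and v: "tempered v" and far: "k + 3 \<le> j \<or> j + 6 \<le> k"
  shows "(LINT x|lborel. (tconv u (Ker (low_symbol (k - 1))) x * tconv v (Ker (dyadic_symbol k)) x) * Ker (dyadic_symbol j) (x - (y::real^'d))) = 0"
proof (rule spectral_product_vanishes[OF u v schwartz_low_symbol schwartz_dyadic_symbol schwartz_dyadic_symbol])
  fix \<xi> \<eta> assume \<xi>: "low_symbol (k - 1) \<xi> \<noteq> 0" and \<eta>: "dyadic_symbol k \<eta> \<noteq> 0"
  have e: "(2::real) powi (k - 1) = 2 powi k / 2" using powi_shift[of k "- 1"] by simp
  have 1: "norm \<xi> \<le> 2 powi k / 2 * (4 / 3)" using low_symbol_support[OF \<xi>] unfolding e .
  note 2 = dyadic_symbol_support[OF \<eta>]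
  have 3: "norm (\<xi> + \<eta>) \<le> norm \<xi> + norm \<eta>" by (rule norm_triangle_ineq)
  have 4: "norm \<eta> - norm \<xi> \<le> norm (\<xi> + \<eta>)" using norm_triangle_ineq2[of \<eta> "- \<xi>"] by (simp add: add.commute)
  have pk: "0 < (2::real) powi k" by (rule powi_pos)
  show "dyadic_symbol j (\<xi> + \<eta>) = 0"
  proof (rule ccontr)
    assume "dyadic_symbol j (\<xi> + \<eta>) \<noteq> 0"
    note 5 = dyadic_symbol_support[OF this]
    show False using far
    proof
      assume "k + 3 \<le> j"
      then have "2 ^ 3 * 2 powi k \<le> (2::real) powi j" by (intro powi_far) simp
      then have "8 * 2 powi k \<le> (2::real) powi j" by simp
      with 1 2 3 5 pk show False by linarith
    next
      assume "j + 6 \<le> k"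
      then have "2 ^ 6 * 2 powi j \<le> (2::real) powi k" by (intro powi_far) simp
      then have "64 * 2 powi j \<le> (2::real) powi k" by simp
      with 1 2 4 5 pk show False by linarith
    qed
  qed
qed

text \<open>The product has frequencies up to \<open>16/3 2\<^sup>k + 8/3 2\<^sup>k\<close>, below \<open>3/4 2\<^sup>j\<close>.\<close>

lemma block_product_spectrum:
  assumes u: "tempered u" and v: "tempered v" and l: "l \<le> k + 1" and j: "k + 4 \<le> j"
  shows "(LINT x|lborel. (tconv u (Ker (dyadic_symbol l)) x * tconv v (Ker (dyadic_symbol k)) x) * Ker (dyadic_symbol j) (x - (y::real^'d))) = 0"
proof (rule spectral_product_vanishes[OF u v schwartz_dyadic_symbol schwartz_dyadic_symbol schwartz_dyadic_symbol])
  fix \<xi> \<eta> assume \<xi>: "dyadic_symbol l \<xi> \<noteq> 0" and \<eta>: "dyadic_symbol k \<eta> \<noteq> 0"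
  have "(2::real) powi l \<le> 2 powi (k + 1)" using l by (intro power_int_increasing) auto
  then have e: "(2::real) powi l \<le> 2 powi k * 2" by (simp add: powi_shift)
  have 3: "norm (\<xi> + \<eta>) \<le> norm \<xi> + norm \<eta>" by (rule norm_triangle_ineq)
  have "2 ^ 4 * 2 powi k \<le> (2::real) powi j" using j by (intro powi_far) simp
  then have j: "16 * 2 powi k \<le> (2::real) powi j" by simp
  show "dyadic_symbol j (\<xi> + \<eta>) = 0"
  proof (rule ccontr)
    assume "dyadic_symbol j (\<xi> + \<eta>) \<noteq> 0"
    from dyadic_symbol_support(1)[OF this] dyadic_symbol_support(2)[OF \<xi>] dyadic_symbol_support(2)[OF \<eta>] e 3 j powi_pos[of k]
    show False by linarith
  qed
qed

lemma dyadic_bounds_tempered: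
  assumes a: "dyadic_bounds p K a A0 A2"
  obtains u where "tempered u" "\<And>l. block chi l a = tconv u (Ker (dyadic_symbol l))"
proof -
  define u where "u = (SOME u. u \<in> a)"
  note t = dyadic_boundsD(1)[OF a]
  have u: "u \<in> a" unfolding u_def by (rule tempered_mod_poly_some[OF t])
  show ?thesis by (rule that[OF tempered_mod_polyE(1)[OF t u] block_eq[OF t u]])
qed

lemma schwartz_Ker_shift: "(\<lambda>x. Ker (dyadic_symbol j) (x - y)) \<in> schwartz"
  by (intro schwartz_shift[of "Ker (dyadic_symbol j)"] schwartz_Ker schwartz_dyadic_symbol)

lemma remainder_spectrum:
  assumes a: "dyadic_bounds p K a A0 A2" and b: "dyadic_bounds p K b B0 B2" and j: "k + 4 \<le> j"
  shows "(LINT x|lborel. remainder_term chi a b k x * Ker (dyadic_symbol j) (x - y)) = 0"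
proof -
  obtain u where u: "tempered u" "\<And>l. block chi l a = tconv u (Ker (dyadic_symbol l))" by (rule dyadic_bounds_tempered[OF a], rule that, assumption, blast)
  obtain v where v: "tempered v" "\<And>l. block chi l b = tconv v (Ker (dyadic_symbol l))" by (rule dyadic_bounds_tempered[OF b], rule that, assumption, blast)
  define h where "h = (\<lambda>l x. (block chi l a x * block chi k b x) * Ker (dyadic_symbol j) (x - y))"
  have hi: "integrable lborel (h l)" for l
  proof -
    have "(\<lambda>x. tconv u (Ker (dyadic_symbol l)) x * (tconv v (Ker (dyadic_symbol k)) x * Ker (dyadic_symbol j) (x - y))) \<in> schwartz"
      by (rule schwartz_tconv_mult[OF u(1) schwartz_Ker[OF schwartz_dyadic_symbol] schwartz_tconv_mult[OF v(1) schwartz_Ker[OF schwartz_dyadic_symbol] schwartz_Ker_shift]])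
    from schwartz_integrable[OF this] show ?thesis unfolding h_def u(2) v(2) mult.assoc .
  qed
  have hz: "(LINT x|lborel. h l x) = 0" if "l \<le> k + 1" for l
    unfolding h_def u(2) v(2) by (rule block_product_spectrum[OF u(1) v(1) that j])
  have "remainder_term chi a b k x * Ker (dyadic_symbol j) (x - y) = h (k - 1) x + h k x + h (k + 1) x" for x
    unfolding remainder_term_def wide_block_eq h_def by (simp add: algebra_simps)
  then have "(LINT x|lborel. remainder_term chi a b k x * Ker (dyadic_symbol j) (x - y)) = (LINT x|lborel. h (k - 1) x + h k x + h (k + 1) x)"
    by simp
  also have "\<dots> = 0" using hi hz[of "k - 1"] hz[of k] hz[of "k + 1"] by simp
  finally show ?thesis .
qed

text \<open>Eight indices \<open>k\<close>, from \<open>j - 2\<close> to \<open>j + 5\<close>, contribute. On them \<open>2\<^sup>k\<close> and \<open>2\<^sup>j\<close> are comparable.\<close>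

lemma paraproduct_block:
  assumes q: "1 \<le> q" "q \<le> p" "p \<le> 2 * q" and K: "1 \<le> K" and p: "p < real CARD('d)"
    and \<epsilon>: "real CARD('d) / q < real CARD('d) / p + 2"
  obtains C where "0 < C" "\<And>a b A0 A2 B0 B2 j. dyadic_bounds p K a A0 A2 \<Longrightarrow> dyadic_bounds p K b B0 B2 \<Longrightarrow>
    Lp_le q (tconv (paraproduct chi a b) (Ker (dyadic_symbol j))) (C * (2 powr (- (real_of_int j * (real CARD('d) / q - 2))) * (A0 * B2)))"
proof -
  have p1: "1 \<le> p" using q by simp
  let ?s = "real CARD('d) / q - 2"
  obtain C1 where C1: "0 < C1" "\<And>a b A0 A2 B0 B2 k. dyadic_bounds p K a A0 A2 \<Longrightarrow> dyadic_bounds p K b B0 B2 \<Longrightarrow>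
    Lp_le q (para_term chi a b k) (C1 * (2 powr (- (real_of_int k * ?s)) * (A0 * B2)))"
    using para_Lp_le[OF q K \<epsilon>] by blast
  obtain C2 where C2: "0 < C2" "\<And>j g M. Lp_le q g M \<Longrightarrow>
    Lp_le q (\<lambda>y::real^'d. LINT x|lborel. g x * Ker (dyadic_symbol j) (x - y)) (C2 * (2 powr (real_of_int j * (real CARD('d) / q - real CARD('d) / q)) * M))"
    using dyadic_convolution[OF q(1) order_refl] by blast
  define C where "C = 2 ^ Suc 8 * (C2 * C1 * 2 powr (5 * \<bar>?s\<bar>))"
  have "0 < C" using C1 C2 by (simp add: C_def)
  then show ?thesis
  proof (rule that)
    fix a b A0 A2 B0 B2 j assume a: "dyadic_bounds p K a A0 A2" and b: "dyadic_bounds p K b B0 B2"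
    have AB: "0 \<le> A0 * B2" using dyadic_boundsD(2)[OF a] dyadic_boundsD(3)[OF b] by simp
    obtain u where u: "tempered u" "\<And>l. block chi l a = tconv u (Ker (dyadic_symbol l))" "\<And>j. low_block chi j a = tconv u (Ker (low_symbol j))"
      "\<And>j y. (\<lambda>i::nat. block chi (j - 1 - int i) a y) sums low_block chi j a y"
      "\<And>j y. norm (low_block chi j a y) \<le> 2 powr real_of_int j * (K * (A0 + A2))"
      using dyadic_realization[OF a K p1] by blast
    obtain v where v: "tempered v" "\<And>l. block chi l b = tconv v (Ker (dyadic_symbol l))" by (rule dyadic_bounds_tempered[OF b], rule that, assumption, blast)
    define c where "c = (\<lambda>k y. LINT x|lborel. para_term chi a b k x * Ker (dyadic_symbol j) (x - y))"
    have cz: "c k y = 0" if "k + 3 \<le> j \<or> j + 6 \<le> k" for k y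
      unfolding c_def para_term_def u(3) v(2) by (rule para_spectrum[OF u(1) v(1) that])
    define M where "M = C2 * C1 * 2 powr (5 * \<bar>?s\<bar>) * (2 powr (- (real_of_int j * ?s)) * (A0 * B2))"
    have M: "0 \<le> M" using C1 C2 AB by (simp add: M_def)
    have fn: "Lp_le q (c (j - 2 + int n)) M" if n: "n < 8" for n
    proof -
      let ?k = "real_of_int (j - 2 + int n)"
      have "\<bar>real n - 2\<bar> \<le> 5" using n by linarith
      then have 1: "\<bar>real n - 2\<bar> * \<bar>?s\<bar> \<le> 5 * \<bar>?s\<bar>" by (rule mult_right_mono) simp
      have 2: "- ((real n - 2) * ?s) \<le> \<bar>real n - 2\<bar> * \<bar>?s\<bar>" by (metis abs_ge_minus_self abs_mult)
      have 3: "- (?k * ?s) = - ((real n - 2) * ?s) + (- (real_of_int j * ?s))" by (simp add: left_diff_distrib distrib_right)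
      have "- (?k * ?s) \<le> 5 * \<bar>?s\<bar> + (- (real_of_int j * ?s))"
        unfolding 3 by (rule add_right_mono[OF order_trans[OF 2 1]])
      then have "2 powr (- (?k * ?s)) \<le> 2 powr (5 * \<bar>?s\<bar> + (- (real_of_int j * ?s)))" by (intro powr_mono) auto
      then have "C2 * (C1 * (2 powr (- (?k * ?s)) * (A0 * B2))) \<le> C2 * (C1 * (2 powr (5 * \<bar>?s\<bar> + (- (real_of_int j * ?s))) * (A0 * B2)))"
        using C1(1) C2(1) AB by (intro mult_left_mono mult_right_mono) auto
      also have "\<dots> = M" unfolding M_def powr_add by (simp only: mult.assoc)
      finally have le: "C2 * (C1 * (2 powr (- (?k * ?s)) * (A0 * B2))) \<le> M" .
      have "Lp_le q (c (j - 2 + int n)) (C2 * (C1 * (2 powr (- (?k * ?s)) * (A0 * B2))))"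
        using C2(2)[OF C1(2)[OF a b, of "j - 2 + int n"], of j] unfolding c_def by simp
      then show ?thesis by (rule Lp_le_mono[OF _ le]) (use q in simp)
    qed
    have "tconv (paraproduct chi a b) (Ker (dyadic_symbol j)) = (\<lambda>y. \<Sum>n<8. c (j - 2 + int n) y)"
    proof
      fix y
      have "(\<lambda>k. c k y) summable_on UNIV"
        using para_tempered(3)[OF a b K p1 p schwartz_Ker_shift, of j y] unfolding c_def distr_of_fun_def .
      then have "(\<lambda>n. c (j - 2 + int n) y) sums (\<Sum>\<^sub>\<infinity>k. c k y)"
        by (rule int_series_from) (intro cz, simp)
      moreover have "(\<lambda>n. c (j - 2 + int n) y) sums (\<Sum>n<8. c (j - 2 + int n) y)"
        by (rule sums_finite) (auto intro!: cz)
      ultimately have "(\<Sum>\<^sub>\<infinity>k. c k y) = (\<Sum>n<8. c (j - 2 + int n) y)" by (rule sums_unique2)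
      then show "tconv (paraproduct chi a b) (Ker (dyadic_symbol j)) y = (\<Sum>n<8. c (j - 2 + int n) y)"
        unfolding tconv_def paraproduct_def distr_sum_def distr_of_fun_def c_def .
    qed
    moreover have "Lp_le q (\<lambda>y. \<Sum>n<8. c (j - 2 + int n) y) (2 ^ Suc 8 * M)" by (rule Lp_le_sum[OF q(1) _ M]) (rule fn)
    ultimately have "Lp_le q (tconv (paraproduct chi a b) (Ker (dyadic_symbol j))) (2 ^ Suc 8 * M)" by (simp only:)
    then show "Lp_le q (tconv (paraproduct chi a b) (Ker (dyadic_symbol j))) (C * (2 powr (- (real_of_int j * ?s)) * (A0 * B2)))"
      unfolding C_def M_def by (simp only: mult.assoc)
  qed
qed

text \<open>All \<open>k \<ge> j - 3\<close> contribute. The decay in \<open>k\<close> is that of the terms in \<open>L\<^sup>r\<close>.\<close>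

lemma remainder_block:
  assumes q: "1 \<le> q" "q \<le> p" "p \<le> 2 * q" and K: "1 \<le> K" and p: "p < real CARD('d)" and d: "3 \<le> real CARD('d)"
  obtains C where "0 < C" "\<And>a b A0 A2 B0 B2 j. dyadic_bounds p K a A0 A2 \<Longrightarrow> dyadic_bounds p K b B0 B2 \<Longrightarrow>
    Lp_le q (tconv (remainder chi a b) (Ker (dyadic_symbol j))) (C * (2 powr (- (real_of_int j * (real CARD('d) / q - 2))) * (A0 * B2)))"
proof -
  have p1: "1 \<le> p" using q by simp
  let ?s = "real CARD('d) / q - 2"
  \<comment> \<open>The least exponent \<open>r \<ge> 1\<close> for which \<open>Lp_le_product\<close> applies; it makes \<open>\<rho>\<close> as large as possible.\<close>
  define r where "r = max 1 (p / 2)"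
  have r: "1 \<le> r" "r \<le> p" "p \<le> 2 * r" "r \<le> q" using q p1 by (auto simp: r_def)
  define \<rho> where "\<rho> = real CARD('d) / r - 2"
  have "2 * r < real CARD('d)" using p d by (simp add: r_def max_def)
  then have \<rho>: "0 < \<rho>" using r by (simp add: \<rho>_def less_divide_eq)
  obtain C1 where C1: "0 < C1" "\<And>a b A0 A2 B0 B2 k. dyadic_bounds p K a A0 A2 \<Longrightarrow> dyadic_bounds p K b B0 B2 \<Longrightarrow>
    Lp_le r (remainder_term chi a b k) (C1 * (2 powr (- (real_of_int k * (real CARD('d) / r - 2))) * (A0 * B2)))"
    using remainder_Lp_le[OF r(1-3) K] by blast
  obtain C2 where C2: "0 < C2" "\<And>j g M. Lp_le r g M \<Longrightarrow>
    Lp_le q (\<lambda>y::real^'d. LINT x|lborel. g x * Ker (dyadic_symbol j) (x - y)) (C2 * (2 powr (real_of_int j * (real CARD('d) / r - real CARD('d) / q)) * M))"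
    using dyadic_convolution[OF r(1,4)] by blast
  define w where "w = (\<lambda>n::nat. (2 powr (- \<rho>)) ^ n)"
  have w0: "0 < w n" for n by (simp add: w_def)
  have "2 powr (- \<rho>) < 1" using \<rho> by (simp add: powr_less_one)
  then have ws: "summable w" unfolding w_def by (intro summable_geometric) simp
  define C where "C = suminf w * (C2 * C1 * 2 powr (3 * \<rho>))"
  have "0 < C" using C1 C2 suminf_pos[OF ws w0] by (simp add: C_def)
  then show ?thesis
  proof (rule that)
    fix a b A0 A2 B0 B2 j assume a: "dyadic_bounds p K a A0 A2" and b: "dyadic_bounds p K b B0 B2"
    have AB: "0 \<le> A0 * B2" using dyadic_boundsD(2)[OF a] dyadic_boundsD(3)[OF b] by simp
    define c where "c = (\<lambda>k y. LINT x|lborel. remainder_term chi a b k x * Ker (dyadic_symbol j) (x - y))"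
    have cz: "c k y = 0" if "k + 4 \<le> j" for k y
      unfolding c_def by (rule remainder_spectrum[OF a b that])
    define M where "M = C2 * C1 * 2 powr (3 * \<rho>) * (2 powr (- (real_of_int j * ?s)) * (A0 * B2))"
    have M: "0 \<le> M" using C1 C2 AB by (simp add: M_def)
    have fn: "Lp_le q (c (j - 3 + int n)) (w n * M)" for n
    proof -
      let ?k = "real_of_int (j - 3 + int n)" and ?e = "real_of_int j * (real CARD('d) / r - real CARD('d) / q)"
      have wn: "w n = 2 powr (- (real n * \<rho>))" by (simp add: w_def powr_realpow[symmetric] powr_powr mult.commute)
      have "?e + (- (?k * (real CARD('d) / r - 2))) = - (real n * \<rho>) + 3 * \<rho> + (- (real_of_int j * ?s))"
      proof -
        have "t * (x - y) + (- ((t - 3 + m) * (x - 2))) = - (m * (x - 2)) + 3 * (x - 2) + (- (t * (y - 2)))" for t m x y :: real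
          by (simp add: algebra_simps)
        from this[of "real_of_int j" "real CARD('d) / r" "real CARD('d) / q" "real n"] show ?thesis unfolding \<rho>_def by simp
      qed
      then have "2 powr ?e * 2 powr (- (?k * (real CARD('d) / r - 2))) = w n * 2 powr (3 * \<rho>) * 2 powr (- (real_of_int j * ?s))"
        unfolding wn powr_add[symmetric] by (simp only:)
      then have "C2 * C1 * (2 powr ?e * 2 powr (- (?k * (real CARD('d) / r - 2)))) * (A0 * B2) = C2 * C1 * (w n * 2 powr (3 * \<rho>) * 2 powr (- (real_of_int j * ?s))) * (A0 * B2)"
        by (simp only:)
      then have "C2 * (2 powr ?e * (C1 * (2 powr (- (?k * (real CARD('d) / r - 2))) * (A0 * B2)))) = w n * M"
        unfolding M_def by (simp only: mult_ac)
      with C2(2)[OF C1(2)[OF a b, of "j - 3 + int n"], of j] show ?thesis unfolding c_def by (simp only:)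
    qed
    have tR: "tempered (remainder chi a b)" by (rule remainder_tempered(2)[OF a b K p1 p])
    have "Lp_le q (tconv (remainder chi a b) (Ker (dyadic_symbol j))) (suminf w * M)"
    proof (rule Lp_le_series[OF q(1) fn w0 ws _ _ M])
      show "tconv (remainder chi a b) (Ker (dyadic_symbol j)) \<in> borel_measurable borel"
        by (intro borel_measurable_continuous_onI tconv_continuous tR schwartz_Ker schwartz_dyadic_symbol)
      fix y
      have "(\<lambda>k. c k y) summable_on UNIV"
        using remainder_tempered(3)[OF a b K p1 p schwartz_Ker_shift, of j y] unfolding c_def distr_of_fun_def .
      then have "(\<lambda>n. c (j - 3 + int n) y) sums (\<Sum>\<^sub>\<infinity>k. c k y)"
        by (rule int_series_from) (intro cz, simp)
      moreover have "tconv (remainder chi a b) (Ker (dyadic_symbol j)) y = (\<Sum>\<^sub>\<infinity>k. c k y)"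
        unfolding tconv_def remainder_def distr_sum_def distr_of_fun_def c_def ..
      ultimately show "ennreal (norm (tconv (remainder chi a b) (Ker (dyadic_symbol j)) y)) \<le> (\<Sum>n. ennreal (norm (c (j - 3 + int n) y)))"
        by (simp only: ennreal_norm_sums)
    qed
    then show "Lp_le q (tconv (remainder chi a b) (Ker (dyadic_symbol j))) (C * (2 powr (- (real_of_int j * ?s)) * (A0 * B2)))"
      unfolding C_def M_def by (simp only: mult.assoc)
  qed
qed

lemma bony_product_bound:
  assumes q: "1 \<le> q" "q \<le> p" "p \<le> 2 * q" and K: "1 \<le> K" and p: "p < real CARD('d)" and d: "3 \<le> real CARD('d)"
    and \<epsilon>: "real CARD('d) / q < real CARD('d) / p + 2"
  obtains C where "0 < C" "\<And>a b A0 A2 B0 B2. dyadic_bounds p K a A0 A2 \<Longrightarrow> dyadic_bounds p K b B0 B2 \<Longrightarrow>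
    bony_product_exists chi a b \<and>
    besov_norm chi (real CARD('d) / q - 2) (ennreal q) \<infinity> (bony_product chi a b) \<le> ennreal (C * (A0 * B2 + B0 * A2))"
proof -
  have p1: "1 \<le> p" using q by simp
  let ?s = "real CARD('d) / q - 2"
  obtain C1 where C1: "0 < C1" "\<And>a b A0 A2 B0 B2 j. dyadic_bounds p K a A0 A2 \<Longrightarrow> dyadic_bounds p K b B0 B2 \<Longrightarrow>
    Lp_le q (tconv (paraproduct chi a b) (Ker (dyadic_symbol j))) (C1 * (2 powr (- (real_of_int j * ?s)) * (A0 * B2)))"
    using paraproduct_block[OF q K p \<epsilon>] by blast
  obtain C2 where C2: "0 < C2" "\<And>a b A0 A2 B0 B2 j. dyadic_bounds p K a A0 A2 \<Longrightarrow> dyadic_bounds p K b B0 B2 \<Longrightarrow>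
    Lp_le q (tconv (remainder chi a b) (Ker (dyadic_symbol j))) (C2 * (2 powr (- (real_of_int j * ?s)) * (A0 * B2)))"
    using remainder_block[OF q K p d] by blast
  have "0 < 64 * (C1 + C2)" using C1 C2 by simp
  then show ?thesis
  proof (rule that)
    fix a b A0 A2 B0 B2 assume a: "dyadic_bounds p K a A0 A2" and b: "dyadic_bounds p K b B0 B2"
    define E where "E = A0 * B2 + B0 * A2"
    have AB: "0 \<le> A0 * B2" "0 \<le> B0 * A2" using dyadic_boundsD(2,3)[OF a] dyadic_boundsD(2,3)[OF b] by auto
    have E: "A0 * B2 \<le> E" "B0 * A2 \<le> E" "0 \<le> E" using AB by (auto simp: E_def)
    note Pab = para_tempered[OF a b K p1 p] and Pba = para_tempered[OF b a K p1 p] and R = remainder_tempered[OF a b K p1 p]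
    define W where "W = (\<lambda>\<psi>. paraproduct chi a b \<psi> + remainder chi a b \<psi> + paraproduct chi b a \<psi>)"
    have tW: "tempered W"
    proof -
      have "tempered (\<lambda>\<psi>. (paraproduct chi a b \<psi> + 1 * remainder chi a b \<psi>) + 1 * paraproduct chi b a \<psi>)"
        by (intro tempered_fun_lincomb Pab(2) Pba(2) R(2))
      then show ?thesis unfolding W_def by simp
    qed
    have bony: "bony_product chi a b = poly_equiv `` {W}" unfolding bony_product_def W_def ..
    have mem: "bony_product chi a b \<in> tempered_mod_poly"
      unfolding bony tempered_mod_poly_def using tW by (intro quotientI) simp
    have Wm: "W \<in> bony_product chi a b"
      unfolding bony by (rule equiv_class_self[OF equiv_poly_equiv]) (simp add: tW)
    have ex: "bony_product_exists chi a b"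
      unfolding bony_product_exists_def using Pab(1) Pba(1) R(1) mem by blast
    have bl: "ennreal (2 powr (real_of_int j * ?s)) * Lp_norm (ennreal q) lborel (\<lambda>x. ennreal (norm (block chi j (bony_product chi a b) x)))
       \<le> ennreal (64 * (C1 + C2) * E)" for j
    proof -
      define M where "M = 2 powr (- (real_of_int j * ?s)) * ((C1 + C2) * E)"
      have le: "c * (2 powr (- (real_of_int j * ?s)) * m) \<le> M" if "c \<le> C1 + C2" "m \<le> E" "0 \<le> m" for c m
      proof -
        have "c * m \<le> (C1 + C2) * E" using that C1(1) C2(1) by (intro mult_mono) auto
        then have "2 powr (- (real_of_int j * ?s)) * (c * m) \<le> M" unfolding M_def by (rule mult_left_mono) simp
        then show ?thesis by (simp only: mult.left_commute)
      qed
      have q0: "0 \<le> q" using q by simp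
      have 1: "Lp_le q (tconv (paraproduct chi a b) (Ker (dyadic_symbol j))) M"
        by (rule Lp_le_mono[OF C1(2)[OF a b] le q0]) (use C2(1) E AB in auto)
      have 2: "Lp_le q (tconv (remainder chi a b) (Ker (dyadic_symbol j))) M"
        by (rule Lp_le_mono[OF C2(2)[OF a b] le q0]) (use C1(1) E AB in auto)
      have 3: "Lp_le q (tconv (paraproduct chi b a) (Ker (dyadic_symbol j))) M"
        by (rule Lp_le_mono[OF C1(2)[OF b a] le q0]) (use C2(1) E AB in auto)
      have M0: "0 \<le> M" by (rule Lp_leD(2)[OF 1])
      have "Lp_le q (tconv (paraproduct chi b a) (Ker (dyadic_symbol j))) (8 * M)"
        by (rule Lp_le_mono[OF 3 _ q0]) (use M0 in simp)
      from Lp_le_plus[OF q(1) Lp_le_plus[OF q(1) 1 2] this]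
      have "Lp_le q (\<lambda>y. tconv (paraproduct chi a b) (Ker (dyadic_symbol j)) y + tconv (remainder chi a b) (Ker (dyadic_symbol j)) y + tconv (paraproduct chi b a) (Ker (dyadic_symbol j)) y) (8 * (8 * M))" .
      moreover have "(\<lambda>y. tconv (paraproduct chi a b) (Ker (dyadic_symbol j)) y + tconv (remainder chi a b) (Ker (dyadic_symbol j)) y + tconv (paraproduct chi b a) (Ker (dyadic_symbol j)) y)
         = block chi j (bony_product chi a b)"
        unfolding block_eq[OF mem Wm] by (rule ext) (simp only: tconv_def W_def)
      ultimately have L: "Lp_le q (block chi j (bony_product chi a b)) (8 * (8 * M))" by (simp only:)
      have "Lp_norm (ennreal q) lborel (\<lambda>x. ennreal (norm (block chi j (bony_product chi a b) x))) \<le> ennreal (8 * (8 * M))"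
        using Lp_le_iff_Lp_norm[OF q(1) Lp_leD(1)[OF L] Lp_leD(2)[OF L]] L by blast
      then have "ennreal (2 powr (real_of_int j * ?s)) * Lp_norm (ennreal q) lborel (\<lambda>x. ennreal (norm (block chi j (bony_product chi a b) x)))
        \<le> ennreal (2 powr (real_of_int j * ?s)) * ennreal (8 * (8 * M))" by (rule mult_left_mono) simp
      also have "\<dots> = ennreal (2 powr (real_of_int j * ?s) * (8 * (8 * M)))" using M0 by (simp only: ennreal_mult'' mult_nonneg_nonneg zero_le_numeral)
      also have "2 powr (real_of_int j * ?s) * (8 * (8 * M)) = 64 * (C1 + C2) * E"
      proof -
        have "2 powr (real_of_int j * ?s) * M = 2 powr 0 * ((C1 + C2) * E)" unfolding M_def by (rule powr2_mult) simp
        then have "8 * (8 * (2 powr (real_of_int j * ?s) * M)) = 64 * (C1 + C2) * E" by simp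
        then show ?thesis by (simp only: mult.left_commute)
      qed
      finally show ?thesis .
    qed
    have "besov_norm chi ?s (ennreal q) \<infinity> (bony_product chi a b) \<le> ennreal (64 * (C1 + C2) * E)"
      unfolding besov_norm_infinity by (rule SUP_least) (rule bl)
    then show "bony_product_exists chi a b \<and>
      besov_norm chi ?s (ennreal q) \<infinity> (bony_product chi a b) \<le> ennreal (64 * (C1 + C2) * (A0 * B2 + B0 * A2))"
      using ex by (simp only: E_def)
  qed
qed

end

theorem proposition3p2:
  fixes chi :: "real^'d::finite \<Rightarrow> real" and d p q :: real
  assumes "littlewood_paley_cutoff chi"
    and "d = real CARD('d)" and "3 \<le> d"
    and "1 \<le> q" and "q \<le> p" and "p \<le> 2 * q" and "p < d"
    and "1 / q < 1 / p + 2 / d"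
  shows "\<exists>C::real. \<forall>a \<in> besov chi (d / p - 2) p \<infinity> \<inter> besov chi (d / p) p \<infinity>.
           \<forall>b \<in> besov chi (d / p - 2) p \<infinity> \<inter> besov chi (d / p) p \<infinity>.
             bony_product_exists chi a b \<and>
             besov_norm chi (d / q - 2) q \<infinity> (bony_product chi a b)
               \<le> ennreal C *
                   (besov_norm chi (d / p - 2) p \<infinity> a * besov_norm chi (d / p) p \<infinity> b +
                    besov_norm chi (d / p - 2) p \<infinity> b * besov_norm chi (d / p) p \<infinity> a)"
proof -
  interpret littlewood_paley chi by unfold_locales (rule assms(1))
  have d: "real CARD('d) = d" by (rule assms(2)[symmetric])
  have p1: "1 \<le> p" using assms by simp
  \<comment> \<open>The exponent condition in the form in which it makes the paraproduct converge.\<close>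
  have "d * (1 / q) < d * (1 / p + 2 / d)" using assms by (intro mult_strict_left_mono) auto
  then have \<epsilon>: "d / q < d / p + 2" using assms by (simp add: distrib_left)
  obtain K where K: "1 \<le> K" "\<And>a. a \<in> besov chi (d / p - 2) (ennreal p) \<infinity> \<Longrightarrow> a \<in> besov chi (d / p) (ennreal p) \<infinity> \<Longrightarrow>
     dyadic_bounds p K a (enn2real (besov_norm chi (d / p - 2) (ennreal p) \<infinity> a)) (enn2real (besov_norm chi (d / p) (ennreal p) \<infinity> a))"
    using dyadic_bounds_exist[OF p1] unfolding d by blast
  obtain C where C: "0 < C" "\<And>a b A0 A2 B0 B2. dyadic_bounds p K a A0 A2 \<Longrightarrow> dyadic_bounds p K b B0 B2 \<Longrightarrow>
    bony_product_exists chi a b \<and>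
    besov_norm chi (d / q - 2) (ennreal q) \<infinity> (bony_product chi a b) \<le> ennreal (C * (A0 * B2 + B0 * A2))"
    using bony_product_bound[of q p K, unfolded d, OF assms(4-6) K(1) assms(7,3) \<epsilon>] by blast
  show ?thesis
  proof (intro exI[of _ C] ballI)
    fix a b assume a: "a \<in> besov chi (d / p - 2) p \<infinity> \<inter> besov chi (d / p) p \<infinity>"
      and b: "b \<in> besov chi (d / p - 2) p \<infinity> \<inter> besov chi (d / p) p \<infinity>"
    have a': "a \<in> besov chi (d / p - 2) p \<infinity>" "a \<in> besov chi (d / p) p \<infinity>" using a by auto
    have b': "b \<in> besov chi (d / p - 2) p \<infinity>" "b \<in> besov chi (d / p) p \<infinity>" using b by auto
    define A0 where "A0 = enn2real (besov_norm chi (d / p - 2) p \<infinity> a)"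
    define A2 where "A2 = enn2real (besov_norm chi (d / p) p \<infinity> a)"
    define B0 where "B0 = enn2real (besov_norm chi (d / p - 2) p \<infinity> b)"
    define B2 where "B2 = enn2real (besov_norm chi (d / p) p \<infinity> b)"
    have e: "besov_norm chi (d / p - 2) p \<infinity> a = ennreal A0" "besov_norm chi (d / p) p \<infinity> a = ennreal A2"
      "besov_norm chi (d / p - 2) p \<infinity> b = ennreal B0" "besov_norm chi (d / p) p \<infinity> b = ennreal B2"
      unfolding A0_def A2_def B0_def B2_def by (rule besov_block_bound(2)[OF p1], fact)+
    have nn: "0 \<le> A0" "0 \<le> A2" "0 \<le> B0" "0 \<le> B2" by (auto simp: A0_def A2_def B0_def B2_def)
    have "ennreal (C * (A0 * B2 + B0 * A2)) = ennreal C * (ennreal A0 * ennreal B2 + ennreal B0 * ennreal A2)"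
      using C(1) nn by (simp add: ennreal_mult ennreal_plus)
    with C(2)[OF K(2)[OF a'] K(2)[OF b'], folded A0_def A2_def B0_def B2_def]
    show "bony_product_exists chi a b \<and>
             besov_norm chi (d / q - 2) q \<infinity> (bony_product chi a b)
               \<le> ennreal C *
                   (besov_norm chi (d / p - 2) p \<infinity> a * besov_norm chi (d / p) p \<infinity> b +
                    besov_norm chi (d / p - 2) p \<infinity> b * besov_norm chi (d / p) p \<infinity> a)"
      unfolding e by (simp only:)
  qed
qed

end
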